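(* Let $k\ge1$, $\sigma_k=\min\{2k+1,k+3\}$, and let $u\in H^{\sigma_k+1}(\Omega)$ be periodic, $\Omega\subset\mathbb R^2$ a rectangle with a uniform Cartesian overlapping mesh. For any $\boldsymbol\psi=(\psi_i^x,\psi_j^y)\in\overline V_x\times\overline V_y$ the following estimates hold: $$\sum_{i,j}\Big|\sum_{l=0}^{\min\{k,2\}}\hat B_{i,j}(\boldsymbol X^lu,\psi_i^x)\Big|\lesssim h^{\sigma_k}\|u\|_{H^{\sigma_k+1}(\Omega)}\|\psi_i^x\|,$$ $$\sum_{i,j}\Big|\sum_{l=0}^{\min\{k,2\}}\hat B_{i,j}(\boldsymbol\Gamma^lu,\psi_j^y)\Big|\lesssim h^{\sigma_k}\|u\|_{H^{\sigma_k+1}(\Omega)}\|\psi_j^y\|.$$ The same estimates hold on the dual mesh, i.e. with $\hat B_{i,j}$ replaced by $\tilde B_{i+1/2,j+1/2}$ and test functions in $\overline W_x\times\overline W_y$.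
   Context: Convention: $A\lesssim B$ means $A\le MB$ with a constant $M>0$ independent of the mesh size $h$ (it may depend on the fixed aspect ratio $h_x/h_y$); here $M$ is also independent of $u$ and $\boldsymbol\psi$. $\|\cdot\|$ is the $L^2(\Omega)$ norm. Mesh and spaces. All functions are periodic on $\Omega$. $I_i=[x_{i-1/2},x_{i+1/2}]$ (length $h_x$, centre $x_i$), $J_j=[y_{j-1/2},y_{j+1/2}]$ (length $h_y$, centre $y_j$), $I_{i+1/2}=[x_i,x_{i+1}]$, $J_{j+1/2}=[y_j,y_{j+1}]$; primal cells $C_{i,j}=I_i\times J_j$, dual cells $C_{i+1/2,j+1/2}=I_{i+1/2}\times J_{j+1/2}$; $h=\max\{h_x,h_y\}$. $V_h$ (resp. $W_h$): $L^2$ functions whose restriction to each primal (resp. dual) cell lies in $\mathbb Q^k$ (degree $\le k$ in each variable). $\overline V_x$ (resp. $\overline V_y$): functions in $V_h$ that on each primal cell are constant in $x$ (resp. in $y$); $\overline W_x,\overline W_y$ the analogous subspaces of $W_h$. In the claim $\psi_i^x$ denotes an element of $\overline V_x$ and $\psi_j^y$ an element of $\overline V_y$ (the index refers to its restriction to a cell). $\tau_{\max}=C_{\rm CFL}/(1/h_x+1/h_y)$ with fixed $C_{\rm CFL}>0$. CDG operators (transport direction $(1,1)$), for $\boldsymbol w=(w_C,w_D)$: $$\hat B_{i,j}(\boldsymbol w,\phi_1)=\tfrac1{\tau_{\max}}\int_{C_{i,j}}(w_D-w_C)\phi_1+\int_{C_{i,j}}w_D(\partial_x\phi_1+\partial_y\phi_1)-\int_{J_j}\big[w_D(x_{i+1/2},y)\phi_1(x_{i+1/2}^-,y)-w_D(x_{i-1/2},y)\phi_1(x_{i-1/2}^+,y)\big]dy-\int_{I_i}\big[w_D(x,y_{j+1/2})\phi_1(x,y_{j+1/2}^-)-w_D(x,y_{j-1/2})\phi_1(x,y_{j-1/2}^+)\big]dx,$$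 and $\tilde B_{i+1/2,j+1/2}(\boldsymbol w,\phi_2)$ is given by the same formula with $w_C,w_D$ interchanged, $\phi_1$ replaced by $\phi_2$ and all indices shifted by $1/2$. One-dimensional operators in $x$ (applied for each fixed $y$, with $\tau_{\max}=C_{\rm CFL}/(1/h_x+1/h_y)$): $$\hat B_i^x(\boldsymbol w,\psi)=\tfrac1{\tau_{\max}}\int_{I_i}(w_D-w_C)\psi dx+\int_{I_i}w_D\partial_x\psi dx-w_D(x_{i+1/2})\psi(x_{i+1/2}^-)+w_D(x_{i-1/2})\psi(x_{i-1/2}^+),$$ $$\widehat P_i^x(\omega,\psi)=\tfrac1{\tau_{\max}}\Big[\int_{x_{i-1/2}}^{x_i}(\omega(x+\tfrac{h_x}2)-\omega(x))\psi dx+\int_{x_i}^{x_{i+1/2}}(\omega(x-\tfrac{h_x}2)-\omega(x))\psi dx\Big]+\int_{x_{i-1/2}}^{x_i}\omega(x+\tfrac{h_x}2)\partial_x\psi dx+\int_{x_i}^{x_{i+1/2}}\omega(x-\tfrac{h_x}2)\partial_x\psi dx-\omega(x_i)\big(\psi(x_{i+1/2}^-)-\psi(x_{i-1/2}^+)\big).$$ $\tilde B^x_{i+1/2}$ is $\hat B_i^x$ with $C,D$ interchanged and indices shifted by $1/2$; $\widetilde P^x_{i+1/2}$ is $\widehat P_i^x$ with indices shifted by $1/2$. $\widehat{\mathcal T}_i^x(\psi;\boldsymbol w):=\hat B_i^x(\boldsymbol w,\psi)-\widehat P_i^x(w_C,\psi)$, $\widetilde{\mathcal T}_{i+1/2}^x(\psi;\boldsymbol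 w):=\tilde B_{i+1/2}^x(\boldsymbol w,\psi)-\widetilde P_{i+1/2}^x(w_D,\psi)$. Also $$\widehat{\mathcal D}_i^x(\boldsymbol w,\psi)=\int_{I_i}w_D\psi dx-\int_{x_{i-1/2}}^{x_i}w_C(x+\tfrac{h_x}2)\psi dx-\int_{x_i}^{x_{i+1/2}}w_C(x-\tfrac{h_x}2)\psi dx,$$ and $\widetilde{\mathcal D}^x_{i+1/2}$ is the same with $C,D$ interchanged and indices shifted by $1/2$. $\Delta_x^\pm w(x):=w(x)-w(x\pm h_x/2)$. Directional projections. For each $y$, $P_C^x\omega(\cdot,y)$ is the piecewise $\mathbb P^k$ function of $x$ on the cells $I_i$ with $\int_{I_i}P_C^x\omega\,dx=\int_{I_i}\omega\,dx$ and $\widehat P_i^x(P_C^x\omega,\psi)=\widehat P_i^x(\omega,\psi)$ for all $\psi\in\mathbb P^k(I_i)$ (well-defined); $P_D^x$ is the analogue on the cells $I_{i+1/2}$ with $\widetilde P_{i+1/2}^x$. $P_C^y,P_D^y$ are analogous in $y$. Directional corrections. $\boldsymbol\chi^0u=(\chi_C^0u,\chi_D^0u):=(u-P_C^xu,u-P_D^xu)$ and $\boldsymbol\chi^lu:=0$ for $l<0$. For $l>0$, $\boldsymbol\chi^lu=(\chi_C^lu,\chi_D^lu)$ is, for each $y$, the pair of piecewise polynomials in $x$ of degree $\le k$ on the cells $I_i$, resp. $I_{i+1/2}$, with zero $x$-mean on each cell, such that for all $\psi_1\in\mathbb P^k(I_i)$, $\psi_2\in\mathbb P^k(I_{i+1/2})$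 with zero mean, $$\widehat P_i^x(-\chi_C^lu,\psi_1)=\int_{I_i}(\chi_C^{l-1}\partial_xu)\psi_1dx+\widehat{\mathcal T}_i^x(\psi_1;\boldsymbol\chi^{l-1}u)-\widehat{\mathcal D}_i^x(\boldsymbol\chi^{l-2}\partial_yu,\psi_1)+\int_{x_{i-1/2}}^{x_i}[\Delta_x^+(\chi_C^{l-1}\partial_yu)]\psi_1dx+\int_{x_i}^{x_{i+1/2}}[\Delta_x^-(\chi_C^{l-1}\partial_yu)]\psi_1dx,$$ $$\widetilde P_{i+1/2}^x(-\chi_D^lu,\psi_2)=\int_{I_{i+1/2}}(\chi_D^{l-1}\partial_xu)\psi_2dx+\widetilde{\mathcal T}_{i+1/2}^x(\psi_2;\boldsymbol\chi^{l-1}u)-\widetilde{\mathcal D}_{i+1/2}^x(\boldsymbol\chi^{l-2}\partial_yu,\psi_2)+\int_{x_i}^{x_{i+1/2}}[\Delta_x^+(\chi_D^{l-1}\partial_yu)]\psi_2dx+\int_{x_{i+1/2}}^{x_{i+1}}[\Delta_x^-(\chi_D^{l-1}\partial_yu)]\psi_2dx.$$ $\boldsymbol\gamma^lu$ is defined analogously in the $y$-direction (interchange the roles of $x$ and $y$, $\boldsymbol\gamma^0u=(u-P_C^yu,u-P_D^yu)$). $\boldsymbol G^y$ (resp. $\boldsymbol G^x$) is the componentwise one-dimensional Gauss–Lobatto projection in $y$ on the cells $J_j$ (primal component) and $J_{j+1/2}$ (dual component) (resp. in $x$ on $I_i$, $I_{i+1/2}$): on a cell $J$, $Gv\in\mathbb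 P^k(J)$ agrees with $v$ at both endpoints of $J$ and $\int_J(v-Gv)p=0$ for all $p\in\mathbb P^{k-2}(J)$. $\boldsymbol X^lu:=\boldsymbol G^y(\boldsymbol\chi^lu)$ and $\boldsymbol\Gamma^lu:=\boldsymbol G^x(\boldsymbol\gamma^lu)$ for $l\ge0$. *)

theory Defs
  imports "HOL-Analysis.Analysis" "HOL-Computational_Algebra.Polynomial"
begin

text \<open>
  Functions of two variables are curried, of type \<^typ>\<open>real \<Rightarrow> real \<Rightarrow> real\<close>, and periodic
  functions live on the whole plane.  \<^term>\<open>integral\<close> is the Henstock-Kurzweil integral; it ignores
  null sets and agrees with the Lebesgue integral on absolutely integrable functions.
\<close>

section \<open>Periodic Sobolev spaces on a rectangle\<close>

definition rect :: "real \<Rightarrow> real \<Rightarrow> real \<Rightarrow> real \<Rightarrow> (real \<times> real) set" where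
  "rect x0 x1 y0 y1 = {x0..x1} \<times> {y0..y1}"

definition periodic2 :: "real \<Rightarrow> real \<Rightarrow> (real \<Rightarrow> real \<Rightarrow> real) \<Rightarrow> bool" where
  "periodic2 Lx Ly f \<longleftrightarrow> (\<forall>x y. f (x + Lx) y = f x y \<and> f x (y + Ly) = f x y)"

definition L2_on :: "(real \<times> real) set \<Rightarrow> (real \<Rightarrow> real \<Rightarrow> real) \<Rightarrow> bool" where
  "L2_on S f \<longleftrightarrow> (\<lambda>(x, y). f x y) \<in> borel_measurable (lebesgue_on S)
     \<and> (\<lambda>(x, y). (f x y)\<^sup>2) absolutely_integrable_on S"

definition L2_norm :: "(real \<times> real) set \<Rightarrow> (real \<Rightarrow> real \<Rightarrow> real) \<Rightarrow> real" where
  "L2_norm S f = sqrt (integral S (\<lambda>(x, y). (f x y)\<^sup>2))"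

text \<open>
  \<open>d m n\<close> is the mixed partial derivative of order \<open>m\<close> in the first and \<open>n\<close> in the second variable
  of the infinitely differentiable function \<open>d 0 0\<close>.
\<close>

definition smooth_jet :: "(nat \<Rightarrow> nat \<Rightarrow> real \<Rightarrow> real \<Rightarrow> real) \<Rightarrow> bool" where
  "smooth_jet d \<longleftrightarrow> (\<forall>m n. continuous_on UNIV (\<lambda>(x, y). d m n x y) \<and>
     (\<forall>x y. ((\<lambda>s. d m n s y) has_real_derivative d (Suc m) n x y) (at x) \<and>
            ((\<lambda>t. d m n x t) has_real_derivative d m (Suc n) x y) (at y)))"

text \<open>
  Weak derivatives are tested against smooth periodic functions, so no jump of \<open>u\<close> or of its
  derivatives is allowed across the boundary of the rectangle: the space below is the Sobolev space
  on the torus.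
\<close>

definition weak_deriv ::
    "real \<Rightarrow> real \<Rightarrow> real \<Rightarrow> real \<Rightarrow> nat \<Rightarrow> nat \<Rightarrow> (real \<Rightarrow> real \<Rightarrow> real) \<Rightarrow> (real \<Rightarrow> real \<Rightarrow> real) \<Rightarrow> bool" where
  "weak_deriv x0 x1 y0 y1 m n u g \<longleftrightarrow> L2_on (rect x0 x1 y0 y1) g \<and>
     (\<forall>d. smooth_jet d \<and> periodic2 (x1 - x0) (y1 - y0) (d 0 0) \<longrightarrow>
        integral (rect x0 x1 y0 y1) (\<lambda>(x, y). u x y * d m n x y)
        = (-1) ^ (m + n) * integral (rect x0 x1 y0 y1) (\<lambda>(x, y). g x y * d 0 0 x y))"

definition H_per :: "real \<Rightarrow> real \<Rightarrow> real \<Rightarrow> real \<Rightarrow> nat \<Rightarrow> (real \<Rightarrow> real \<Rightarrow> real) set" where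
  "H_per x0 x1 y0 y1 s = {u. periodic2 (x1 - x0) (y1 - y0) u \<and> L2_on (rect x0 x1 y0 y1) u \<and>
     (\<forall>m n. m + n \<le> s \<longrightarrow> (\<exists>g. weak_deriv x0 x1 y0 y1 m n u g))}"

text \<open>The weak derivative is unique up to null sets, so the choice below does not affect the norm.\<close>

definition H_norm :: "real \<Rightarrow> real \<Rightarrow> real \<Rightarrow> real \<Rightarrow> nat \<Rightarrow> (real \<Rightarrow> real \<Rightarrow> real) \<Rightarrow> real" where
  "H_norm x0 x1 y0 y1 s u =
     sqrt (\<Sum>(m, n) \<in> {(m, n). m + n \<le> s}.
       (L2_norm (rect x0 x1 y0 y1) (SOME g. weak_deriv x0 x1 y0 y1 m n u g))\<^sup>2)"

text \<open>
  In two dimensions an element of \<open>H\<^sup>s\<close> with \<open>s \<ge> 2\<close> has a unique continuous representative, which is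
  of class \<open>C\<close> to the power \<open>s - 2\<close>.  Point values and the classical partial derivatives \<open>dx\<close>, \<open>dy\<close>
  are taken on this representative.
\<close>

definition cont_rep :: "(real \<Rightarrow> real \<Rightarrow> real) \<Rightarrow> real \<Rightarrow> real \<Rightarrow> real" where
  "cont_rep u = (THE v. continuous_on UNIV (\<lambda>(x, y). v x y) \<and>
     (AE p in lebesgue. v (fst p) (snd p) = u (fst p) (snd p)))"

definition dx :: "(real \<Rightarrow> real \<Rightarrow> real) \<Rightarrow> real \<Rightarrow> real \<Rightarrow> real" where
  "dx f x y = deriv (\<lambda>s. f s y) x"

definition dy :: "(real \<Rightarrow> real \<Rightarrow> real) \<Rightarrow> real \<Rightarrow> real \<Rightarrow> real" where
  "dy f x y = deriv (\<lambda>t. f x t) y"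

section \<open>Overlapping meshes\<close>

text \<open>
  A one-dimensional cell is given by its width \<open>h\<close> and its centre \<open>c\<close>, so that a shift of all indices
  by one half is a shift of the centre by \<open>h / 2\<close>.  If the domain starts at \<open>z0\<close>, the primal cells are
  \<open>[z0 + n h, z0 + (n + 1) h]\<close> and the dual cells are \<open>[z0 + (n + 1/2) h, z0 + (n + 3/2) h]\<close>, for all
  integers \<open>n\<close>.
\<close>

datatype part = Primal | Dual

fun other :: "part \<Rightarrow> part" where
  "other Primal = Dual"
| "other Dual = Primal"

definition cell :: "real \<Rightarrow> real \<Rightarrow> real set" where
  "cell h c = {c - h / 2 .. c + h / 2}"

definition offset :: "part \<Rightarrow> real \<Rightarrow> real \<Rightarrow> real" where
  "offset m h z0 = (case m of Primal \<Rightarrow> z0 | Dual \<Rightarrow> z0 + h / 2)"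

text \<open>\<open>centre m h z0 i\<close> is the centre of the \<open>i\<close>-th cell: \<open>x\<^sub>i\<close> for the primal mesh and
  \<open>x\<^sub>i + h / 2\<close> for the dual mesh; the cells of one period are those with index \<open>1, \<dots>, N\<close>.\<close>

definition centre :: "part \<Rightarrow> real \<Rightarrow> real \<Rightarrow> int \<Rightarrow> real" where
  "centre m h z0 i = offset m h z0 + (of_int i - 1 / 2) * h"

text \<open>Centre of the cell that contains the point \<open>z\<close> (a common end point of two cells is attributed
  to the right one).\<close>

definition centre_at :: "part \<Rightarrow> real \<Rightarrow> real \<Rightarrow> real \<Rightarrow> real" where
  "centre_at m h z0 z = centre m h z0 (\<lfloor>(z - offset m h z0) / h\<rfloor> + 1)"

text \<open>Piecewise \<open>Q\<^sup>k\<close> functions (\<open>V\<^sub>h\<close> for the primal and \<open>W\<^sub>h\<close> for the dual mesh).  As for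
  elements of \<open>L\<^sup>2\<close>, the values on the cell boundaries are irrelevant.\<close>

definition Qspace ::
    "part \<Rightarrow> nat \<Rightarrow> real \<Rightarrow> real \<Rightarrow> real \<Rightarrow> real \<Rightarrow> nat \<Rightarrow> nat \<Rightarrow> (real \<Rightarrow> real \<Rightarrow> real) set" where
  "Qspace m k x0 y0 hx hy Nx Ny = {v. periodic2 (real Nx * hx) (real Ny * hy) v \<and>
     (\<forall>i j. \<exists>a :: nat \<Rightarrow> nat \<Rightarrow> real.
        \<forall>x \<in> interior (cell hx (centre m hx x0 i)). \<forall>y \<in> interior (cell hy (centre m hy y0 j)).
          v x y = (\<Sum>p\<le>k. \<Sum>q\<le>k. a p q * x ^ p * y ^ q))}"

definition Qbar_x ::
    "part \<Rightarrow> nat \<Rightarrow> real \<Rightarrow> real \<Rightarrow> real \<Rightarrow> real \<Rightarrow> nat \<Rightarrow> nat \<Rightarrow> (real \<Rightarrow> real \<Rightarrow> real) set" where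
  "Qbar_x m k x0 y0 hx hy Nx Ny = {v \<in> Qspace m k x0 y0 hx hy Nx Ny.
     \<forall>i j. \<forall>x \<in> interior (cell hx (centre m hx x0 i)). \<forall>x' \<in> interior (cell hx (centre m hx x0 i)).
       \<forall>y \<in> interior (cell hy (centre m hy y0 j)). v x y = v x' y}"

definition Qbar_y ::
    "part \<Rightarrow> nat \<Rightarrow> real \<Rightarrow> real \<Rightarrow> real \<Rightarrow> real \<Rightarrow> nat \<Rightarrow> nat \<Rightarrow> (real \<Rightarrow> real \<Rightarrow> real) set" where
  "Qbar_y m k x0 y0 hx hy Nx Ny = {v \<in> Qspace m k x0 y0 hx hy Nx Ny.
     \<forall>i j. \<forall>x \<in> interior (cell hx (centre m hx x0 i)).
       \<forall>y \<in> interior (cell hy (centre m hy y0 j)). \<forall>y' \<in> interior (cell hy (centre m hy y0 j)).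
         v x y = v x y'}"

section \<open>Central DG operators\<close>

definition tau_max :: "real \<Rightarrow> real \<Rightarrow> real \<Rightarrow> real" where
  "tau_max CFL hx hy = CFL / (1 / hx + 1 / hy)"

text \<open>
  In every operator below \<open>wC\<close> is the component on the mesh of the current cell and \<open>wD\<close> the
  component on the other mesh.  The operators carrying a tilde are obtained by exchanging
  the two components and using the centre of a dual cell.
\<close>

definition B2 ::
    "real \<Rightarrow> real \<Rightarrow> real \<Rightarrow> real \<Rightarrow> real \<Rightarrow> (real \<Rightarrow> real \<Rightarrow> real) \<Rightarrow> (real \<Rightarrow> real \<Rightarrow> real)
     \<Rightarrow> (real \<Rightarrow> real \<Rightarrow> real) \<Rightarrow> real" where
  "B2 \<tau> hx hy cx cy wC wD \<phi> =
     1 / \<tau> * integral (cell hx cx \<times> cell hy cy) (\<lambda>(x, y). (wD x y - wC x y) * \<phi> x y)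
     + integral (cell hx cx \<times> cell hy cy) (\<lambda>(x, y). wD x y * (dx \<phi> x y + dy \<phi> x y))
     - integral (cell hy cy) (\<lambda>y.
         wD (cx + hx / 2) y * Lim (at_left (cx + hx / 2)) (\<lambda>s. \<phi> s y)
         - wD (cx - hx / 2) y * Lim (at_right (cx - hx / 2)) (\<lambda>s. \<phi> s y))
     - integral (cell hx cx) (\<lambda>x.
         wD x (cy + hy / 2) * Lim (at_left (cy + hy / 2)) (\<lambda>t. \<phi> x t)
         - wD x (cy - hy / 2) * Lim (at_right (cy - hy / 2)) (\<lambda>t. \<phi> x t))"

definition B1 ::
    "real \<Rightarrow> real \<Rightarrow> real \<Rightarrow> (real \<Rightarrow> real) \<Rightarrow> (real \<Rightarrow> real) \<Rightarrow> real poly \<Rightarrow> real" where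
  "B1 \<tau> h c wC wD \<psi> =
     1 / \<tau> * integral (cell h c) (\<lambda>x. (wD x - wC x) * poly \<psi> x)
     + integral (cell h c) (\<lambda>x. wD x * poly (pderiv \<psi>) x)
     - wD (c + h / 2) * poly \<psi> (c + h / 2) + wD (c - h / 2) * poly \<psi> (c - h / 2)"

definition P1 :: "real \<Rightarrow> real \<Rightarrow> real \<Rightarrow> (real \<Rightarrow> real) \<Rightarrow> real poly \<Rightarrow> real" where
  "P1 \<tau> h c \<omega> \<psi> =
     1 / \<tau> * (integral {c - h / 2 .. c} (\<lambda>x. (\<omega> (x + h / 2) - \<omega> x) * poly \<psi> x)
              + integral {c .. c + h / 2} (\<lambda>x. (\<omega> (x - h / 2) - \<omega> x) * poly \<psi> x))
     + integral {c - h / 2 .. c} (\<lambda>x. \<omega> (x + h / 2) * poly (pderiv \<psi>) x)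
     + integral {c .. c + h / 2} (\<lambda>x. \<omega> (x - h / 2) * poly (pderiv \<psi>) x)
     - \<omega> c * (poly \<psi> (c + h / 2) - poly \<psi> (c - h / 2))"

definition T1 ::
    "real \<Rightarrow> real \<Rightarrow> real \<Rightarrow> (real \<Rightarrow> real) \<Rightarrow> (real \<Rightarrow> real) \<Rightarrow> real poly \<Rightarrow> real" where
  "T1 \<tau> h c wC wD \<psi> = B1 \<tau> h c wC wD \<psi> - P1 \<tau> h c wC \<psi>"

definition D1 :: "real \<Rightarrow> real \<Rightarrow> (real \<Rightarrow> real) \<Rightarrow> (real \<Rightarrow> real) \<Rightarrow> real poly \<Rightarrow> real" where
  "D1 h c wC wD \<psi> =
     integral (cell h c) (\<lambda>x. wD x * poly \<psi> x)
     - integral {c - h / 2 .. c} (\<lambda>x. wC (x + h / 2) * poly \<psi> x)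
     - integral {c .. c + h / 2} (\<lambda>x. wC (x - h / 2) * poly \<psi> x)"

section \<open>Directional projections and corrections\<close>

definition cell_proj :: "nat \<Rightarrow> real \<Rightarrow> real \<Rightarrow> real \<Rightarrow> (real \<Rightarrow> real) \<Rightarrow> real poly" where
  "cell_proj k \<tau> h c \<omega> = (THE p. degree p \<le> k \<and>
     integral (cell h c) (poly p) = integral (cell h c) \<omega> \<and>
     (\<forall>\<psi>. degree \<psi> \<le> k \<longrightarrow> P1 \<tau> h c (poly p) \<psi> = P1 \<tau> h c \<omega> \<psi>))"

text \<open>The zero-mean polynomial \<open>p\<close> on the cell whose negative has the prescribed values
  under \<^const>\<open>P1\<close> for all zero-mean test polynomials.\<close>

definition cell_corr :: "nat \<Rightarrow> real \<Rightarrow> real \<Rightarrow> real \<Rightarrow> (real poly \<Rightarrow> real) \<Rightarrow> real poly" where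
  "cell_corr k \<tau> h c F = (THE p. degree p \<le> k \<and> integral (cell h c) (poly p) = 0 \<and>
     (\<forall>\<psi>. degree \<psi> \<le> k \<and> integral (cell h c) (poly \<psi>) = 0 \<longrightarrow>
        P1 \<tau> h c (\<lambda>x. - poly p x) \<psi> = F \<psi>))"

text \<open>
  \<open>chi k \<tau> h x0 l m u\<close> is the correction of level \<open>l\<close> in the \<open>x\<close>-direction, on the mesh \<open>m\<close> with cell
  width \<open>h\<close>.  The case distinction on \<open>l\<close> implements the convention that corrections of negative
  level are zero.
\<close>

fun chi ::
    "nat \<Rightarrow> real \<Rightarrow> real \<Rightarrow> real \<Rightarrow> nat \<Rightarrow> part \<Rightarrow> (real \<Rightarrow> real \<Rightarrow> real) \<Rightarrow> real \<Rightarrow> real \<Rightarrow> real" where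
  "chi k \<tau> h x0 0 m u =
     (\<lambda>x y. u x y - poly (cell_proj k \<tau> h (centre_at m h x0 x) (\<lambda>s. u s y)) x)"
| "chi k \<tau> h x0 (Suc l) m u =
     (\<lambda>x y. let c = centre_at m h x0 x in
        poly (cell_corr k \<tau> h c (\<lambda>\<psi>.
            integral (cell h c) (\<lambda>s. chi k \<tau> h x0 l m (dx u) s y * poly \<psi> s)
            + T1 \<tau> h c (\<lambda>s. chi k \<tau> h x0 l m u s y) (\<lambda>s. chi k \<tau> h x0 l (other m) u s y) \<psi>
            - (case l of 0 \<Rightarrow> 0
               | Suc l' \<Rightarrow> D1 h c (\<lambda>s. chi k \<tau> h x0 l' m (dy u) s y)
                                 (\<lambda>s. chi k \<tau> h x0 l' (other m) (dy u) s y) \<psi>)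
            + integral {c - h / 2 .. c} (\<lambda>s.
                (chi k \<tau> h x0 l m (dy u) s y - chi k \<tau> h x0 l m (dy u) (s + h / 2) y) * poly \<psi> s)
            + integral {c .. c + h / 2} (\<lambda>s.
                (chi k \<tau> h x0 l m (dy u) s y - chi k \<tau> h x0 l m (dy u) (s - h / 2) y) * poly \<psi> s)))
          x)"

text \<open>The test polynomials \<open>q\<close> have degree at most \<open>k - 2\<close>; for \<open>k = 1\<close> there are none.\<close>

definition gauss_lobatto :: "nat \<Rightarrow> real \<Rightarrow> real \<Rightarrow> (real \<Rightarrow> real) \<Rightarrow> real poly" where
  "gauss_lobatto k h c v = (THE p. degree p \<le> k \<and>
     poly p (c - h / 2) = v (c - h / 2) \<and> poly p (c + h / 2) = v (c + h / 2) \<and>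
     (\<forall>q. degree q + 2 \<le> k \<longrightarrow> integral (cell h c) (\<lambda>t. (v t - poly p t) * poly q t) = 0))"

definition corr_X ::
    "nat \<Rightarrow> real \<Rightarrow> real \<Rightarrow> real \<Rightarrow> real \<Rightarrow> real \<Rightarrow> nat \<Rightarrow> part \<Rightarrow> (real \<Rightarrow> real \<Rightarrow> real)
     \<Rightarrow> real \<Rightarrow> real \<Rightarrow> real" where
  "corr_X k \<tau> hx hy x0 y0 l m u x y =
     poly (gauss_lobatto k hy (centre_at m hy y0 y) (\<lambda>t. chi k \<tau> hx x0 l m u x t)) y"

text \<open>The corrections in the \<open>y\<close>-direction arise by exchanging the roles of the two variables.\<close>

definition gam ::
    "nat \<Rightarrow> real \<Rightarrow> real \<Rightarrow> real \<Rightarrow> nat \<Rightarrow> part \<Rightarrow> (real \<Rightarrow> real \<Rightarrow> real) \<Rightarrow> real \<Rightarrow> real \<Rightarrow> real" where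
  "gam k \<tau> h y0 l m u x y = chi k \<tau> h y0 l m (\<lambda>s t. u t s) y x"

definition corr_Gam ::
    "nat \<Rightarrow> real \<Rightarrow> real \<Rightarrow> real \<Rightarrow> real \<Rightarrow> real \<Rightarrow> nat \<Rightarrow> part \<Rightarrow> (real \<Rightarrow> real \<Rightarrow> real)
     \<Rightarrow> real \<Rightarrow> real \<Rightarrow> real" where
  "corr_Gam k \<tau> hx hy x0 y0 l m u x y =
     poly (gauss_lobatto k hx (centre_at m hx x0 x) (\<lambda>s. gam k \<tau> hy y0 l m u s y)) x"

end

theory Submission
  imports Defs
begin

text \<open>
  After scaling to a reference cell, the sum over \<open>l\<close> of the local terms is a linear functional of the
  derivatives of \<open>u\<close> on a neighbourhood of five by five cells, bounded by their maximum up to order two.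
  It vanishes for polynomials \<open>u\<close> of total degree at most \<open>\<sigma>\<close>: level \<open>l\<close> annihilates polynomials of
  degree at most \<open>k + l\<close> and leaves polynomials of degree at most \<open>k\<close> in \<open>y\<close>, on which the Gauss-Lobatto
  projection is the identity; an integration by parts in \<open>y\<close> reduces the functional to the test function
  paired with a residual, and the residual of level \<open>1\<close> cancels that of level \<open>0\<close> by the
  equation defining the correction, tested with \<open>\<psi> = x\<close>, while that of level \<open>2\<close> vanishes.  Hence, as in the
  Bramble-Hilbert lemma, the functional is controlled by the derivatives of \<open>u\<close> of order \<open>\<sigma> + 1\<close>, and scaling
  produces the factor \<open>h\<close> to the power \<open>\<sigma>\<close>; the cells are summed by the Cauchy-Schwarz inequality.

  These steps need a smooth \<open>u\<close>.  They are applied to the partial sums of the Fourier series of \<open>u\<close>,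
  which converge to the continuous representative uniformly with all derivatives up to order two,
  and whose derivatives of order \<open>\<sigma> + 1\<close> are bounded by those of \<open>u\<close> through Bessel's inequality.
\<close>

text \<open>The two entries of \<open>\<sigma>\<close> have different origins. Order at most 2k + 2
  keeps every level of degree at most k in y; order at most k + 4 comes from stopping at level 2,
  which annihilates the central difference in x of such a polynomial. The corrections are definite
  descriptions, made cell by cell from classical derivatives of u, so nothing can be computed before
  well-posedness is known. It rests on an energy identity: on the reference cell P1 of p tested with
  p is -1/t times the integral of (p(x + 1/2) - p(x))^2, and a polynomial of period 1/2 is constant.
  Two devices tame the recursion. Derivatives are carried as data and never computed, and the
  component on the other mesh is a translate of the data by half a cell, so that a single function
  \<open>loc\<close> describes both meshes. Both variables are scaled by the same width h. The
  aspect ratio survives as the half height b of the reference cell and the time step as t = \<tau> /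
  h, so every constant depends on k, t and b only. In the end t and b are functions of the CFL
  number and of hx / hy.\<close>

section \<open>Linear algebra: functionals on polynomials and their dual bases\<close>

lemma homogeneous_system_nontrivial:
  fixes A :: "'i \<Rightarrow> 'j \<Rightarrow> real"
  assumes "finite I" "finite J" "card I < card J"
  shows "\<exists>c. (\<exists>j\<in>J. c j \<noteq> 0) \<and> (\<forall>i\<in>I. (\<Sum>j\<in>J. A i j * c j) = 0)"
  using assms
proof (induction I arbitrary: A J rule: finite_induct)
  case empty
  then obtain j where "j \<in> J" by fastforce
  then show ?case by (intro exI[of _ "\<lambda>_. 1"]) auto
next
  case (insert i0 I)
  show ?case
  proof (cases "\<forall>j\<in>J. A i0 j = 0")
    case True
    then show ?thesis using insert.IH[of J A] insert by auto
  next
    case False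
    then obtain r where r: "r \<in> J" "A i0 r \<noteq> 0" by blast
    define J' where "J' = J - {r}"
    have J': "finite J'" "card I < card J'" "r \<notin> J'" "J = insert r J'"
      using insert r by (auto simp: J'_def)
    \<comment> \<open>Gaussian elimination: equation \<open>i0\<close> is solved for the unknown
      \<open>r\<close> and substituted into the others; \<open>c'\<close> below recovers
      \<open>r\<close> by back substitution.\<close>
    obtain c where c: "\<exists>j\<in>J'. c j \<noteq> 0"
      "\<And>i. i \<in> I \<Longrightarrow> (\<Sum>j\<in>J'. (A i j - A i r * A i0 j / A i0 r) * c j) = 0"
      using insert.IH[of J' "\<lambda>i j. A i j - A i r * A i0 j / A i0 r"] J' by auto
    define c' where "c' = c(r := - (\<Sum>j\<in>J'. A i0 j * c j) / A i0 r)"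
    have eq: "(\<Sum>j\<in>J'. A i j * c' j) = (\<Sum>j\<in>J'. A i j * c j)" for i
      using J' by (intro sum.cong) (auto simp: c'_def)
    have "(\<Sum>j\<in>J. A i j * c' j) = 0" if "i \<in> insert i0 I" for i
    proof (cases "i = i0")
      case True
      then show ?thesis using J' r by (simp add: eq) (simp add: c'_def)
    next
      case False
      then have "(\<Sum>j\<in>J'. A i j * c j) - A i r / A i0 r * (\<Sum>j\<in>J'. A i0 j * c j) = 0"
        using c(2)[of i] that by (simp add: sum_distrib_left sum_subtractf algebra_simps)
      then show ?thesis using J' r by (simp add: eq) (simp add: c'_def)
    qed
    moreover have "\<exists>j\<in>J. c' j \<noteq> 0" using c(1) J' by (auto simp: c'_def)
    ultimately show ?thesis by blast
  qed
qed

definition lin_poly :: "(real poly \<Rightarrow> real) \<Rightarrow> bool" where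
  "lin_poly L \<longleftrightarrow> (\<forall>p q. L (p + q) = L p + L q) \<and> (\<forall>a p. L (smult a p) = a * L p)"

lemma lin_polyD:
  assumes "lin_poly L"
  shows "L (p + q) = L p + L q" "L (smult a p) = a * L p" "L 0 = 0" "L (- p) = - L p"
    "L (p - q) = L p - L q" "L (sum f S) = (\<Sum>i\<in>S. L (f i))"
proof -
  show 1: "L (p + q) = L p + L q" "L (smult a p) = a * L p" for p q a using assms by (auto simp: lin_poly_def)
  show 2: "L 0 = 0" using 1(2)[of 0 0] by simp
  show 3: "L (- p) = - L p" for p using 1(2)[of "-1" p] by simp
  show "L (p - q) = L p - L q" using 1(1)[of p "- q"] 3 by simp
  show "L (sum f S) = (\<Sum>i\<in>S. L (f i))" by (induction S rule: infinite_finite_induct) (auto simp: 1 2)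
qed

text \<open>Dropping the j-th of the k + 1 functionals leaves k equations for k + 1 coefficients. By
  injectivity a nontrivial solution is not annihilated by \<open>L j\<close>, and dividing by that
  value gives \<open>e j\<close>. It serves the P1 functionals, the Gauss-Lobatto functionals and
  the moments in the inverse estimate.\<close>

lemma dual_basis_exists:
  assumes lin: "\<And>i. i \<le> k \<Longrightarrow> lin_poly (L i)"
    and inj: "\<And>p. degree p \<le> k \<Longrightarrow> (\<And>i. i \<le> k \<Longrightarrow> L i p = 0) \<Longrightarrow> p = 0"
  shows "\<exists>e :: nat \<Rightarrow> real poly. \<forall>j\<le>k. degree (e j) \<le> k \<and> (\<forall>i\<le>k. L i (e j) = (if i = j then 1 else 0))"
proof -
  have "\<exists>p. degree p \<le> k \<and> (\<forall>i\<le>k. L i p = (if i = j then 1 else 0))" if j: "j \<le> k" for j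
  proof -
    obtain c where c: "\<exists>n\<in>{..k}. c n \<noteq> 0" "\<And>i. i \<in> {..k} - {j} \<Longrightarrow> (\<Sum>n\<le>k. L i (monom 1 n) * c n) = 0"
      using homogeneous_system_nontrivial[of "{..k} - {j}" "{..k}" "\<lambda>i n. L i (monom 1 n)"] j by auto
    define p where "p = (\<Sum>n\<le>k. smult (c n) (monom 1 n))"
    have deg: "degree p \<le> k" unfolding p_def
      by (intro degree_sum_le) (auto simp: smult_monom intro: order.trans[OF degree_monom_le])
    have "coeff p n = c n" if "n \<le> k" for n
      using that by (simp add: p_def coeff_sum smult_monom)
    then have p0: "p \<noteq> 0" using c(1) by force
    have Lp: "L i p = 0" if "i \<le> k" "i \<noteq> j" for i
      using c(2)[of i] that by (simp add: p_def lin_polyD[OF lin[OF that(1)]] mult.commute)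
    have "L j p \<noteq> 0" using inj[OF deg] Lp p0 by blast
    then show ?thesis
      using Lp lin_polyD(2)[OF lin] deg j
      by (intro exI[of _ "smult (1 / L j p) p"]) auto
  qed
  then show ?thesis by metis
qed

lemma dual_basis_expand:
  assumes lin: "\<And>i. i \<le> k \<Longrightarrow> lin_poly (L i)"
    and inj: "\<And>p. degree p \<le> k \<Longrightarrow> (\<And>i. i \<le> k \<Longrightarrow> L i p = 0) \<Longrightarrow> p = 0"
    and e: "\<And>j. j \<le> k \<Longrightarrow> degree (e j) \<le> k"
      "\<And>i j. i \<le> k \<Longrightarrow> j \<le> k \<Longrightarrow> L i (e j) = (if i = j then 1 else 0)"
    and p: "degree p \<le> k" "\<And>i. i \<le> k \<Longrightarrow> L i p = b i"
  shows "p = (\<Sum>j\<le>k. smult (b j) (e j))"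
proof -
  have "p - (\<Sum>j\<le>k. smult (b j) (e j)) = 0"
  proof (rule inj)
    show "degree (p - (\<Sum>j\<le>k. smult (b j) (e j))) \<le> k"
      using p e by (intro degree_diff_le degree_sum_le) (auto intro: order.trans[OF degree_smult_le])
    show "L i (p - (\<Sum>j\<le>k. smult (b j) (e j))) = 0" if i: "i \<le> k" for i
      using p(2)[OF i] e(2)[OF i] i
      by (simp add: lin_polyD[OF lin[OF i]] if_distrib[of "times _"] cong: if_cong)
  qed
  then show ?thesis by simp
qed

lemma dual_basis_apply:
  fixes i k :: nat
  assumes lin: "lin_poly (L i)" and i: "i \<le> k"
    and e: "\<And>j. j \<le> k \<Longrightarrow> L i (e j) = (if i = j then 1 else 0)"
  shows "L i (\<Sum>j\<le>k. smult (b j) (e j)) = b i"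
proof -
  have "L i (\<Sum>j\<le>k. smult (b j) (e j)) = (\<Sum>j\<le>k. if i = j then b j else 0)"
    unfolding lin_polyD[OF lin] by (intro sum.cong) (auto simp: e)
  then show ?thesis using i by simp
qed

lemma degree_dual_sum_le:
  assumes "\<And>j. j \<in> S \<Longrightarrow> degree (e j) \<le> k"
  shows "degree (\<Sum>j\<in>S. smult (b j) (e j)) \<le> k"
  using assms by (cases "finite S") (auto intro!: degree_sum_le intro: order.trans[OF degree_smult_le])

section \<open>The reference cell\<close>

lemma continuous_imp_integrable:
  fixes f :: "real \<Rightarrow> real"
  assumes "continuous_on UNIV f" shows "f integrable_on {a..b}"
  by (meson assms continuous_on_subset integrable_continuous_real subset_UNIV)

lemma continuous_on_shift:
  fixes f :: "real \<Rightarrow> real"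
  assumes "continuous_on UNIV f" shows "continuous_on S (\<lambda>x. f (x + s))" "continuous_on S f"
proof -
  show "continuous_on S (\<lambda>x. f (x + s))"
    by (rule continuous_on_compose2[OF assms]) (auto intro!: continuous_intros)
qed (use assms continuous_on_subset in blast)

lemma continuous_curried:
  fixes f :: "real \<Rightarrow> real \<Rightarrow> real"
  assumes "continuous_on UNIV (\<lambda>(x, y). f x y)" "continuous_on S g" "continuous_on S h"
  shows "continuous_on S (\<lambda>z. f (g z) (h z))"
  using continuous_on_compose2[OF assms(1) continuous_on_Pair[OF assms(2,3)]] by auto

text \<open>All operators are sums of such integrals and of point values, so linearity, boundedness
  and continuity in a parameter need be proved for this shape only. The shift \<open>s\<close>
  selects the half cell on which \<omega> is sampled.\<close>

definition weighted_int :: "real \<Rightarrow> real \<Rightarrow> real \<Rightarrow> real poly \<Rightarrow> (real \<Rightarrow> real) \<Rightarrow> real" where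
  "weighted_int s a b \<psi> \<omega> = integral {a..b} (\<lambda>x. \<omega> (x + s) * poly \<psi> x)"

lemma weighted_int_lin:
  assumes "continuous_on UNIV f" "continuous_on UNIV g"
  shows "weighted_int s a b \<psi> (\<lambda>x. \<alpha> * f x + \<beta> * g x)
    = \<alpha> * weighted_int s a b \<psi> f + \<beta> * weighted_int s a b \<psi> g"
proof -
  have "weighted_int s a b \<psi> (\<lambda>x. \<alpha> * f x + \<beta> * g x)
      = integral {a..b} (\<lambda>x. \<alpha> * (f (x + s) * poly \<psi> x) + \<beta> * (g (x + s) * poly \<psi> x))"
    by (simp add: weighted_int_def algebra_simps)
  also have "\<dots> = integral {a..b} (\<lambda>x. \<alpha> * (f (x + s) * poly \<psi> x))
      + integral {a..b} (\<lambda>x. \<beta> * (g (x + s) * poly \<psi> x))"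
    by (intro integral_add continuous_imp_integrable continuous_intros continuous_on_shift[OF assms(1)] continuous_on_shift[OF assms(2)])
  finally show ?thesis by (simp add: weighted_int_def)
qed

lemma weighted_int_lin_poly:
  assumes "continuous_on UNIV f"
  shows "lin_poly (\<lambda>\<psi>. weighted_int s a b \<psi> f)"
proof -
  have "weighted_int s a b (p + q) f = weighted_int s a b p f + weighted_int s a b q f" for p q
  proof -
    have "weighted_int s a b (p + q) f
        = integral {a..b} (\<lambda>x. f (x + s) * poly p x + f (x + s) * poly q x)"
      by (simp add: weighted_int_def algebra_simps)
    also have "\<dots> = integral {a..b} (\<lambda>x. f (x + s) * poly p x) + integral {a..b} (\<lambda>x. f (x + s) * poly q x)"
      by (intro integral_add continuous_imp_integrable continuous_intros continuous_on_shift[OF assms])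
    finally show ?thesis by (simp add: weighted_int_def)
  qed
  moreover have "weighted_int s a b (smult c p) f = c * weighted_int s a b p f" for c p
  proof -
    have "(\<lambda>x. f (x + s) * poly (smult c p) x) = (\<lambda>x. c * (f (x + s) * poly p x))"
      by (auto simp: fun_eq_iff)
    then show ?thesis by (simp add: weighted_int_def)
  qed
  ultimately show ?thesis by (auto simp: lin_poly_def)
qed

lemma abs_integral_le:
  fixes f :: "real \<Rightarrow> real"
  assumes "f integrable_on {a..b}" "\<And>x. x \<in> {a..b} \<Longrightarrow> \<bar>f x\<bar> \<le> B" "a \<le> b"
  shows "\<bar>integral {a..b} f\<bar> \<le> B * (b - a)"
proof -
  have B: "0 \<le> B" using assms(2)[of a] assms(3) by auto
  have "(f has_integral integral {a..b} f) (cbox a b)" using assms(1) by auto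
  from has_integral_bound[OF B this] assms(2,3) show ?thesis by auto
qed

lemma poly_bounded_on:
  fixes a b :: real
  shows "\<exists>N\<ge>0. \<forall>x\<in>{a..b}. \<bar>poly p x\<bar> \<le> N"
proof -
  have "bounded (poly p ` {a..b})"
    by (intro compact_imp_bounded compact_continuous_image continuous_intros compact_Icc)
  then obtain N where "\<forall>x\<in>{a..b}. \<bar>poly p x\<bar> \<le> N" by (auto simp: bounded_iff)
  then show ?thesis by (intro exI[of _ "\<bar>N\<bar>"]) force
qed

lemma weighted_int_bound:
  assumes "a \<le> b"
  shows "\<exists>C\<ge>0. \<forall>(\<omega> :: real \<Rightarrow> real) M. continuous_on UNIV \<omega> \<longrightarrow> (\<forall>x\<in>{a + s..b + s}. \<bar>\<omega> x\<bar> \<le> M) \<longrightarrow>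
    \<bar>weighted_int s a b \<psi> \<omega>\<bar> \<le> C * M"
proof -
  obtain N where N: "N \<ge> 0" "\<forall>x\<in>{a..b}. \<bar>poly \<psi> x\<bar> \<le> N" using poly_bounded_on by blast
  show ?thesis
  proof (intro exI[of _ "N * (b - a)"] conjI allI impI)
    show "0 \<le> N * (b - a)" using N assms by simp
    fix \<omega> :: "real \<Rightarrow> real" and M assume *: "continuous_on UNIV \<omega>" "\<forall>x\<in>{a + s..b + s}. \<bar>\<omega> x\<bar> \<le> M"
    have "\<bar>weighted_int s a b \<psi> \<omega>\<bar> \<le> (M * N) * (b - a)"
      unfolding weighted_int_def
    proof (intro abs_integral_le assms)
      show "(\<lambda>x. \<omega> (x + s) * poly \<psi> x) integrable_on {a..b}"
        by (intro continuous_imp_integrable continuous_intros continuous_on_shift[OF *(1)])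
      fix x assume x: "x \<in> {a..b}"
      then have "\<bar>\<omega> (x + s)\<bar> \<le> M" using *(2) by auto
      moreover from this have "M \<ge> 0" by linarith
      ultimately show "\<bar>\<omega> (x + s) * poly \<psi> x\<bar> \<le> M * N"
        unfolding abs_mult using N x by (intro mult_mono) auto
    qed
    then show "\<bar>weighted_int s a b \<psi> \<omega>\<bar> \<le> N * (b - a) * M" by (simp add: mult_ac)
  qed
qed

lemma weighted_int_continuous:
  fixes f :: "real \<Rightarrow> real \<Rightarrow> real"
  assumes "continuous_on UNIV (\<lambda>(x, y). f x y)"
  shows "continuous_on UNIV (\<lambda>y. weighted_int s a b \<psi> (\<lambda>x. f x y))"
  unfolding weighted_int_def
proof -
  have "continuous_on (UNIV \<times> cbox a b) (\<lambda>(y, x). f (x + s) y * poly \<psi> x)"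
    unfolding case_prod_beta by (intro continuous_intros continuous_curried[OF assms])
  from integral_continuous_on_param[OF this]
  show "continuous_on UNIV (\<lambda>y. integral {a..b} (\<lambda>x. f (x + s) y * poly \<psi> x))" by simp
qed

text \<open>Moving the shift from \<omega> to the polynomial turns every integral into moments of
  \<omega> over half cells; the identities for the test polynomials 1, x, x^2 are computed in this
  form.\<close>

lemma weighted_int_shift:
  assumes "continuous_on UNIV \<omega>"
  shows "weighted_int s a b \<psi> \<omega> = weighted_int 0 (a + s) (b + s) (\<psi> \<circ>\<^sub>p [:- s, 1:]) \<omega>"
proof -
  let ?g = "\<lambda>x. \<omega> x * poly (\<psi> \<circ>\<^sub>p [:- s, 1:]) x"
  have "continuous_on {a + s..b + s} ?g"
    by (intro continuous_intros continuous_on_shift(2)[OF assms])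
  from integral_shift[OF this] show ?thesis
    by (simp add: weighted_int_def o_def poly_pcompose)
qed

text \<open>\<open>P1ref\<close>, \<open>Tref\<close> and \<open>Dref\<close> are the operators \<^const>\<open>P1\<close>, \<^const>\<open>T1\<close> and
  \<^const>\<open>D1\<close> on the cell \<open>[- (1/2), 1/2]\<close>.  The last two depend on the pair \<open>w\<close> only through the
  differences \<open>Em\<close>, \<open>Ep\<close> of the dual component on the left and right neighbour with the
  translates of the primal component.\<close>

definition P1ref :: "real \<Rightarrow> (real \<Rightarrow> real) \<Rightarrow> real poly \<Rightarrow> real" where
  "P1ref t \<omega> \<psi> =
     1 / t * (weighted_int (1/2) (- (1/2)) 0 \<psi> \<omega> - weighted_int 0 (- (1/2)) 0 \<psi> \<omega>
            + (weighted_int (- (1/2)) 0 (1/2) \<psi> \<omega> - weighted_int 0 0 (1/2) \<psi> \<omega>))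
     + weighted_int (1/2) (- (1/2)) 0 (pderiv \<psi>) \<omega> + weighted_int (- (1/2)) 0 (1/2) (pderiv \<psi>) \<omega>
     - \<omega> 0 * (poly \<psi> (1/2) - poly \<psi> (- (1/2)))"

definition Dref :: "(real \<Rightarrow> real) \<Rightarrow> (real \<Rightarrow> real) \<Rightarrow> real poly \<Rightarrow> real" where
  "Dref Em Ep \<psi> = weighted_int (1/2) (- (1/2)) 0 \<psi> Em + weighted_int (- (1/2)) 0 (1/2) \<psi> Ep"

definition Tref :: "real \<Rightarrow> (real \<Rightarrow> real) \<Rightarrow> (real \<Rightarrow> real) \<Rightarrow> real poly \<Rightarrow> real" where
  "Tref t Em Ep \<psi> = 1 / t * Dref Em Ep \<psi> + Dref Em Ep (pderiv \<psi>)
     - Ep 0 * poly \<psi> (1/2) + Em 0 * poly \<psi> (- (1/2))"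

text \<open>The two \<Delta> terms taken together: on each half of the cell the value at a point
  minus the value half a cell further inside the same cell.\<close>

definition jumpref :: "(real \<Rightarrow> real) \<Rightarrow> real poly \<Rightarrow> real" where
  "jumpref W \<psi> = weighted_int 0 (- (1/2)) (1/2) \<psi> W - Dref W W \<psi>"

text \<open>In order, the six functions stand for the previous level of the x-derivative, the left
  and right differences of the previous level, those of the level before it for the y-derivative,
  and the previous level of the y-derivative. Treated as independent arguments they make the
  right-hand side a linear functional.\<close>

definition rhsref :: "real \<Rightarrow> (real \<Rightarrow> real) \<Rightarrow> (real \<Rightarrow> real) \<Rightarrow> (real \<Rightarrow> real) \<Rightarrow> (real \<Rightarrow> real)
    \<Rightarrow> (real \<Rightarrow> real) \<Rightarrow> (real \<Rightarrow> real) \<Rightarrow> real poly \<Rightarrow> real" where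
  "rhsref t A Em Ep Km Kp W \<psi> =
     weighted_int 0 (- (1/2)) (1/2) \<psi> A + Tref t Em Ep \<psi> - Dref Km Kp \<psi> + jumpref W \<psi>"

lemma P1_eq_P1ref:
  assumes "continuous_on UNIV \<omega>"
  shows "P1 t 1 0 \<omega> \<psi> = P1ref t \<omega> \<psi>"
proof -
  have "integral {a..b} (\<lambda>x. (\<omega> (x + s) - \<omega> x) * poly \<psi> x)
      = weighted_int s a b \<psi> \<omega> - weighted_int 0 a b \<psi> \<omega>" for s a b
  proof -
    have "integral {a..b} (\<lambda>x. (\<omega> (x + s) - \<omega> x) * poly \<psi> x)
        = integral {a..b} (\<lambda>x. \<omega> (x + s) * poly \<psi> x - \<omega> x * poly \<psi> x)"
      by (simp add: algebra_simps)
    also have "\<dots> = integral {a..b} (\<lambda>x. \<omega> (x + s) * poly \<psi> x) - integral {a..b} (\<lambda>x. \<omega> x * poly \<psi> x)"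
      by (intro integral_diff continuous_imp_integrable continuous_intros continuous_on_shift[OF assms])
    finally show ?thesis by (simp add: weighted_int_def)
  qed
  from this[of _ _ "1/2"] this[of _ _ "- (1/2)"] show ?thesis
    by (simp add: P1_def P1ref_def weighted_int_def)
qed

lemma P1ref_lin:
  assumes "continuous_on UNIV f" "continuous_on UNIV g"
  shows "P1ref t (\<lambda>x. \<alpha> * f x + \<beta> * g x) \<psi> = \<alpha> * P1ref t f \<psi> + \<beta> * P1ref t g \<psi>"
  unfolding P1ref_def weighted_int_lin[OF assms] by (simp add: field_simps add_divide_distrib diff_divide_distrib)

lemma lin_poly_add: "lin_poly f \<Longrightarrow> lin_poly g \<Longrightarrow> lin_poly (\<lambda>p. f p + g p)"
  and lin_poly_diff: "lin_poly f \<Longrightarrow> lin_poly g \<Longrightarrow> lin_poly (\<lambda>p. f p - g p)"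
  and lin_poly_mult: "lin_poly f \<Longrightarrow> lin_poly (\<lambda>p. c * f p)"
  and lin_poly_pderiv: "lin_poly f \<Longrightarrow> lin_poly (\<lambda>p. f (pderiv p))"
  and lin_poly_eval: "lin_poly (\<lambda>p. poly p x)"
  by (auto simp: lin_poly_def algebra_simps pderiv_add pderiv_smult)

lemma P1ref_lin_poly:
  assumes "continuous_on UNIV f" shows "lin_poly (P1ref t f)"
  unfolding P1ref_def
  by (intro lin_poly_add lin_poly_diff lin_poly_mult lin_poly_pderiv lin_poly_eval weighted_int_lin_poly
      lin_poly_pderiv[of "\<lambda>\<psi>. weighted_int _ _ _ \<psi> _"] assms)

lemma Dref_lin_poly:
  assumes "continuous_on UNIV Em" "continuous_on UNIV Ep" shows "lin_poly (Dref Em Ep)"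
  unfolding Dref_def by (intro lin_poly_add weighted_int_lin_poly assms)

lemma rhsref_lin_poly:
  assumes "continuous_on UNIV A" "continuous_on UNIV Em" "continuous_on UNIV Ep"
    "continuous_on UNIV Km" "continuous_on UNIV Kp" "continuous_on UNIV W"
  shows "lin_poly (rhsref t A Em Ep Km Kp W)"
  unfolding rhsref_def Tref_def jumpref_def
  by (subst mult.commute[of "Ep 0"], subst mult.commute[of "Em 0"], subst (1 2) mult.commute[of _ "_ 0"],
      intro lin_poly_add lin_poly_diff lin_poly_mult lin_poly_pderiv[of "Dref Em Ep"] lin_poly_eval
      weighted_int_lin_poly Dref_lin_poly assms)

lemma Dref_lin:
  assumes "continuous_on UNIV f" "continuous_on UNIV g" "continuous_on UNIV f'" "continuous_on UNIV g'"
  shows "Dref (\<lambda>x. \<alpha> * f x + \<beta> * f' x) (\<lambda>x. \<alpha> * g x + \<beta> * g' x) \<psi> = \<alpha> * Dref f g \<psi> + \<beta> * Dref f' g' \<psi>"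
  unfolding Dref_def by (simp add: weighted_int_lin assms algebra_simps)

lemma rhsref_lin:
  assumes "continuous_on UNIV A" "continuous_on UNIV Em" "continuous_on UNIV Ep"
    "continuous_on UNIV Km" "continuous_on UNIV Kp" "continuous_on UNIV W"
    "continuous_on UNIV A'" "continuous_on UNIV Em'" "continuous_on UNIV Ep'"
    "continuous_on UNIV Km'" "continuous_on UNIV Kp'" "continuous_on UNIV W'"
  shows "rhsref t (\<lambda>x. \<alpha> * A x + \<beta> * A' x) (\<lambda>x. \<alpha> * Em x + \<beta> * Em' x) (\<lambda>x. \<alpha> * Ep x + \<beta> * Ep' x)
      (\<lambda>x. \<alpha> * Km x + \<beta> * Km' x) (\<lambda>x. \<alpha> * Kp x + \<beta> * Kp' x) (\<lambda>x. \<alpha> * W x + \<beta> * W' x) \<psi>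
    = \<alpha> * rhsref t A Em Ep Km Kp W \<psi> + \<beta> * rhsref t A' Em' Ep' Km' Kp' W' \<psi>"
  unfolding rhsref_def Tref_def jumpref_def
  by (simp add: weighted_int_lin Dref_lin assms field_simps add_divide_distrib)

text \<open>The relation \<open>Q\<close> between data and bound stays abstract, so the boundedness
  of a composite functional follows by introduction rules that mirror its formula.\<close>

lemma bounded_functional_add:
  fixes F G :: "'w \<Rightarrow> real" and Q :: "'w \<Rightarrow> real \<Rightarrow> bool"
  assumes "\<exists>C\<ge>0. \<forall>w M. Q w M \<longrightarrow> \<bar>F w\<bar> \<le> C * M" "\<exists>C\<ge>0. \<forall>w M. Q w M \<longrightarrow> \<bar>G w\<bar> \<le> C * M"
  shows "\<exists>C\<ge>0. \<forall>w M. Q w M \<longrightarrow> \<bar>F w + G w\<bar> \<le> C * M"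
    and "\<exists>C\<ge>0. \<forall>w M. Q w M \<longrightarrow> \<bar>F w - G w\<bar> \<le> C * M"
proof -
  obtain C D where C: "C \<ge> 0" "\<And>w M. Q w M \<Longrightarrow> \<bar>F w\<bar> \<le> C * M"
    and D: "D \<ge> 0" "\<And>w M. Q w M \<Longrightarrow> \<bar>G w\<bar> \<le> D * M" using assms by blast
  have "\<bar>F w + G w\<bar> \<le> (C + D) * M" "\<bar>F w - G w\<bar> \<le> (C + D) * M" if "Q w M" for w M
    using C(2)[OF that] D(2)[OF that] abs_triangle_ineq[of "F w" "G w"] abs_triangle_ineq4[of "F w" "G w"]
    by (simp_all add: distrib_right)
  moreover have "C + D \<ge> 0" using C D by simp
  ultimately show "\<exists>C\<ge>0. \<forall>w M. Q w M \<longrightarrow> \<bar>F w + G w\<bar> \<le> C * M" "\<exists>C\<ge>0. \<forall>w M. Q w M \<longrightarrow> \<bar>F w - G w\<bar> \<le> C * M"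
    by blast+
qed

lemma bounded_functional_mult:
  fixes F :: "'w \<Rightarrow> real" and Q :: "'w \<Rightarrow> real \<Rightarrow> bool"
  assumes "\<exists>C\<ge>0. \<forall>w M. Q w M \<longrightarrow> \<bar>F w\<bar> \<le> C * M"
  shows "\<exists>C\<ge>0. \<forall>w M. Q w M \<longrightarrow> \<bar>c * F w\<bar> \<le> C * M" "\<exists>C\<ge>0. \<forall>w M. Q w M \<longrightarrow> \<bar>F w * c\<bar> \<le> C * M"
proof -
  obtain C where C: "C \<ge> 0" "\<And>w M. Q w M \<Longrightarrow> \<bar>F w\<bar> \<le> C * M" using assms by blast
  have "\<bar>c * F w\<bar> \<le> \<bar>c\<bar> * C * M" if "Q w M" for w M
    using mult_left_mono[OF C(2)[OF that], of "\<bar>c\<bar>"] by (simp add: abs_mult mult.assoc)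
  then show "\<exists>C\<ge>0. \<forall>w M. Q w M \<longrightarrow> \<bar>c * F w\<bar> \<le> C * M" "\<exists>C\<ge>0. \<forall>w M. Q w M \<longrightarrow> \<bar>F w * c\<bar> \<le> C * M"
    using C(1) by (metis abs_ge_zero mult_nonneg_nonneg, metis abs_ge_zero mult_nonneg_nonneg mult.commute)
qed

text \<open>The abstract rules above speak of a single datum \<open>w\<close>; a sequence packs the
  six arguments of \<open>rhsref\<close>, read at indices 0 to 5, into one.\<close>

definition bdd6 :: "(nat \<Rightarrow> real \<Rightarrow> real) \<Rightarrow> real \<Rightarrow> bool" where
  "bdd6 w M \<longleftrightarrow> (\<forall>i. continuous_on UNIV (w i) \<and> (\<forall>x. \<bar>x\<bar> \<le> 1/2 \<longrightarrow> \<bar>w i x\<bar> \<le> M))"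

lemma weighted_int_bdd6:
  assumes "a \<le> b" "a + s \<ge> - (1/2)" "b + s \<le> 1/2"
  shows "\<exists>C\<ge>0. \<forall>w M. bdd6 w M \<longrightarrow> \<bar>weighted_int s a b \<psi> (w i)\<bar> \<le> C * M"
proof -
  obtain C where C: "C \<ge> 0" "\<And>\<omega> M. continuous_on UNIV \<omega> \<Longrightarrow> (\<forall>x\<in>{a + s..b + s}. \<bar>\<omega> x\<bar> \<le> M) \<Longrightarrow>
    \<bar>weighted_int s a b \<psi> \<omega>\<bar> \<le> C * M" using weighted_int_bound[OF assms(1)] by blast
  show ?thesis using C(1) assms(2,3)
    by (intro exI[of _ C] conjI allI impI C(2)) (auto simp: bdd6_def)
qed

lemma eval_bdd6: "\<exists>C\<ge>0. \<forall>w M. bdd6 w M \<longrightarrow> \<bar>w i 0\<bar> \<le> C * M"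
  by (intro exI[of _ 1]) (auto simp: bdd6_def)

lemma P1ref_bdd6: "\<exists>C\<ge>0. \<forall>w M. bdd6 w M \<longrightarrow> \<bar>P1ref t (w i) \<psi>\<bar> \<le> C * M"
  unfolding P1ref_def
  by (intro bounded_functional_add bounded_functional_mult weighted_int_bdd6 eval_bdd6) auto

lemma Dref_bdd6: "\<exists>C\<ge>0. \<forall>w M. bdd6 w M \<longrightarrow> \<bar>Dref (w i) (w j) \<psi>\<bar> \<le> C * M"
  unfolding Dref_def by (intro bounded_functional_add weighted_int_bdd6) auto

lemma rhsref_bdd6:
  "\<exists>C\<ge>0. \<forall>w M. bdd6 w M \<longrightarrow> \<bar>rhsref t (w 0) (w 1) (w 2) (w 3) (w 4) (w 5) \<psi>\<bar> \<le> C * M"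
  unfolding rhsref_def Tref_def jumpref_def
  by (intro bounded_functional_add bounded_functional_mult Dref_bdd6 weighted_int_bdd6 eval_bdd6) auto

lemma P1ref_continuous:
  fixes f :: "real \<Rightarrow> real \<Rightarrow> real"
  assumes "continuous_on UNIV (\<lambda>(x, y). f x y)"
  shows "continuous_on UNIV (\<lambda>y. P1ref t (\<lambda>x. f x y) \<psi>)"
  unfolding P1ref_def
  by (intro continuous_intros weighted_int_continuous continuous_curried[of f] assms)

lemma Dref_continuous:
  fixes f g :: "real \<Rightarrow> real \<Rightarrow> real"
  assumes "continuous_on UNIV (\<lambda>(x, y). f x y)" "continuous_on UNIV (\<lambda>(x, y). g x y)"
  shows "continuous_on UNIV (\<lambda>y. Dref (\<lambda>x. f x y) (\<lambda>x. g x y) \<psi>)"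
  unfolding Dref_def by (intro continuous_intros weighted_int_continuous assms)

lemma rhsref_continuous:
  fixes A Em Ep Km Kp W :: "real \<Rightarrow> real \<Rightarrow> real"
  assumes "continuous_on UNIV (\<lambda>(x, y). A x y)" "continuous_on UNIV (\<lambda>(x, y). Em x y)"
    "continuous_on UNIV (\<lambda>(x, y). Ep x y)" "continuous_on UNIV (\<lambda>(x, y). Km x y)"
    "continuous_on UNIV (\<lambda>(x, y). Kp x y)" "continuous_on UNIV (\<lambda>(x, y). W x y)"
  shows "continuous_on UNIV (\<lambda>y. rhsref t (\<lambda>x. A x y) (\<lambda>x. Em x y) (\<lambda>x. Ep x y)
    (\<lambda>x. Km x y) (\<lambda>x. Kp x y) (\<lambda>x. W x y) \<psi>)"
  unfolding rhsref_def Tref_def jumpref_def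
  by (intro continuous_intros weighted_int_continuous Dref_continuous
      continuous_curried[of Ep] continuous_curried[of Em] assms)

lemma integral_translate:
  fixes f :: "real \<Rightarrow> real"
  assumes "continuous_on UNIV f"
  shows "integral {a..b} (\<lambda>x. f (x + c)) = integral {a + c..b + c} f"
  using integral_shift[OF continuous_on_shift(2)[OF assms], of a b c] by (simp add: o_def)

lemma weighted_int_0_poly [simp]: "weighted_int s a b 0 \<omega> = 0"
  by (simp add: weighted_int_def)

lemma weighted_int_const:
  assumes "continuous_on UNIV \<omega>"
  shows "weighted_int s a b [:c:] \<omega> = c * integral {a + s..b + s} \<omega>"
proof -
  have "weighted_int s a b [:c:] \<omega> = integral {a..b} (\<lambda>x. \<omega> (x + s)) * c"
    by (simp add: weighted_int_def)
  then show ?thesis by (simp add: integral_translate[OF assms])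
qed

lemma poly_const_fun: "poly [:c:] = (\<lambda>x. c)" by (auto simp: fun_eq_iff)

section \<open>Well-posedness of the projection and of the corrections\<close>

text \<open>The two halves exchange their masses, so the four integrals cancel. Constant tests being
  void, P1 yields only k conditions on a polynomial of degree k, and the mean has to supply the last
  one.\<close>

lemma P1ref_const:
  assumes "continuous_on UNIV \<omega>" shows "P1ref t \<omega> [:c:] = 0"
  by (simp add: P1ref_def weighted_int_const[OF assms])

text \<open>Energy identity. Substitution brings everything to the left half, where the two
  derivative terms form the derivative of p(x) p(x + 1/2); its boundary values cancel the point term
  of P1. The remaining mass terms complete a square, so for t > 0 only polynomials of period 1/2
  have zero energy.\<close>

lemma P1ref_diagonal:
  "P1ref t (poly p) p = - (1 / t) * integral {- (1/2)..0} (\<lambda>x. (poly p (x + 1/2) - poly p x)\<^sup>2)"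
proof -
  let ?I = "\<lambda>f. integral {- (1/2)..0::real} f"
  let ?q = "\<lambda>x. poly p (x + 1/2)"
  have c: "continuous_on S (\<lambda>x. poly q (x + s))" "continuous_on S (poly q)" for S s and q :: "real poly"
    by (intro continuous_intros)+
  have int: "f integrable_on {a..b}" if "continuous_on UNIV f" for f :: "real \<Rightarrow> real" and a b
    by (rule continuous_imp_integrable[OF that])
  have 1: "weighted_int (1/2) (- (1/2)) 0 p (poly p) = ?I (\<lambda>x. ?q x * poly p x)"
    by (simp add: weighted_int_def)
  have 2: "weighted_int (- (1/2)) 0 (1/2) q (poly p) = ?I (\<lambda>x. poly p x * poly q (x + 1/2))" for q
    using integral_translate[of "\<lambda>x. poly p (x - 1/2) * poly q x" "- (1/2)" 0 "1/2"]
    by (simp add: weighted_int_def continuous_intros)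
  have 3: "weighted_int 0 (- (1/2)) 0 p (poly p) = ?I (\<lambda>x. (poly p x)\<^sup>2)"
    by (simp add: weighted_int_def power2_eq_square)
  have 4: "weighted_int 0 0 (1/2) p (poly p) = ?I (\<lambda>x. (?q x)\<^sup>2)"
    using integral_translate[of "\<lambda>x. (poly p x)\<^sup>2" "- (1/2)" 0 "1/2"]
    by (simp add: weighted_int_def power2_eq_square continuous_intros)
  have 5: "weighted_int (1/2) (- (1/2)) 0 (pderiv p) (poly p) = ?I (\<lambda>x. ?q x * poly (pderiv p) x)"
    by (simp add: weighted_int_def)
  have "((\<lambda>x. ?q x * poly (pderiv p) x + poly p x * poly (pderiv p) (x + 1/2)) has_integral
      (poly p (0 + 1/2) * poly p 0 - poly p (- (1/2) + 1/2) * poly p (- (1/2)))) {- (1/2)..0::real}"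
    by (intro fundamental_theorem_of_calculus)
      (auto intro!: derivative_eq_intros simp: has_real_derivative_iff_has_vector_derivative[symmetric])
  then have 6: "?I (\<lambda>x. ?q x * poly (pderiv p) x) + ?I (\<lambda>x. poly p x * poly (pderiv p) (x + 1/2))
      = poly p 0 * (poly p (1/2) - poly p (- (1/2)))"
    by (subst integral_add[symmetric]) (auto intro!: int continuous_intros simp: integral_unique algebra_simps)
  have "?I (\<lambda>x. (?q x - poly p x)\<^sup>2)
      = ?I (\<lambda>x. ((?q x)\<^sup>2 + (poly p x)\<^sup>2) - 2 * (?q x * poly p x))"
    by (simp add: power2_diff algebra_simps)
  also have "\<dots> = ?I (\<lambda>x. (?q x)\<^sup>2 + (poly p x)\<^sup>2) - ?I (\<lambda>x. 2 * (?q x * poly p x))"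
    by (intro integral_diff int continuous_intros)
  also have "?I (\<lambda>x. (?q x)\<^sup>2 + (poly p x)\<^sup>2) = ?I (\<lambda>x. (?q x)\<^sup>2) + ?I (\<lambda>x. (poly p x)\<^sup>2)"
    by (intro integral_add int continuous_intros)
  finally have 7: "?I (\<lambda>x. (?q x - poly p x)\<^sup>2)
      = ?I (\<lambda>x. (?q x)\<^sup>2) + ?I (\<lambda>x. (poly p x)\<^sup>2) - 2 * ?I (\<lambda>x. ?q x * poly p x)" by simp
  show ?thesis
    unfolding P1ref_def 1 2 3 4 5 7 
    using 6 by (simp add: mult.commute[of "poly p _" "poly p (_ + 1/2)"]) (simp add: algebra_simps flip: add_divide_distrib diff_divide_distrib)
qed

text \<open>The degrees of freedom of the projection; the mean takes the index 0 of the void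
  constant test.\<close>

definition Lref :: "real \<Rightarrow> nat \<Rightarrow> (real \<Rightarrow> real) \<Rightarrow> real" where
  "Lref t j \<omega> = (if j = 0 then weighted_int 0 (- (1/2)) (1/2) 1 \<omega> else P1ref t \<omega> (monom 1 j))"

lemma Lref_0: "Lref t 0 \<omega> = integral {- (1/2)..1/2} \<omega>"
  by (simp add: Lref_def weighted_int_def)

lemma Lref_lin_poly: "lin_poly (\<lambda>p. Lref t j (poly p))"
proof -
  have *: "P1ref t (poly (p + q)) \<psi> = P1ref t (poly p) \<psi> + P1ref t (poly q) \<psi>"
    "P1ref t (poly (smult a p)) \<psi> = a * P1ref t (poly p) \<psi>"
    "weighted_int 0 (- (1/2)) (1/2) 1 (poly (p + q)) = weighted_int 0 (- (1/2)) (1/2) 1 (poly p) + weighted_int 0 (- (1/2)) (1/2) 1 (poly q)"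
    "weighted_int 0 (- (1/2)) (1/2) 1 (poly (smult a p)) = a * weighted_int 0 (- (1/2)) (1/2) 1 (poly p)"
    for p q a \<psi>
    using P1ref_lin[of "poly p" "poly q" t 1 1] P1ref_lin[of "poly p" "poly p" t a 0]
      weighted_int_lin[of "poly p" "poly q" 0 "- (1/2)" "1/2" 1 1 1]
      weighted_int_lin[of "poly p" "poly p" 0 "- (1/2)" "1/2" 1 a 0]
    by (simp_all add: continuous_intros poly_add[abs_def] poly_smult[abs_def] one_pCons del: poly_1)
  show ?thesis unfolding lin_poly_def Lref_def by (auto simp: *)
qed

lemma poly_zero_on_interval:
  fixes p :: "real poly"
  assumes "a < b" "\<And>x. x \<in> {a..b} \<Longrightarrow> poly p x = 0"
  shows "p = 0"
proof (rule ccontr)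
  assume "p \<noteq> 0"
  then have "finite {x. poly p x = 0}" by (rule poly_roots_finite)
  moreover have "{a..b} \<subseteq> {x. poly p x = 0}" using assms by auto
  ultimately have "finite {a..b}" using finite_subset by blast
  then show False using assms(1) by (simp add: infinite_Icc)
qed

lemma poly_eq_const_on_unbounded:
  fixes p :: "real poly"
  assumes "\<And>n::nat. poly p (real n / 2) = c" shows "p = [:c:]"
proof (rule ccontr)
  assume "p \<noteq> [:c:]"
  then have "finite {x. poly (p - [:c:]) x = 0}" by (intro poly_roots_finite) auto
  moreover have "range (\<lambda>n::nat. real n / 2) \<subseteq> {x. poly (p - [:c:]) x = 0}" using assms by auto
  ultimately have "finite (range (\<lambda>n::nat. real n / 2))" using finite_subset by blast
  then show False using finite_imageD[of "\<lambda>n::nat. real n / 2" UNIV] by (auto simp: inj_on_def)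
qed

lemma integral_square_zero_imp_zero:
  fixes f :: "real \<Rightarrow> real"
  assumes "continuous_on UNIV f" "integral {a..b} (\<lambda>x. (f x)\<^sup>2) = 0" "a < b" "x \<in> {a..b}"
  shows "f x = 0"
proof -
  have "continuous_on {a..b} (\<lambda>x. (f x)\<^sup>2)" by (intro continuous_intros continuous_on_shift(2)[OF assms(1)])
  from integral_eq_0_iff[OF this] assms(2-4) show ?thesis by auto
qed

lemma P1ref_monoms:
  assumes "continuous_on UNIV \<omega>" "degree \<psi> \<le> k"
  shows "P1ref t \<omega> \<psi> = (\<Sum>j=1..k. coeff \<psi> j * P1ref t \<omega> (monom 1 j))"
proof -
  note L = lin_polyD[OF P1ref_lin_poly[OF assms(1)]]
  have "\<psi> = (\<Sum>j\<le>k. smult (coeff \<psi> j) (monom 1 j))"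
    using poly_as_sum_of_monoms'[OF assms(2)] by (simp add: smult_monom)
  then have "P1ref t \<omega> \<psi> = (\<Sum>j\<le>k. coeff \<psi> j * P1ref t \<omega> (monom 1 j))"
    using L(6)[where S = "{..k}" and f = "\<lambda>j. smult (coeff \<psi> j) (monom 1 j)"] by (simp add: L(2))
  also have "{..k} = insert 0 {1..k}" by auto
  finally show ?thesis using P1ref_const[OF assms(1), of t 1] by (simp add: monom_0)
qed

text \<open>Expanding the test p in monomials shows that P1 vanishes on (p, p). By the energy
  identity p has period 1/2, first on an interval and then everywhere, so it is constant, and the
  mean removes the constant.\<close>

lemma Lref_inj:
  assumes "t > 0" "degree p \<le> k" "\<And>j. j \<le> k \<Longrightarrow> Lref t j (poly p) = 0"
  shows "p = 0"
proof -
  have "P1ref t (poly p) (monom 1 j) = 0" if "j \<in> {1..k}" for j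
    using assms(3)[of j] that by (simp add: Lref_def)
  then have "P1ref t (poly p) p = 0"
    using P1ref_monoms[of "poly p" p k t] assms(2) by (simp add: continuous_intros)
  then have 0: "integral {- (1/2)..0} (\<lambda>x. (poly p (x + 1/2) - poly p x)\<^sup>2) = 0"
    using assms(1) by (simp add: P1ref_diagonal)
  have per: "p \<circ>\<^sub>p [:1/2, 1:] - p = 0"
  proof (rule poly_zero_on_interval[of "- (1/2)" 0])
    fix x :: real assume "x \<in> {- (1/2)..0}"
    then have "poly p (x + 1/2) - poly p x = 0"
      by (intro integral_square_zero_imp_zero[OF _ 0]) (auto intro!: continuous_intros)
    then show "poly (p \<circ>\<^sub>p [:1/2, 1:] - p) x = 0" by (simp add: poly_pcompose add.commute)
  qed simp
  then have *: "poly p (x + 1/2) = poly p x" for x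
  proof -
    have "poly (p \<circ>\<^sub>p [:1/2, 1:]) x = poly p x" using per by simp
    then show ?thesis by (simp add: poly_pcompose add.commute)
  qed
  have "poly p (real n / 2) = poly p 0" for n
  proof (induction n)
    case (Suc n)
    then show ?case using *[of "real n / 2"] by (simp add: add_divide_distrib add.commute)
  qed simp
  then have p: "p = [:poly p 0:]" by (rule poly_eq_const_on_unbounded)
  have "Lref t 0 (poly [:poly p 0:]) = 0" using assms(3)[of 0] p by simp
  then have "poly p 0 = 0" by (simp add: Lref_0 poly_const_fun)
  then show ?thesis using p by simp
qed

definition Lbasis :: "nat \<Rightarrow> real \<Rightarrow> nat \<Rightarrow> real poly" where
  "Lbasis k t = (SOME e. \<forall>j\<le>k. degree (e j) \<le> k \<and> (\<forall>i\<le>k. Lref t i (poly (e j)) = (if i = j then 1 else 0)))"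

lemma Lbasis:
  assumes "t > 0" "j \<le> k"
  shows "degree (Lbasis k t j) \<le> k"
    "i \<le> k \<Longrightarrow> Lref t i (poly (Lbasis k t j)) = (if i = j then 1 else 0)"
proof -
  have "\<exists>e. \<forall>j\<le>k. degree (e j) \<le> k \<and> (\<forall>i\<le>k. Lref t i (poly (e j)) = (if i = j then 1 else 0))"
    by (rule dual_basis_exists[where L = "\<lambda>i p. Lref t i (poly p)"])
      (use assms(1) Lref_inj Lref_lin_poly in blast)+
  from someI_ex[OF this] assms(2)
  show "degree (Lbasis k t j) \<le> k" "i \<le> k \<Longrightarrow> Lref t i (poly (Lbasis k t j)) = (if i = j then 1 else 0)"
    unfolding Lbasis_def by blast+
qed

lemma Lref_Lbasis_sum:
  assumes "t > 0" "i \<le> k" "S \<subseteq> {..k}"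
  shows "Lref t i (poly (\<Sum>j\<in>S. smult (b j) (Lbasis k t j))) = (if i \<in> S then b i else 0)"
proof -
  have fin: "finite S" using assms(3) finite_subset by blast
  have "Lref t i (poly (\<Sum>j\<in>S. smult (b j) (Lbasis k t j))) = (\<Sum>j\<in>S. if i = j then b j else 0)"
    using assms by (subst lin_polyD(6)[OF Lref_lin_poly], subst lin_polyD(2)[OF Lref_lin_poly])
      (auto intro!: sum.cong simp: Lbasis(2))
  then show ?thesis using fin by simp
qed

lemma Lref_unique:
  assumes "t > 0" "degree p \<le> k" "degree q \<le> k" "\<And>j. j \<le> k \<Longrightarrow> Lref t j (poly p) = Lref t j (poly q)"
  shows "p = q"
proof -
  have "p - q = 0" using assms lin_polyD(5)[OF Lref_lin_poly]
    by (intro Lref_inj[of t _ k]) (auto intro: degree_diff_le)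
  then show ?thesis by simp
qed

text \<open>Unique existence is recorded next to the explicit value because the definite description
  on an arbitrary cell is later identified with this one, which is legitimate only if it
  denotes.\<close>

lemma cell_proj_ref:
  assumes "t > 0" "continuous_on UNIV \<omega>"
  shows "cell_proj k t 1 0 \<omega> = (\<Sum>j\<le>k. smult (Lref t j \<omega>) (Lbasis k t j))" (is "_ = ?p")
    and "\<exists>!p. degree p \<le> k \<and> integral (cell 1 0) (poly p) = integral (cell 1 0) \<omega> \<and>
      (\<forall>\<psi>. degree \<psi> \<le> k \<longrightarrow> P1 t 1 0 (poly p) \<psi> = P1 t 1 0 \<omega> \<psi>)" (is "\<exists>!p. ?Q p")
proof -
  have deg: "degree ?p \<le> k" using assms by (intro degree_dual_sum_le Lbasis) auto
  have L: "Lref t j (poly ?p) = Lref t j \<omega>" if "j \<le> k" for j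
    using Lref_Lbasis_sum[OF assms(1) that, of "{..k}"] that by simp
  have c: "continuous_on UNIV (poly p)" for p :: "real poly" by (intro continuous_intros)
  have ce: "cell 1 0 = {- (1/2)..1/2}" by (simp add: cell_def)
  have P: "?Q ?p"
  proof (intro conjI allI impI)
    show "degree ?p \<le> k" by (rule deg)
    show "integral (cell 1 0) (poly ?p) = integral (cell 1 0) \<omega>"
      using L[of 0] by (simp add: Lref_0 ce)
    fix \<psi> :: "real poly" assume d: "degree \<psi> \<le> k"
    have "P1ref t (poly ?p) \<psi> = P1ref t \<omega> \<psi>"
      unfolding P1ref_monoms[OF c d] P1ref_monoms[OF assms(2) d]
    proof (intro sum.cong refl)
      fix j assume "j \<in> {1..k}"
      then have "P1ref t (poly ?p) (monom 1 j) = P1ref t \<omega> (monom 1 j)"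
        using L[of j] unfolding Lref_def by (metis atLeastAtMost_iff not_one_le_zero)
      then show "coeff \<psi> j * P1ref t (poly ?p) (monom 1 j) = coeff \<psi> j * P1ref t \<omega> (monom 1 j)"
        by simp
    qed
    then show "P1 t 1 0 (poly ?p) \<psi> = P1 t 1 0 \<omega> \<psi>" by (simp only: P1_eq_P1ref[OF c] P1_eq_P1ref[OF assms(2)])
  qed
  have U: "q = ?p" if q: "?Q q" for q
  proof (rule Lref_unique[OF assms(1) _ deg])
    show "degree q \<le> k" using q by simp
    fix j assume j: "j \<le> k"
    have "Lref t j (poly q) = Lref t j \<omega>"
    proof (cases "j = 0")
      case True then show ?thesis using q by (simp add: Lref_0 ce)
    next
      case False
      have "P1 t 1 0 (poly q) (monom 1 j) = P1 t 1 0 \<omega> (monom 1 j)"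
        using q j by (meson degree_monom_le order.trans)
      then show ?thesis using False by (simp add: Lref_def P1_eq_P1ref[OF c] P1_eq_P1ref[OF assms(2)])
    qed
    then show "Lref t j (poly q) = Lref t j (poly ?p)" using L[OF j] by simp
  qed
  show "cell_proj k t 1 0 \<omega> = ?p" unfolding cell_proj_def using P U by (rule the_equality)
  show "\<exists>!p. ?Q p" using P U by (rule ex1I)
qed

text \<open>A spanning family of the zero-mean test polynomials. P1 does not see the subtracted
  constant, so these tests have the same effect as the monomials.\<close>

definition zmonom :: "nat \<Rightarrow> real poly" where
  "zmonom j = monom 1 j - [:integral {- (1/2)..1/2} (poly (monom 1 j)):]"

lemma zmonom: "degree (zmonom j) \<le> j" "integral {- (1/2)..1/2} (poly (zmonom j)) = 0"
proof -
  show "degree (zmonom j) \<le> j"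
    unfolding zmonom_def by (intro degree_diff_le degree_monom_le) simp
  have "integral {- (1/2)..1/2} (poly (zmonom j))
      = integral {- (1/2)..1/2} (poly (monom 1 j)) - integral {- (1/2)..1/2::real} (\<lambda>x. integral {- (1/2)..1/2} (poly (monom 1 j)))"
    unfolding zmonom_def poly_diff[abs_def] poly_const_fun
    by (intro integral_diff continuous_imp_integrable continuous_intros)
  then show "integral {- (1/2)..1/2} (poly (zmonom j)) = 0" by simp
qed

lemma P1ref_zmonom:
  assumes "continuous_on UNIV \<omega>" shows "P1ref t \<omega> (zmonom j) = P1ref t \<omega> (monom 1 j)"
  unfolding zmonom_def by (simp only: lin_polyD(5)[OF P1ref_lin_poly[OF assms]] P1ref_const[OF assms] diff_zero)

lemma zero_mean_expand:
  assumes "degree \<psi> \<le> k" "integral {- (1/2)..1/2} (poly \<psi>) = 0"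
  shows "\<psi> = (\<Sum>j=1..k. smult (coeff \<psi> j) (zmonom j))"
proof -
  define \<phi> where "\<phi> = (\<Sum>j=1..k. smult (coeff \<psi> j) (zmonom j))"
  have "lin_poly (\<lambda>p. Lref 1 0 (poly p))" by (rule Lref_lin_poly)
  then have lin: "lin_poly (\<lambda>p. integral {- (1/2)..1/2} (poly p))" by (simp add: Lref_0)
  have "integral {- (1/2)..1/2} (poly \<phi>) = 0"
    unfolding \<phi>_def lin_polyD(6)[OF lin] lin_polyD(2)[OF lin] zmonom(2) by simp
  then have i0: "integral {- (1/2)..1/2} (poly (\<psi> - \<phi>)) = 0" by (simp only: lin_polyD(5)[OF lin] assms)
  have "coeff (\<psi> - \<phi>) n = 0" if "n \<noteq> 0" for n
  proof -
    have "coeff (zmonom j) n = (if j = n then 1 else 0)" for j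
      using that by (cases n) (auto simp: zmonom_def)
    then have "coeff \<phi> n = (\<Sum>j=1..k. coeff \<psi> j * (if j = n then 1 else 0))"
      by (simp add: \<phi>_def coeff_sum)
    also have "\<dots> = (\<Sum>j=1..k. if j = n then coeff \<psi> j else 0)"
      by (intro sum.cong) auto
    also have "\<dots> = coeff \<psi> n" using that assms(1) by (auto simp: coeff_eq_0)
    finally show ?thesis by simp
  qed
  moreover define c where "c = coeff (\<psi> - \<phi>) 0"
  \<comment> \<open>All coefficients above the constant one agree, and zero mean settles the
    constant.\<close>
  ultimately have e: "\<psi> - \<phi> = [:c:]"
    by (intro poly_eqI) (auto simp: coeff_pCons split: nat.splits)
  then have "integral {- (1/2)..1/2} (poly [:c:]) = 0" using i0 by simp
  then have "c = 0" by (simp add: poly_const_fun)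
  then show ?thesis using e by (simp add: \<phi>_def)
qed

text \<open>The sign stems from the definition, which prescribes P1 of -p. The second claim extends
  the equation from the basis tests to all zero-mean tests; its instance with the test x drives the
  cancellation of residuals.\<close>

lemma cell_corr_ref:
  assumes "t > 0" "lin_poly F"
  shows "cell_corr k t 1 0 F = (\<Sum>j=1..k. smult (- F (zmonom j)) (Lbasis k t j))" (is "_ = ?p")
    and "degree \<psi> \<le> k \<Longrightarrow> integral {- (1/2)..1/2} (poly \<psi>) = 0 \<Longrightarrow>
      P1ref t (poly (\<Sum>j=1..k. smult (- F (zmonom j)) (Lbasis k t j))) \<psi> = - F \<psi>"
    and "\<exists>!p. degree p \<le> k \<and> integral (cell 1 0) (poly p) = 0 \<and>
      (\<forall>\<psi>. degree \<psi> \<le> k \<and> integral (cell 1 0) (poly \<psi>) = 0 \<longrightarrow> P1 t 1 0 (\<lambda>x. - poly p x) \<psi> = F \<psi>)" (is "\<exists>!p. ?Q p")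
proof -
  have deg: "degree ?p \<le> k" using assms by (intro degree_dual_sum_le Lbasis) auto
  \<comment> \<open>Leaving out the basis element of index 0 is what encodes zero mean.\<close>
  have L: "Lref t j (poly ?p) = (if j = 0 then 0 else - F (zmonom j))" if "j \<le> k" for j
    by (subst Lref_Lbasis_sum[OF assms(1) that]) (use that in auto)
  have c: "continuous_on UNIV (poly p)" for p :: "real poly" by (intro continuous_intros)
  have ce: "cell 1 0 = {- (1/2)..1/2}" by (simp add: cell_def)
  have neg: "P1 t 1 0 (\<lambda>x. - poly p x) \<psi> = - P1ref t (poly p) \<psi>" for p \<psi>
  proof -
    have "continuous_on UNIV (\<lambda>x. - poly p x)" by (intro continuous_intros)
    then show ?thesis using P1ref_lin[OF c c, of t "-1" p 0 p] by (simp add: P1_eq_P1ref)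
  qed
  have m: "P1ref t (poly ?p) (zmonom j) = - F (zmonom j)" if "1 \<le> j" "j \<le> k" for j
    using L[OF that(2)] that by (simp add: Lref_def P1ref_zmonom[OF c])
  show *: "P1ref t (poly ?p) \<psi> = - F \<psi>" if "degree \<psi> \<le> k" "integral {- (1/2)..1/2} (poly \<psi>) = 0" for \<psi>
  proof -
    note z = zero_mean_expand[OF that]
    have "P1ref t (poly ?p) (\<Sum>j=1..k. smult (coeff \<psi> j) (zmonom j)) = (\<Sum>j=1..k. coeff \<psi> j * (- F (zmonom j)))"
      using m by (simp add: lin_polyD[OF P1ref_lin_poly[OF c]])
    also have "\<dots> = - F (\<Sum>j=1..k. smult (coeff \<psi> j) (zmonom j))"
      by (simp add: lin_polyD[OF assms(2)] sum_negf)
    finally show ?thesis using z by simp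
  qed
  have P: "?Q ?p"
    using deg L[of 0] * unfolding neg ce by (auto simp: Lref_0)
  have U: "q = ?p" if q: "?Q q" for q
    proof (rule Lref_unique[OF assms(1) _ deg])
      show "degree q \<le> k" using q by simp
      fix j assume j: "j \<le> k"
      show "Lref t j (poly q) = Lref t j (poly ?p)"
      proof (cases "j = 0")
        case True then show ?thesis using q L[OF j] by (simp add: Lref_0 ce)
      next
        case False
        have "P1 t 1 0 (\<lambda>x. - poly q x) (zmonom j) = F (zmonom j)"
          using q j zmonom[of j] ce by (metis order.trans)
        then show ?thesis using False L[OF j] unfolding neg by (simp add: Lref_def P1ref_zmonom[OF c])
      qed
    qed
  show "cell_corr k t 1 0 F = ?p" unfolding cell_corr_def using P U by (rule the_equality)
  show "\<exists>!p. ?Q p" using P U by (rule ex1I)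
qed

section \<open>The corrections on the reference cell\<close>

text \<open>A function of two variables enters together with its partial derivatives: \<open>d a b\<close> is the
  derivative of order \<open>a\<close> in the first and \<open>b\<close> in the second variable.\<close>

type_synonym jet = "nat \<Rightarrow> nat \<Rightarrow> real \<Rightarrow> real \<Rightarrow> real"

definition jcont :: "jet \<Rightarrow> bool" where
  "jcont d \<longleftrightarrow> (\<forall>a b. continuous_on UNIV (\<lambda>(x, y). d a b x y))"

definition jdx :: "jet \<Rightarrow> jet" where "jdx d = (\<lambda>a b. d (Suc a) b)"
definition jdy :: "jet \<Rightarrow> jet" where "jdy d = (\<lambda>a b. d a (Suc b))"
definition jshift :: "real \<Rightarrow> real \<Rightarrow> jet \<Rightarrow> jet" where
  "jshift r s d = (\<lambda>a b x y. d a b (x + r) (y + s))"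
definition jlin :: "real \<Rightarrow> jet \<Rightarrow> real \<Rightarrow> jet \<Rightarrow> jet" where
  "jlin \<alpha> d \<beta> d' = (\<lambda>a b x y. \<alpha> * d a b x y + \<beta> * d' a b x y)"
definition jdiff :: "real \<Rightarrow> jet \<Rightarrow> jet" where "jdiff r d = jlin 1 (jshift r 0 d) (-1) d"

lemmas jet_defs = jdx_def jdy_def jshift_def jlin_def jdiff_def

lemma jcont_slice: "jcont d \<Longrightarrow> continuous_on S (\<lambda>x. d a b x y)"
  unfolding jcont_def by (rule continuous_curried) (auto intro: continuous_intros)

lemma jcont_jdx: "jcont d \<Longrightarrow> jcont (jdx d)" and jcont_jdy: "jcont d \<Longrightarrow> jcont (jdy d)"
  by (auto simp: jcont_def jdx_def jdy_def)

lemma jcont_jshift: "jcont d \<Longrightarrow> jcont (jshift r s d)"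
  unfolding jcont_def jshift_def case_prod_beta
  by (intro allI continuous_curried[of "d _ _"] continuous_intros) (auto simp: case_prod_beta)

lemma jcont_jlin: "jcont d \<Longrightarrow> jcont d' \<Longrightarrow> jcont (jlin \<alpha> d \<beta> d')"
  unfolding jcont_def jlin_def case_prod_beta by (auto intro!: continuous_intros)

lemma jcont_jdiff: "jcont d \<Longrightarrow> jcont (jdiff r d)"
  unfolding jdiff_def by (intro jcont_jlin jcont_jshift)

lemmas jcont_intros = jcont_jdx jcont_jdy jcont_jshift jcont_jlin jcont_jdiff

text \<open>The counterpart of \<open>chi\<close> on the reference cell. A neighbouring cell of the
  other mesh is reached by translating the jet by 1/2 in x, so both components are given by this one
  function, and their differences by \<open>jdiff\<close>. Derivatives of u are read off the jet.
  The coordinate y is a mere parameter.\<close>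

fun loc :: "nat \<Rightarrow> real \<Rightarrow> nat \<Rightarrow> jet \<Rightarrow> real \<Rightarrow> real \<Rightarrow> real" where
  "loc k t 0 d = (\<lambda>x y. d 0 0 x y - (\<Sum>j\<le>k. Lref t j (\<lambda>s. d 0 0 s y) * poly (Lbasis k t j) x))"
| "loc k t (Suc l) d = (\<lambda>x y. - (\<Sum>j=1..k. rhsref t (\<lambda>s. loc k t l (jdx d) s y)
      (\<lambda>s. loc k t l (jdiff (- (1/2)) d) s y) (\<lambda>s. loc k t l (jdiff (1/2) d) s y)
      (case l of 0 \<Rightarrow> (\<lambda>s. 0) | Suc l' \<Rightarrow> (\<lambda>s. loc k t l' (jdiff (- (1/2)) (jdy d)) s y))
      (case l of 0 \<Rightarrow> (\<lambda>s. 0) | Suc l' \<Rightarrow> (\<lambda>s. loc k t l' (jdiff (1/2) (jdy d)) s y))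
      (\<lambda>s. loc k t l (jdy d) s y) (zmonom j) * poly (Lbasis k t j) x))"

definition locprev :: "nat \<Rightarrow> real \<Rightarrow> nat \<Rightarrow> jet \<Rightarrow> real \<Rightarrow> real \<Rightarrow> real" where
  "locprev k t l d = (case l of 0 \<Rightarrow> (\<lambda>x y. 0) | Suc l' \<Rightarrow> loc k t l' d)"

definition locrhs :: "nat \<Rightarrow> real \<Rightarrow> nat \<Rightarrow> jet \<Rightarrow> real \<Rightarrow> real poly \<Rightarrow> real" where
  "locrhs k t l d y = rhsref t (\<lambda>s. loc k t l (jdx d) s y)
      (\<lambda>s. loc k t l (jdiff (- (1/2)) d) s y) (\<lambda>s. loc k t l (jdiff (1/2) d) s y)
      (\<lambda>s. locprev k t l (jdiff (- (1/2)) (jdy d)) s y) (\<lambda>s. locprev k t l (jdiff (1/2) (jdy d)) s y)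
      (\<lambda>s. loc k t l (jdy d) s y)"

lemma loc_Suc: "loc k t (Suc l) d x y = - (\<Sum>j=1..k. locrhs k t l d y (zmonom j) * poly (Lbasis k t j) x)"
  by (cases l) (auto simp: locrhs_def locprev_def)

declare loc.simps(2) [simp del]

text \<open>The recursion for level l + 1 reaches back to the levels l and l - 1, hence two
  hypotheses.\<close>

lemma level_induct [case_names 0 Suc]:
  assumes "P 0" "\<And>l. P l \<Longrightarrow> (\<And>l'. l = Suc l' \<Longrightarrow> P l') \<Longrightarrow> P (Suc l)"
  shows "P (l :: nat)"
proof (induction l rule: less_induct)
  case (less l)
  then show ?case using assms by (cases l) auto
qed

lemma Lref_continuous:
  fixes f :: "real \<Rightarrow> real \<Rightarrow> real"
  assumes "continuous_on UNIV (\<lambda>(x, y). f x y)"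
  shows "continuous_on UNIV (\<lambda>y. Lref t j (\<lambda>x. f x y))"
  by (cases "j = 0") (simp_all add: Lref_def weighted_int_continuous P1ref_continuous assms)

lemma continuous_on_snd_poly:
  assumes "continuous_on UNIV f"
  shows "continuous_on UNIV (\<lambda>z::real \<times> real. f (snd z) * poly p (fst z) :: real)"
  by (intro continuous_intros continuous_on_compose2[OF assms]) auto

lemma loc_continuous: "jcont d \<Longrightarrow> continuous_on UNIV (\<lambda>(x, y). loc k t l d x y)"
proof (induction l arbitrary: d rule: level_induct)
  case 0
  have c: "continuous_on UNIV (\<lambda>(x, y). d 0 0 x y)" using 0 by (simp add: jcont_def)
  show ?case unfolding loc.simps case_prod_beta
    by (intro continuous_on_diff continuous_on_sum continuous_on_snd_poly Lref_continuous c
        c[unfolded case_prod_beta])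
next
  case (Suc l)
  have "continuous_on UNIV (\<lambda>(x, y). locprev k t l d' x y)" if "jcont d'" for d'
    using Suc.IH(2)[OF _ that] by (auto simp: locprev_def case_prod_beta split: nat.splits)
  note this[OF jcont_jdiff[OF jcont_jdy[OF Suc.prems]]]
  then have "continuous_on UNIV (\<lambda>y. locrhs k t l d y \<psi>)" for \<psi>
    unfolding locrhs_def by (intro rhsref_continuous Suc.IH(1) jcont_intros Suc.prems) auto
  then show ?case unfolding loc_Suc case_prod_beta
    by (intro continuous_on_minus continuous_on_sum continuous_on_snd_poly)
qed

lemma locprev_continuous: "jcont d \<Longrightarrow> continuous_on UNIV (\<lambda>(x, y). locprev k t l d x y)"
  using loc_continuous by (auto simp: locprev_def case_prod_beta split: nat.splits)

lemma loc_slice: "jcont d \<Longrightarrow> continuous_on UNIV (\<lambda>x. loc k t l d x y)"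
  by (rule continuous_curried[OF loc_continuous]) (auto intro: continuous_intros)

lemma locprev_slice: "jcont d \<Longrightarrow> continuous_on UNIV (\<lambda>x. locprev k t l d x y)"
  by (rule continuous_curried[OF locprev_continuous]) (auto intro: continuous_intros)

lemma Lref_lin:
  assumes "continuous_on UNIV f" "continuous_on UNIV g"
  shows "Lref t j (\<lambda>x. \<alpha> * f x + \<beta> * g x) = \<alpha> * Lref t j f + \<beta> * Lref t j g"
  unfolding Lref_def by (simp add: weighted_int_lin P1ref_lin assms)

lemma jet_ops_jlin:
  "jdx (jlin \<alpha> d \<beta> d') = jlin \<alpha> (jdx d) \<beta> (jdx d')"
  "jdy (jlin \<alpha> d \<beta> d') = jlin \<alpha> (jdy d) \<beta> (jdy d')"
  "jshift r s (jlin \<alpha> d \<beta> d') = jlin \<alpha> (jshift r s d) \<beta> (jshift r s d')"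
  "jdiff r (jlin \<alpha> d \<beta> d') = jlin \<alpha> (jdiff r d) \<beta> (jdiff r d')"
  by (auto simp: jet_defs fun_eq_iff algebra_simps)

lemma jet_ops_commute:
  "jdx (jshift r s d) = jshift r s (jdx d)" "jdy (jshift r s d) = jshift r s (jdy d)"
  "jdiff q (jshift r s d) = jshift r s (jdiff q d)" "jdx (jdiff r d) = jdiff r (jdx d)"
  "jdy (jdiff r d) = jdiff r (jdy d)" "jdy (jdx d) = jdx (jdy d)"
  "jshift r s (jshift r' s' d) = jshift (r + r') (s + s') d"
  by (auto simp: jet_defs fun_eq_iff algebra_simps)

lemma loc_jlin:
  "jcont d \<Longrightarrow> jcont d' \<Longrightarrow>
    loc k t l (jlin \<alpha> d \<beta> d') x y = \<alpha> * loc k t l d x y + \<beta> * loc k t l d' x y"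
proof (induction l arbitrary: d d' x rule: level_induct)
  case 0
  have "Lref t j (\<lambda>s. \<alpha> * d 0 0 s y + \<beta> * d' 0 0 s y) = \<alpha> * Lref t j (\<lambda>s. d 0 0 s y) + \<beta> * Lref t j (\<lambda>s. d' 0 0 s y)" for j
    by (intro Lref_lin jcont_slice 0)
  then show ?case by (simp add: jlin_def algebra_simps sum.distrib sum_distrib_left)
next
  case (Suc l)
  have p: "locprev k t l (jlin \<alpha> d \<beta> d') x y = \<alpha> * locprev k t l d x y + \<beta> * locprev k t l d' x y"
    if "jcont d" "jcont d'" for d d' x
    using Suc.IH(2)[OF _ that] by (auto simp: locprev_def split: nat.splits)
  have "locrhs k t l (jlin \<alpha> d \<beta> d') y \<psi> = \<alpha> * locrhs k t l d y \<psi> + \<beta> * locrhs k t l d' y \<psi>" for \<psi>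
    unfolding locrhs_def jet_ops_jlin
    by (simp only: Suc.IH(1) p jcont_intros Suc.prems) (intro rhsref_lin loc_slice locprev_slice jcont_intros Suc.prems)
  then show ?case by (simp add: loc_Suc algebra_simps sum.distrib sum_distrib_left)
qed

text \<open>Differences of a level are the level of a difference. This justifies
  \<open>jdiff\<close> in the recursion and is the source of the gain of one polynomial degree per
  level.\<close>

lemma loc_jdiff: "jcont d \<Longrightarrow> loc k t l (jdiff r d) x y = loc k t l (jshift r 0 d) x y - loc k t l d x y"
  unfolding jdiff_def by (simp add: loc_jlin jcont_intros)

lemma loc_jshift_snd: "loc k t l (jshift 0 s d) x y = loc k t l d x (y + s)"
proof (induction l arbitrary: d x rule: level_induct)
  case 0
  then show ?case by (simp add: jshift_def)
next
  case (Suc l)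
  have "locprev k t l (jshift 0 s d) x y = locprev k t l d x (y + s)" for d x
    using Suc.IH(2) by (auto simp: locprev_def split: nat.splits)
  then have "locrhs k t l (jshift 0 s d) y = locrhs k t l d (y + s)"
    unfolding locrhs_def jet_ops_commute by (simp only: Suc.IH(1))
  then show ?case by (simp add: loc_Suc)
qed

text \<open>The height y is frozen because the corrections in x act on each horizontal line
  separately.\<close>

definition jbound :: "nat \<Rightarrow> real \<Rightarrow> jet \<Rightarrow> real \<Rightarrow> real \<Rightarrow> bool" where
  "jbound l R d y M \<longleftrightarrow> jcont d \<and> (\<forall>a b s. a + b \<le> l \<longrightarrow> \<bar>s\<bar> \<le> R \<longrightarrow> \<bar>d a b s y\<bar> \<le> M)"

text \<open>The price of one level: one order of differentiation and half a cell of width on either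
  side.\<close>

lemma jbound_ops:
  assumes "jbound (Suc l) (R + 1/2) d y M"
  shows "jbound l R (jdx d) y M" "jbound l R (jdy d) y M"
    "\<bar>r\<bar> \<le> 1/2 \<Longrightarrow> jbound l R (jdiff r d) y (2 * M)"
proof -
  have d: "jcont d" "\<And>a b s. a + b \<le> Suc l \<Longrightarrow> \<bar>s\<bar> \<le> R + 1/2 \<Longrightarrow> \<bar>d a b s y\<bar> \<le> M"
    using assms by (auto simp: jbound_def)
  show "jbound l R (jdx d) y M" "jbound l R (jdy d) y M"
    using d jcont_jdx[OF d(1)] jcont_jdy[OF d(1)] by (auto simp: jbound_def) (auto simp: jdx_def jdy_def)
  assume r: "\<bar>r\<bar> \<le> 1/2"
  have "\<bar>d a b (s + r) y - d a b s y\<bar> \<le> 2 * M" if "a + b \<le> l" "\<bar>s\<bar> \<le> R" for a b s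
    using d(2)[of a b "s + r"] d(2)[of a b s] that r by linarith
  then show "jbound l R (jdiff r d) y (2 * M)"
    using d by (auto simp: jbound_def jcont_intros) (auto simp: jet_defs)
qed

lemma jbound_nonneg: "jbound l R d y M \<Longrightarrow> R \<ge> 0 \<Longrightarrow> M \<ge> 0"
  unfolding jbound_def by (metis abs_ge_zero abs_zero add_0 order.trans zero_le)

lemma Lref_bdd6: "\<exists>C\<ge>0. \<forall>w M. bdd6 w M \<longrightarrow> \<bar>Lref t j (w 0)\<bar> \<le> C * M"
proof (cases "j = 0")
  case True
  then show ?thesis unfolding Lref_def by (simp, intro weighted_int_bdd6) auto
next
  case False
  then show ?thesis unfolding Lref_def by (simp, intro P1ref_bdd6)
qed

text \<open>The radius (l + 1) / 2 is the half width of the cell plus half a cell for each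
  level.\<close>

lemma loc_bound:
  "\<exists>C\<ge>0. \<forall>d y M. jbound l ((real l + 1) / 2) d y M \<longrightarrow> (\<forall>x. \<bar>x\<bar> \<le> 1/2 \<longrightarrow> \<bar>loc k t l d x y\<bar> \<le> C * M)"
proof (induction l rule: level_induct)
  case 0
  have "\<exists>C\<ge>0. \<forall>w M. bdd6 w M \<longrightarrow> (\<forall>x. \<bar>x\<bar> \<le> 1/2 \<longrightarrow> \<bar>Lref t j (w 0) * poly (Lbasis k t j) x\<bar> \<le> C * M)" for j
  proof -
    obtain C where C: "C \<ge> 0" "\<And>w M. bdd6 w M \<Longrightarrow> \<bar>Lref t j (w 0)\<bar> \<le> C * M" using Lref_bdd6 by blast
    obtain N where N: "N \<ge> 0" "\<And>x. x \<in> {- (1/2)..1/2} \<Longrightarrow> \<bar>poly (Lbasis k t j) x\<bar> \<le> N" using poly_bounded_on by blast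
    have "\<bar>Lref t j (w 0) * poly (Lbasis k t j) x\<bar> \<le> C * N * M" if "bdd6 w M" "\<bar>x\<bar> \<le> 1/2" for w M x
    proof -
      have "\<bar>Lref t j (w 0)\<bar> * \<bar>poly (Lbasis k t j) x\<bar> \<le> (C * M) * N"
      proof (intro mult_mono C(2) N(2) that)
        show "x \<in> {- (1/2)..1/2}" using that(2) by (simp only: atLeastAtMost_iff) linarith
        have "0 \<le> \<bar>Lref t j (w 0)\<bar>" by simp
        also have "\<dots> \<le> C * M" by (rule C(2)[OF that(1)])
        finally show "0 \<le> C * M" .
      qed simp
      then show ?thesis by (simp add: abs_mult mult_ac)
    qed
    then show ?thesis using C(1) N(1) by (intro exI[of _ "C * N"]) auto
  qed
  then obtain C where C: "\<And>j. C j \<ge> 0" "\<And>j w M x. bdd6 w M \<Longrightarrow> \<bar>x\<bar> \<le> 1/2 \<Longrightarrow> \<bar>Lref t j (w 0) * poly (Lbasis k t j) x\<bar> \<le> C j * M"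
    by metis
  have "\<bar>loc k t 0 d x y\<bar> \<le> (1 + (\<Sum>j\<le>k. C j)) * M" if "jbound 0 (1/2) d y M" "\<bar>x\<bar> \<le> 1/2" for d x y M
  proof -
    have b: "bdd6 (\<lambda>_ s. d 0 0 s y) M"
      using that(1) by (auto simp: jbound_def bdd6_def intro: jcont_slice)
    have "\<bar>\<Sum>j\<le>k. Lref t j (\<lambda>s. d 0 0 s y) * poly (Lbasis k t j) x\<bar> \<le> (\<Sum>j\<le>k. C j * M)"
      by (intro order.trans[OF sum_abs] sum_mono C(2)[OF b that(2)])
    moreover have "\<bar>d 0 0 x y\<bar> \<le> M" using that by (auto simp: jbound_def)
    moreover have "(1 + (\<Sum>j\<le>k. C j)) * M = M + (\<Sum>j\<le>k. C j * M)"
      by (simp add: distrib_right sum_distrib_right)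
    ultimately show ?thesis unfolding loc.simps by linarith
  qed
  then show ?case using C(1) by (intro exI[of _ "1 + (\<Sum>j\<le>k. C j)"]) (auto intro!: add_nonneg_nonneg sum_nonneg)
next
  case (Suc l)
  obtain C where C: "C \<ge> 0" "\<And>d y M x. jbound l ((real l + 1) / 2) d y M \<Longrightarrow> \<bar>x\<bar> \<le> 1/2 \<Longrightarrow> \<bar>loc k t l d x y\<bar> \<le> C * M"
    using Suc.IH(1) by blast
  have "\<exists>D\<ge>0. \<forall>d y M x. jbound (l - 1) (real l / 2) d y M \<longrightarrow> \<bar>x\<bar> \<le> 1/2 \<longrightarrow> \<bar>locprev k t l d x y\<bar> \<le> D * M"
  proof (cases l)
    case (Suc l')
    show ?thesis using Suc.IH(2)[OF Suc] by (auto simp: locprev_def Suc add.commute)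
  qed (auto simp: locprev_def intro: exI[of _ 0])
  then obtain D where D: "D \<ge> 0" "\<And>d y M x. jbound (l - 1) (real l / 2) d y M \<Longrightarrow> \<bar>x\<bar> \<le> 1/2 \<Longrightarrow> \<bar>locprev k t l d x y\<bar> \<le> D * M"
    by blast
  \<comment> \<open>The factor 2 pays for the differences, which double the bound of the
    data.\<close>
  define E where "E = 2 * (C + D)"
  have E: "E \<ge> 0" using C D by (simp add: E_def)
  have "\<exists>B\<ge>0. \<forall>d y M x. jbound (Suc l) ((real (Suc l) + 1) / 2) d y M \<longrightarrow> \<bar>x\<bar> \<le> 1/2 \<longrightarrow>
      \<bar>locrhs k t l d y (zmonom j) * poly (Lbasis k t j) x\<bar> \<le> B * M" for j
  proof -
    obtain A where A: "A \<ge> 0" "\<And>w M. bdd6 w M \<Longrightarrow> \<bar>rhsref t (w 0) (w 1) (w 2) (w 3) (w 4) (w 5) (zmonom j)\<bar> \<le> A * M"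
      using rhsref_bdd6 by blast
    obtain N where N: "N \<ge> 0" "\<And>x. x \<in> {- (1/2)..1/2} \<Longrightarrow> \<bar>poly (Lbasis k t j) x\<bar> \<le> N" using poly_bounded_on by blast
    have "\<bar>locrhs k t l d y (zmonom j) * poly (Lbasis k t j) x\<bar> \<le> A * E * N * M"
      if d: "jbound (Suc l) ((real (Suc l) + 1) / 2) d y M" and x: "\<bar>x\<bar> \<le> 1/2" for d y M x
    proof -
      have M: "M \<ge> 0" using jbound_nonneg[OF d] by simp
      have jc: "jcont d" using d by (simp add: jbound_def)
      have d': "jbound (Suc l) ((real l + 1) / 2 + 1/2) d y M" using d by (simp add: add_divide_distrib add_ac)
      note o = jbound_ops[OF d']
      \<comment> \<open>The level before the previous one sees a derivative and a difference, so two
        orders and two half cells are spent at once.\<close>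
      have o2: "jbound (l - 1) (real l / 2) (jdiff r (jdy d)) y (2 * M)" if "\<bar>r\<bar> \<le> 1/2" "l \<noteq> 0" for r
        by (rule jbound_ops(3)) (use o(2) that in \<open>simp_all add: add_divide_distrib\<close>)
      have le: "C * M \<le> E * M" "C * (2 * M) \<le> E * M" "D * (2 * M) \<le> E * M"
        using C D M by (auto simp: E_def algebra_simps)
      have "\<bar>locprev k t l (jdiff r (jdy d)) s y\<bar> \<le> E * M" if "\<bar>r\<bar> \<le> 1/2" "\<bar>s\<bar> \<le> 1/2" for r s
      proof (cases "l = 0")
        case True then show ?thesis using E M by (simp add: locprev_def)
      next
        case False
        from D(2)[OF o2[OF that(1) False] that(2)] le show ?thesis by linarith
      qed
      moreover have "\<bar>loc k t l (jdx d) s y\<bar> \<le> E * M" "\<bar>loc k t l (jdy d) s y\<bar> \<le> E * M"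
        if "\<bar>s\<bar> \<le> 1/2" for s
        using C(2)[OF o(1) that] C(2)[OF o(2) that] le by linarith+
      moreover have "\<bar>loc k t l (jdiff r d) s y\<bar> \<le> E * M" if "\<bar>r\<bar> \<le> 1/2" "\<bar>s\<bar> \<le> 1/2" for r s
        using C(2)[OF o(3)[OF that(1)] that(2)] le by linarith
      ultimately have b: "bdd6 (\<lambda>i. if i = 0 then (\<lambda>s. loc k t l (jdx d) s y)
          else if i = 1 then (\<lambda>s. loc k t l (jdiff (- (1/2)) d) s y)
          else if i = 2 then (\<lambda>s. loc k t l (jdiff (1/2) d) s y)
          else if i = 3 then (\<lambda>s. locprev k t l (jdiff (- (1/2)) (jdy d)) s y)
          else if i = 4 then (\<lambda>s. locprev k t l (jdiff (1/2) (jdy d)) s y)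
          else (\<lambda>s. loc k t l (jdy d) s y)) (E * M)"
        unfolding bdd6_def by (simp add: loc_slice locprev_slice jcont_intros jc)
      have "\<bar>locrhs k t l d y (zmonom j)\<bar> \<le> A * (E * M)"
        using A(2)[OF b] by (simp add: locrhs_def)
      then have "\<bar>locrhs k t l d y (zmonom j)\<bar> * \<bar>poly (Lbasis k t j) x\<bar> \<le> (A * (E * M)) * N"
      proof (intro mult_mono N(2))
        show "x \<in> {- (1/2)..1/2}" using x by (simp only: atLeastAtMost_iff) linarith
      qed (use A E M in auto)
      then show ?thesis by (simp add: abs_mult mult_ac)
    qed
    then show ?thesis using A(1) E N(1) by (intro exI[of _ "A * E * N"]) auto
  qed
  then obtain B where B: "\<And>j. B j \<ge> 0" "\<And>j d y M x. jbound (Suc l) ((real (Suc l) + 1) / 2) d y M \<Longrightarrow> \<bar>x\<bar> \<le> 1/2 \<Longrightarrow>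
      \<bar>locrhs k t l d y (zmonom j) * poly (Lbasis k t j) x\<bar> \<le> B j * M"
    by metis
  have "\<bar>loc k t (Suc l) d x y\<bar> \<le> (\<Sum>j=1..k. B j) * M"
    if "jbound (Suc l) ((real (Suc l) + 1) / 2) d y M" "\<bar>x\<bar> \<le> 1/2" for d y M x
    unfolding loc_Suc abs_minus_cancel sum_distrib_right
    by (intro order.trans[OF sum_abs] sum_mono B(2)[OF that])
  then show ?case using B(1) by (intro exI[of _ "\<Sum>j=1..k. B j"]) (auto intro!: sum_nonneg)
qed

lemma locrhs_lin_poly: "jcont d \<Longrightarrow> lin_poly (locrhs k t l d y)"
  unfolding locrhs_def by (intro rhsref_lin_poly loc_slice locprev_slice jcont_intros)

lemma loc_mean:
  assumes "t > 0" "jcont d"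
  shows "integral {- (1/2)..1/2} (\<lambda>x. loc k t l d x y) = 0"
proof (cases l)
  case 0
  define p where "p = (\<Sum>j\<le>k. smult (Lref t j (\<lambda>s. d 0 0 s y)) (Lbasis k t j))"
  have "Lref t 0 (poly p) = Lref t 0 (\<lambda>s. d 0 0 s y)"
    unfolding p_def by (subst Lref_Lbasis_sum[OF assms(1)]) auto
  then have "integral {- (1/2)..1/2} (\<lambda>x. d 0 0 x y - poly p x) = 0"
    by (subst integral_diff) (auto simp: Lref_0 intro!: continuous_imp_integrable continuous_on_poly jcont_slice[OF assms(2)] continuous_on_id)
  then show ?thesis by (simp add: 0 p_def poly_sum)
next
  case (Suc l')
  have "Lref t 0 (poly (\<Sum>j=1..k. smult (- locrhs k t l' d y (zmonom j)) (Lbasis k t j))) = 0"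
    by (subst Lref_Lbasis_sum[OF assms(1)]) auto
  moreover have "poly (\<Sum>j=1..k. smult (- locrhs k t l' d y (zmonom j)) (Lbasis k t j)) = (\<lambda>x. loc k t l d x y)"
    by (simp add: fun_eq_iff Suc loc_Suc poly_sum sum_negf)
  ultimately show ?thesis by (simp only: Lref_0)
qed

text \<open>Galerkin orthogonality of the projection error.\<close>

lemma loc_0_P1ref:
  assumes "t > 0" "jcont d" "degree \<psi> \<le> k"
  shows "P1ref t (\<lambda>x. loc k t 0 d x y) \<psi> = 0"
proof -
  define p where "p = (\<Sum>j\<le>k. smult (Lref t j (\<lambda>s. d 0 0 s y)) (Lbasis k t j))"
  have c: "continuous_on UNIV (poly p)" "continuous_on UNIV (\<lambda>s. d 0 0 s y)"
    by (intro continuous_intros jcont_slice assms)+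
  have "P1ref t (\<lambda>s. d 0 0 s y) \<psi> = P1ref t (poly p) \<psi>"
    unfolding P1ref_monoms[OF c(1) assms(3)] P1ref_monoms[OF c(2) assms(3)]
  proof (intro sum.cong refl)
    fix j assume j: "j \<in> {1..k}"
    have "Lref t j (poly p) = Lref t j (\<lambda>s. d 0 0 s y)"
      unfolding p_def using j by (subst Lref_Lbasis_sum[OF assms(1)]) auto
    then show "coeff \<psi> j * P1ref t (\<lambda>s. d 0 0 s y) (monom 1 j) = coeff \<psi> j * P1ref t (poly p) (monom 1 j)"
      using j by (simp add: Lref_def)
  qed
  moreover have "(\<lambda>x. loc k t 0 d x y) = (\<lambda>x. 1 * d 0 0 x y + (-1) * poly p x)"
    by (auto simp: p_def poly_sum)
  ultimately show ?thesis by (simp only: P1ref_lin[OF c(2,1)])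
qed

text \<open>The defining equation of the correction, available for every zero-mean test and not only
  for the basis ones.\<close>

lemma loc_Suc_P1ref:
  assumes "t > 0" "jcont d" "degree \<psi> \<le> k" "integral {- (1/2)..1/2} (poly \<psi>) = 0"
  shows "P1ref t (\<lambda>x. loc k t (Suc l) d x y) \<psi> = - locrhs k t l d y \<psi>"
proof -
  have "(\<lambda>x. loc k t (Suc l) d x y) = poly (\<Sum>j=1..k. smult (- locrhs k t l d y (zmonom j)) (Lbasis k t j))"
    by (simp add: fun_eq_iff loc_Suc poly_sum sum_negf)
  then show ?thesis
    using cell_corr_ref(2)[OF assms(1) locrhs_lin_poly[OF assms(2)] assms(3,4)] by simp
qed

declare loc.simps(1) [simp del]

section \<open>Exactness for polynomials\<close>

text \<open>\<open>tpoly n\<close> is the space of polynomials in two variables of total degree less than \<open>n\<close>.\<close>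

inductive tpoly :: "nat \<Rightarrow> (real \<Rightarrow> real \<Rightarrow> real) \<Rightarrow> bool" for n where
  zero: "tpoly n (\<lambda>x y. 0)"
| add_monom: "tpoly n f \<Longrightarrow> i + j < n \<Longrightarrow> tpoly n (\<lambda>x y. f x y + c * x ^ i * y ^ j)"

lemma tpoly_monom: "i + j < n \<Longrightarrow> tpoly n (\<lambda>x y. c * x ^ i * y ^ j)"
  using tpoly.add_monom[OF tpoly.zero, of i j n c] by simp

lemma tpoly_add: "tpoly n f \<Longrightarrow> tpoly n g \<Longrightarrow> tpoly n (\<lambda>x y. f x y + g x y)"
proof (induction rule: tpoly.induct)
  case (add_monom f i j c)
  then show ?case using tpoly.add_monom[of n "\<lambda>x y. f x y + g x y" i j c] by (simp add: add_ac)
qed simp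

lemma tpoly_scale: "tpoly n f \<Longrightarrow> tpoly n (\<lambda>x y. \<alpha> * f x y)"
proof (induction rule: tpoly.induct)
  case (add_monom f i j c)
  then show ?case using tpoly.add_monom[of n "\<lambda>x y. \<alpha> * f x y" i j "\<alpha> * c"] by (simp add: algebra_simps)
qed (simp add: tpoly.zero)

lemma tpoly_mono: "tpoly n f \<Longrightarrow> n \<le> m \<Longrightarrow> tpoly m f"
  by (induction rule: tpoly.induct) (auto intro: tpoly.intros)

lemma tpoly_sum: "(\<And>i. i \<in> S \<Longrightarrow> tpoly n (f i)) \<Longrightarrow> tpoly n (\<lambda>x y. \<Sum>i\<in>S. f i x y)"
  by (induction S rule: infinite_finite_induct) (auto intro: tpoly.zero tpoly_add)

lemma tpoly_0: "tpoly 0 f \<Longrightarrow> f x y = 0"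
  by (induction rule: tpoly.induct) auto

lemma tpoly_continuous: "tpoly n f \<Longrightarrow> continuous_on UNIV (\<lambda>(x, y). f x y)"
  by (induction rule: tpoly.induct) (auto simp: case_prod_beta intro!: continuous_intros)

lemma tpoly_poly: "tpoly n f \<Longrightarrow> n \<le> Suc k \<Longrightarrow> \<exists>p. degree p \<le> k \<and> (\<forall>x. f x y = poly p x)"
proof (induction rule: tpoly.induct)
  case (add_monom f i j c)
  then obtain p where p: "degree p \<le> k" "\<forall>x. f x y = poly p x" by blast
  show ?case
    using add_monom.hyps add_monom.prems p
    by (intro exI[of _ "p + monom (c * y ^ j) i"])
      (auto simp: poly_monom mult_ac intro!: degree_add_le order.trans[OF degree_monom_le])
qed (auto intro: exI[of _ 0])

lemma power_shift_expand:
  "\<exists>c. \<forall>x::real. (x + r) ^ Suc i = x ^ Suc i + r * (real (Suc i) * x ^ i) + (\<Sum>m<i. c m * x ^ m)"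
proof -
  have "(x + r) ^ Suc i = x ^ Suc i + r * (real (Suc i) * x ^ i)
      + (\<Sum>m<i. (of_nat (Suc i choose m) * r ^ (Suc i - m)) * x ^ m)" for x
    unfolding binomial_ring lessThan_Suc_atMost[symmetric]
    by (simp add: algebra_simps)
  then show ?thesis by (intro exI[of _ "\<lambda>m. of_nat (Suc i choose m) * r ^ (Suc i - m)"] allI)
qed

text \<open>By the binomial theorem a difference equals r times the derivative up to an error two
  degrees lower. The second degree matters: it allows level 0 of a difference to be replaced by r
  times level 0 of the derivative.\<close>

lemma tpoly_shift:
  "tpoly n f \<Longrightarrow> \<exists>g. tpoly (n - 1) g \<and> (\<forall>x y. ((\<lambda>s. f s y) has_real_derivative g x y) (at x)) \<and>
     tpoly (n - 2) (\<lambda>x y. f (x + r) y - f x y - r * g x y)"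
proof (induction rule: tpoly.induct)
  case zero
  then show ?case by (intro exI[of _ "\<lambda>x y. 0"]) (auto intro: tpoly.zero)
next
  case (add_monom f i j c)
  then obtain g where g: "tpoly (n - 1) g" "\<And>x y. ((\<lambda>s. f s y) has_real_derivative g x y) (at x)"
    "tpoly (n - 2) (\<lambda>x y. f (x + r) y - f x y - r * g x y)" by blast
  show ?case
  proof (cases i)
    case 0
    then show ?thesis using g by (intro exI[of _ g]) (auto intro!: derivative_eq_intros)
  next
    case (Suc i')
    obtain e where e: "\<And>x::real. (x + r) ^ Suc i' = x ^ Suc i' + r * (real (Suc i') * x ^ i') + (\<Sum>m<i'. e m * x ^ m)"
      using power_shift_expand by blast
    define g' where "g' = (\<lambda>x y. g x y + (c * real (Suc i')) * x ^ i' * y ^ j)"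
    have 1: "tpoly (n - 1) g'"
      unfolding g'_def using add_monom.hyps Suc by (intro tpoly.add_monom g) auto
    have 2: "((\<lambda>s. f s y + c * s ^ i * y ^ j) has_real_derivative g' x y) (at x)" for x y
      unfolding g'_def Suc by (auto intro!: derivative_eq_intros g(2) simp del: power_Suc)
    have "tpoly (n - 2) (\<lambda>x y. (f (x + r) y - f x y - r * g x y) + (\<Sum>m<i'. (c * e m) * x ^ m * y ^ j))"
      using add_monom.hyps Suc by (intro tpoly_add g(3) tpoly_sum tpoly_monom) auto
    also have "(\<lambda>x y. (f (x + r) y - f x y - r * g x y) + (\<Sum>m<i'. (c * e m) * x ^ m * y ^ j))
      = (\<lambda>x y. (f (x + r) y + c * (x + r) ^ i * y ^ j) - (f x y + c * x ^ i * y ^ j) - r * g' x y)"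
      unfolding Suc g'_def e by (simp add: fun_eq_iff algebra_simps sum_distrib_left sum_distrib_right del: power_Suc)
    finally show ?thesis using 1 2 by blast
  qed
qed

text \<open>Requiring the degree drop of each derivative explicitly makes \<open>jdx\<close> and
  \<open>jdy\<close> lower \<open>n\<close> by one without inspecting the polynomial.\<close>

definition pjet :: "nat \<Rightarrow> jet \<Rightarrow> bool" where
  "pjet n d \<longleftrightarrow> (\<forall>a b. tpoly (n - (a + b)) (d a b)) \<and> (\<forall>a b x y.
     ((\<lambda>s. d a b s y) has_real_derivative d (Suc a) b x y) (at x) \<and>
     ((\<lambda>s. d a b x s) has_real_derivative d a (Suc b) x y) (at y))"

lemma pjet_jcont: "pjet n d \<Longrightarrow> jcont d"
  unfolding pjet_def jcont_def by (auto intro: tpoly_continuous)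

lemma pjet_jdx: "pjet n d \<Longrightarrow> pjet (n - 1) (jdx d)" and pjet_jdy: "pjet n d \<Longrightarrow> pjet (n - 1) (jdy d)"
  unfolding pjet_def jdx_def jdy_def by auto (metis diff_diff_left plus_1_eq_Suc add_Suc add_Suc_right)+

lemma pjet_mono: "pjet n d \<Longrightarrow> n \<le> m \<Longrightarrow> pjet m d"
  unfolding pjet_def by (meson diff_le_mono tpoly_mono)

lemma pjet_jlin:
  assumes "pjet n d" "pjet n d'" shows "pjet n (jlin \<alpha> d \<beta> d')"
proof -
  have d: "tpoly (n - (a + b)) (d a b)" "((\<lambda>s. d a b s y) has_real_derivative d (Suc a) b x y) (at x)"
    "((\<lambda>s. d a b x s) has_real_derivative d a (Suc b) x y) (at y)"
    "tpoly (n - (a + b)) (d' a b)" "((\<lambda>s. d' a b s y) has_real_derivative d' (Suc a) b x y) (at x)"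
    "((\<lambda>s. d' a b x s) has_real_derivative d' a (Suc b) x y) (at y)" for a b x y
    using assms by (auto simp: pjet_def)
  show ?thesis unfolding pjet_def jlin_def
    by (intro conjI allI tpoly_add tpoly_scale d DERIV_add DERIV_cmult)
qed

lemma pjet_jdiff_lin: assumes "pjet n d" shows "pjet (n - 2) (jlin 1 (jdiff r d) (- r) (jdx d))"
proof -
  have t: "tpoly (n - (a + b)) (d a b)"
    and dx: "((\<lambda>s. d a b s y) has_real_derivative d (Suc a) b x y) (at x)"
    and dy: "((\<lambda>s. d a b x s) has_real_derivative d a (Suc b) x y) (at y)" for a b x y
    using assms by (auto simp: pjet_def)
  have dx': "((\<lambda>s. d a b (s + r) y) has_real_derivative d (Suc a) b (x + r) y) (at x)" for a b x y
    using dx[of a b y "x + r"] by (simp only: DERIV_shift[of "\<lambda>s. d a b s y"])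
  have "tpoly (n - (a + b) - 2) (\<lambda>x y. d a b (x + r) y - d a b x y - r * d (Suc a) b x y)" for a b
  proof -
    obtain g where g: "\<And>x y. ((\<lambda>s. d a b s y) has_real_derivative g x y) (at x)"
      "tpoly (n - (a + b) - 2) (\<lambda>x y. d a b (x + r) y - d a b x y - r * g x y)"
      using tpoly_shift[OF t] by blast
    have "g x y = d (Suc a) b x y" for x y using DERIV_unique g(1) dx by blast
    then show ?thesis using g(2) by simp
  qed
  then have 1: "tpoly (n - 2 - (a + b)) (jlin 1 (jdiff r d) (- r) (jdx d) a b)" for a b
    by (simp add: jet_defs diff_right_commute diff_commute)
  show ?thesis unfolding pjet_def
  proof (intro conjI allI 1)
    fix a b x y
    show "((\<lambda>s. jlin 1 (jdiff r d) (- r) (jdx d) a b s y) has_real_derivative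
        jlin 1 (jdiff r d) (- r) (jdx d) (Suc a) b x y) (at x)"
      unfolding jet_defs by (auto intro!: derivative_eq_intros dx dx')
    show "((\<lambda>s. jlin 1 (jdiff r d) (- r) (jdx d) a b x s) has_real_derivative
        jlin 1 (jdiff r d) (- r) (jdx d) a (Suc b) x y) (at y)"
      unfolding jet_defs by (auto intro!: derivative_eq_intros dy)
  qed
qed

lemma pjet_jdiff: assumes "pjet n d" shows "pjet (n - 1) (jdiff r d)"
proof -
  have "jdiff r d = jlin 1 (jlin 1 (jdiff r d) (- r) (jdx d)) r (jdx d)"
    by (auto simp: jlin_def fun_eq_iff)
  moreover have "pjet (n - 1) (jlin 1 (jlin 1 (jdiff r d) (- r) (jdx d)) r (jdx d))"
    by (intro pjet_jlin pjet_jdx pjet_mono[OF pjet_jdiff_lin[OF assms]] assms) simp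
  ultimately show ?thesis by metis
qed

lemma pjet_jshift_fst: assumes "pjet n d" shows "pjet n (jshift r 0 d)"
proof -
  have "jshift r 0 d = jlin 1 (jdiff r d) 1 d" by (auto simp: jet_defs fun_eq_iff)
  moreover have "pjet n (jlin 1 (jdiff r d) 1 d)"
    by (intro pjet_jlin pjet_mono[OF pjet_jdiff[OF assms]] assms) simp
  ultimately show ?thesis by metis
qed

lemma rhsref_zero: "rhsref t (\<lambda>s. 0) (\<lambda>s. 0) (\<lambda>s. 0) (\<lambda>s. 0) (\<lambda>s. 0) (\<lambda>s. 0) \<psi> = 0"
  by (simp add: rhsref_def Tref_def jumpref_def Dref_def weighted_int_def)

text \<open>Level 0 is the error of a projection that reproduces degree k. Each further level sees
  its data only through derivatives and differences, which lose one degree, and the level before it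
  through a difference of a y-derivative, which loses two.\<close>

lemma loc_kills: "t > 0 \<Longrightarrow> pjet n d \<Longrightarrow> n \<le> k + l + 1 \<Longrightarrow> loc k t l d x y = 0"
proof (induction l arbitrary: d n x rule: level_induct)
  case 0
  have "tpoly n (d 0 0)" using 0(2) unfolding pjet_def by (metis add_0 diff_zero)
  from tpoly_poly[OF this, of k y] obtain p where p: "degree p \<le> k" "\<And>x. d 0 0 x y = poly p x"
    using 0 by auto
  have "p = (\<Sum>j\<le>k. smult (Lref t j (poly p)) (Lbasis k t j))"
    using 0 p by (intro Lref_unique[of t _ k] degree_dual_sum_le Lbasis)
      (simp_all add: Lref_Lbasis_sum)
  then have "poly p x = poly (\<Sum>j\<le>k. smult (Lref t j (poly p)) (Lbasis k t j)) x" by simp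
  then have "poly p x = (\<Sum>j\<le>k. Lref t j (poly p) * poly (Lbasis k t j) x)"
    by (simp only: poly_smult poly_sum)
  moreover have "(\<lambda>s. d 0 0 s y) = poly p" using p(2) by auto
  ultimately show ?case using p(2) by (simp add: loc.simps(1))
next
  case (Suc l)
  have "locprev k t l (jdiff r (jdy d)) s y = 0" for r s
  proof (cases l)
    case (Suc l')
    show ?thesis
      using Suc.IH(2)[OF Suc \<open>0 < t\<close> pjet_jdiff[OF pjet_jdy[OF \<open>pjet n d\<close>]]] Suc \<open>n \<le> k + Suc l + 1\<close>
      by (simp add: locprev_def)
  qed (simp add: locprev_def)
  moreover have "loc k t l (jdx d) s y = 0" "loc k t l (jdy d) s y = 0" "loc k t l (jdiff r d) s y = 0" for r s
    using Suc.prems by (auto intro!: Suc.IH(1) pjet_jdx pjet_jdy pjet_jdiff)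
  ultimately show ?case by (simp add: loc_Suc locrhs_def rhsref_zero)
qed

lemma loc_sum:
  assumes "finite S" "\<And>i. i \<in> S \<Longrightarrow> jcont (D i)"
  shows "loc k t l (\<lambda>a b x y. \<Sum>i\<in>S. c i * D i a b x y) x y = (\<Sum>i\<in>S. c i * loc k t l (D i) x y)"
    and "jcont (\<lambda>a b x y. \<Sum>i\<in>S. c i * D i a b x y)"
  using assms
proof (induction S rule: finite_induct)
  case empty
  { case 1
    have z: "jcont (\<lambda>a b x y. 0)" by (auto simp: jcont_def case_prod_beta)
    from loc_jlin[OF z z, of k t l 0 0 x y] show ?case by (simp add: jlin_def)
  next
    case 2
    show ?case by (auto simp: jcont_def case_prod_beta)
  }
next
  case (insert i S)
  have eq: "(\<lambda>a b x y. \<Sum>i\<in>insert i S. c i * D i a b x y) = jlin (c i) (D i) 1 (\<lambda>a b x y. \<Sum>i\<in>S. c i * D i a b x y)"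
    using insert.hyps by (simp add: jlin_def fun_eq_iff)
  { case 1
    then show ?case using insert unfolding eq by (subst loc_jlin) auto
  next
    case 2
    then show ?case using insert unfolding eq by (intro jcont_jlin) auto
  }
qed

lemma jdy_funpow: "(jdy ^^ j) d a b = d a (b + j)"
  by (induction j arbitrary: b) (auto simp: jdy_def)

lemma pjet_jdy_funpow: "pjet n d \<Longrightarrow> pjet (n - j) ((jdy ^^ j) d)"
proof (induction j)
  case (Suc j)
  then show ?case using pjet_jdy[of "n - j" "(jdy ^^ j) d"] by simp
qed simp

lemma pjet_taylor:
  assumes "pjet n d"
  shows "d a b x (y + u) = (\<Sum>j<n. u ^ j / fact j * (jdy ^^ j) d a b x y)"
proof -
  have dy: "((\<lambda>s. d a b x s) has_real_derivative d a (Suc b) x y) (at y)" for a b x y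
    using assms by (auto simp: pjet_def)
  have dy': "((\<lambda>s. d a b x (y + s)) has_real_derivative d a (Suc b) x (y + s)) (at s)" for a b x s
    using dy[of a b x "y + s"] DERIV_shift[of "\<lambda>s. d a b x s" _ s y] by (simp add: add.commute)
  have "\<exists>t. \<bar>t\<bar> \<le> \<bar>u\<bar> \<and> d a b x (y + u) = (\<Sum>m<n. d a (b + m) x (y + 0) / fact m * u ^ m)
      + d a (b + n) x (y + t) / fact n * u ^ n"
    by (rule Maclaurin_all_le[where f = "\<lambda>u. d a b x (y + u)" and diff = "\<lambda>m u. d a (b + m) x (y + u)"])
      (use dy' in auto)
  moreover have "d a (b + n) x s = 0" for s
  proof -
    have "tpoly (n - (a + (b + n))) (d a (b + n))" using assms unfolding pjet_def by blast
    then show ?thesis by (simp add: tpoly_0)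
  qed
  ultimately show ?thesis by (simp add: jdy_funpow mult.commute)
qed

text \<open>The corrections commute with translations in y, and for polynomial data the Taylor
  expansion in y is finite; so the dependence on y becomes explicit.\<close>

lemma loc_taylor:
  assumes "pjet n d"
  shows "loc k t l d x y = (\<Sum>j<n. y ^ j / fact j * loc k t l ((jdy ^^ j) d) x 0)"
proof -
  have "loc k t l d x y = loc k t l (jshift 0 y d) x 0" by (simp add: loc_jshift_snd)
  also have "jshift 0 y d = (\<lambda>a b x s. \<Sum>j<n. y ^ j / fact j * (jdy ^^ j) d a b x s)"
    using pjet_taylor[OF assms] by (simp add: jshift_def fun_eq_iff)
  also have "loc k t l \<dots> x 0 = (\<Sum>j<n. y ^ j / fact j * loc k t l ((jdy ^^ j) d) x 0)"
    by (intro loc_sum(1)) (auto intro: pjet_jcont pjet_jdy_funpow assms)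
  finally show ?thesis .
qed

text \<open>The j-th Taylor coefficient in y is level l of data of order n - j, which vanishes once
  n - j \<le> k + l + 1. For n \<le> 2k + 2 this removes all j > k: the origin of the entry 2k + 1
  of \<open>\<sigma>\<close>.\<close>

lemma loc_poly_snd:
  assumes "t > 0" "pjet n d" "n \<le> 2 * k + 2"
  shows "\<exists>p. degree p \<le> k \<and> (\<forall>y. loc k t l d x y = poly p y)"
proof -
  define p where "p = (\<Sum>j<n. monom (loc k t l ((jdy ^^ j) d) x 0 / fact j) j)"
  have "degree (monom (loc k t l ((jdy ^^ j) d) x 0 / fact j) j) \<le> k" for j
  proof (cases "n \<le> k + l + 1 + j")
    case True
    then have "loc k t l ((jdy ^^ j) d) x 0 = 0"
      by (intro loc_kills[OF assms(1) pjet_jdy_funpow[OF assms(2)]]) simp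
    then show ?thesis by simp
  next
    case False
    then show ?thesis using assms(3) by (intro order.trans[OF degree_monom_le]) simp
  qed
  then have "degree p \<le> k" unfolding p_def by (intro degree_sum_le) auto
  moreover have "loc k t l d x y = poly p y" for y
    by (subst loc_taylor[OF assms(2)]) (simp add: p_def poly_sum poly_monom mult.commute)
  ultimately show ?thesis by blast
qed

lemma loc_deriv_snd:
  assumes "pjet n d"
  shows "((\<lambda>y. loc k t l d x y) has_real_derivative loc k t l (jdy d) x y) (at y)"
proof -
  let ?A = "\<lambda>j. loc k t l ((jdy ^^ j) d) x 0"
  have "((\<lambda>y. \<Sum>j<n. y ^ j / fact j * ?A j) has_real_derivative
      (\<Sum>j<n. real j * y ^ (j - 1) / fact j * ?A j)) (at y)"
    by (auto intro!: derivative_eq_intros sum.cong)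
  moreover have "(\<Sum>j<n. real j * y ^ (j - 1) / fact j * ?A j) = loc k t l (jdy d) x y"
  proof (cases n)
    case 0
    then show ?thesis using loc_taylor[OF pjet_jdy[OF assms], of k t l x y] by simp
  next
    case (Suc m)
    have "(\<Sum>j<n. real j * y ^ (j - 1) / fact j * ?A j) = (\<Sum>j<m. y ^ j / fact j * ?A (Suc j))"
    proof -
      have "real (Suc j) * y ^ j / fact (Suc j) = y ^ j / fact j" for j
        unfolding fact_Suc by simp
      then show ?thesis unfolding Suc sum.lessThan_Suc_shift by simp
    qed
    also have "\<dots> = loc k t l (jdy d) x y"
      using loc_taylor[OF pjet_jdy[OF assms], of k t l x y] by (simp add: Suc funpow_swap1)
    finally show ?thesis .
  qed
  ultimately show ?thesis using loc_taylor[OF assms, of k t l x] by (simp add: fun_eq_iff)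
qed

lemma linear_poly_weighted:
  assumes "continuous_on UNIV \<omega>"
  shows "weighted_int 0 a b [:c0, c1:] \<omega> = c0 * integral {a..b} \<omega> + c1 * weighted_int 0 a b [:0, 1:] \<omega>"
    "weighted_int 0 a b [:c0, c1, c2:] \<omega> = c0 * integral {a..b} \<omega> + c1 * weighted_int 0 a b [:0, 1:] \<omega>
      + c2 * weighted_int 0 a b [:0, 0, 1:] \<omega>"
proof -
  note L = lin_polyD[OF weighted_int_lin_poly[OF assms]]
  have "weighted_int 0 a b [:c0, c1:] \<omega> = weighted_int 0 a b ([:c0:] + smult c1 [:0, 1:]) \<omega>" by simp
  then show "weighted_int 0 a b [:c0, c1:] \<omega> = c0 * integral {a..b} \<omega> + c1 * weighted_int 0 a b [:0, 1:] \<omega>"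
    by (simp only: L weighted_int_const[OF assms]) simp
  have "weighted_int 0 a b [:c0, c1, c2:] \<omega>
      = weighted_int 0 a b ([:c0:] + smult c1 [:0, 1:] + smult c2 [:0, 0, 1:]) \<omega>" by simp
  then show "weighted_int 0 a b [:c0, c1, c2:] \<omega> = c0 * integral {a..b} \<omega> + c1 * weighted_int 0 a b [:0, 1:] \<omega>
      + c2 * weighted_int 0 a b [:0, 0, 1:] \<omega>"
    by (simp only: L weighted_int_const[OF assms]) simp
qed

lemma weighted_int_split:
  assumes "continuous_on UNIV \<omega>"
  shows "weighted_int 0 (- (1/2)) (1/2) \<psi> \<omega> = weighted_int 0 (- (1/2)) 0 \<psi> \<omega> + weighted_int 0 0 (1/2) \<psi> \<omega>"
  unfolding weighted_int_def
  by (rule Henstock_Kurzweil_Integration.integral_combine[symmetric])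
    (auto intro!: continuous_imp_integrable continuous_intros continuous_on_shift[OF assms])

text \<open>For tests of degree at most two everything reduces to \<open>R\<close> and to the first
  and second moments on the two halves, whose masses are opposite because the mean is zero. In the
  last identity the differences -\<omega>/2 and \<omega>/2 combine with the mass term into P1 tested
  with x^2, a quantity that vanishes for projection errors when k is at least 2.\<close>

lemma reference_identities:
  assumes c: "continuous_on UNIV \<omega>" and m: "integral {- (1/2)..1/2} \<omega> = 0"
  defines "R \<equiv> integral {0..1/2} \<omega>"
  shows "integral {- (1/2)..0} \<omega> = - R"
    and "P1ref t \<omega> [:0, 1:] = - (1 / t) * R - \<omega> 0"
    and "jumpref \<omega> [:0, 1:] = R"
    and "weighted_int 0 (- (1/2)) (1/2) [:0, 1:] \<omega> + Tref t (\<lambda>x. - (1/2) * \<omega> x) (\<lambda>x. 1/2 * \<omega> x) [:0, 1:]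
      = 1/2 * P1ref t \<omega> [:0, 0, 1:]"
proof -
  have "integral {- (1/2)..0} \<omega> + R = integral {- (1/2)..1/2} \<omega>" unfolding R_def
    by (rule Henstock_Kurzweil_Integration.integral_combine) (auto intro!: continuous_imp_integrable c)
  then show L: "integral {- (1/2)..0} \<omega> = - R" using m by simp
  have sh: "weighted_int (1/2) (- (1/2)) 0 \<psi> \<omega> = weighted_int 0 0 (1/2) (\<psi> \<circ>\<^sub>p [:- (1/2), 1:]) \<omega>"
    "weighted_int (- (1/2)) 0 (1/2) \<psi> \<omega> = weighted_int 0 (- (1/2)) 0 (\<psi> \<circ>\<^sub>p [:1/2, 1:]) \<omega>" for \<psi>
    using weighted_int_shift[OF c, of "1/2" "- (1/2)" 0 \<psi>] weighted_int_shift[OF c, of "- (1/2)" 0 "1/2" \<psi>] by simp_all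
  have w: "weighted_int 0 a b [:c0, c1:] \<omega> = c0 * integral {a..b} \<omega> + c1 * weighted_int 0 a b [:0, 1:] \<omega>"
    "weighted_int 0 a b [:c0, c1, c2:] \<omega> = c0 * integral {a..b} \<omega> + c1 * weighted_int 0 a b [:0, 1:] \<omega>
      + c2 * weighted_int 0 a b [:0, 0, 1:] \<omega>" for a b c0 c1 c2 by (fact linear_poly_weighted[OF c])+
  have pc: "[:0, 1:] \<circ>\<^sub>p [:c, 1:] = [:c, 1:]" "[:0, 0, 1:] \<circ>\<^sub>p [:c, 1:] = [:c * c, 2 * c, 1:]"
    "[:0, 2:] \<circ>\<^sub>p [:c, 1:] = [:2 * c, 2:]" for c :: real
    by (simp_all add: pcompose_pCons)
  have pd: "pderiv [:0, 1:] = [:1 :: real:]" "pderiv [:0, 0, 1:] = [:0, 2 :: real:]"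
    by (simp_all add: pderiv_pCons)
  let ?W = "\<lambda>a b. weighted_int 0 a b [:0, 1:] \<omega>" and ?V = "\<lambda>a b. weighted_int 0 a b [:0, 0, 1:] \<omega>"
  have e1: "weighted_int (1/2) (- (1/2)) 0 [:0, 1:] \<omega> = ?W 0 (1/2) - 1/2 * R"
    by (simp only: sh pc w(1)[of 0 "1/2" "- (1/2)" 1] L) (simp add: R_def)
  have e2: "weighted_int (- (1/2)) 0 (1/2) [:0, 1:] \<omega> = ?W (- (1/2)) 0 - 1/2 * R"
    by (simp only: sh pc w(1)[of "- (1/2)" 0 "1/2" 1] L)
  have e3: "weighted_int (1/2) (- (1/2)) 0 [:0, 0, 1:] \<omega> = ?V 0 (1/2) - ?W 0 (1/2) + 1/4 * R"
    by (simp only: sh pc w(2)[of 0 "1/2" "- (1/2) * - (1/2)" "2 * - (1/2)" 1] L) (simp add: R_def)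
  have e4: "weighted_int (- (1/2)) 0 (1/2) [:0, 0, 1:] \<omega> = ?V (- (1/2)) 0 + ?W (- (1/2)) 0 - 1/4 * R"
    by (simp only: sh pc w(2)[of "- (1/2)" 0 "1/2 * (1/2)" "2 * (1/2)" 1] L)
  have e5: "weighted_int (1/2) (- (1/2)) 0 [:1:] \<omega> = R"
    by (simp only: weighted_int_const[OF c], (simp add: R_def)?)
  have e6: "weighted_int (- (1/2)) 0 (1/2) [:1:] \<omega> = - R"
    by (simp only: weighted_int_const[OF c], (simp add: L)?)
  have e7: "weighted_int (1/2) (- (1/2)) 0 [:0, 2:] \<omega> = 2 * ?W 0 (1/2) - R"
    by (simp only: sh pc w(1)[of 0 "1/2" "2 * - (1/2)" 2] L, (simp add: R_def)?)
  have e8: "weighted_int (- (1/2)) 0 (1/2) [:0, 2:] \<omega> = 2 * ?W (- (1/2)) 0 - R"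
    by (simp only: sh pc w(1)[of "- (1/2)" 0 "2 * (1/2)" 2] L, (simp)?)
  note e = e1 e2 e3 e4 e5 e6 e7 e8
  show P: "P1ref t \<omega> [:0, 1:] = - (1 / t) * R - \<omega> 0"
    unfolding P1ref_def pd e by (simp add: field_simps)
  show "jumpref \<omega> [:0, 1:] = R"
    unfolding jumpref_def Dref_def e weighted_int_split[OF c] by simp
  have sc: "weighted_int s a b \<psi> (\<lambda>x. \<alpha> * \<omega> x) = \<alpha> * weighted_int s a b \<psi> \<omega>" for s a b \<psi> \<alpha>
    using weighted_int_lin[OF c c, of s a b \<psi> \<alpha> 0] by simp
  show "weighted_int 0 (- (1/2)) (1/2) [:0, 1:] \<omega> + Tref t (\<lambda>x. - (1/2) * \<omega> x) (\<lambda>x. 1/2 * \<omega> x) [:0, 1:]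
      = 1/2 * P1ref t \<omega> [:0, 0, 1:]"
  proof -
    define q where "q = 1 / t"
    show ?thesis
      unfolding Tref_def P1ref_def Dref_def sc pd e weighted_int_split[OF c] q_def[symmetric]
      by (simp add: algebra_simps)
  qed
qed

text \<open>How the other component looks on a cell: the right half of its left neighbour, then the
  left half of its right neighbour. The midpoint goes to the right neighbour, in agreement with
  \<open>centre_at\<close>.\<close>

definition xglue :: "(real \<Rightarrow> real) \<Rightarrow> (real \<Rightarrow> real) \<Rightarrow> real \<Rightarrow> real" where
  "xglue Wm Wp x = (if x < 0 then Wm (x + 1/2) else Wp (x - 1/2))"

lemma xglue_has_integral:
  assumes "continuous_on UNIV Wm" "continuous_on UNIV Wp"
  shows "(xglue Wm Wp has_integral integral {0..1/2} Wm + integral {- (1/2)..0} Wp) {- (1/2)..1/2}"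
proof (rule has_integral_combine[of "- (1/2)" 0 "1/2"])
  have "((\<lambda>x. Wm (x + 1/2)) has_integral integral {0..1/2} Wm) {- (1/2)..0}"
    using integral_translate[OF assms(1), of "- (1/2)" 0 "1/2"]
    by (simp add: has_integral_iff continuous_imp_integrable continuous_on_shift[OF assms(1)])
  then show "(xglue Wm Wp has_integral integral {0..1/2} Wm) {- (1/2)..0}"
    by (rule has_integral_spike[of "{0}", rotated 2]) (auto simp: xglue_def)
  have "((\<lambda>x. Wp (x - 1/2)) has_integral integral {- (1/2)..0} Wp) {0..1/2}"
    using integral_translate[OF assms(2), of 0 "1/2" "- (1/2)"] continuous_on_shift(1)[OF assms(2), of UNIV "- (1/2)"]
    by (simp add: has_integral_iff continuous_imp_integrable)
  then show "(xglue Wm Wp has_integral integral {- (1/2)..0} Wp) {0..1/2}"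
    by (rule has_integral_eq[rotated]) (auto simp: xglue_def)
qed auto

definition locglue :: "nat \<Rightarrow> real \<Rightarrow> nat \<Rightarrow> jet \<Rightarrow> real \<Rightarrow> real \<Rightarrow> real" where
  "locglue k t l d x y = xglue (\<lambda>s. loc k t l (jshift (- (1/2)) 0 d) s y) (\<lambda>s. loc k t l (jshift (1/2) 0 d) s y) x"

definition centdiff :: "jet \<Rightarrow> jet" where
  "centdiff d = jlin 1 (jshift (1/2) 0 d) (-1) (jshift (- (1/2)) 0 d)"

lemma pjet_centdiff: assumes "pjet n d" shows "pjet (n - 1) (centdiff d)"
proof -
  have "centdiff d = jlin 1 (jdiff (1/2) d) (-1) (jdiff (- (1/2)) d)"
    by (auto simp: centdiff_def jet_defs fun_eq_iff)
  then show ?thesis using pjet_jlin pjet_jdiff assms by metis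
qed

text \<open>Zero mean turns the left mass of the right neighbour into minus its right mass, so only
  the right mass of the difference of the two neighbours is left.\<close>

lemma locglue_integral:
  assumes "t > 0" "jcont d"
  shows "((\<lambda>x. locglue k t l d x y) has_integral - integral {0..1/2} (\<lambda>x. loc k t l (centdiff d) x y)) {- (1/2)..1/2}"
proof -
  let ?m = "\<lambda>s. loc k t l (jshift (- (1/2)) 0 d) s y" and ?p = "\<lambda>s. loc k t l (jshift (1/2) 0 d) s y"
  have c: "continuous_on UNIV ?m" "continuous_on UNIV ?p" by (intro loc_slice jcont_intros assms)+
  have "integral {- (1/2)..0} ?p = - integral {0..1/2} ?p"
    by (intro reference_identities(1) c loc_mean assms jcont_intros)
  moreover have "integral {0..1/2} (\<lambda>x. loc k t l (centdiff d) x y) = integral {0..1/2} (\<lambda>x. ?p x - ?m x)"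
    by (simp add: centdiff_def loc_jlin jcont_intros assms)
  moreover have "\<dots> = integral {0..1/2} ?p - integral {0..1/2} ?m"
    by (intro integral_diff continuous_imp_integrable c)
  ultimately have "- integral {0..1/2} (\<lambda>x. loc k t l (centdiff d) x y) = integral {0..1/2} ?m + integral {- (1/2)..0} ?p"
    by simp
  then show ?thesis using xglue_has_integral[OF c] by (simp add: locglue_def)
qed

text \<open>What multiplies the test function at height y in the operator B after integration by
  parts in y, for a test function constant in x.\<close>

definition xresidual :: "nat \<Rightarrow> real \<Rightarrow> nat \<Rightarrow> jet \<Rightarrow> real \<Rightarrow> real" where
  "xresidual k t l d y = 1 / t * integral {- (1/2)..1/2} (\<lambda>x. locglue k t l d x y - loc k t l d x y)
     - (loc k t l (jshift (1/2) 0 d) 0 y - loc k t l (jshift (- (1/2)) 0 d) 0 y)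
     - integral {- (1/2)..1/2} (\<lambda>x. locglue k t l (jdy d) x y)"

text \<open>Up to the y-derivative term the residual is exactly P1 of the central difference tested
  with x. This links it with the equation that defines the next level.\<close>

lemma xresidual_eq:
  assumes "t > 0" "jcont d"
  shows "xresidual k t l d y = P1ref t (\<lambda>x. loc k t l (centdiff d) x y) [:0, 1:]
    + integral {0..1/2} (\<lambda>x. loc k t l (jdy (centdiff d)) x y)"
proof -
  let ?v = "centdiff d"
  have v: "jcont ?v" unfolding centdiff_def by (intro jcont_intros assms)
  have "integral {- (1/2)..1/2} (\<lambda>x. locglue k t l d x y - loc k t l d x y)
      = integral {- (1/2)..1/2} (\<lambda>x. locglue k t l d x y) - integral {- (1/2)..1/2} (\<lambda>x. loc k t l d x y)"
    by (intro integral_diff has_integral_integrable[OF locglue_integral[OF assms]]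
        continuous_imp_integrable loc_slice assms)
  then have "integral {- (1/2)..1/2} (\<lambda>x. locglue k t l d x y - loc k t l d x y)
      = - integral {0..1/2} (\<lambda>x. loc k t l ?v x y)"
    using locglue_integral[OF assms, of k l y] by (simp add: loc_mean[OF assms] has_integral_iff)
  moreover have "integral {- (1/2)..1/2} (\<lambda>x. locglue k t l (jdy d) x y)
      = - integral {0..1/2} (\<lambda>x. loc k t l (jdy ?v) x y)"
    using locglue_integral[OF assms(1) jcont_jdy[OF assms(2)], of k l y]
    by (simp add: has_integral_iff centdiff_def jet_ops_jlin jet_ops_commute)
  moreover have "loc k t l (jshift (1/2) 0 d) 0 y - loc k t l (jshift (- (1/2)) 0 d) 0 y = loc k t l ?v 0 y"
    by (simp add: centdiff_def loc_jlin jcont_intros assms)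
  ultimately show ?thesis
    unfolding xresidual_def reference_identities(2)[OF loc_slice[OF v] loc_mean[OF assms(1) v]] by simp
qed

lemma integral_X: "integral {- (1/2)..1/2} (poly [:0, 1 :: real:]) = 0"
proof -
  have "((\<lambda>x::real. x) has_integral ((1/2)\<^sup>2 / 2 - (- (1/2))\<^sup>2 / 2)) {- (1/2)..1/2}"
    by (intro fundamental_theorem_of_calculus)
      (auto intro!: derivative_eq_intros simp: has_real_derivative_iff_has_vector_derivative[symmetric])
  moreover have "poly [:0, 1:] = (\<lambda>x::real. x)" by (auto simp: fun_eq_iff)
  ultimately show ?thesis by (simp add: has_integral_iff)
qed

theorem xresidual_sum_zero:
  assumes "t > 0" "k \<ge> 1" "pjet n d" "n \<le> 2 * k + 2" "n \<le> k + 4"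
  shows "(\<Sum>l=0..min k 2. xresidual k t l d y) = 0"
proof -
  define v where "v = centdiff d"
  have v: "pjet (n - 1) v" unfolding v_def by (intro pjet_centdiff assms)
  have jv: "jcont v" by (rule pjet_jcont[OF v])
  have Q: "xresidual k t l d y = P1ref t (\<lambda>x. loc k t l v x y) [:0, 1:]
      + integral {0..1/2} (\<lambda>x. loc k t l (jdy v) x y)" for l
    unfolding v_def by (intro xresidual_eq assms pjet_jcont[OF assms(3)])
  \<comment> \<open>The y-derivative of the central difference has order n - 2 \<le> k + 2, which
    every level from 1 on annihilates.\<close>
  have zi: "integral {0..1/2} (\<lambda>x. loc k t l (jdy v) x y) = 0" if "l \<ge> 1" for l
    using that assms by (simp add: loc_kills[OF assms(1) pjet_jdy[OF v]])
  have d1: "degree [:0, 1 :: real:] \<le> k" using assms(2) by simp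
  have Q0: "xresidual k t 0 d y = integral {0..1/2} (\<lambda>x. loc k t 0 (jdy v) x y)"
    unfolding Q using loc_0_P1ref[OF assms(1) jv d1, of y] by simp
  define w where "w = (\<lambda>x. loc k t 0 (jdx v) x y)"
  have cw: "continuous_on UNIV w" unfolding w_def by (intro loc_slice jcont_intros jv)
  have mw: "integral {- (1/2)..1/2} w = 0" unfolding w_def by (intro loc_mean assms jcont_intros jv)
  \<comment> \<open>The error of replacing the difference by the derivative has order n - 3 \<le> k
    + 1, hence is invisible to level 0.\<close>
  have dif: "loc k t 0 (jdiff r v) x y = r * w x" for r x
  proof -
    have "loc k t 0 (jlin 1 (jdiff r v) (- r) (jdx v)) x y = 0"
      using assms by (intro loc_kills[OF assms(1) pjet_jdiff_lin[OF v]]) simp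
    then show ?thesis unfolding w_def by (simp add: loc_jlin jcont_intros jv)
  qed
  \<comment> \<open>For k = 1 the test x^2 is not admissible, but then n \<le> 4 and
    \<open>w\<close> itself vanishes; for larger k it is Galerkin orthogonality.\<close>
  have Pw: "P1ref t w [:0, 0, 1:] = 0"
  proof (cases "k = 1")
    case True
    have "w = (\<lambda>x. 0)"
      unfolding w_def using True assms by (auto simp: loc_kills[OF assms(1) pjet_jdx[OF v]] simp del: loc.simps)
    then show ?thesis using P1ref_lin[OF cw cw, of t 0 0 "[:0, 0, 1:]"] by simp
  next
    case False
    then show ?thesis unfolding w_def using assms(2) by (intro loc_0_P1ref assms(1) jcont_intros jv) simp
  qed
  \<comment> \<open>At the lowest level the term D is absent. The first two terms give half of P1
    tested with x^2, that is 0, and the jump term reproduces the residual of level 0.\<close>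
  have "locrhs k t 0 v y [:0, 1:] = weighted_int 0 (- (1/2)) (1/2) [:0, 1:] w
      + Tref t (\<lambda>x. - (1/2) * w x) (\<lambda>x. 1/2 * w x) [:0, 1:] + jumpref (\<lambda>s. loc k t 0 (jdy v) s y) [:0, 1:]"
    unfolding locrhs_def rhsref_def dif w_def[symmetric] by (simp add: locprev_def Dref_def weighted_int_def)
  also have "\<dots> = integral {0..1/2} (\<lambda>x. loc k t 0 (jdy v) x y)"
    unfolding reference_identities(4)[OF cw mw] Pw
    by (subst reference_identities(3)) (auto intro!: loc_slice loc_mean assms jcont_intros jv simp del: loc.simps)
  finally have Q1: "xresidual k t 1 d y = - integral {0..1/2} (\<lambda>x. loc k t 0 (jdy v) x y)"
    unfolding Q zi[OF order.refl] using loc_Suc_P1ref[OF assms(1) jv d1 integral_X, of 0 y] by simp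
  show ?thesis
  proof (cases "k = 1")
    case True
    then show ?thesis using Q0 Q1 by (simp del: loc.simps)
  next
    case False
    \<comment> \<open>The central difference has order n - 1 \<le> k + 3, which level 2 annihilates:
      here the bound k + 4 enters.\<close>
    have "(\<lambda>x. loc k t 2 v x y) = (\<lambda>x. 0)" using assms by (intro ext loc_kills[OF _ v]) auto
    then have "P1ref t (\<lambda>x. loc k t 2 v x y) [:0, 1:] = 0"
      using P1ref_lin[OF cw cw, of t 0 0 "[:0, 1:]"] by simp
    then have "xresidual k t 2 d y = 0" unfolding Q using zi[of 2] by simp
    moreover have "{0..min k 2} = {0, 1, 2}" using False assms(2) by auto
    ultimately show ?thesis using Q0 Q1 by (simp del: loc.simps)
  qed
qed

section \<open>Polynomial approximation on a rectangle\<close>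

definition cont2 :: "(real \<Rightarrow> real \<Rightarrow> real) \<Rightarrow> bool" where
  "cont2 f \<longleftrightarrow> continuous_on UNIV (\<lambda>(x, y). f x y)"

definition iint :: "real \<Rightarrow> real \<Rightarrow> (real \<Rightarrow> real \<Rightarrow> real) \<Rightarrow> real" where
  "iint a b f = integral {- a..a} (\<lambda>x. integral {- b..b} (f x))"

lemma cont2_slices:
  assumes "cont2 f" shows "continuous_on S (f x)" "continuous_on S (\<lambda>x. f x y)"
  using assms unfolding cont2_def by (auto intro!: continuous_curried[of f] continuous_intros)

lemma cont2_intros:
  "cont2 f \<Longrightarrow> cont2 g \<Longrightarrow> cont2 (\<lambda>x y. f x y + g x y)"
  "cont2 f \<Longrightarrow> cont2 g \<Longrightarrow> cont2 (\<lambda>x y. f x y - g x y)"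
  "cont2 f \<Longrightarrow> cont2 (\<lambda>x y. c * f x y)"
  "cont2 f \<Longrightarrow> cont2 (\<lambda>x y. \<bar>f x y\<bar>)"
  "cont2 (\<lambda>x y. c)"
  by (auto simp: cont2_def case_prod_beta intro!: continuous_intros)

lemma cont2_swap: "cont2 f \<Longrightarrow> cont2 (\<lambda>x y. f y x)"
  unfolding cont2_def case_prod_beta
  by (rule continuous_curried) (auto simp: case_prod_beta intro!: continuous_intros)

lemma cont2_integral:
  assumes "cont2 f" shows "continuous_on S (\<lambda>x. integral {c..e} (f x))"
proof -
  have "continuous_on (S \<times> cbox c e) (\<lambda>(x, y). f x y)"
    using assms unfolding cont2_def by (rule continuous_on_subset) simp
  from integral_continuous_on_param[OF this] show ?thesis by simp
qed

lemma cont2_integral': "cont2 f \<Longrightarrow> continuous_on S (\<lambda>y. integral {c..e} (\<lambda>x. f x y))"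
  using cont2_integral[of "\<lambda>y x. f x y"] cont2_swap by blast

lemma iint_add: assumes "cont2 f" "cont2 g" shows "iint a b (\<lambda>x y. f x y + g x y) = iint a b f + iint a b g"
proof -
  have "integral {- b..b} (\<lambda>y. f x y + g x y) = integral {- b..b} (f x) + integral {- b..b} (g x)" for x
    by (intro integral_add continuous_imp_integrable cont2_slices assms)
  then show ?thesis unfolding iint_def
    by (simp, intro integral_add continuous_imp_integrable cont2_integral assms)
qed

lemma iint_cmult: "iint a b (\<lambda>x y. c * f x y) = c * iint a b f"
  unfolding iint_def by simp

lemma iint_diff: assumes "cont2 f" "cont2 g" shows "iint a b (\<lambda>x y. f x y - g x y) = iint a b f - iint a b g"
proof -
  have "integral {- b..b} (\<lambda>y. f x y - g x y) = integral {- b..b} (f x) - integral {- b..b} (g x)" for x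
    by (intro integral_diff continuous_imp_integrable cont2_slices assms)
  then show ?thesis unfolding iint_def
    by (simp, intro integral_diff continuous_imp_integrable cont2_integral assms)
qed

lemma iint_mono:
  assumes "cont2 f" "cont2 g" "\<And>x y. x \<in> {- a..a} \<Longrightarrow> y \<in> {- b..b} \<Longrightarrow> f x y \<le> g x y"
  shows "iint a b f \<le> iint a b g"
  unfolding iint_def
  by (intro integral_le continuous_imp_integrable cont2_integral cont2_slices assms)

lemma iint_const: "a \<ge> 0 \<Longrightarrow> b \<ge> 0 \<Longrightarrow> iint a b (\<lambda>x y. c) = 4 * a * b * c"
  by (simp add: iint_def)

lemma iint_abs_nonneg: "cont2 f \<Longrightarrow> iint a b (\<lambda>x y. \<bar>f x y\<bar>) \<ge> 0"
  unfolding iint_def by (intro integral_nonneg continuous_imp_integrable cont2_integral cont2_slices cont2_intros) auto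

lemma iint_swap: assumes "cont2 f" shows "iint a b f = iint b a (\<lambda>x y. f y x)"
proof -
  have "continuous_on (cbox (- a, - b) (a, b)) (\<lambda>(x, y). f x y)"
    using assms unfolding cont2_def by (rule continuous_on_subset) simp
  from integral_swap_continuous[OF this] show ?thesis by (simp add: iint_def)
qed

lemma abs_diff_le_integral_deriv:
  fixes f :: "real \<Rightarrow> real"
  assumes "\<And>x. (f has_real_derivative f' x) (at x)" "continuous_on UNIV f'"
    "x \<in> {- a..a}" "s \<in> {- a..a}"
  shows "\<bar>f x - f s\<bar> \<le> integral {- a..a} (\<lambda>z. \<bar>f' z\<bar>)"
proof -
  have *: "\<bar>f u - f v\<bar> \<le> integral {- a..a} (\<lambda>z. \<bar>f' z\<bar>)" if "v \<le> u" "u \<in> {- a..a}" "v \<in> {- a..a}" for u v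
  proof -
    have c: "continuous_on UNIV (\<lambda>z. \<bar>f' z\<bar>)" by (intro continuous_intros assms)
    have "(f' has_integral f u - f v) {v..u}"
      using that(1) assms(1) by (intro fundamental_theorem_of_calculus)
        (auto simp: has_real_derivative_iff_has_vector_derivative[symmetric] intro: DERIV_subset)
    then have "\<bar>f u - f v\<bar> = \<bar>integral {v..u} f'\<bar>" by (simp add: has_integral_iff)
    also have "\<dots> \<le> integral {v..u} (\<lambda>z. \<bar>f' z\<bar>)"
      using integral_norm_bound_integral[of f' "{v..u}" "\<lambda>z. \<bar>f' z\<bar>"] continuous_imp_integrable[OF assms(2)]
        continuous_imp_integrable[OF c] by simp
    also have "\<dots> \<le> integral {- a..a} (\<lambda>z. \<bar>f' z\<bar>)"
      using that by (intro integral_subset_le continuous_imp_integrable c) auto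
    finally show ?thesis .
  qed
  show ?thesis using *[of s x] *[of x s] assms(3,4) by (cases "s \<le> x") (auto simp: abs_minus_commute)
qed

text \<open>Average |f(x)| \<le> |f(s)| + integral of |f'| over s.\<close>

lemma sup_le_integral:
  fixes f :: "real \<Rightarrow> real"
  assumes "a > 0" "\<And>x. (f has_real_derivative f' x) (at x)" "continuous_on UNIV f'" "x \<in> {- a..a}"
  shows "\<bar>f x\<bar> \<le> 1 / (2 * a) * integral {- a..a} (\<lambda>z. \<bar>f z\<bar>) + integral {- a..a} (\<lambda>z. \<bar>f' z\<bar>)"
proof -
  let ?D = "integral {- a..a} (\<lambda>z. \<bar>f' z\<bar>)"
  have cf: "continuous_on UNIV f" using assms(2) by (meson DERIV_continuous_on has_field_derivative_at_within)
  have c: "continuous_on UNIV (\<lambda>z. \<bar>f z\<bar>)" by (intro continuous_intros cf)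
  have "\<bar>f x\<bar> - ?D \<le> \<bar>f s\<bar>" if "s \<in> {- a..a}" for s
    using abs_diff_le_integral_deriv[OF assms(2-4) that] by linarith
  then have "integral {- a..a} (\<lambda>s. \<bar>f x\<bar> - ?D) \<le> integral {- a..a} (\<lambda>z. \<bar>f z\<bar>)"
    by (intro integral_le continuous_imp_integrable c continuous_intros) auto
  then have "2 * a * (\<bar>f x\<bar> - ?D) \<le> integral {- a..a} (\<lambda>z. \<bar>f z\<bar>)" using assms(1) by simp
  then have "\<bar>f x\<bar> - ?D \<le> integral {- a..a} (\<lambda>z. \<bar>f z\<bar>) / (2 * a)"
    using assms(1) by (simp add: pos_le_divide_eq mult.commute)
  then show ?thesis by simp
qed

lemma smooth_jetD:
  assumes "smooth_jet d"
  shows "cont2 (d m n)" "((\<lambda>s. d m n s y) has_real_derivative d (Suc m) n x y) (at x)"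
    "((\<lambda>t. d m n x t) has_real_derivative d m (Suc n) x y) (at y)"
  using assms by (auto simp: smooth_jet_def cont2_def)

text \<open>The one-dimensional bound is used once in each variable. This produces mixed derivatives
  with at most one extra order per variable, so two orders are lost in total.\<close>

lemma sobolev_rectangle:
  assumes ab: "a > 0" "b > 0"
  shows "\<exists>C\<ge>0. \<forall>d m n x y. smooth_jet d \<longrightarrow> x \<in> {- a..a} \<longrightarrow> y \<in> {- b..b} \<longrightarrow>
    \<bar>d m n x y\<bar> \<le> C * (iint a b (\<lambda>x y. \<bar>d m n x y\<bar>) + iint a b (\<lambda>x y. \<bar>d (Suc m) n x y\<bar>)
      + iint a b (\<lambda>x y. \<bar>d m (Suc n) x y\<bar>) + iint a b (\<lambda>x y. \<bar>d (Suc m) (Suc n) x y\<bar>))"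
proof -
  define A B where "A = 1 / (2 * a)" and "B = 1 / (2 * b)"
  have AB: "A \<ge> 0" "B \<ge> 0" using ab by (auto simp: A_def B_def)
  define C where "C = A * B + A + B + 1"
  have C: "A * B \<le> C" "A \<le> C" "B \<le> C" "1 \<le> C" using AB by (auto simp: C_def)
  have "\<bar>d m n x y\<bar> \<le> C * (iint a b (\<lambda>x y. \<bar>d m n x y\<bar>) + iint a b (\<lambda>x y. \<bar>d (Suc m) n x y\<bar>)
      + iint a b (\<lambda>x y. \<bar>d m (Suc n) x y\<bar>) + iint a b (\<lambda>x y. \<bar>d (Suc m) (Suc n) x y\<bar>))"
    if d: "smooth_jet d" and x: "x \<in> {- a..a}" and y: "y \<in> {- b..b}" for d m n x y
  proof -
    note D = smooth_jetD[OF d]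
    note c = cont2_intros(4)[OF D(1)]
    have i: "integral {- a..a} (\<lambda>x. \<bar>d m n x y\<bar>) \<le> B * iint a b (\<lambda>x y. \<bar>d m n x y\<bar>) + iint a b (\<lambda>x y. \<bar>d m (Suc n) x y\<bar>)" for m n
    proof -
      have "integral {- a..a} (\<lambda>x. \<bar>d m n x y\<bar>)
          \<le> integral {- a..a} (\<lambda>x. B * integral {- b..b} (\<lambda>y. \<bar>d m n x y\<bar>) + integral {- b..b} (\<lambda>y. \<bar>d m (Suc n) x y\<bar>))"
        unfolding B_def
        by (intro integral_le continuous_imp_integrable continuous_intros cont2_integral cont2_slices(2)[OF D(1)] c
            sup_le_integral ab D y cont2_slices(1))
      also have "\<dots> = B * iint a b (\<lambda>x y. \<bar>d m n x y\<bar>) + iint a b (\<lambda>x y. \<bar>d m (Suc n) x y\<bar>)"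
        unfolding iint_def
        by (subst integral_add) (intro continuous_imp_integrable continuous_intros cont2_integral c | simp)+
      finally show ?thesis .
    qed
    have "\<bar>d m n x y\<bar> \<le> A * integral {- a..a} (\<lambda>x. \<bar>d m n x y\<bar>) + integral {- a..a} (\<lambda>x. \<bar>d (Suc m) n x y\<bar>)"
      unfolding A_def by (intro sup_le_integral ab D x cont2_slices(2))
    also have "\<dots> \<le> A * (B * iint a b (\<lambda>x y. \<bar>d m n x y\<bar>) + iint a b (\<lambda>x y. \<bar>d m (Suc n) x y\<bar>))
        + (B * iint a b (\<lambda>x y. \<bar>d (Suc m) n x y\<bar>) + iint a b (\<lambda>x y. \<bar>d (Suc m) (Suc n) x y\<bar>))"
      by (intro add_mono mult_left_mono i AB)
    also have "\<dots> = (A * B) * iint a b (\<lambda>x y. \<bar>d m n x y\<bar>) + B * iint a b (\<lambda>x y. \<bar>d (Suc m) n x y\<bar>)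
        + A * iint a b (\<lambda>x y. \<bar>d m (Suc n) x y\<bar>) + 1 * iint a b (\<lambda>x y. \<bar>d (Suc m) (Suc n) x y\<bar>)"
      by (simp add: algebra_simps)
    also have "\<dots> \<le> C * iint a b (\<lambda>x y. \<bar>d m n x y\<bar>) + C * iint a b (\<lambda>x y. \<bar>d (Suc m) n x y\<bar>)
        + C * iint a b (\<lambda>x y. \<bar>d m (Suc n) x y\<bar>) + C * iint a b (\<lambda>x y. \<bar>d (Suc m) (Suc n) x y\<bar>)"
      by (intro add_mono mult_right_mono C iint_abs_nonneg D(1))
    finally show ?thesis by (simp add: algebra_simps)
  qed
  moreover have "C \<ge> 0" using C by linarith
  ultimately show ?thesis by blast
qed

text \<open>Two points are joined by a horizontal and a vertical segment. Integrating over the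
  second point uses the zero mean, integrating over the first gives the claim.\<close>

lemma poincare_rectangle:
  assumes ab: "a > 0" "b > 0" and d: "smooth_jet d" and mean: "iint a b (d m n) = 0"
  shows "iint a b (\<lambda>x y. \<bar>d m n x y\<bar>) \<le> (2 * a + 2 * b) *
    (iint a b (\<lambda>x y. \<bar>d (Suc m) n x y\<bar>) + iint a b (\<lambda>x y. \<bar>d m (Suc n) x y\<bar>))"
proof -
  note D = smooth_jetD[OF d]
  note c = cont2_intros(4)[OF D(1)]
  define X where "X = (\<lambda>y. integral {- a..a} (\<lambda>z. \<bar>d (Suc m) n z y\<bar>))"
  define Y where "Y = (\<lambda>x. integral {- b..b} (\<lambda>z. \<bar>d m (Suc n) x z\<bar>))"
  define IX IY where "IX = iint a b (\<lambda>x y. \<bar>d (Suc m) n x y\<bar>)" and "IY = iint a b (\<lambda>x y. \<bar>d m (Suc n) x y\<bar>)"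
  have nn: "IX \<ge> 0" "IY \<ge> 0" unfolding IX_def IY_def by (intro iint_abs_nonneg D(1))+
  have "continuous_on UNIV X" "continuous_on UNIV Y"
    unfolding X_def Y_def by (intro cont2_integral'[OF c] cont2_integral[OF c])+
  then have cX: "cont2 (\<lambda>x y. X y)" and cY: "cont2 (\<lambda>x y. Y x)"
    unfolding cont2_def case_prod_beta
    using continuous_on_compose2[OF _ continuous_on_snd[OF continuous_on_id], of UNIV X UNIV]
      continuous_on_compose2[OF _ continuous_on_fst[OF continuous_on_id], of UNIV Y UNIV] by auto
  have pw: "4 * a * b * \<bar>d m n x y\<bar> \<le> 4 * a * b * X y + 2 * b * IY" if x: "x \<in> {- a..a}" and y: "y \<in> {- b..b}" for x y
  proof -
    have "\<bar>d m n x y - d m n x' y'\<bar> \<le> X y + Y x'" if "x' \<in> {- a..a}" "y' \<in> {- b..b}" for x' y'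
    proof -
      have "\<bar>d m n x y - d m n x' y\<bar> \<le> X y" unfolding X_def
        by (intro abs_diff_le_integral_deriv D(2) cont2_slices D(1) x that)
      moreover have "\<bar>d m n x' y - d m n x' y'\<bar> \<le> Y x'" unfolding Y_def
        by (intro abs_diff_le_integral_deriv[where f = "d m n x'"] D(3) cont2_slices D(1) y that)
      ultimately show ?thesis by linarith
    qed
    then have bd: "d m n x y - d m n x' y' \<le> X y + Y x'" "d m n x' y' - d m n x y \<le> X y + Y x'"
      if "x' \<in> {- a..a}" "y' \<in> {- b..b}" for x' y' using that by (fastforce simp: abs_le_iff)+
    have "iint a b (\<lambda>x' y'. d m n x y - d m n x' y') \<le> iint a b (\<lambda>x' y'. X y + Y x')"
      "iint a b (\<lambda>x' y'. d m n x' y' - d m n x y) \<le> iint a b (\<lambda>x' y'. X y + Y x')"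
      by (intro iint_mono cont2_intros D(1) cY bd; assumption)+
    moreover have "iint a b (\<lambda>x' y'. X y + Y x') = 4 * a * b * X y + 2 * b * IY"
    proof -
      have "iint a b (\<lambda>x' y'. X y + Y x') = iint a b (\<lambda>x' y'. X y) + iint a b (\<lambda>x' y'. Y x')"
        by (intro iint_add cont2_intros cY)
      moreover have "iint a b (\<lambda>x' y'. Y x') = 2 * b * IY"
        using ab by (simp add: iint_def IY_def Y_def)
      ultimately show ?thesis using ab by (simp add: iint_const)
    qed
    ultimately have "4 * a * b * d m n x y \<le> 4 * a * b * X y + 2 * b * IY"
      "- (4 * a * b * d m n x y) \<le> 4 * a * b * X y + 2 * b * IY"
      using ab by (simp_all add: iint_diff cont2_intros D(1) iint_const mean)
    moreover have "4 * a * b * \<bar>d m n x y\<bar> = \<bar>4 * a * b * d m n x y\<bar>" using ab by (simp add: abs_mult)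
    ultimately show ?thesis by linarith
  qed
  have "iint a b (\<lambda>x y. 4 * a * b * \<bar>d m n x y\<bar>) \<le> iint a b (\<lambda>x y. 4 * a * b * X y + 2 * b * IY)"
    by (intro iint_mono cont2_intros D(1) cX pw)
  moreover have "iint a b (\<lambda>x y. 4 * a * b * X y + 2 * b * IY) = 4 * a * b * (2 * a * IX + 2 * b * IY)"
  proof -
    have "iint a b (\<lambda>x y. X y) = 2 * a * integral {- b..b} X" using ab by (simp add: iint_def)
    also have "integral {- b..b} X = IX"
      unfolding IX_def by (subst iint_swap[OF c]) (simp add: iint_def X_def)
    finally have 1: "iint a b (\<lambda>x y. X y) = 2 * a * IX" .
    have "iint a b (\<lambda>x y. 4 * a * b * X y + 2 * b * IY) = iint a b (\<lambda>x y. 4 * a * b * X y) + iint a b (\<lambda>x y. 2 * b * IY)"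
      by (intro iint_add cont2_intros cX)
    then show ?thesis using ab 1 by (simp only: iint_cmult iint_const) (simp add: iint_const algebra_simps)
  qed
  ultimately have "4 * a * b * iint a b (\<lambda>x y. \<bar>d m n x y\<bar>) \<le> 4 * a * b * (2 * a * IX + 2 * b * IY)"
    by (simp only: iint_cmult)
  then have "iint a b (\<lambda>x y. \<bar>d m n x y\<bar>) \<le> 2 * a * IX + 2 * b * IY" using ab by simp
  also have "\<dots> \<le> (2 * a + 2 * b) * (IX + IY)" using ab nn by (simp add: algebra_simps)
  finally show ?thesis by (simp add: IX_def IY_def)
qed

text \<open>The jet of x^i / i! y^j / j!. With this normalisation its derivative of order (i, j) is
  1 and the other derivatives of order i + j vanish, so prescribed means can be read off as
  coefficients.\<close>

definition mjet :: "nat \<Rightarrow> nat \<Rightarrow> jet" where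
  "mjet i j a b x y = (if a \<le> i \<and> b \<le> j then x ^ (i - a) / fact (i - a) * (y ^ (j - b) / fact (j - b)) else 0)"

lemma power_fact_deriv:
  fixes x :: real
  shows "((\<lambda>s. s ^ Suc n / fact (Suc n)) has_real_derivative x ^ n / fact n) (at x)"
  by (rule DERIV_cong, (rule derivative_intros)+) (simp_all del: power_Suc of_nat_Suc)

lemma pjet_mjet: "pjet (Suc (i + j)) (mjet i j)"
  unfolding pjet_def
proof (intro conjI allI)
  fix a b x y
  show "tpoly (Suc (i + j) - (a + b)) (mjet i j a b)"
  proof (cases "a \<le> i \<and> b \<le> j")
    case True
    then have "mjet i j a b = (\<lambda>x y. (1 / (fact (i - a) * fact (j - b))) * x ^ (i - a) * y ^ (j - b))"
      by (auto simp: mjet_def fun_eq_iff)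
    moreover have "tpoly (Suc (i + j) - (a + b)) (\<lambda>x y. (1 / (fact (i - a) * fact (j - b))) * x ^ (i - a) * y ^ (j - b))"
      by (intro tpoly_monom) (use True in arith)
    ultimately show ?thesis by simp
  next
    case False
    then have "mjet i j a b = (\<lambda>x y. 0)" by (auto simp: mjet_def fun_eq_iff)
    then show ?thesis by (simp add: tpoly.zero)
  qed
  have 1: "((\<lambda>s. if a \<le> i then s ^ (i - a) / fact (i - a) else 0) has_real_derivative
      (if Suc a \<le> i then x ^ (i - Suc a) / fact (i - Suc a) else 0)) (at x)" for a i and x :: real
  proof (cases "Suc a \<le> i")
    case True
    then have "i - a = Suc (i - Suc a)" by simp
    then show ?thesis using power_fact_deriv[of "i - Suc a" x] True by (simp del: power_Suc fact_Suc)
  next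
    case False
    then have "(\<lambda>s::real. if a \<le> i then s ^ (i - a) / fact (i - a) else 0) = (\<lambda>s. if a \<le> i then 1 else 0)"
      by (auto simp: fun_eq_iff)
    then show ?thesis using False by simp
  qed
  have e: "mjet i j a b x y = (if a \<le> i then x ^ (i - a) / fact (i - a) else 0) * (if b \<le> j then y ^ (j - b) / fact (j - b) else 0)"
    for a b x y by (simp add: mjet_def)
  show "((\<lambda>s. mjet i j a b s y) has_real_derivative mjet i j (Suc a) b x y) (at x)"
    unfolding e by (intro DERIV_cmult_right 1)
  show "((\<lambda>s. mjet i j a b x s) has_real_derivative mjet i j a (Suc b) x y) (at y)"
    unfolding e by (intro DERIV_cmult 1)
qed

lemma pjet_zero: "pjet n (\<lambda>a b x y. 0)" by (auto simp: pjet_def tpoly.zero)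

lemma pjet_sum: "finite S \<Longrightarrow> (\<And>i. i \<in> S \<Longrightarrow> pjet n (D i)) \<Longrightarrow> pjet n (\<lambda>a b x y. \<Sum>i\<in>S. c i * D i a b x y)"
proof (induction S rule: finite_induct)
  case (insert i S)
  have "pjet n (jlin (c i) (D i) 1 (\<lambda>a b x y. \<Sum>i\<in>S. c i * D i a b x y))" using insert by (intro pjet_jlin) auto
  then show ?case using insert.hyps by (simp add: jlin_def)
qed (simp add: pjet_zero)

lemma pjet_smooth: "pjet n d \<Longrightarrow> smooth_jet d"
  using pjet_jcont by (auto simp: pjet_def smooth_jet_def jcont_def)

lemma smooth_jet_jlin:
  assumes "smooth_jet d" "smooth_jet d'" shows "smooth_jet (jlin \<alpha> d \<beta> d')"
  using smooth_jetD[OF assms(1)] smooth_jetD[OF assms(2)] unfolding smooth_jet_def jlin_def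
  by (auto simp: cont2_def case_prod_beta intro!: continuous_intros DERIV_add DERIV_cmult)

text \<open>The means are matched from the highest order downwards: monomials of degree r change
  those of order r independently of each other and leave higher orders alone.\<close>

lemma mean_matching_polynomial:
  assumes ab: "a > 0" "b > 0" and d: "smooth_jet d"
  shows "n \<le> s \<Longrightarrow> \<exists>p. pjet s p \<and> (\<forall>i j. s - n \<le> i + j \<longrightarrow> i + j < s \<longrightarrow> iint a b (\<lambda>x y. d i j x y - p i j x y) = 0)"
proof (induction n)
  case 0
  then show ?case using pjet_zero by fastforce
next
  case (Suc n)
  then obtain p where p: "pjet s p" "\<And>i j. s - n \<le> i + j \<Longrightarrow> i + j < s \<Longrightarrow> iint a b (\<lambda>x y. d i j x y - p i j x y) = 0"
    by fastforce
  define r where "r = s - Suc n"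
  \<comment> \<open>The mean that is still missing; 4ab is the area of the rectangle.\<close>
  define c where "c i = iint a b (\<lambda>x y. d i (r - i) x y - p i (r - i) x y) / (4 * a * b)" for i
  define q :: jet where "q = (\<lambda>\<alpha> \<beta> x y. \<Sum>i\<le>r. c i * mjet i (r - i) \<alpha> \<beta> x y)"
  have "pjet s (mjet i (r - i))" if "i \<le> r" for i
  proof (rule pjet_mono)
    show "pjet (Suc (i + (r - i))) (mjet i (r - i))" by (rule pjet_mjet)
    show "Suc (i + (r - i)) \<le> s" using that Suc.prems by (simp add: r_def)
  qed
  then have pq: "pjet s q" unfolding q_def by (intro pjet_sum) auto
  have q: "q i j x y = (if i + j = r then c i else 0)" if "r \<le> i + j" for i j x y
  proof -
    have "q i j x y = (\<Sum>i'\<le>r. if i' = i then (if i + j = r then c i else 0) else 0)"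
      unfolding q_def using that by (intro sum.cong) (auto simp: mjet_def)
    then show ?thesis using that by auto
  qed
  note cd = smooth_jetD(1)[OF d] and cp = smooth_jetD(1)[OF pjet_smooth[OF p(1)]] and cq = smooth_jetD(1)[OF pjet_smooth[OF pq]]
  have "iint a b (\<lambda>x y. d i j x y - jlin 1 p 1 q i j x y) = 0" if "s - Suc n \<le> i + j" "i + j < s" for i j
  proof -
    have "iint a b (\<lambda>x y. d i j x y - jlin 1 p 1 q i j x y) = iint a b (\<lambda>x y. (d i j x y - p i j x y) - q i j x y)"
      by (simp add: jlin_def algebra_simps)
    also have "\<dots> = iint a b (\<lambda>x y. d i j x y - p i j x y) - iint a b (q i j)"
      by (intro iint_diff cont2_intros cd cp cq)
    also have "\<dots> = 0"
    proof (cases "i + j = r")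
      case True
      then have "q i j = (\<lambda>x y. c i)" "j = r - i" using q[of i j] by auto
      then show ?thesis using ab by (simp add: iint_const c_def)
    next
      case False
      then have "q i j = (\<lambda>x y. 0)" using q[of i j] that by (auto simp: r_def fun_eq_iff)
      moreover have "s - n \<le> i + j" using False that by (auto simp: r_def)
      ultimately show ?thesis using p(2) that by (simp add: iint_def)
    qed
    finally show ?thesis .
  qed
  then show ?case using pjet_jlin[OF p(1) pq] by blast
qed

text \<open>With all means of order below s matched, the Poincare inequality climbs to order s,
  where the polynomial has disappeared. The Sobolev bound for orders up to 2 consumes orders up to
  4, whence s \<ge> 4.\<close>

theorem polynomial_approximation:
  assumes ab: "a > 0" "b > 0" and s: "s \<ge> 4"
  shows "\<exists>C\<ge>0. \<forall>d. smooth_jet d \<longrightarrow> (\<exists>p. pjet s p \<and> (\<forall>i j x y. i + j \<le> 2 \<longrightarrow> x \<in> {- a..a} \<longrightarrow> y \<in> {- b..b} \<longrightarrow>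
    \<bar>d i j x y - p i j x y\<bar> \<le> C * (\<Sum>m\<le>s. iint a b (\<lambda>x y. \<bar>d m (s - m) x y\<bar>))))"
proof -
  obtain S where S: "S \<ge> 0" "\<And>d m n x y. smooth_jet d \<Longrightarrow> x \<in> {- a..a} \<Longrightarrow> y \<in> {- b..b} \<Longrightarrow>
    \<bar>d m n x y\<bar> \<le> S * (iint a b (\<lambda>x y. \<bar>d m n x y\<bar>) + iint a b (\<lambda>x y. \<bar>d (Suc m) n x y\<bar>)
      + iint a b (\<lambda>x y. \<bar>d m (Suc n) x y\<bar>) + iint a b (\<lambda>x y. \<bar>d (Suc m) (Suc n) x y\<bar>))"
    using sobolev_rectangle[OF ab] by blast
  \<comment> \<open>One Poincare step, applied to two derivatives; the added 1 makes the powers of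
    \<open>K\<close> increasing.\<close>
  define K where "K = 2 * (2 * a + 2 * b) + 1"
  have K: "K \<ge> 1" using ab by (simp add: K_def)
  have "\<exists>p. pjet s p \<and> (\<forall>i j x y. i + j \<le> 2 \<longrightarrow> x \<in> {- a..a} \<longrightarrow> y \<in> {- b..b} \<longrightarrow>
    \<bar>d i j x y - p i j x y\<bar> \<le> (4 * S * K ^ s) * (\<Sum>m\<le>s. iint a b (\<lambda>x y. \<bar>d m (s - m) x y\<bar>)))" if d: "smooth_jet d" for d
  proof -
    obtain p where p: "pjet s p" "\<And>i j. i + j < s \<Longrightarrow> iint a b (\<lambda>x y. d i j x y - p i j x y) = 0"
      using mean_matching_polynomial[OF ab d, of s s] by auto
    define w where "w = jlin 1 d (-1) p"
    have w: "smooth_jet w" unfolding w_def by (intro smooth_jet_jlin d pjet_smooth[OF p(1)])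
    define N where "N = (\<Sum>m\<le>s. iint a b (\<lambda>x y. \<bar>d m (s - m) x y\<bar>))"
    have N: "N \<ge> 0" unfolding N_def by (intro sum_nonneg iint_abs_nonneg smooth_jetD[OF d])
    have chain: "iint a b (\<lambda>x y. \<bar>w i j x y\<bar>) \<le> K ^ n * N" if "i + j + n = s" for i j n
      using that
    proof (induction n arbitrary: i j)
      case 0
      have "tpoly (s - (i + j)) (p i j)" using p(1) by (simp add: pjet_def)
      then have "p i j x y = 0" for x y using 0 by (simp add: tpoly_0)
      then have "iint a b (\<lambda>x y. \<bar>w i j x y\<bar>) = iint a b (\<lambda>x y. \<bar>d i (s - i) x y\<bar>)"
        using 0 by (auto simp: w_def jlin_def)
      also have "\<dots> \<le> N" unfolding N_def
        using 0 by (intro member_le_sum[of i "{..s}" "\<lambda>m. iint a b (\<lambda>x y. \<bar>d m (s - m) x y\<bar>)"] iint_abs_nonneg smooth_jetD[OF d]) auto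
      finally show ?case by simp
    next
      case (Suc n)
      have "iint a b (w i j) = 0" using p(2)[of i j] Suc.prems by (simp add: w_def jlin_def)
      from poincare_rectangle[OF ab w this]
      have "iint a b (\<lambda>x y. \<bar>w i j x y\<bar>) \<le> (2 * a + 2 * b) * (K ^ n * N + K ^ n * N)"
        using Suc.IH[of "Suc i" j] Suc.IH[of i "Suc j"] Suc.prems ab
        by (elim order.trans) (intro mult_left_mono add_mono; simp)
      also have "\<dots> \<le> K ^ Suc n * N"
        using K N by (simp add: K_def algebra_simps)
      finally show ?case .
    qed
    have low: "iint a b (\<lambda>x y. \<bar>w i j x y\<bar>) \<le> K ^ s * N" if "i + j \<le> s" for i j
    proof -
      have "iint a b (\<lambda>x y. \<bar>w i j x y\<bar>) \<le> K ^ (s - (i + j)) * N" by (rule chain) (use that in simp)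
      also have "\<dots> \<le> K ^ s * N" using K N by (intro mult_right_mono power_increasing) auto
      finally show ?thesis .
    qed
    have "\<bar>w i j x y\<bar> \<le> 4 * S * K ^ s * N" if "i + j \<le> 2" "x \<in> {- a..a}" "y \<in> {- b..b}" for i j x y
    proof -
      have "\<bar>w i j x y\<bar> \<le> S * (K ^ s * N + K ^ s * N + K ^ s * N + K ^ s * N)"
        using that s S(1) by (intro order.trans[OF S(2)[OF w that(2,3)]] mult_left_mono add_mono low) auto
      then show ?thesis by (simp add: algebra_simps)
    qed
    then show ?thesis using p(1) by (auto simp: w_def jlin_def N_def)
  qed
  moreover have "4 * S * K ^ s \<ge> 0" using S K by simp
  ultimately show ?thesis by blast
qed

section \<open>Fourier series on the torus\<close>

definition freq :: "real \<Rightarrow> int \<Rightarrow> real" where "freq L p = 2 * pi * of_int p / L"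

text \<open>A real orthonormal basis indexed by the integers, cosines for positive and sines for
  negative indices. The minus sign makes differentiation uniform: the derivative of index p is -freq
  p times the function of index -p.\<close>

definition trig :: "real \<Rightarrow> int \<Rightarrow> real \<Rightarrow> real" where
  "trig L p x = (if p = 0 then 1 / sqrt L else if p > 0 then sqrt (2 / L) * cos (freq L p * x)
     else - (sqrt (2 / L) * sin (freq L p * x)))"

fun trigd :: "real \<Rightarrow> nat \<Rightarrow> int \<Rightarrow> real \<Rightarrow> real" where
  "trigd L 0 p x = trig L p x"
| "trigd L (Suc a) p x = - freq L p * trigd L a (- p) x"

fun trigc :: "real \<Rightarrow> nat \<Rightarrow> int \<Rightarrow> real" where
  "trigc L 0 p = 1"
| "trigc L (Suc a) p = - freq L p * trigc L a (- p)"

text \<open>An odd number of derivatives exchanges sines and cosines, that is, flips the sign of the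
  index.\<close>

definition par :: "nat \<Rightarrow> int \<Rightarrow> int" where "par a p = (if even a then p else - p)"

lemma freq_minus [simp]: "freq L (- p) = - freq L p" and freq_0 [simp]: "freq L 0 = 0"
  by (auto simp: freq_def)

lemma par_par [simp]: "par a (par a p) = p" and par_eq_iff [simp]: "par a p = par a q \<longleftrightarrow> p = q"
  by (auto simp: par_def)

lemma abs_trigc: "\<bar>trigc L a p\<bar> = \<bar>freq L p\<bar> ^ a"
  by (induction a arbitrary: p) (auto simp: abs_mult)

lemma trigd_eq: "trigd L a p x = trigc L a p * trig L (par a p) x"
  by (induction a arbitrary: p) (auto simp: par_def)

lemma trig_deriv: "(trig L p has_real_derivative trigd L 1 p x) (at x)"
proof -
  have *: "(trig L p has_real_derivative - freq L p * trig L (- p) x) (at x)"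
  proof (cases "p = 0")
    case True
    then have "trig L p = (\<lambda>x. 1 / sqrt L)" by (auto simp: trig_def fun_eq_iff)
    then show ?thesis using True by simp
  next
    case False
    show ?thesis
    proof (cases "p > 0")
      case True
      then have "trig L p = (\<lambda>x. sqrt (2 / L) * cos (freq L p * x))" by (auto simp: trig_def fun_eq_iff)
      then show ?thesis using True by (auto intro!: derivative_eq_intros simp: trig_def)
    next
      case False
      then have "trig L p = (\<lambda>x. - (sqrt (2 / L) * sin (freq L p * x)))"
        using \<open>p \<noteq> 0\<close> by (auto simp: trig_def fun_eq_iff)
      then show ?thesis using False \<open>p \<noteq> 0\<close> by (auto intro!: derivative_eq_intros simp: trig_def)
    qed
  qed
  then show ?thesis by simp
qed

lemma trigd_deriv: "(trigd L a p has_real_derivative trigd L (Suc a) p x) (at x)"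
proof (induction a arbitrary: p)
  case 0
  have "trigd L 0 p = trig L p" by (simp add: fun_eq_iff)
  then show ?case using trig_deriv[of L p x] by simp
next
  case (Suc a)
  have "trigd L (Suc a) p = (\<lambda>x. - freq L p * trigd L a (- p) x)" by (simp add: fun_eq_iff)
  then show ?case using DERIV_cmult[OF Suc[of "- p"], of "- freq L p"] by simp
qed

lemma trigd_continuous: "continuous_on S (trigd L a p)"
  by (meson DERIV_continuous_on has_field_derivative_at_within trigd_deriv)

lemma trig_continuous: "continuous_on S (trig L p)"
  using trigd_continuous[of S L 0 p] by (simp add: fun_eq_iff[symmetric] cong: continuous_on_cong)

lemma trig_periodic: assumes "L > 0" shows "trig L p (x + L) = trig L p x"
proof -
  have "freq L p * (x + L) = freq L p * x + 2 * pi * of_int p" using assms by (simp add: freq_def field_simps)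
  then show ?thesis by (simp add: trig_def cos_add sin_add cos_int_2pin sin_int_2pin)
qed

lemma trigd_periodic: "L > 0 \<Longrightarrow> trigd L a p (x + L) = trigd L a p x"
  by (simp add: trigd_eq trig_periodic)

lemma trig_bound: assumes "L > 0" shows "\<bar>trig L p x\<bar> \<le> sqrt (2 / L)"
proof -
  have "1 / sqrt L \<le> sqrt (2 / L)" using assms by (simp add: real_sqrt_divide divide_right_mono)
  then show ?thesis using assms
    by (auto simp: trig_def abs_mult intro!: mult_left_le)
qed

text \<open>Integration by parts alone relates the products with flipped indices; no product
  formulas are needed. Different squared frequencies give orthogonality as for eigenfunctions of a
  symmetric operator, and the remaining pairs p, -p are treated separately.\<close>

lemma trig_orthonormal:
  assumes ab: "a < b" and L: "L = b - a"
  shows "integral {a..b} (\<lambda>x. trig L p x * trig L q x) = (if p = q then 1 else 0)"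
proof -
  define I where "I p q = integral {a..b} (\<lambda>x. trig L p x * trig L q x)" for p q
  have L0: "L > 0" and Lb: "b = a + L" using assms by auto
  have int: "(\<lambda>x. c * (trig L p x * trig L q x)) integrable_on {a..b}" for p q c
    by (intro integrable_continuous_real continuous_intros trig_continuous)
  have sym: "I p q = I q p" for p q by (simp add: I_def mult.commute)
  have parts: "freq L p * I (- p) q + freq L q * I p (- q) = 0" for p q
  proof -
    have "((\<lambda>x. trigd L 1 p x * trig L q x + trigd L 1 q x * trig L p x) has_integral
        (trig L p b * trig L q b - trig L p a * trig L q a)) {a..b}"
    proof (rule fundamental_theorem_of_calculus)
      fix x
      show "((\<lambda>x. trig L p x * trig L q x) has_vector_derivative
          trigd L 1 p x * trig L q x + trigd L 1 q x * trig L p x) (at x within {a..b})"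
        unfolding has_real_derivative_iff_has_vector_derivative[symmetric]
        by (rule DERIV_subset[OF DERIV_mult[OF trig_deriv trig_deriv]]) simp
    qed (use ab in simp)
    moreover have "trig L p b * trig L q b - trig L p a * trig L q a = 0"
      unfolding Lb by (simp add: trig_periodic[OF L0])
    moreover have "trigd L 1 p x * trig L q x + trigd L 1 q x * trig L p x
        = (- freq L p) * (trig L (- p) x * trig L q x) + (- freq L q) * (trig L p x * trig L (- q) x)" for x
      by (simp add: algebra_simps)
    ultimately have "integral {a..b} (\<lambda>x. (- freq L p) * (trig L (- p) x * trig L q x) + (- freq L q) * (trig L p x * trig L (- q) x)) = 0"
      by (simp only: has_integral_iff)
    moreover have "integral {a..b} (\<lambda>x. (- freq L p) * (trig L (- p) x * trig L q x) + (- freq L q) * (trig L p x * trig L (- q) x))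
      = integral {a..b} (\<lambda>x. (- freq L p) * (trig L (- p) x * trig L q x)) + integral {a..b} (\<lambda>x. (- freq L q) * (trig L p x * trig L (- q) x))"
      by (intro integral_add int)
    ultimately show ?thesis by (simp add: I_def)
  qed
  have f0: "freq L p = 0 \<longleftrightarrow> p = 0" for p using L0 by (simp add: freq_def)
  have "I p q = (if p = q then 1 else 0)"
  proof (cases "p = q \<or> p = - q")
    case False
    have 1: "freq L p * I p q = freq L q * I (- p) (- q)" using parts[of "- p" q] by simp
    have 2: "freq L q * I p q = freq L p * I (- p) (- q)" using parts[of p "- q"] by simp
    \<comment> \<open>Applying the relation in both variables shows that both squared frequencies
      yield the same product.\<close>
    have "((freq L p)\<^sup>2 - (freq L q)\<^sup>2) * I p q = freq L p * (freq L p * I p q) - freq L q * (freq L q * I p q)"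
      by (simp add: power2_eq_square algebra_simps)
    also have "\<dots> = 0" unfolding 1 2 by simp
    finally have "(freq L p)\<^sup>2 = (freq L q)\<^sup>2 \<or> I p q = 0" by simp
    moreover have "(freq L p)\<^sup>2 \<noteq> (freq L q)\<^sup>2"
      using False L0 by (auto simp: power2_eq_iff freq_def field_simps)
    ultimately show ?thesis using False by simp
  next
    case True
    show ?thesis
    proof (cases "p = q")
      case False
      then have q: "q = - p" "p \<noteq> 0" using True by auto
      have "freq L p * I p q = 0" using parts[of p p] sym[of "- p" p] q by simp
      then show ?thesis using q f0 by auto
    next
      case True
      show ?thesis
      proof (cases "p = 0")
        case p0: True
        then show ?thesis using True ab L L0 by (simp add: I_def trig_def power_divide flip: power2_eq_square)
      next
        case False
        \<comment> \<open>Sine and cosine of one frequency have equal norm, and their squares add up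
          to the constant 2 / L.\<close>
        have "freq L p * I p p = freq L p * I (- p) (- p)"
          using parts[of "- p" p] unfolding freq_minus minus_minus by linarith
        moreover have "freq L p \<noteq> 0" using f0 False by blast
        ultimately have e: "I p p = I (- p) (- p)" by (metis mult_left_cancel)
        have "trig L p x * trig L p x + trig L (- p) x * trig L (- p) x = 2 / L" for x
        proof -
          define r where "r = sqrt (2 / L)"
          have rr: "r * r = 2 / L" unfolding r_def using L0 by (subst real_sqrt_mult_self) simp
          define C S where "C = cos (freq L p * x)" and "S = sin (freq L p * x)"
          have "trig L p x * trig L p x + trig L (- p) x * trig L (- p) x = (r * r) * (C\<^sup>2 + S\<^sup>2)"
            using False unfolding trig_def r_def[symmetric] power2_eq_square freq_minus
              minus_mult_left[symmetric] cos_minus sin_minus C_def[symmetric] S_def[symmetric]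
            by (auto simp: algebra_simps)
          then show ?thesis by (simp only: sin_cos_squared_add2 rr mult_1_right C_def S_def)
        qed
        then have "I p p + I (- p) (- p) = integral {a..b} (\<lambda>x. 2 / L)"
          unfolding I_def using int[of 1] by (subst integral_add[symmetric]) auto
        also have "\<dots> = 2" using ab L L0 by (simp add: field_simps)
        finally show ?thesis using e True by simp
      qed
    qed
  qed
  then show ?thesis by (simp add: I_def)
qed

lemma integral_nonneg_always:
  fixes f :: "'a::euclidean_space \<Rightarrow> real"
  assumes "\<And>x. f x \<ge> 0" shows "integral S f \<ge> 0"
  by (cases "f integrable_on S") (use assms in \<open>auto intro: integral_nonneg simp: not_integrable_integral\<close>)

lemma rect_cbox: "rect x0 x1 y0 y1 = cbox (x0, y0) (x1, y1)"
  by (simp add: rect_def cbox_Pair_eq)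

lemma cont2_tensor: "continuous_on UNIV f \<Longrightarrow> continuous_on UNIV g \<Longrightarrow> cont2 (\<lambda>x y. f x * g y)"
  unfolding cont2_def case_prod_unfold
  by (intro continuous_intros continuous_on_compose2[of UNIV f UNIV fst] continuous_on_compose2[of UNIV g UNIV snd]) auto

lemma cont2_mult: "cont2 f \<Longrightarrow> cont2 g \<Longrightarrow> cont2 (\<lambda>x y. f x y * g x y)"
  unfolding cont2_def case_prod_unfold by (intro continuous_intros) 

lemma cont2_sum: "(\<And>i. i \<in> A \<Longrightarrow> cont2 (f i)) \<Longrightarrow> cont2 (\<lambda>x y. \<Sum>i\<in>A. f i x y)"
  unfolding cont2_def case_prod_unfold by (intro continuous_intros)

lemma cont2_abs_integrable:
  assumes "cont2 f" shows "(\<lambda>(x, y). f x y) absolutely_integrable_on rect x0 x1 y0 y1"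
  unfolding rect_cbox using assms by (intro absolutely_integrable_continuous) (auto simp: cont2_def intro: continuous_on_subset)

lemma rect_lebesgue: "rect x0 x1 y0 y1 \<in> sets lebesgue"
  by (simp add: rect_cbox)

lemma cont2_L2: assumes "cont2 f" shows "L2_on (rect x0 x1 y0 y1) f"
proof -
  have "(\<lambda>(x, y). f x y) \<in> borel_measurable (lebesgue_on (rect x0 x1 y0 y1))"
    using assms by (intro continuous_imp_measurable_on_sets_lebesgue rect_lebesgue) (auto simp: cont2_def intro: continuous_on_subset)
  moreover have "(\<lambda>(x, y). (f x y)\<^sup>2) absolutely_integrable_on rect x0 x1 y0 y1"
    using cont2_abs_integrable[OF cont2_mult[OF assms assms]] by (simp add: power2_eq_square)
  ultimately show ?thesis by (simp add: L2_on_def)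
qed

lemma L2_mult_integrable:
  assumes "L2_on (rect x0 x1 y0 y1) f" "L2_on (rect x0 x1 y0 y1) g"
  shows "(\<lambda>(x, y). f x y * g x y) absolutely_integrable_on rect x0 x1 y0 y1"
proof (rule measurable_bounded_by_integrable_imp_absolutely_integrable)
  let ?R = "rect x0 x1 y0 y1"
  show "(\<lambda>(x, y). f x y * g x y) \<in> borel_measurable (lebesgue_on ?R)"
    using assms unfolding L2_on_def case_prod_unfold by (intro borel_measurable_times) auto
  show "?R \<in> sets lebesgue" by (rule rect_lebesgue)
  have "(\<lambda>(x, y). (f x y)\<^sup>2) integrable_on ?R" "(\<lambda>(x, y). (g x y)\<^sup>2) integrable_on ?R"
    using assms by (auto simp: L2_on_def absolutely_integrable_on_def)
  from integrable_add[OF this]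
  show "(\<lambda>(x, y). (f x y)\<^sup>2 + (g x y)\<^sup>2) integrable_on ?R" by (simp add: case_prod_unfold)
  fix z assume "z \<in> ?R"
  have "\<bar>f x y * g x y\<bar> \<le> (f x y)\<^sup>2 + (g x y)\<^sup>2" for x y
  proof -
    have "0 \<le> (\<bar>f x y\<bar> - \<bar>g x y\<bar>)\<^sup>2" by simp
    then have "2 * (\<bar>f x y\<bar> * \<bar>g x y\<bar>) \<le> (f x y)\<^sup>2 + (g x y)\<^sup>2" by (simp add: power2_diff)
    moreover have "0 \<le> \<bar>f x y\<bar> * \<bar>g x y\<bar>" by simp
    ultimately show ?thesis unfolding abs_mult by linarith
  qed
  then show "norm ((\<lambda>(x, y). f x y * g x y) z) \<le> (\<lambda>(x, y). (f x y)\<^sup>2 + (g x y)\<^sup>2) z"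
    by (auto split: prod.split)
qed

section \<open>Fourier coefficients and partial sums of periodic functions\<close>

locale torus =
  fixes x0 x1 y0 y1 :: real
  assumes x01: "x0 < x1" and y01: "y0 < y1"
begin

abbreviation "R \<equiv> rect x0 x1 y0 y1"
abbreviation "Lx \<equiv> x1 - x0"
abbreviation "Ly \<equiv> y1 - y0"

definition bas :: "int \<Rightarrow> int \<Rightarrow> real \<Rightarrow> real \<Rightarrow> real" where
  "bas p q x y = trig Lx p x * trig Ly q y"

definition ip :: "(real \<Rightarrow> real \<Rightarrow> real) \<Rightarrow> (real \<Rightarrow> real \<Rightarrow> real) \<Rightarrow> real" where
  "ip f g = integral R (\<lambda>(x, y). f x y * g x y)"

lemma ip_integrable:
  assumes "L2_on R f" "L2_on R g" shows "(\<lambda>(x, y). f x y * g x y) integrable_on R"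
  using L2_mult_integrable[OF assms] by (simp add: absolutely_integrable_on_def)

lemma ip_integrable':
  assumes "L2_on R f" "L2_on R g" shows "(\<lambda>z. f (fst z) (snd z) * g (fst z) (snd z)) integrable_on R"
  using ip_integrable[OF assms] by (simp add: case_prod_unfold)

lemma ip_commute: "ip f g = ip g f" by (simp add: ip_def mult.commute)

lemma cont2_bas: "cont2 (bas p q)"
  unfolding bas_def by (intro cont2_tensor trig_continuous)

lemma ip_bas: "ip (bas p q) (bas p' q') = (if p = p' \<and> q = q' then 1 else 0)"
proof -
  have "ip (bas p q) (bas p' q') = integral {x0..x1} (\<lambda>x. integral {y0..y1} (\<lambda>y. bas p q x y * bas p' q' x y))"
    unfolding ip_def rect_cbox
    using integral_prod_continuous[of x0 y0 x1 y1 "\<lambda>(x, y). bas p q x y * bas p' q' x y"]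
      cont2_mult[OF cont2_bas cont2_bas, of p q p' q'] by (auto simp: cont2_def intro: continuous_on_subset)
  also have "\<dots> = integral {x0..x1} (\<lambda>x. (trig Lx p x * trig Lx p' x) * integral {y0..y1} (\<lambda>y. trig Ly q y * trig Ly q' y))"
    by (subst integral_mult_right[symmetric]) (simp add: bas_def mult_ac)
  also have "\<dots> = (if p = p' \<and> q = q' then 1 else 0)"
    using trig_orthonormal[OF x01 refl, of p p'] trig_orthonormal[OF y01 refl, of q q'] by (auto simp: mult_ac)
  finally show ?thesis .
qed

lemma ip_sum:
  assumes "finite A" "L2_on R g" "\<And>i. i \<in> A \<Longrightarrow> cont2 (f i)"
  shows "ip g (\<lambda>x y. \<Sum>i\<in>A. c i * f i x y) = (\<Sum>i\<in>A. c i * ip g (f i))"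
proof -
  have "ip g (\<lambda>x y. \<Sum>i\<in>A. c i * f i x y)
      = integral R (\<lambda>z. \<Sum>i\<in>A. c i * (g (fst z) (snd z) * f i (fst z) (snd z)))"
    by (simp add: ip_def case_prod_unfold sum_distrib_left mult_ac)
  also have "\<dots> = (\<Sum>i\<in>A. integral R (\<lambda>z. c i * (g (fst z) (snd z) * f i (fst z) (snd z))))"
    by (intro integral_sum assms integrable_on_mult_right ip_integrable' cont2_L2)
  finally show ?thesis by (simp add: ip_def case_prod_unfold)
qed

lemma ip_trig_sum:
  fixes c :: "'i \<Rightarrow> real" and \<alpha> \<beta> :: "'i \<Rightarrow> int"
  assumes "finite A" "inj_on (\<lambda>i. (\<alpha> i, \<beta> i)) A"
  defines "P \<equiv> (\<lambda>x y. \<Sum>i\<in>A. c i * bas (\<alpha> i) (\<beta> i) x y)"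
  shows "ip P P = (\<Sum>i\<in>A. (c i)\<^sup>2)"
proof -
  have cP: "cont2 P" unfolding P_def by (intro cont2_sum cont2_intros cont2_bas)
  have "ip P (bas (\<alpha> j) (\<beta> j)) = c j" if "j \<in> A" for j
  proof -
    have "ip P (bas (\<alpha> j) (\<beta> j)) = ip (bas (\<alpha> j) (\<beta> j)) P" by (rule ip_commute)
    also have "\<dots> = (\<Sum>i\<in>A. c i * ip (bas (\<alpha> j) (\<beta> j)) (bas (\<alpha> i) (\<beta> i)))"
      unfolding P_def by (intro ip_sum assms cont2_L2 cont2_bas)
    also have "\<dots> = (\<Sum>i\<in>A. if j = i then c i else 0)"
      using assms(2) that by (intro sum.cong) (auto simp: ip_bas inj_on_def)
    finally show ?thesis using assms(1) that by simp
  qed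
  moreover have "ip P P = (\<Sum>i\<in>A. c i * ip P (bas (\<alpha> i) (\<beta> i)))"
    by (subst (2) P_def) (intro ip_sum assms cont2_L2 cP cont2_bas)
  ultimately show ?thesis by (simp add: power2_eq_square)
qed

lemma ip_nonneg: "ip f f \<ge> 0"
  unfolding ip_def by (rule integral_nonneg_always) (auto simp: case_prod_unfold)

text \<open>The squared distance of \<open>g\<close> from its orthogonal projection is
  nonnegative.\<close>

lemma bessel:
  assumes "finite A" "L2_on R g"
  shows "(\<Sum>(p, q)\<in>A. (ip g (bas p q))\<^sup>2) \<le> ip g g"
proof -
  define c where "c i = ip g (bas (fst i) (snd i))" for i
  define P where "P = (\<lambda>x y. \<Sum>i\<in>A. c i * bas (fst i) (snd i) x y)"
  have cP: "cont2 P" unfolding P_def by (intro cont2_sum cont2_intros cont2_bas)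
  note LP = cont2_L2[OF cP]
  have gP: "ip g P = (\<Sum>i\<in>A. (c i)\<^sup>2)"
  proof -
    have "ip g P = (\<Sum>i\<in>A. c i * ip g (bas (fst i) (snd i)))"
      unfolding P_def by (intro ip_sum assms cont2_bas)
    then show ?thesis by (simp add: c_def power2_eq_square)
  qed
  have PP: "ip P P = (\<Sum>i\<in>A. (c i)\<^sup>2)" unfolding P_def by (intro ip_trig_sum assms) (auto simp: inj_on_def)
  have i: "(\<lambda>z. g (fst z) (snd z) * g (fst z) (snd z)) integrable_on R"
    "(\<lambda>z. g (fst z) (snd z) * P (fst z) (snd z)) integrable_on R"
    "(\<lambda>z. P (fst z) (snd z) * P (fst z) (snd z)) integrable_on R"
    by (intro ip_integrable' assms LP)+
  have "0 \<le> integral R (\<lambda>z. (g (fst z) (snd z) - P (fst z) (snd z))\<^sup>2)"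
    by (rule integral_nonneg_always) auto
  also have "(\<lambda>z. (g (fst z) (snd z) - P (fst z) (snd z))\<^sup>2) = (\<lambda>z. (g (fst z) (snd z) * g (fst z) (snd z)
      - 2 * (g (fst z) (snd z) * P (fst z) (snd z))) + P (fst z) (snd z) * P (fst z) (snd z))"
    by (auto simp: power2_eq_square algebra_simps)
  also have "integral R \<dots> = (ip g g - 2 * ip g P) + ip P P"
    unfolding ip_def case_prod_unfold
    by (subst integral_add, intro integrable_diff integrable_on_mult_right i, rule i,
        subst integral_diff) (auto intro!: i integrable_on_mult_right[of _ _ 2])
  finally show ?thesis using gP PP by (simp add: c_def case_prod_unfold)
qed

lemma smooth_jet_trig: "smooth_jet (\<lambda>a b x y. trigd Lx a p x * trigd Ly b q y)"
  unfolding smooth_jet_def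
  by (auto intro!: DERIV_cmult DERIV_cmult_right trigd_deriv simp del: trigd.simps
      simp: cont2_tensor[unfolded cont2_def] trigd_continuous)

text \<open>The weak derivative is tested with the basis function of flipped index, whose derivative
  of order (m, n) is a multiple of \<open>bas p q\<close>. Absolute values suffice, since only
  squares enter the Bessel inequality.\<close>

lemma fourier_weak_deriv:
  assumes "weak_deriv x0 x1 y0 y1 m n u g"
  shows "\<bar>ip u (bas p q)\<bar> * (\<bar>freq Lx p\<bar> ^ m * \<bar>freq Ly q\<bar> ^ n) = \<bar>ip g (bas (par m p) (par n q))\<bar>"
proof -
  define p' q' where "p' = par m p" and "q' = par n q"
  define d where "d = (\<lambda>a b x y. trigd Lx a p' x * trigd Ly b q' y)"
  have sj: "smooth_jet d" unfolding d_def by (rule smooth_jet_trig)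
  have per: "periodic2 (x1 - x0) (y1 - y0) (d 0 0)"
    using x01 y01 by (simp add: periodic2_def d_def trig_periodic)
  have "integral R (\<lambda>(x, y). u x y * d m n x y) = (-1) ^ (m + n) * integral R (\<lambda>(x, y). g x y * d 0 0 x y)"
    using assms sj per unfolding weak_deriv_def by blast
  moreover have "integral R (\<lambda>(x, y). g x y * d 0 0 x y) = ip g (bas p' q')"
    by (simp add: ip_def d_def bas_def)
  moreover have "integral R (\<lambda>(x, y). u x y * d m n x y) = (trigc Lx m p' * trigc Ly n q') * ip u (bas p q)"
  proof -
    have "u x y * d m n x y = (trigc Lx m p' * trigc Ly n q') * (u x y * bas p q x y)" for x y
      by (simp add: d_def trigd_eq p'_def q'_def bas_def)
    then have "integral R (\<lambda>(x, y). u x y * d m n x y) = integral R (\<lambda>z. (trigc Lx m p' * trigc Ly n q') * (case z of (x, y) \<Rightarrow> u x y * bas p q x y))"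
      by (simp only: case_prod_unfold)
    then show ?thesis by (simp only: ip_def integral_mult_right)
  qed
  ultimately have "\<bar>(trigc Lx m p' * trigc Ly n q') * ip u (bas p q)\<bar> = \<bar>(-1) ^ (m + n) * ip g (bas p' q')\<bar>" by simp
  then have "\<bar>freq Lx p'\<bar> ^ m * \<bar>freq Ly q'\<bar> ^ n * \<bar>ip u (bas p q)\<bar> = \<bar>ip g (bas p' q')\<bar>"
    by (simp add: abs_mult abs_trigc power_abs)
  moreover have "\<bar>freq Lx p'\<bar> = \<bar>freq Lx p\<bar>" "\<bar>freq Ly q'\<bar> = \<bar>freq Ly q\<bar>" by (auto simp: p'_def q'_def par_def)
  ultimately show ?thesis by (simp add: p'_def q'_def mult_ac)
qed

lemma fourier_deriv_bessel:
  assumes "weak_deriv x0 x1 y0 y1 m n u g" "finite A"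
  shows "(\<Sum>(p, q)\<in>A. (\<bar>ip u (bas p q)\<bar> * (\<bar>freq Lx p\<bar> ^ m * \<bar>freq Ly q\<bar> ^ n))\<^sup>2) \<le> ip g g"
proof -
  let ?h = "\<lambda>(p, q). (par m p, par n q)"
  have "(\<Sum>(p, q)\<in>A. (\<bar>ip u (bas p q)\<bar> * (\<bar>freq Lx p\<bar> ^ m * \<bar>freq Ly q\<bar> ^ n))\<^sup>2)
      = (\<Sum>(p, q)\<in>A. (ip g (bas (par m p) (par n q)))\<^sup>2)"
    by (simp add: fourier_weak_deriv[OF assms(1)])
  also have "\<dots> = (\<Sum>(p, q)\<in>?h ` A. (ip g (bas p q))\<^sup>2)"
    by (subst sum.reindex) (auto simp: inj_on_def case_prod_unfold)
  also have "\<dots> \<le> ip g g"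
    using assms by (intro bessel) (auto simp: weak_deriv_def)
  finally show ?thesis .
qed

definition box_idx :: "nat \<Rightarrow> (int \<times> int) set" where
  "box_idx n = {- int n..int n} \<times> {- int n..int n}"

definition partial :: "(real \<Rightarrow> real \<Rightarrow> real) \<Rightarrow> nat \<Rightarrow> jet" where
  "partial u n a b x y = (\<Sum>(p, q)\<in>box_idx n. ip u (bas p q) * (trigd Lx a p x * trigd Ly b q y))"

lemma finite_box_idx: "finite (box_idx n)" by (simp add: box_idx_def)

lemma partial_smooth: "smooth_jet (partial u n)"
proof -
  note D = smooth_jetD[OF smooth_jet_trig]
  have "cont2 (partial u n a b)" for a b
    unfolding partial_def case_prod_unfold by (intro cont2_sum cont2_intros(3) D(1))
  then show ?thesis unfolding smooth_jet_def cont2_def partial_def case_prod_unfold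
    by (intro conjI allI DERIV_sum DERIV_cmult D) auto
qed

lemma partial_periodic: "periodic2 Lx Ly (partial u n a b)"
  using x01 y01 by (simp add: periodic2_def partial_def trigd_periodic)

lemma partial_norm:
  assumes "weak_deriv x0 x1 y0 y1 a b u g"
  shows "integral R (\<lambda>(x, y). (partial u n a b x y)\<^sup>2) \<le> (L2_norm R g)\<^sup>2"
proof -
  define c where "c = (\<lambda>(p, q). ip u (bas p q) * (trigc Lx a p * trigc Ly b q))"
  have "partial u n a b = (\<lambda>x y. \<Sum>i\<in>box_idx n. c i * bas (par a (fst i)) (par b (snd i)) x y)"
    by (auto simp: partial_def c_def fun_eq_iff bas_def trigd_eq case_prod_unfold mult_ac intro!: sum.cong)
  then have "ip (partial u n a b) (partial u n a b) = (\<Sum>i\<in>box_idx n. (c i)\<^sup>2)"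
    by (simp only:) (intro ip_trig_sum finite_box_idx, auto simp: inj_on_def)
  also have "\<dots> = (\<Sum>(p, q)\<in>box_idx n. (\<bar>ip u (bas p q)\<bar> * (\<bar>freq Lx p\<bar> ^ a * \<bar>freq Ly q\<bar> ^ b))\<^sup>2)"
  proof (intro sum.cong refl)
    fix i assume "i \<in> box_idx n"
    have "\<bar>c i\<bar> = \<bar>ip u (bas (fst i) (snd i))\<bar> * (\<bar>freq Lx (fst i)\<bar> ^ a * \<bar>freq Ly (snd i)\<bar> ^ b)"
      by (simp add: c_def case_prod_unfold abs_mult abs_trigc)
    then have "(c i)\<^sup>2 = (\<bar>ip u (bas (fst i) (snd i))\<bar> * (\<bar>freq Lx (fst i)\<bar> ^ a * \<bar>freq Ly (snd i)\<bar> ^ b))\<^sup>2"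
      by (metis power2_abs)
    then show "(c i)\<^sup>2 = (case i of (p, q) \<Rightarrow> (\<bar>ip u (bas p q)\<bar> * (\<bar>freq Lx p\<bar> ^ a * \<bar>freq Ly q\<bar> ^ b))\<^sup>2)"
      by (simp add: case_prod_unfold)
  qed
  also have "\<dots> \<le> ip g g" by (intro fourier_deriv_bessel assms finite_box_idx)
  also have "ip g g = (L2_norm R g)\<^sup>2"
    using ip_nonneg[of g] by (simp add: ip_def L2_norm_def power2_eq_square case_prod_unfold)
  finally show ?thesis by (simp add: ip_def power2_eq_square)
qed

lemma sum_inverse_freq_bounded:
  assumes "L > 0"
  shows "\<exists>C\<ge>0. \<forall>n::nat. (\<Sum>p\<in>{- int n..int n}. 1 / (1 + (freq L p)\<^sup>2)) \<le> C"
proof -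
  define K where "K = (L / (2 * pi))\<^sup>2"
  have s: "summable (\<lambda>n. 1 / real (Suc n) ^ 2)" using inverse_squares_sums by (auto simp: sums_iff)
  define C where "C = 1 + 2 * K * (\<Sum>n. 1 / real (Suc n) ^ 2)"
  have le: "1 / (1 + (freq L p)\<^sup>2) \<le> K / (of_int p)\<^sup>2" if "p \<noteq> 0" for p
  proof -
    have "K / (of_int p)\<^sup>2 = 1 / (freq L p)\<^sup>2" by (simp add: K_def freq_def power_divide power_mult_distrib)
    moreover have "(freq L p)\<^sup>2 > 0" using that assms by (simp add: freq_def)
    ultimately show ?thesis by (simp add: frac_le)
  qed
  have "(\<Sum>p\<in>{- int n..int n}. 1 / (1 + (freq L p)\<^sup>2)) \<le> 1 + 2 * K * (\<Sum>i<n. 1 / real (Suc i) ^ 2)" for n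
  proof (induction n)
    case (Suc n)
    have "{- int (Suc n)..int (Suc n)} = insert (int (Suc n)) (insert (- int (Suc n)) {- int n..int n})" by auto
    then have "(\<Sum>p\<in>{- int (Suc n)..int (Suc n)}. 1 / (1 + (freq L p)\<^sup>2))
      = 1 / (1 + (freq L (int (Suc n)))\<^sup>2) + (1 / (1 + (freq L (- int (Suc n)))\<^sup>2) + (\<Sum>p\<in>{- int n..int n}. 1 / (1 + (freq L p)\<^sup>2)))"
      by simp
    also have "\<dots> \<le> K / (real (Suc n))\<^sup>2 + (K / (real (Suc n))\<^sup>2 + (1 + 2 * K * (\<Sum>i<n. 1 / real (Suc i) ^ 2)))"
      using le[of "int (Suc n)"] le[of "- int (Suc n)"] Suc by (intro add_mono) (simp_all del: of_nat_Suc freq_minus)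
    finally show ?case by (simp add: algebra_simps del: of_nat_Suc)
  qed simp
  also have "1 + 2 * K * (\<Sum>i<n. 1 / real (Suc i) ^ 2) \<le> C" for n
    unfolding C_def by (intro add_left_mono mult_left_mono sum_le_suminf s) (auto simp: K_def)
  finally have "\<forall>n::nat. (\<Sum>p\<in>{- int n..int n}. 1 / (1 + (freq L p)\<^sup>2)) \<le> C" by blast
  moreover from this have "C \<ge> 0"
  proof -
    have "0 \<le> (\<Sum>p\<in>{- int 0..int 0}. 1 / (1 + (freq L p)\<^sup>2))" by (intro sum_nonneg) auto
    also have "\<dots> \<le> C" using \<open>\<forall>n::nat. (\<Sum>p\<in>{- int n..int n}. 1 / (1 + (freq L p)\<^sup>2)) \<le> C\<close> by blast
    finally show ?thesis .
  qed
  ultimately show ?thesis by blast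
qed

lemma finite_subset_box_idx: "finite A \<Longrightarrow> \<exists>n. A \<subseteq> box_idx n"
proof (induction A rule: finite_induct)
  case (insert i A)
  then obtain n where n: "A \<subseteq> box_idx n" by blast
  define m where "m = max n (nat (max \<bar>fst i\<bar> \<bar>snd i\<bar>))"
  have "box_idx n \<subseteq> box_idx m" by (auto simp: box_idx_def m_def)
  moreover have "i \<in> box_idx m" by (cases i) (auto simp: box_idx_def m_def)
  ultimately show ?case using n by (intro exI[of _ m]) auto
qed simp

text \<open>Two additional derivatives, one per variable, make the weighted coefficients square
  summable with weight \<open>W\<close>, while 1 / \<open>W\<close> is summable.\<close>

lemma fourier_summable:
  assumes u: "u \<in> H_per x0 x1 y0 y1 s" and s: "a + b + 2 \<le> s"
  shows "(\<lambda>(p, q). \<bar>ip u (bas p q)\<bar> * (\<bar>freq Lx p\<bar> ^ a * \<bar>freq Ly q\<bar> ^ b)) summable_on UNIV"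
proof -
  define k where "k = (\<lambda>(p, q). \<bar>ip u (bas p q)\<bar> * (\<bar>freq Lx p\<bar> ^ a * \<bar>freq Ly q\<bar> ^ b))"
  \<comment> \<open>The product form lets the sum of 1 / \<open>W\<close> factor into two
    one-dimensional sums, and the weighted squares expand into four Bessel sums.\<close>
  define W where "W = (\<lambda>(p, q). (1 + (freq Lx p)\<^sup>2) * (1 + (freq Ly q)\<^sup>2))"
  have W: "W i > 0" for i by (auto simp: W_def case_prod_unfold add_pos_nonneg)
  have wd: "\<exists>g. weak_deriv x0 x1 y0 y1 m n u g" if "m + n \<le> s" for m n using u that by (auto simp: H_per_def)
  define C where "C m n = ip (SOME g. weak_deriv x0 x1 y0 y1 m n u g) (SOME g. weak_deriv x0 x1 y0 y1 m n u g)" for m n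
  have C: "(\<Sum>(p, q)\<in>A. (\<bar>ip u (bas p q)\<bar> * (\<bar>freq Lx p\<bar> ^ m * \<bar>freq Ly q\<bar> ^ n))\<^sup>2) \<le> C m n"
    if "m + n \<le> s" "finite A" for m n A
    unfolding C_def by (rule fourier_deriv_bessel[OF someI_ex[OF wd[OF that(1)]] that(2)])
  define C4 where "C4 = C a b + C (Suc a) b + C a (Suc b) + C (Suc a) (Suc b)"
  have S1: "(\<Sum>i\<in>A. (k i)\<^sup>2 * W i) \<le> C4" if "finite A" for A
  proof -
    have "(\<Sum>i\<in>A. (k i)\<^sup>2 * W i) = (\<Sum>(p, q)\<in>A. (\<bar>ip u (bas p q)\<bar> * (\<bar>freq Lx p\<bar> ^ a * \<bar>freq Ly q\<bar> ^ b))\<^sup>2)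
        + (\<Sum>(p, q)\<in>A. (\<bar>ip u (bas p q)\<bar> * (\<bar>freq Lx p\<bar> ^ Suc a * \<bar>freq Ly q\<bar> ^ b))\<^sup>2)
        + (\<Sum>(p, q)\<in>A. (\<bar>ip u (bas p q)\<bar> * (\<bar>freq Lx p\<bar> ^ a * \<bar>freq Ly q\<bar> ^ Suc b))\<^sup>2)
        + (\<Sum>(p, q)\<in>A. (\<bar>ip u (bas p q)\<bar> * (\<bar>freq Lx p\<bar> ^ Suc a * \<bar>freq Ly q\<bar> ^ Suc b))\<^sup>2)"
      unfolding sum.distrib[symmetric]
    proof (intro sum.cong refl)
      fix i :: "int \<times> int"
      obtain p q where i: "i = (p, q)" by (cases i)
      have id: "(z * (f ^ a * g ^ b))\<^sup>2 * ((1 + f\<^sup>2) * (1 + g\<^sup>2)) = (z * (f ^ a * g ^ b))\<^sup>2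
        + (z * (f ^ Suc a * g ^ b))\<^sup>2 + (z * (f ^ a * g ^ Suc b))\<^sup>2 + (z * (f ^ Suc a * g ^ Suc b))\<^sup>2" for z f g :: real
      proof -
        define K where "K = z * (f ^ a * g ^ b)"
        have "z * (f ^ Suc a * g ^ b) = K * f" "z * (f ^ a * g ^ Suc b) = K * g"
          "z * (f ^ Suc a * g ^ Suc b) = K * f * g" by (simp_all add: K_def mult_ac)
        then show ?thesis unfolding K_def[symmetric] by (simp only:) (simp add: power2_eq_square algebra_simps)
      qed
      show "(k i)\<^sup>2 * W i = (case i of (p, q) \<Rightarrow> (\<bar>ip u (bas p q)\<bar> * (\<bar>freq Lx p\<bar> ^ a * \<bar>freq Ly q\<bar> ^ b))\<^sup>2)
        + (case i of (p, q) \<Rightarrow> (\<bar>ip u (bas p q)\<bar> * (\<bar>freq Lx p\<bar> ^ Suc a * \<bar>freq Ly q\<bar> ^ b))\<^sup>2)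
        + (case i of (p, q) \<Rightarrow> (\<bar>ip u (bas p q)\<bar> * (\<bar>freq Lx p\<bar> ^ a * \<bar>freq Ly q\<bar> ^ Suc b))\<^sup>2)
        + (case i of (p, q) \<Rightarrow> (\<bar>ip u (bas p q)\<bar> * (\<bar>freq Lx p\<bar> ^ Suc a * \<bar>freq Ly q\<bar> ^ Suc b))\<^sup>2)"
        using id[of "\<bar>ip u (bas p q)\<bar>" "\<bar>freq Lx p\<bar>" "\<bar>freq Ly q\<bar>"]
        by (simp only: i k_def W_def prod.case power2_abs)
    qed
    then show ?thesis using s C[OF _ that, of a b] C[OF _ that, of "Suc a" b] C[OF _ that, of a "Suc b"]
        C[OF _ that, of "Suc a" "Suc b"] by (simp add: C4_def)
  qed
  obtain Cx Cy where Cx: "Cx \<ge> 0" "\<And>n::nat. (\<Sum>p\<in>{- int n..int n}. 1 / (1 + (freq Lx p)\<^sup>2)) \<le> Cx"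
    and Cy: "Cy \<ge> 0" "\<And>n::nat. (\<Sum>p\<in>{- int n..int n}. 1 / (1 + (freq Ly p)\<^sup>2)) \<le> Cy"
    using sum_inverse_freq_bounded[of Lx] sum_inverse_freq_bounded[of Ly] x01 y01 by (metis diff_gt_0_iff_gt)
  have S2: "(\<Sum>i\<in>A. 1 / W i) \<le> Cx * Cy" if fA: "finite A" for A
  proof -
    obtain n where n: "A \<subseteq> box_idx n" using finite_subset_box_idx[OF fA] by blast
    have "(\<Sum>i\<in>A. 1 / W i) \<le> (\<Sum>i\<in>box_idx n. 1 / W i)"
      using W by (intro sum_mono2 finite_box_idx n) (auto simp: less_imp_le)
    also have "\<dots> = (\<Sum>p\<in>{- int n..int n}. 1 / (1 + (freq Lx p)\<^sup>2)) * (\<Sum>q\<in>{- int n..int n}. 1 / (1 + (freq Ly q)\<^sup>2))"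
      unfolding sum_product box_idx_def sum.cartesian_product by (intro sum.cong) (auto simp: W_def)
    also have "\<dots> \<le> Cx * Cy" by (intro mult_mono Cx Cy sum_nonneg) auto
    finally show ?thesis .
  qed
  \<comment> \<open>An additive form of the Cauchy-Schwarz inequality: either k \<le> 1 / W, or k^2
    W already dominates k.\<close>
  have le: "k i \<le> (k i)\<^sup>2 * W i + 1 / W i" for i
  proof -
    have k0: "k i \<ge> 0" by (auto simp: k_def case_prod_unfold)
    show ?thesis
    proof (cases "k i * W i \<ge> 1")
      case True
      then have "k i * 1 \<le> k i * (k i * W i)" using k0 by (intro mult_left_mono)
      then show ?thesis using W[of i] by (simp add: power2_eq_square mult_ac add_increasing2)
    next
      case False
      then have "k i \<le> 1 / W i" using W[of i] by (simp add: field_simps)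
      then show ?thesis using W[of i] by (simp add: add_increasing)
    qed
  qed
  have "sum k A \<le> C4 + Cx * Cy" if "finite A" for A
  proof -
    have "sum k A \<le> (\<Sum>i\<in>A. (k i)\<^sup>2 * W i + 1 / W i)" by (intro sum_mono le)
    also have "\<dots> \<le> C4 + Cx * Cy" unfolding sum.distrib by (intro add_mono S1 S2 that)
    finally show ?thesis .
  qed
  then have "k summable_on UNIV"
    by (intro nonneg_bdd_above_summable_on) (auto simp: k_def bdd_above_def)
  then show ?thesis by (simp add: k_def)
qed

lemma partial_uniform_limit:
  assumes u: "u \<in> H_per x0 x1 y0 y1 s" and s: "a + b + 2 \<le> s"
  shows "\<exists>w. uniform_limit UNIV (\<lambda>n z. partial u n a b (fst z) (snd z)) w sequentially"
proof -
  let ?f = "\<lambda>i z. ip u (bas (fst i) (snd i)) * (trigd Lx a (fst i) (fst z) * trigd Ly b (snd i) (snd z))"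
  let ?k = "\<lambda>i. \<bar>ip u (bas (fst i) (snd i))\<bar> * (\<bar>freq Lx (fst i)\<bar> ^ a * \<bar>freq Ly (snd i)\<bar> ^ b)"
  define K where "K = sqrt (2 / Lx) * sqrt (2 / Ly)"
  have "(\<lambda>i. ?k i * K) summable_on UNIV"
    using fourier_summable[OF assms] by (intro summable_on_cmult_left) (simp add: case_prod_unfold)
  moreover have "norm (?f i z) \<le> ?k i * K" for i z
  proof -
    have "norm (?f i z) = ?k i * (\<bar>trig Lx (par a (fst i)) (fst z)\<bar> * \<bar>trig Ly (par b (snd i)) (snd z)\<bar>)"
      by (simp add: trigd_eq abs_mult abs_trigc mult_ac)
    also have "\<dots> \<le> ?k i * K" unfolding K_def using x01 y01
      by (intro mult_left_mono mult_mono trig_bound) auto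
    finally show ?thesis .
  qed
  ultimately have lim: "uniform_limit UNIV (\<lambda>A z. \<Sum>i\<in>A. ?f i z) (\<lambda>z. \<Sum>\<^sub>\<infinity>i. ?f i z) (finite_subsets_at_top UNIV)"
    by (intro Weierstrass_m_test_general)
  \<comment> \<open>The M-test gives a limit along all finite index sets; the square boxes are
    cofinal among them.\<close>
  have "filterlim box_idx (finite_subsets_at_top UNIV) sequentially"
    unfolding filterlim_finite_subsets_at_top
  proof (intro allI impI)
    fix A :: "(int \<times> int) set" assume "finite A \<and> A \<subseteq> UNIV"
    then obtain n where n: "A \<subseteq> box_idx n" using finite_subset_box_idx by blast
    have "A \<subseteq> box_idx m" if "m \<ge> n" for m using n that by (force simp: box_idx_def)
    then show "\<forall>\<^sub>F m in sequentially. finite (box_idx m) \<and> A \<subseteq> box_idx m \<and> box_idx m \<subseteq> UNIV"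
      using finite_box_idx by (auto simp: eventually_sequentially)
  qed
  from filterlim_compose[OF lim this]
  show ?thesis by (auto simp: partial_def case_prod_unfold o_def intro!: exI)
qed

end

section \<open>Completeness of the trigonometric system\<close>

inductive trigspan :: "real \<Rightarrow> (real \<Rightarrow> real) \<Rightarrow> bool" for L where
  zero: "trigspan L (\<lambda>x. 0)"
| add_trig: "trigspan L f \<Longrightarrow> trigspan L (\<lambda>x. f x + c * trig L p x)"

lemma trigspan_scaled: "trigspan L (\<lambda>x. c * trig L p x)"
  using trigspan.add_trig[OF trigspan.zero, of L c p] by simp

lemma trigspan_add: "trigspan L f \<Longrightarrow> trigspan L g \<Longrightarrow> trigspan L (\<lambda>x. f x + g x)"
proof (induction rule: trigspan.induct)
  case (add_trig f c p)
  then show ?case using trigspan.add_trig[of L "\<lambda>x. f x + g x" c p] by (simp add: add_ac)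
qed simp

lemma trigspan_scale: "trigspan L f \<Longrightarrow> trigspan L (\<lambda>x. \<alpha> * f x)"
proof (induction rule: trigspan.induct)
  case (add_trig f c p)
  then show ?case using trigspan.add_trig[of L "\<lambda>x. \<alpha> * f x" "\<alpha> * c" p] by (simp add: algebra_simps)
qed (simp add: trigspan.zero)

lemma trigspan_sum: "(\<And>i. i \<in> A \<Longrightarrow> trigspan L (f i)) \<Longrightarrow> trigspan L (\<lambda>x. \<Sum>i\<in>A. f i x)"
  by (induction A rule: infinite_finite_induct) (auto intro: trigspan.zero trigspan_add)

lemma trigspan_continuous: "trigspan L f \<Longrightarrow> continuous_on S f"
  by (induction rule: trigspan.induct) (auto intro!: continuous_intros trig_continuous)

lemma trigspan_cos:
  assumes "L > 0" shows "trigspan L (\<lambda>x. cos (freq L p * x - \<alpha>))"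
proof -
  have pos: "trigspan L (\<lambda>x. cos (freq L p * x - \<alpha>))" if "p \<ge> 0" for p \<alpha>
  proof (cases "p = 0")
    case True
    have "(\<lambda>x. cos (freq L p * x - \<alpha>)) = (\<lambda>x. (cos \<alpha> * sqrt L) * trig L 0 x)"
      using True assms by (auto simp: trig_def)
    then show ?thesis by (simp only: trigspan_scaled)
  next
    case False
    have s: "sqrt (2 / L) \<noteq> 0" using assms by simp
    have "(\<lambda>x. cos (freq L p * x - \<alpha>)) = (\<lambda>x. cos \<alpha> / sqrt (2 / L) * trig L p x + sin \<alpha> / sqrt (2 / L) * trig L (- p) x)"
      using False that s by (auto simp: trig_def cos_diff simp del: real_sqrt_divide)
    then show ?thesis by (simp only: trigspan_add trigspan_scaled)
  qed
  show ?thesis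
  proof (cases "p \<ge> 0")
    case False
    have "cos (freq L p * x - \<alpha>) = cos (freq L (- p) * x - (- \<alpha>))" for x
      using cos_minus[of "freq L p * x - \<alpha>"] by (simp add: algebra_simps)
    then show ?thesis using pos[of "- p" "- \<alpha>"] False by simp
  qed (rule pos)
qed

lemma trig_as_cos: "\<exists>c \<beta>. \<forall>x. trig L p x = c * cos (freq L p * x - \<beta>)"
proof (cases "p = 0")
  case True
  then show ?thesis by (intro exI[of _ "1 / sqrt L"] exI[of _ 0]) (simp add: trig_def)
next
  case p: False
  show ?thesis
  proof (cases "p > 0")
    case True
    then show ?thesis by (intro exI[of _ "sqrt (2 / L)"] exI[of _ 0]) (simp add: trig_def)
  next
    case False
    then show ?thesis using p
      by (intro exI[of _ "- sqrt (2 / L)"] exI[of _ "pi / 2"]) (simp add: trig_def cos_diff)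
  qed
qed

text \<open>The product formula for cosines shifts the index by one up and down, so powers of a
  translated cosine, and then polynomials in it, stay in the span.\<close>

lemma trigspan_mult_cos:
  assumes "L > 0" shows "trigspan L f \<Longrightarrow> trigspan L (\<lambda>x. f x * cos (freq L 1 * x - \<alpha>))"
proof (induction rule: trigspan.induct)
  case (add_trig f c p)
  obtain d \<beta> where t: "\<And>x. trig L p x = d * cos (freq L p * x - \<beta>)" using trig_as_cos by blast
  have fr: "freq L (p + q) = freq L p + freq L q" for q by (simp add: freq_def algebra_simps add_divide_distrib)
  have pc: "cos (freq L p * x - \<beta>) * cos (freq L 1 * x - \<alpha>)
      = (cos (freq L (p + (- 1)) * x - (\<beta> - \<alpha>)) + cos (freq L (p + 1) * x - (\<beta> + \<alpha>))) / 2" for x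
    unfolding cos_times_cos fr by (simp add: algebra_simps)
  have "c * trig L p x * cos (freq L 1 * x - \<alpha>) = (c * d) * (cos (freq L p * x - \<beta>) * cos (freq L 1 * x - \<alpha>))" for x
    by (simp add: t)
  then have "c * trig L p x * cos (freq L 1 * x - \<alpha>) = (c * d / 2) * cos (freq L (p + (- 1)) * x - (\<beta> - \<alpha>))
          + (c * d / 2) * cos (freq L (p + 1) * x - (\<beta> + \<alpha>))" for x
    unfolding pc by (simp only: distrib_left times_divide_eq_right times_divide_eq_left add_divide_distrib)
  then have "(\<lambda>x. (f x + c * trig L p x) * cos (freq L 1 * x - \<alpha>))
      = (\<lambda>x. f x * cos (freq L 1 * x - \<alpha>) + ((c * d / 2) * cos (freq L (p + (- 1)) * x - (\<beta> - \<alpha>))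
          + (c * d / 2) * cos (freq L (p + 1) * x - (\<beta> + \<alpha>))))"
    by (simp only: fun_eq_iff distrib_right simp_thms)
  then show ?case
    by (simp only:) (intro trigspan_add add_trig trigspan_scale trigspan_cos assms)
qed (simp add: trigspan.zero)

lemma trigspan_cos_power: "L > 0 \<Longrightarrow> trigspan L (\<lambda>x. cos (freq L 1 * x - \<alpha>) ^ n)"
proof (induction n)
  case 0
  then show ?case using trigspan_cos[of L 0 0] by simp
next
  case (Suc n)
  then show ?case using trigspan_mult_cos[of L "\<lambda>x. cos (freq L 1 * x - \<alpha>) ^ n" \<alpha>] by (simp add: mult.commute)
qed

text \<open>A step function of a cosine is the bounded pointwise limit of polynomials in that
  cosine. The bound 2 is the height 1 of the ramps plus an approximation error of at most 1.\<close>

lemma trigspan_step: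
  assumes "L > 0"
  shows "\<exists>T. (\<forall>j::nat. trigspan L (T j)) \<and> (\<forall>j x. \<bar>T j x\<bar> \<le> 2) \<and>
    (\<forall>x. (\<lambda>j. T j x) \<longlonglongrightarrow> (if cos (freq L 1 * x - \<alpha>) > r then 1 else 0))"
proof -
  \<comment> \<open>Steepening ramps that vanish up to \<open>r\<close> and converge to the
    indicator of the open half line beyond it.\<close>
  define g where "g j z = min 1 (max 0 (real j * (z - r)))" for j :: nat and z :: real
  have "\<exists>q. real_polynomial_function q \<and> (\<forall>z\<in>{- 1..1}. \<bar>g j z - q z\<bar> < 1 / real (Suc j))" for j
  proof -
    have "continuous_on {- 1..1} (g j)" unfolding g_def by (intro continuous_intros)
    from Stone_Weierstrass_real_polynomial_function[OF compact_Icc this, of "1 / real (Suc j)"] show ?thesis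
      by (metis of_nat_0_less_iff zero_less_Suc zero_less_divide_1_iff)
  qed
  then obtain q where q: "\<And>j. real_polynomial_function (q j)"
    "\<And>j z. z \<in> {- 1..1} \<Longrightarrow> \<bar>g j z - q j z\<bar> < 1 / real (Suc j)" by metis
  let ?c = "\<lambda>x. cos (freq L 1 * x - \<alpha>)"
  have c: "?c x \<in> {- 1..1}" for x by simp
  have 1: "trigspan L (\<lambda>x. q j (?c x))" for j
  proof -
    obtain a n where "q j = (\<lambda>z. \<Sum>i\<le>n. a i * z ^ i)" using q(1) real_polynomial_function_iff_sum by blast
    then show ?thesis using assms by (auto intro!: trigspan_sum trigspan_scale trigspan_cos_power)
  qed
  have 2: "\<bar>q j (?c x)\<bar> \<le> 2" for j x
  proof -
    have "1 / real (Suc j) \<le> 1" by simp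
    moreover have "\<bar>g j (?c x)\<bar> \<le> 1" by (auto simp: g_def)
    ultimately show ?thesis using q(2)[OF c, of j x] by linarith
  qed
  have 3: "(\<lambda>j. q j (?c x)) \<longlonglongrightarrow> (if ?c x > r then 1 else 0)" for x
  proof -
    have "(\<lambda>j. g j (?c x)) \<longlonglongrightarrow> (if ?c x > r then 1 else 0)"
    proof (cases "?c x > r")
      case True
      obtain N :: nat where N: "real N * (?c x - r) > 1" using True ex_less_of_nat_mult by (metis diff_gt_0_iff_gt)
      have "g j (?c x) = 1" if "j \<ge> N" for j
      proof -
        have "real N * (?c x - r) \<le> real j * (?c x - r)" using that True by (intro mult_right_mono) auto
        then show ?thesis using N by (simp add: g_def)
      qed
      then have "\<forall>\<^sub>F j in sequentially. g j (?c x) = 1" by (auto simp: eventually_sequentially)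
      then show ?thesis using True by (simp add: tendsto_eventually)
    next
      case False
      then have "g j (?c x) = 0" for j by (simp add: g_def mult_nonneg_nonpos)
      then show ?thesis using False by simp
    qed
    moreover have "(\<lambda>j. q j (?c x) - g j (?c x)) \<longlonglongrightarrow> 0"
    proof (rule Lim_null_comparison)
      show "\<forall>\<^sub>F j in sequentially. norm (q j (?c x) - g j (?c x)) \<le> 1 / real (Suc j)"
        using q(2)[OF c] by (intro always_eventually) (auto simp: abs_minus_commute intro: less_imp_le)
      show "(\<lambda>j. 1 / real (Suc j)) \<longlonglongrightarrow> 0" by (rule LIMSEQ_Suc[OF lim_1_over_n])
    qed
    ultimately show ?thesis using tendsto_add[of "\<lambda>j. q j (?c x) - g j (?c x)" 0] by fastforce
  qed
  show ?thesis using 1 2 3 by (intro exI[of _ "\<lambda>j x. q j (?c x)"]) auto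
qed

text \<open>Within one period an interval is the set where the cosine centred at its midpoint
  exceeds its value at the end points; this is how boxes become accessible to trigonometric
  polynomials.\<close>

lemma arc_indicator:
  assumes "x0 < x1" "x0 \<le> a" "a < b" "b \<le> x1" "x \<in> {x0..x1}"
  defines "w \<equiv> freq (x1 - x0) 1"
  shows "cos (w * x - w * ((a + b) / 2)) > cos (w * ((b - a) / 2)) \<longleftrightarrow> a < x \<and> x < b"
proof -
  have w: "w > 0" "w * (x1 - x0) = 2 * pi" using assms by (auto simp: w_def freq_def)
  define \<theta> where "\<theta> = w * ((b - a) / 2)"
  define z where "z = \<bar>w * (x - (a + b) / 2)\<bar>"
  have \<theta>: "0 < \<theta>" using w assms by (simp add: \<theta>_def)
  have "w * (b - a) \<le> w * (x1 - x0)" using w assms by (intro mult_left_mono) auto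
  then have \<theta>2: "\<theta> \<le> pi" using w by (simp add: \<theta>_def)
  have cz: "cos (w * x - w * ((a + b) / 2)) = cos z" unfolding z_def cos_abs_real by (simp add: algebra_simps)
  have ab: "a < x \<and> x < b \<longleftrightarrow> z < \<theta>"
  proof -
    have "z = w * \<bar>x - (a + b) / 2\<bar>" using w by (simp add: z_def abs_mult)
    then have "z < \<theta> \<longleftrightarrow> \<bar>x - (a + b) / 2\<bar> < (b - a) / 2" using w by (simp add: \<theta>_def)
    also have "\<dots> \<longleftrightarrow> a < x \<and> x < b" by (auto simp: abs_less_iff field_simps)
    finally show ?thesis by simp
  qed
  \<comment> \<open>The phase distance from the midpoint stays below 2 pi - \<theta>, so the cosine,
    although it rises again beyond pi, does not exceed cos \<theta> there.\<close>
  have zb: "z \<le> 2 * pi - \<theta>"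
  proof -
    have "\<bar>x - (a + b) / 2\<bar> \<le> (x1 - x0) - (b - a) / 2" using assms(2-5) by (auto simp: abs_le_iff field_simps)
    then have "w * \<bar>x - (a + b) / 2\<bar> \<le> w * ((x1 - x0) - (b - a) / 2)" using w by (intro mult_left_mono) auto
    also have "\<dots> = 2 * pi - \<theta>" unfolding \<theta>_def w(2)[symmetric] by (rule right_diff_distrib)
    also have "w * \<bar>x - (a + b) / 2\<bar> = z" using w by (simp only: z_def abs_mult abs_of_pos)
    finally show ?thesis .
  qed
  have z0: "z \<ge> 0" by (simp add: z_def)
  have "cos z > cos \<theta> \<longleftrightarrow> z < \<theta>"
  proof (cases "z \<le> pi")
    case True
    then show ?thesis using z0 \<theta> \<theta>2 by (simp add: cos_mono_less_eq)
  next
    case False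
    have "cos z = cos (2 * pi - z)" by (simp add: cos_diff)
    moreover have "cos (2 * pi - z) > cos \<theta> \<longleftrightarrow> 2 * pi - z < \<theta>"
      using False zb \<theta> \<theta>2 by (intro cos_mono_less_eq) auto
    ultimately show ?thesis using zb False \<theta>2 by auto
  qed
  then show ?thesis using ab cz by (simp add: \<theta>_def)
qed

lemma AE_lebesgue_iff_negligible:
  "(AE z in lebesgue. P z) \<longleftrightarrow> negligible {z :: 'a::euclidean_space. \<not> P z}"
  unfolding eventually_ae_filter_negligible using negligible_subset by blast

text \<open>Open boxes are stable under intersection and generate the Borel sets; the sets with
  vanishing integral are closed under countable disjoint unions and, thanks to the vanishing total
  integral, under complements.\<close>

lemma zero_on_boxes_imp_AE_zero:
  fixes F :: "'a::euclidean_space \<Rightarrow> real"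
  assumes F: "integrable lebesgue F" and box: "\<And>a b. (LINT z:box a b|lebesgue. F z) = 0"
    and tot: "(LINT z|lebesgue. F z) = 0"
  shows "AE z in lebesgue. F z = 0"
proof -
  have si: "set_integrable lebesgue A F" if "A \<in> sets lebesgue" for A
    unfolding set_integrable_def by (rule integrable_mult_indicator[OF that F])
  have bor: "(LINT z:A|lebesgue. F z) = 0" if "A \<in> sigma_sets UNIV (range (\<lambda>(a, b). box a b :: 'a set))" for A
  proof -
    have lm: "B \<in> sets lebesgue" if "B \<in> sigma_sets UNIV (range (\<lambda>(a, b). box a b :: 'a set))" for B
    proof -
      have "B \<in> sets borel" using that by (simp add: borel_eq_box)
      then show ?thesis by simp
    qed
    have st: "Int_stable (range (\<lambda>(a, b). box a b :: 'a set))"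
      by (auto simp: Int_stable_def box_Int_box)
    have pw: "range (\<lambda>(a, b). box a b :: 'a set) \<subseteq> Pow UNIV" by simp
    show ?thesis using st pw that
    proof (induction rule: sigma_sets_induct_disjoint)
      case (basic A)
      then show ?case using box by auto
    next
      case (compl A)
      have "(LINT z:UNIV - A|lebesgue. F z) = (LINT z|lebesgue. F z - indicator A z *\<^sub>R F z)"
        unfolding set_lebesgue_integral_def by (rule arg_cong[where f = "integral\<^sup>L lebesgue"]) (auto simp: indicator_def fun_eq_iff)
      also have "\<dots> = (LINT z|lebesgue. F z) - (LINT z:A|lebesgue. F z)"
        unfolding set_lebesgue_integral_def using si[OF lm[OF compl(1)]]
        by (intro Bochner_Integration.integral_diff F) (simp add: set_integrable_def)
      finally show ?case using compl tot by simp
    next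
      case (union A)
      have m: "A i \<in> sets lebesgue" for i using union by (intro lm) auto
      have "(LINT z:(\<Union>i. A i)|lebesgue. F z) = (\<Sum>i. (LINT z:(A i)|lebesgue. F z))"
      proof (intro lebesgue_integral_countable_add m si)
        show "A i \<inter> A j = {}" if "i \<noteq> j" for i j using union(1) that by (auto simp: disjoint_family_on_def)
        show "(\<Union>i. A i) \<in> sets lebesgue" using m by auto
      qed
      then show ?case using union by simp
    qed (simp_all add: set_lebesgue_integral_def)
  qed
  have "AE z in lebesgue. F z = (\<lambda>_. 0) z"
  proof (rule density_unique_real[OF F])
    show "integrable lebesgue (\<lambda>_. 0 :: real)" by simp
    \<comment> \<open>A Lebesgue set differs from a Borel set by a null set only.\<close>
    fix A :: "'a set" assume A: "A \<in> sets lebesgue"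
    then obtain S N N' where S: "A = S \<union> N" "N \<subseteq> N'" "N' \<in> null_sets lborel" "S \<in> sets lborel"
      by (rule sets_completionE)
    have "N' \<in> null_sets lebesgue" using S(3) by (rule null_sets_completionI)
    then have "AE z in lebesgue. z \<notin> N'" by (rule AE_not_in)
    then have "AE z in lebesgue. z \<in> S \<longleftrightarrow> z \<in> A" using S by (elim AE_mp) auto
    moreover have "S \<in> sets lebesgue" using S(4) by simp
    ultimately have "(LINT z:A|lebesgue. F z) = (LINT z:S|lebesgue. F z)"
      using si A by (intro set_integral_cong_set) (auto simp: set_integrable_def set_borel_measurable_def)
    also have "\<dots> = 0" using S(4) by (intro bor) (simp add: borel_eq_box)
    finally show "(LINT z:A|lebesgue. F z) = (LINT z:A|lebesgue. 0)" by simp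
  qed
  then show ?thesis by simp
qed

text \<open>Convergence of the functions need only be pointwise; it identifies the limit whose
  derivative the uniform limit of derivatives is.\<close>

lemma deriv_uniform_limit:
  fixes f :: "nat \<Rightarrow> real \<Rightarrow> real"
  assumes d: "\<And>n x. (f n has_real_derivative f' n x) (at x)"
    and u: "uniform_limit UNIV f' g' sequentially" and p: "\<And>x. (\<lambda>n. f n x) \<longlonglongrightarrow> g x"
  shows "(g has_real_derivative g' x) (at x)"
proof -
  have "\<exists>G. \<forall>x\<in>UNIV. (\<lambda>n. f n x) \<longlonglongrightarrow> G x \<and> (G has_derivative (\<lambda>h. g' x * h)) (at x within UNIV)"
  proof (rule has_derivative_sequence[where f' = "\<lambda>n x h. f' n x * h", OF convex_UNIV _ _ UNIV_I p])
    show "(f n has_derivative (\<lambda>h. f' n x * h)) (at x within UNIV)" for n x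
      using d[of n x] by (simp add: has_field_derivative_def)
    fix e :: real assume "e > 0"
    then have "\<forall>\<^sub>F n in sequentially. \<forall>x\<in>UNIV. dist (f' n x) (g' x) < e" using u by (auto simp: uniform_limit_iff)
    then show "\<forall>\<^sub>F n in sequentially. \<forall>x\<in>UNIV. \<forall>h. norm (f' n x * h - g' x * h) \<le> e * norm h"
    proof eventually_elim
      case (elim n)
      show ?case
      proof (intro ballI allI)
        fix x h
        have "norm (f' n x * h - g' x * h) = \<bar>f' n x - g' x\<bar> * norm h" by (simp add: abs_mult left_diff_distrib[symmetric])
        also have "\<dots> \<le> e * norm h" using elim by (intro mult_right_mono) (auto simp: dist_real_def intro: less_imp_le)
        finally show "norm (f' n x * h - g' x * h) \<le> e * norm h" .
      qed
    qed
  qed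
  then obtain G where G: "\<And>x. (\<lambda>n. f n x) \<longlonglongrightarrow> G x" "\<And>x. (G has_derivative (\<lambda>h. g' x * h)) (at x)" by auto
  have "G = g" using G(1) p LIMSEQ_unique by blast
  then show ?thesis using G(2) by (simp add: has_field_derivative_def)
qed

lemma uniform_limit_precompose:
  assumes "uniform_limit UNIV f l F" shows "uniform_limit UNIV (\<lambda>n s. f n (h s)) (\<lambda>s. l (h s)) F"
  unfolding uniform_limit_iff
proof (intro allI impI)
  fix e :: real assume "e > 0"
  with assms have "\<forall>\<^sub>F n in F. \<forall>x\<in>UNIV. dist (f n x) (l x) < e" unfolding uniform_limit_iff by blast
  then show "\<forall>\<^sub>F n in F. \<forall>x\<in>UNIV. dist (f n (h x)) (l (h x)) < e" by eventually_elim auto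
qed

lemma continuous_AE_unique:
  assumes "continuous_on UNIV (\<lambda>(x, y). v x y :: real)" "continuous_on UNIV (\<lambda>(x, y). w x y)"
    "AE p in lebesgue. v (fst p) (snd p) = w (fst p) (snd p)"
  shows "v = w"
proof (rule ccontr)
  assume "v \<noteq> w"
  then obtain x y where xy: "v x y \<noteq> w x y" by (auto simp: fun_eq_iff)
  let ?S = "{p. v (fst p) (snd p) \<noteq> w (fst p) (snd p)}"
  have "open ?S" using assms(1,2) by (intro open_Collect_neq) (simp_all add: case_prod_unfold)
  moreover have "(x, y) \<in> ?S" using xy by simp
  ultimately have "\<not> negligible ?S" using open_not_negligible by blast
  moreover have "negligible ?S" using assms(3) by (simp add: AE_lebesgue_iff_negligible)
  ultimately show False by simp
qed

context torus
begin

lemma ip_lin: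
  assumes "L2_on R f" "cont2 g" "cont2 h"
  shows "ip f (\<lambda>x y. g x y + c * h x y) = ip f g + c * ip f h"
  using ip_sum[of "{0, 1::nat}" f "\<lambda>i. if i = 0 then g else h" "\<lambda>i. if i = 0 then 1 else c"] assms by simp

lemma ip_trigspan:
  assumes f: "L2_on R f" "\<And>p q. ip f (bas p q) = 0"
  shows "trigspan Lx \<phi> \<Longrightarrow> trigspan Ly \<psi> \<Longrightarrow> ip f (\<lambda>x y. \<phi> x * \<psi> y) = 0"
proof (induction rule: trigspan.induct)
  case zero
  then show ?case by (simp add: ip_def case_prod_unfold)
next
  case (add_trig \<phi> c p)
  have c\<psi>: "continuous_on UNIV \<psi>" using add_trig by (intro trigspan_continuous[of Ly])
  have "ip f (\<lambda>x y. trig Lx p x * \<psi> y) = 0" using add_trig.prems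
  proof (induction rule: trigspan.induct)
    case zero
    then show ?case by (simp add: ip_def case_prod_unfold)
  next
    case (add_trig \<psi> c q)
    have "ip f (\<lambda>x y. trig Lx p x * (\<psi> y + c * trig Ly q y)) = ip f (\<lambda>x y. trig Lx p x * \<psi> y + c * bas p q x y)"
      by (simp add: bas_def algebra_simps)
    also have "\<dots> = 0"
      using add_trig f by (subst ip_lin) (auto intro!: cont2_tensor trig_continuous trigspan_continuous cont2_bas)
    finally show ?case .
  qed
  moreover have "ip f (\<lambda>x y. (\<phi> x + c * trig Lx p x) * \<psi> y) = ip f (\<lambda>x y. \<phi> x * \<psi> y + c * (trig Lx p x * \<psi> y))"
    by (simp add: algebra_simps)
  moreover have "\<dots> = ip f (\<lambda>x y. \<phi> x * \<psi> y) + c * ip f (\<lambda>x y. trig Lx p x * \<psi> y)"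
    using add_trig.hyps by (intro ip_lin f cont2_tensor c\<psi> trig_continuous trigspan_continuous)
  ultimately show ?case using add_trig by simp
qed

text \<open>Dominated convergence from products of trigonometric polynomials to products of step
  functions; the two factors are bounded by 2, hence the majorant 4 |f|.\<close>

lemma ip_step:
  assumes f: "L2_on R f" "\<And>p q. ip f (bas p q) = 0"
  shows "integral R (\<lambda>(x, y). f x y * ((if cos (freq Lx 1 * x - \<alpha>) > r then 1 else 0) * (if cos (freq Ly 1 * y - \<beta>) > s then 1 else 0))) = 0"
proof -
  have Lp: "Lx > 0" "Ly > 0" using x01 y01 by auto
  obtain T where T: "\<And>j. trigspan Lx (T j)" "\<And>j x. \<bar>T j x\<bar> \<le> 2"
    "\<And>x. (\<lambda>j. T j x) \<longlonglongrightarrow> (if cos (freq Lx 1 * x - \<alpha>) > r then 1 else 0)"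
    using trigspan_step[OF Lp(1)] by blast
  obtain U where U: "\<And>j. trigspan Ly (U j)" "\<And>j x. \<bar>U j x\<bar> \<le> 2"
    "\<And>x. (\<lambda>j. U j x) \<longlonglongrightarrow> (if cos (freq Ly 1 * x - \<beta>) > s then 1 else 0)"
    using trigspan_step[OF Lp(2)] by blast
  let ?I = "\<lambda>z. f (fst z) (snd z) * ((if cos (freq Lx 1 * fst z - \<alpha>) > r then 1 else 0) * (if cos (freq Ly 1 * snd z - \<beta>) > s then 1 else 0))"
  have "(\<lambda>j. integral R (\<lambda>z. f (fst z) (snd z) * (T j (fst z) * U j (snd z)))) \<longlonglongrightarrow> integral R ?I"
  proof (rule dominated_convergence(2))
    show "(\<lambda>z. f (fst z) (snd z) * (T j (fst z) * U j (snd z))) integrable_on R" for j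
      by (rule ip_integrable') (intro f cont2_L2 cont2_tensor trigspan_continuous[OF T(1)] trigspan_continuous[OF U(1)])+
    have "(\<lambda>(x, y). f x y * 1) absolutely_integrable_on R"
      by (rule L2_mult_integrable[OF f(1)]) (intro cont2_L2 cont2_intros)
    then have "(\<lambda>z. norm (f (fst z) (snd z))) integrable_on R"
      by (simp add: absolutely_integrable_on_def case_prod_unfold)
    from integrable_on_mult_right[OF this, of 4]
    show "(\<lambda>z. 4 * \<bar>f (fst z) (snd z)\<bar>) integrable_on R" by simp
    show "norm (f (fst z) (snd z) * (T j (fst z) * U j (snd z))) \<le> 4 * \<bar>f (fst z) (snd z)\<bar>" for j z
    proof -
      have "\<bar>T j (fst z)\<bar> * \<bar>U j (snd z)\<bar> \<le> 2 * 2" by (intro mult_mono T U) auto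
      from mult_left_mono[OF this, of "\<bar>f (fst z) (snd z)\<bar>"] show ?thesis by (simp add: abs_mult)
    qed
    show "(\<lambda>j. f (fst z) (snd z) * (T j (fst z) * U j (snd z))) \<longlonglongrightarrow> ?I z" for z
      by (intro tendsto_mult tendsto_const T U)
  qed
  moreover have "integral R (\<lambda>z. f (fst z) (snd z) * (T j (fst z) * U j (snd z))) = 0" for j
    using ip_trigspan[OF f T(1)[of j] U(1)[of j]] by (simp add: ip_def case_prod_unfold)
  ultimately show ?thesis by (simp add: case_prod_unfold LIMSEQ_const_iff)
qed

text \<open>The integral over every open box inside the rectangle vanishes by the arc indicators,
  and such integrals determine a function almost everywhere.\<close>

lemma fourier_complete:
  assumes f: "L2_on R f" "\<And>p q. ip f (bas p q) = 0"
  shows "negligible {z \<in> R. f (fst z) (snd z) \<noteq> 0}"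
proof -
  let ?Ro = "box (x0, y0) (x1, y1)"
  \<comment> \<open>Cutting off outside the open rectangle reduces an arbitrary box to one inside;
    the boundary that is lost is a null set.\<close>
  define F where "F z = indicator ?Ro z * f (fst z) (snd z)" for z
  have "(\<lambda>(x, y). f x y * 1) absolutely_integrable_on R"
    by (rule L2_mult_integrable[OF f(1)]) (intro cont2_L2 cont2_intros)
  then have ai: "set_integrable lebesgue R (\<lambda>z. f (fst z) (snd z))" by (simp add: case_prod_unfold)
  have sub: "?Ro \<subseteq> R" by (simp add: rect_cbox box_subset_cbox)
  have aiA: "set_integrable lebesgue (A \<inter> ?Ro) (\<lambda>z. f (fst z) (snd z))" if "A \<in> sets lebesgue" for A
    using that sub by (intro set_integrable_subset[OF ai]) auto
  have F: "integrable lebesgue F" using aiA[of UNIV] by (simp add: set_integrable_def F_def[abs_def])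
  have key: "(LINT z:A|lebesgue. F z) = integral R (\<lambda>z. f (fst z) (snd z) * indicator (A \<inter> ?Ro) z)" if "A \<in> sets lebesgue" for A
  proof -
    have "(LINT z:A|lebesgue. F z) = (LINT z:A \<inter> ?Ro|lebesgue. f (fst z) (snd z))"
      unfolding set_lebesgue_integral_def F_def by (intro Bochner_Integration.integral_cong) (auto simp: indicator_def)
    also have "\<dots> = integral (A \<inter> ?Ro) (\<lambda>z. f (fst z) (snd z))" by (rule set_lebesgue_integral_eq_integral(2)[OF aiA[OF that]])
    also have "\<dots> = integral R (\<lambda>z. if z \<in> A \<inter> ?Ro then f (fst z) (snd z) else 0)"
      using sub by (subst integral_restrict_Int) (auto intro!: arg_cong[where f = "\<lambda>S. integral S (\<lambda>z. f (fst z) (snd z))"])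
    also have "\<dots> = integral R (\<lambda>z. f (fst z) (snd z) * indicator (A \<inter> ?Ro) z)"
      by (intro integral_cong) (auto simp: indicator_def)
    finally show ?thesis .
  qed
  have open_box: "integral R (\<lambda>z. f (fst z) (snd z) * indicator (box (a, c) (b, d)) z) = 0"
    if "x0 \<le> a" "b \<le> x1" "y0 \<le> c" "d \<le> y1" for a b c d
  proof (cases "a < b \<and> c < d")
    case True
    have "indicator (box (a, c) (b, d)) z = ((if cos (freq Lx 1 * fst z - freq Lx 1 * ((a + b) / 2)) > cos (freq Lx 1 * ((b - a) / 2)) then 1 else 0)
      * (if cos (freq Ly 1 * snd z - freq Ly 1 * ((c + d) / 2)) > cos (freq Ly 1 * ((d - c) / 2)) then 1 else (0::real)))" if "z \<in> R" for z
    proof -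
      have z: "fst z \<in> {x0..x1}" "snd z \<in> {y0..y1}" using that by (auto simp: rect_def)
      have "z \<in> box (a, c) (b, d) \<longleftrightarrow> (a < fst z \<and> fst z < b) \<and> (c < snd z \<and> snd z < d)"
        by (cases z) (auto simp: mem_box Basis_prod_def)
      then show ?thesis
        using arc_indicator[OF x01 \<open>x0 \<le> a\<close> _ \<open>b \<le> x1\<close> z(1)] arc_indicator[OF y01 \<open>y0 \<le> c\<close> _ \<open>d \<le> y1\<close> z(2)] True
        by (simp add: indicator_def)
    qed
    then have "integral R (\<lambda>z. f (fst z) (snd z) * indicator (box (a, c) (b, d)) z) = integral R (\<lambda>(x, y). f x y *
      ((if cos (freq Lx 1 * x - freq Lx 1 * ((a + b) / 2)) > cos (freq Lx 1 * ((b - a) / 2)) then 1 else 0)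
      * (if cos (freq Ly 1 * y - freq Ly 1 * ((c + d) / 2)) > cos (freq Ly 1 * ((d - c) / 2)) then 1 else 0)))"
      by (intro integral_cong) (simp add: case_prod_unfold)
    then show ?thesis using ip_step[OF f] by simp
  next
    case False
    then have "box (a, c) (b, d) = {}" by (auto simp: box_eq_empty Basis_prod_def)
    then show ?thesis by simp
  qed
  have bx: "(LINT z:box a b|lebesgue. F z) = 0" for a b
  proof -
    obtain a1 a2 b1 b2 where ab: "a = (a1, a2)" "b = (b1, b2)" by (cases a, cases b)
    have "box a b \<inter> ?Ro = box (max a1 x0, max a2 y0) (min b1 x1, min b2 y1)"
      unfolding ab by (auto simp: mem_box Basis_prod_def)
    then show ?thesis by (subst key) (simp_all add: open_box)
  qed
  have "(LINT z|lebesgue. F z) = (LINT z:?Ro|lebesgue. F z)"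
    unfolding set_lebesgue_integral_def by (intro Bochner_Integration.integral_cong) (auto simp: F_def indicator_def)
  then have "AE z in lebesgue. F z = 0" using zero_on_boxes_imp_AE_zero[OF F bx] bx by simp
  then have "negligible {z. F z \<noteq> 0}"
    by (simp add: AE_lebesgue_iff_negligible)
  moreover have "negligible (R - ?Ro)" unfolding rect_cbox by (rule negligible_frontier_interval)
  ultimately have "negligible ({z. F z \<noteq> 0} \<union> (R - ?Ro))" by (rule negligible_Un)
  then show ?thesis by (rule negligible_subset) (auto simp: F_def indicator_def)
qed

lemma periodic2_int:
  assumes "periodic2 A B f" shows "f (x + of_int i * A) (y + of_int j * B) = f x y"
proof -
  have p: "f (x + A) y = f x y" "f x (y + B) = f x y" for x y using assms by (auto simp: periodic2_def)
  have 1: "f (x + of_int i * A) y = f x y" for x y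
  proof (induction i rule: int_induct[where k = 0])
    case (step1 i)
    then show ?case using p(1)[of "x + of_int i * A" y] by (simp add: algebra_simps)
  next
    case (step2 i)
    then show ?case using p(1)[of "x + of_int (i - 1) * A" y] by (simp add: algebra_simps)
  qed simp
  have 2: "f x (y + of_int j * B) = f x y" for x y
  proof (induction j rule: int_induct[where k = 0])
    case (step1 j)
    then show ?case using p(2)[of x "y + of_int j * B"] by (simp add: algebra_simps)
  next
    case (step2 j)
    then show ?case using p(2)[of x "y + of_int (j - 1) * B"] by (simp add: algebra_simps)
  qed simp
  show ?thesis using 1 2 by simp
qed

text \<open>The plane is covered by countably many translates of the rectangle.\<close>

lemma negligible_periodic:
  assumes "periodic2 Lx Ly f" "negligible {z \<in> R. f (fst z) (snd z) \<noteq> (0::real)}"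
  shows "negligible {z. f (fst z) (snd z) \<noteq> 0}"
proof -
  let ?N = "{z \<in> R. f (fst z) (snd z) \<noteq> 0}"
  have "{z. f (fst z) (snd z) \<noteq> 0} \<subseteq> (\<Union>i\<in>(UNIV :: (int \<times> int) set). (+) (of_int (fst i) * Lx, of_int (snd i) * Ly) ` ?N)"
  proof
    fix z assume z: "z \<in> {z. f (fst z) (snd z) \<noteq> 0}"
    define i where "i = \<lfloor>(fst z - x0) / Lx\<rfloor>"
    define j where "j = \<lfloor>(snd z - y0) / Ly\<rfloor>"
    define v where "v = (fst z - of_int i * Lx, snd z - of_int j * Ly)"
    have a: "of_int i \<le> (fst z - x0) / Lx" "(fst z - x0) / Lx \<le> of_int i + 1"
      "of_int j \<le> (snd z - y0) / Ly" "(snd z - y0) / Ly \<le> of_int j + 1"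
      unfolding i_def j_def by linarith+
    then have "v \<in> R" using x01 y01 by (auto simp: v_def rect_def field_simps)
    moreover have "f (fst v) (snd v) = f (fst z) (snd z)"
      using periodic2_int[OF assms(1), of "fst v" i "snd v" j] by (simp add: v_def)
    ultimately have "v \<in> ?N" using z by simp
    moreover have "z = (+) (of_int i * Lx, of_int j * Ly) v" by (simp add: v_def prod_eq_iff)
    ultimately show "z \<in> (\<Union>i\<in>(UNIV :: (int \<times> int) set). (+) (of_int (fst i) * Lx, of_int (snd i) * Ly) ` ?N)"
      by (intro UN_I[of "(i, j)"]) auto
  qed
  moreover have "negligible (\<Union>i\<in>(UNIV :: (int \<times> int) set). (+) (of_int (fst i) * Lx, of_int (snd i) * Ly) ` ?N)"
    unfolding negligible_iff_null_sets
  proof (rule null_sets_UN')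
    fix i :: "int \<times> int"
    show "(+) (of_int (fst i) * Lx, of_int (snd i) * Ly) ` ?N \<in> null_sets lebesgue"
      using negligible_translation[OF assms(2)] negligible_iff_null_sets by blast
  qed simp
  ultimately show ?thesis using negligible_subset by blast
qed

text \<open>The uniform limit of the partial sums has the Fourier coefficients of \<open>u\<close>,
  hence equals \<open>u\<close> almost everywhere by completeness, and so is its continuous
  representative. Differentiability up to order two follows from uniform convergence of the
  differentiated sums.\<close>

theorem smooth_approximation:
  assumes u: "u \<in> H_per x0 x1 y0 y1 s" and s: "s \<ge> 4"
  shows "\<exists>w. jcont w \<and> w 0 0 = cont_rep u \<and>
    (\<forall>a b x y. a + b < 2 \<longrightarrow> ((\<lambda>s. w a b s y) has_real_derivative w (Suc a) b x y) (at x) \<and>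
       ((\<lambda>t. w a b x t) has_real_derivative w a (Suc b) x y) (at y)) \<and>
    (\<forall>a b. a + b \<le> 2 \<longrightarrow> uniform_limit UNIV (\<lambda>n z. partial u n a b (fst z) (snd z)) (\<lambda>z. w a b (fst z) (snd z)) sequentially)"
proof -
  have ex: "\<exists>w. uniform_limit UNIV (\<lambda>n z. partial u n a b (fst z) (snd z)) w sequentially" if "a + b \<le> 2" for a b
    using that s by (intro partial_uniform_limit[OF u]) simp
  define W where "W a b = (SOME w. uniform_limit UNIV (\<lambda>n z. partial u n a b (fst z) (snd z)) w sequentially)" for a b
  have W: "uniform_limit UNIV (\<lambda>n z. partial u n a b (fst z) (snd z)) (W a b) sequentially" if "a + b \<le> 2" for a b
    unfolding W_def by (rule someI_ex[OF ex[OF that]])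
  \<comment> \<open>The hypothesis s \<ge> 4 gives limits up to order two only; beyond it the
    entries are set to zero, which keeps the jet continuous.\<close>
  define w :: jet where "w = (\<lambda>a b x y. if a + b \<le> 2 then W a b (x, y) else 0)"
  have lim: "uniform_limit UNIV (\<lambda>n z. partial u n a b (fst z) (snd z)) (\<lambda>z. w a b (fst z) (snd z)) sequentially" if "a + b \<le> 2" for a b
    using W[OF that] that by (simp add: w_def)
  note D = smooth_jetD[OF partial_smooth]
  have cw: "cont2 (w a b)" for a b
  proof (cases "a + b \<le> 2")
    case True
    have "continuous_on UNIV (\<lambda>z. w a b (fst z) (snd z))"
      by (rule uniform_limit_theorem[OF _ lim[OF True]])
        (use D(1) in \<open>auto simp: cont2_def case_prod_unfold intro!: always_eventually\<close>)
    then show ?thesis by (simp add: cont2_def case_prod_unfold)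
  next
    case False
    then have "w a b = (\<lambda>x y. 0)" by (auto simp: w_def fun_eq_iff)
    then show ?thesis by (simp add: cont2_intros)
  qed
  have jw: "jcont w" using cw by (simp add: jcont_def cont2_def)
  have pt: "(\<lambda>n. partial u n a b x y) \<longlonglongrightarrow> w a b x y" if "a + b \<le> 2" for a b x y
    using tendsto_uniform_limitI[OF lim[OF that], of "(x, y)"] by simp
  have dw: "((\<lambda>s. w a b s y) has_real_derivative w (Suc a) b x y) (at x)"
    "((\<lambda>t. w a b x t) has_real_derivative w a (Suc b) x y) (at y)" if "a + b < 2" for a b x y
  proof -
    have "uniform_limit UNIV (\<lambda>n s. partial u n (Suc a) b s y) (\<lambda>s. w (Suc a) b s y) sequentially"
      using uniform_limit_precompose[OF lim[of "Suc a" b], of "\<lambda>s. (s, y)"] that by simp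
    then show "((\<lambda>s. w a b s y) has_real_derivative w (Suc a) b x y) (at x)"
      by (rule deriv_uniform_limit[OF D(2)]) (use pt that in simp)
    have "uniform_limit UNIV (\<lambda>n t. partial u n a (Suc b) x t) (\<lambda>t. w a (Suc b) x t) sequentially"
      using uniform_limit_precompose[OF lim[of a "Suc b"], of "\<lambda>t. (x, t)"] that by simp
    then show "((\<lambda>t. w a b x t) has_real_derivative w a (Suc b) x y) (at y)"
      by (rule deriv_uniform_limit[where f = "\<lambda>n t. partial u n a b x t", OF D(3)]) (use pt that in simp)
  qed
  have uL: "L2_on R u" "periodic2 Lx Ly u" using u by (auto simp: H_per_def)
  define f where "f x y = u x y - w 0 0 x y" for x y
  note cw0 = cw[of 0 0]
  have per: "periodic2 Lx Ly (w 0 0)"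
    unfolding periodic2_def
  proof (intro allI conjI)
    fix x y
    have p: "partial u n 0 0 (x + Lx) y = partial u n 0 0 x y" "partial u n 0 0 x (y + Ly) = partial u n 0 0 x y" for n
      using partial_periodic[of u n 0 0] by (auto simp: periodic2_def)
    show "w 0 0 (x + Lx) y = w 0 0 x y" using pt[of 0 0 "x + Lx" y] pt[of 0 0 x y] unfolding p by (simp add: LIMSEQ_unique)
    show "w 0 0 x (y + Ly) = w 0 0 x y" using pt[of 0 0 x "y + Ly"] pt[of 0 0 x y] unfolding p by (simp add: LIMSEQ_unique)
  qed
  have fL: "L2_on R f"
  proof -
    have wL: "L2_on R (w 0 0)" by (rule cont2_L2[OF cw0])
    have m: "(\<lambda>(x, y). f x y) \<in> borel_measurable (lebesgue_on R)"
      using uL(1) wL unfolding L2_on_def f_def case_prod_unfold by (intro borel_measurable_diff) auto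
    have "(\<lambda>z. (u (fst z) (snd z))\<^sup>2 - 2 * (u (fst z) (snd z) * w 0 0 (fst z) (snd z)) + (w 0 0 (fst z) (snd z))\<^sup>2) absolutely_integrable_on R"
      using uL(1) wL L2_mult_integrable[OF uL(1) wL] unfolding L2_on_def case_prod_unfold
      by (intro set_integral_add set_integral_diff set_integrable_mult_right) auto
    then have "(\<lambda>(x, y). (f x y)\<^sup>2) absolutely_integrable_on R"
      by (simp add: f_def case_prod_unfold power2_diff algebra_simps)
    then show ?thesis using m by (simp add: L2_on_def)
  qed
  \<comment> \<open>Uniform convergence passes to the integral against \<open>bas p q\<close>, and
    that coefficient of the partial sums is constant as soon as the box contains (p, q).\<close>
  have ipw: "ip (w 0 0) (bas p q) = ip u (bas p q)" for p q
  proof -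
    have "uniform_limit (cbox (x0, y0) (x1, y1)) (\<lambda>n z. partial u n 0 0 (fst z) (snd z) * bas p q (fst z) (snd z))
        (\<lambda>z. w 0 0 (fst z) (snd z) * bas p q (fst z) (snd z)) sequentially"
    proof (rule uniform_lim_mult)
      show "uniform_limit (cbox (x0, y0) (x1, y1)) (\<lambda>n z. partial u n 0 0 (fst z) (snd z)) (\<lambda>z. w 0 0 (fst z) (snd z)) sequentially"
        by (rule uniform_limit_on_subset[OF lim]) auto
      show "bounded ((\<lambda>z. w 0 0 (fst z) (snd z)) ` cbox (x0, y0) (x1, y1))"
        "bounded ((\<lambda>z. bas p q (fst z) (snd z)) ` cbox (x0, y0) (x1, y1))"
        using cw0 cont2_bas[of p q] unfolding cont2_def case_prod_unfold
        by (auto intro!: compact_imp_bounded compact_continuous_image compact_cbox intro: continuous_on_subset)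
    qed (simp add: uniform_limit_const)
    note ul = this
    have cn: "continuous_on (cbox (x0, y0) (x1, y1)) (\<lambda>z. partial u n 0 0 (fst z) (snd z) * bas p q (fst z) (snd z))" for n
    proof -
      have "continuous_on UNIV (\<lambda>z. partial u n 0 0 (fst z) (snd z) * bas p q (fst z) (snd z))"
        using cont2_mult[OF D(1)[of u n 0 0] cont2_bas[of p q]] by (simp add: cont2_def case_prod_unfold)
      then show ?thesis using continuous_on_subset by blast
    qed
    obtain I J where IJ: "\<And>n. ((\<lambda>z. partial u n 0 0 (fst z) (snd z) * bas p q (fst z) (snd z)) has_integral I n) (cbox (x0, y0) (x1, y1))"
      "((\<lambda>z. w 0 0 (fst z) (snd z) * bas p q (fst z) (snd z)) has_integral J) (cbox (x0, y0) (x1, y1))" "I \<longlonglongrightarrow> J"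
      using uniform_limit_integral_cbox[OF ul cn sequentially_bot] by blast
    have In: "I n = (\<Sum>i\<in>box_idx n. ip u (bas (fst i) (snd i)) * ip (bas p q) (bas (fst i) (snd i)))" for n
    proof -
      have "I n = ip (partial u n 0 0) (bas p q)" using IJ(1)[of n] by (simp add: ip_def rect_cbox case_prod_unfold has_integral_iff)
      also have "\<dots> = ip (bas p q) (\<lambda>x y. \<Sum>i\<in>box_idx n. ip u (bas (fst i) (snd i)) * bas (fst i) (snd i) x y)"
      proof -
        have "partial u n 0 0 = (\<lambda>x y. \<Sum>i\<in>box_idx n. ip u (bas (fst i) (snd i)) * bas (fst i) (snd i) x y)"
          by (simp add: fun_eq_iff partial_def bas_def case_prod_unfold)
        then show ?thesis using ip_commute by metis
      qed
      also have "\<dots> = (\<Sum>i\<in>box_idx n. ip u (bas (fst i) (snd i)) * ip (bas p q) (bas (fst i) (snd i)))"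
        by (intro ip_sum finite_box_idx cont2_L2 cont2_bas)
      finally show ?thesis .
    qed
    have "I n = ip u (bas p q)" if "(p, q) \<in> box_idx n" for n
    proof -
      have "I n = (\<Sum>i\<in>box_idx n. if i = (p, q) then ip u (bas p q) else 0)"
        unfolding In by (intro sum.cong) (auto simp: ip_bas)
      then show ?thesis using that finite_box_idx by simp
    qed
    moreover obtain N where "(p, q) \<in> box_idx N" using finite_subset_box_idx[of "{(p, q)}"] by auto
    then have "(p, q) \<in> box_idx n" if "n \<ge> N" for n using that by (force simp: box_idx_def)
    ultimately have "\<forall>\<^sub>F n in sequentially. I n = ip u (bas p q)" by (auto simp: eventually_sequentially)
    then have "I \<longlonglongrightarrow> ip u (bas p q)" by (rule tendsto_eventually)
    then have "J = ip u (bas p q)" using IJ(3) LIMSEQ_unique by blast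
    then show ?thesis using IJ(2) by (simp add: ip_def rect_cbox case_prod_unfold has_integral_iff)
  qed
  have "ip f (bas p q) = 0" for p q
  proof -
    have "ip f (bas p q) = ip (bas p q) f" by (rule ip_commute)
    have "ip f (bas p q) = integral R (\<lambda>z. u (fst z) (snd z) * bas p q (fst z) (snd z) - w 0 0 (fst z) (snd z) * bas p q (fst z) (snd z))"
      by (simp add: ip_def f_def case_prod_unfold algebra_simps)
    also have "\<dots> = ip u (bas p q) - ip (w 0 0) (bas p q)"
      unfolding ip_def case_prod_unfold by (intro integral_diff ip_integrable' uL cont2_L2 cont2_bas cw0)
    finally show ?thesis using ipw by simp
  qed
  from fourier_complete[OF fL this] have "negligible {z. f (fst z) (snd z) \<noteq> 0}"
    using uL(2) per by (intro negligible_periodic) (auto simp: periodic2_def f_def)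
  then have "AE z in lebesgue. f (fst z) (snd z) = 0"
    by (simp add: AE_lebesgue_iff_negligible)
  then have ae: "AE z in lebesgue. w 0 0 (fst z) (snd z) = u (fst z) (snd z)" by (elim AE_mp) (auto simp: f_def)
  have cr: "cont_rep u = w 0 0"
    unfolding cont_rep_def
  proof (rule the_equality)
    show "continuous_on UNIV (\<lambda>(x, y). w 0 0 x y) \<and> (AE p in lebesgue. w 0 0 (fst p) (snd p) = u (fst p) (snd p))"
      using cw0 ae by (simp add: cont2_def)
    fix v assume v: "continuous_on UNIV (\<lambda>(x, y). v x y) \<and> (AE p in lebesgue. v (fst p) (snd p) = u (fst p) (snd p))"
    show "v = w 0 0"
    proof (rule continuous_AE_unique)
      show "AE p in lebesgue. v (fst p) (snd p) = w 0 0 (fst p) (snd p)" using v ae by (auto elim: AE_mp)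
    qed (use v cw0 in \<open>auto simp: cont2_def\<close>)
  qed
  show ?thesis
  proof (intro exI[of _ w] conjI allI impI)
    show "jcont w" by (rule jw)
    show "w 0 0 = cont_rep u" by (rule cr[symmetric])
  qed (fact dw(1) dw(2) lim)+
qed

text \<open>Only derivatives of exact order s are needed later, and they form part of the sum in the
  norm.\<close>

lemma partial_H_norm:
  assumes u: "u \<in> H_per x0 x1 y0 y1 s"
  shows "(\<Sum>m\<le>s. integral R (\<lambda>(x, y). (partial u n m (s - m) x y)\<^sup>2)) \<le> (H_norm x0 x1 y0 y1 s u)\<^sup>2"
proof -
  let ?g = "\<lambda>m n. SOME g. weak_deriv x0 x1 y0 y1 m n u g"
  let ?S = "{(m, n). m + n \<le> s}"
  have fin: "finite ?S" by (rule finite_subset[of _ "{..s} \<times> {..s}"]) auto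
  have "(\<Sum>m\<le>s. integral R (\<lambda>(x, y). (partial u n m (s - m) x y)\<^sup>2)) \<le> (\<Sum>m\<le>s. (L2_norm R (?g m (s - m)))\<^sup>2)"
  proof (rule sum_mono)
    fix m assume "m \<in> {..s}"
    then have "\<exists>g. weak_deriv x0 x1 y0 y1 m (s - m) u g" using u by (auto simp: H_per_def)
    then show "integral R (\<lambda>(x, y). (partial u n m (s - m) x y)\<^sup>2) \<le> (L2_norm R (?g m (s - m)))\<^sup>2"
      by (rule partial_norm[OF someI_ex])
  qed
  also have "\<dots> = (\<Sum>(m, n)\<in>(\<lambda>m. (m, s - m)) ` {..s}. (L2_norm R (?g m n))\<^sup>2)"
    by (subst sum.reindex) (auto simp: inj_on_def)
  also have "\<dots> \<le> (\<Sum>(m, n)\<in>?S. (L2_norm R (?g m n))\<^sup>2)"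
    by (intro sum_mono2 fin) auto
  also have "\<dots> = (H_norm x0 x1 y0 y1 s u)\<^sup>2"
    unfolding H_norm_def by (subst real_sqrt_pow2) (auto intro!: sum_nonneg)
  finally show ?thesis .
qed

end

section \<open>The local functional\<close>

definition GLfun :: "real \<Rightarrow> nat \<Rightarrow> (real \<Rightarrow> real) \<Rightarrow> real" where
  "GLfun b j v = (if j = 0 then v (- b) else if j = 1 then v b
     else weighted_int 0 (- b) b (monom 1 (j - 2)) v)"

lemma GLfun_lin:
  assumes "continuous_on UNIV f" "continuous_on UNIV g"
  shows "GLfun b j (\<lambda>x. \<alpha> * f x + \<beta> * g x) = \<alpha> * GLfun b j f + \<beta> * GLfun b j g"
  unfolding GLfun_def by (simp add: weighted_int_lin assms)

lemma poly_continuous: "continuous_on S (poly (p :: real poly))"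
  by (intro continuous_intros)

lemma GLfun_lin_poly: "lin_poly (\<lambda>p. GLfun b j (poly p))"
  using GLfun_lin[OF poly_continuous poly_continuous, of b j 1 _ 1] GLfun_lin[OF poly_continuous poly_continuous, of b j _ _ 0]
  unfolding lin_poly_def by (simp add: poly_add[abs_def] poly_smult[abs_def])

lemma weighted_int_orth:
  assumes v: "continuous_on UNIV v" and "\<And>j. j < n \<Longrightarrow> weighted_int 0 a b (monom 1 j) v = 0" "degree q < n"
  shows "weighted_int 0 a b q v = 0"
proof -
  note L = lin_polyD[OF weighted_int_lin_poly[OF v]]
  have "q = (\<Sum>j\<le>degree q. smult (coeff q j) (monom 1 j))"
    by (simp add: smult_monom poly_as_sum_of_monoms)
  then have "weighted_int 0 a b q v = (\<Sum>j\<le>degree q. coeff q j * weighted_int 0 a b (monom 1 j) v)"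
    using L(6)[where S = "{..degree q}" and f = "\<lambda>j. smult (coeff q j) (monom 1 j)"] by (simp add: L(2))
  also have "\<dots> = 0" using assms by (intro sum.neutral) auto
  finally show ?thesis .
qed

text \<open>A polynomial in the kernel is (x^2 - b^2) q with q of degree at most k - 2. Testing with
  q itself gives a vanishing integral of (b^2 - x^2) q^2, so q = 0.\<close>

lemma GLfun_inj:
  assumes b: "b > 0" and k: "k \<ge> 1" and p: "degree p \<le> k" "\<And>j. j \<le> k \<Longrightarrow> GLfun b j (poly p) = 0"
  shows "p = 0"
proof (rule ccontr)
  assume p0: "p \<noteq> 0"
  have "poly p (- b) = 0" "poly p b = 0" using p(2)[of 0] p(2)[of 1] k by (simp_all add: GLfun_def)
  then obtain p1 where p1: "p = [:- b, 1:] * p1" by (auto simp: poly_eq_0_iff_dvd)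
  then have "poly p1 (- b) = 0" using \<open>poly p (- b) = 0\<close> b by auto
  then obtain q where q: "p1 = [:b, 1:] * q" by (auto simp: poly_eq_0_iff_dvd)
  have pq: "p = ([:- b, 1:] * [:b, 1:]) * q" using p1 q by (simp only: mult.assoc)
  have q0: "q \<noteq> 0" using p0 pq by auto
  have "degree p = 2 + degree q"
    unfolding pq using q0 by (subst degree_mult_eq) (auto simp: degree_mult_eq)
  then have dq: "degree q < k - 1" using p(1) by simp
  have "weighted_int 0 (- b) b q (poly p) = 0"
  proof (rule weighted_int_orth[OF poly_continuous _ dq])
    show "weighted_int 0 (- b) b (monom 1 j) (poly p) = 0" if "j < k - 1" for j
      using p(2)[of "j + 2"] that by (simp add: GLfun_def)
  qed
  then have z: "integral {- b..b} (\<lambda>x. (b * b - x * x) * (poly q x)\<^sup>2) = 0"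
    unfolding weighted_int_def pq
    by (simp add: power2_eq_square algebra_simps flip: integral_neg) (metis (no_types, lifting) integral_neg neg_equal_0_iff_equal minus_diff_eq integral_cong)
  \<comment> \<open>On the inner half interval the weight is strictly positive, and infinitely many
    zeros are enough.\<close>
  have "poly q x = 0" if x: "x \<in> {- (b/2)..b/2}" for x
  proof -
    have cn: "continuous_on {- b..b} (\<lambda>x. (b * b - x * x) * (poly q x)\<^sup>2)" by (intro continuous_intros)
    have nn: "0 \<le> (b * b - x * x) * (poly q x)\<^sup>2" if "x \<in> {- b..b}" for x
    proof -
      have "\<bar>x\<bar> * \<bar>x\<bar> \<le> b * b" using that by (intro mult_mono) auto
      then show ?thesis by simp
    qed
    have "(b * b - x * x) * (poly q x)\<^sup>2 = 0"
      using integral_eq_0_iff[OF cn] nn z x b by auto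
    moreover have "x * x < b * b"
    proof -
      have "\<bar>x\<bar> * \<bar>x\<bar> < b * b" using x b by (intro mult_strict_mono) auto
      then show ?thesis by simp
    qed
    ultimately show ?thesis by simp
  qed
  then have "q = 0" using b by (intro poly_zero_on_interval[of "- (b/2)" "b/2"]) auto
  then show False using q0 by simp
qed

definition GLbasis :: "nat \<Rightarrow> real \<Rightarrow> nat \<Rightarrow> real poly" where
  "GLbasis k b = (SOME e. \<forall>j\<le>k. degree (e j) \<le> k \<and> (\<forall>i\<le>k. GLfun b i (poly (e j)) = (if i = j then 1 else 0)))"

lemma GLbasis:
  assumes "b > 0" "k \<ge> 1" "j \<le> k"
  shows "degree (GLbasis k b j) \<le> k" "i \<le> k \<Longrightarrow> GLfun b i (poly (GLbasis k b j)) = (if i = j then 1 else 0)"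
proof -
  have "\<exists>e. \<forall>j\<le>k. degree (e j) \<le> k \<and> (\<forall>i\<le>k. GLfun b i (poly (e j)) = (if i = j then 1 else 0))"
    by (rule dual_basis_exists[where L = "\<lambda>i p. GLfun b i (poly p)"])
      (use assms GLfun_inj GLfun_lin_poly in blast)+
  from someI_ex[OF this] assms(3)
  show "degree (GLbasis k b j) \<le> k" "i \<le> k \<Longrightarrow> GLfun b i (poly (GLbasis k b j)) = (if i = j then 1 else 0)"
    unfolding GLbasis_def by blast+
qed

definition GLproj :: "nat \<Rightarrow> real \<Rightarrow> (real \<Rightarrow> real) \<Rightarrow> real poly" where
  "GLproj k b v = (\<Sum>j\<le>k. smult (GLfun b j v) (GLbasis k b j))"

lemma GLproj:
  assumes "b > 0" "k \<ge> 1"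
  shows "degree (GLproj k b v) \<le> k" "j \<le> k \<Longrightarrow> GLfun b j (poly (GLproj k b v)) = GLfun b j v"
proof -
  show "degree (GLproj k b v) \<le> k" unfolding GLproj_def using GLbasis assms by (intro degree_dual_sum_le) auto
  show "j \<le> k \<Longrightarrow> GLfun b j (poly (GLproj k b v)) = GLfun b j v" unfolding GLproj_def
    by (rule dual_basis_apply[where L = "\<lambda>i p. GLfun b i (poly p)", OF GLfun_lin_poly]) (use GLbasis(2)[OF assms] in auto)
qed

lemma GLproj_unique:
  assumes "b > 0" "k \<ge> 1" "degree p \<le> k" "\<And>j. j \<le> k \<Longrightarrow> GLfun b j (poly p) = GLfun b j v"
  shows "p = GLproj k b v"
proof -
  have "p - GLproj k b v = 0"
    using assms GLproj[OF assms(1,2), where v = v] lin_polyD(5)[OF GLfun_lin_poly]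
    by (intro GLfun_inj[OF assms(1,2)]) (auto intro: degree_diff_le)
  then show ?thesis by simp
qed

lemma gauss_lobatto_ref:
  assumes "b > 0" "k \<ge> 1" "continuous_on UNIV v"
  shows "gauss_lobatto k (2 * b) 0 v = GLproj k b v"
    and "\<exists>!p. degree p \<le> k \<and> poly p (0 - 2 * b / 2) = v (0 - 2 * b / 2) \<and> poly p (0 + 2 * b / 2) = v (0 + 2 * b / 2) \<and>
      (\<forall>q. degree q + 2 \<le> k \<longrightarrow> integral (cell (2 * b) 0) (\<lambda>t. (v t - poly p t) * poly q t) = 0)"
proof -
  have ce: "cell (2 * b) 0 = {- b..b}" by (simp add: cell_def)
  have wi: "integral {- b..b} (\<lambda>t. (v t - poly p t) * poly q t) = weighted_int 0 (- b) b q v - weighted_int 0 (- b) b q (poly p)" for p q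
  proof -
    have "integral {- b..b} (\<lambda>t. (v t - poly p t) * poly q t) = weighted_int 0 (- b) b q (\<lambda>t. 1 * v t + (-1) * poly p t)"
      by (simp add: weighted_int_def)
    then show ?thesis by (simp only: weighted_int_lin[OF assms(3) poly_continuous])
  qed
  have iff: "(\<forall>q. degree q + 2 \<le> k \<longrightarrow> integral (cell (2 * b) 0) (\<lambda>t. (v t - poly p t) * poly q t) = 0) \<longleftrightarrow>
    (\<forall>j\<in>{2..k}. GLfun b j (poly p) = GLfun b j v)" for p
  proof
    assume *: "\<forall>q. degree q + 2 \<le> k \<longrightarrow> integral (cell (2 * b) 0) (\<lambda>t. (v t - poly p t) * poly q t) = 0"
    show "\<forall>j\<in>{2..k}. GLfun b j (poly p) = GLfun b j v"
    proof
      fix j assume j: "j \<in> {2..k}"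
      have "degree (monom (1::real) (j - 2)) \<le> j - 2" by (rule degree_monom_le)
      then have "degree (monom (1::real) (j - 2)) + 2 \<le> k" using j unfolding atLeastAtMost_iff by linarith
      then show "GLfun b j (poly p) = GLfun b j v" using * j wi[of p "monom 1 (j - 2)"] by (simp add: ce GLfun_def)
    qed
  next
    assume *: "\<forall>j\<in>{2..k}. GLfun b j (poly p) = GLfun b j v"
    let ?w = "\<lambda>t. 1 * v t + (-1) * poly p t"
    have cw: "continuous_on UNIV ?w" by (intro continuous_intros assms)
    have lin: "weighted_int 0 (- b) b q ?w = weighted_int 0 (- b) b q v - weighted_int 0 (- b) b q (poly p)" for q
      by (simp only: weighted_int_lin[OF assms(3) poly_continuous])
    have "weighted_int 0 (- b) b q ?w = 0" if "degree q + 2 \<le> k" for q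
    proof (rule weighted_int_orth[OF cw])
      show "degree q < k - 1" using that by simp
      show "weighted_int 0 (- b) b (monom 1 j) ?w = 0" if "j < k - 1" for j
        unfolding lin using *[rule_format, of "j + 2"] that by (simp add: GLfun_def)
    qed
    then show "\<forall>q. degree q + 2 \<le> k \<longrightarrow> integral (cell (2 * b) 0) (\<lambda>t. (v t - poly p t) * poly q t) = 0"
      unfolding ce wi lin by blast
  qed
  have all: "(poly p (- b) = v (- b) \<and> poly p b = v b \<and> (\<forall>j\<in>{2..k}. GLfun b j (poly p) = GLfun b j v)) \<longleftrightarrow>
    (\<forall>j\<le>k. GLfun b j (poly p) = GLfun b j v)" for p
  proof (intro iffI allI impI)
    fix j assume h: "poly p (- b) = v (- b) \<and> poly p b = v b \<and> (\<forall>j\<in>{2..k}. GLfun b j (poly p) = GLfun b j v)" "j \<le> k"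
    show "GLfun b j (poly p) = GLfun b j v"
    proof (cases "j = 0 \<or> j = 1")
      case True then show ?thesis using h by (auto simp: GLfun_def)
    next
      case False then have "j \<in> {2..k}" using h by auto
      then show ?thesis using h by blast
    qed
  next
    assume h: "\<forall>j\<le>k. GLfun b j (poly p) = GLfun b j v"
    from h[rule_format, of 0] h[rule_format, of 1] assms(2)
    show "poly p (- b) = v (- b) \<and> poly p b = v b \<and> (\<forall>j\<in>{2..k}. GLfun b j (poly p) = GLfun b j v)"
      using h by (auto simp: GLfun_def)
  qed
  have e: "0 - 2 * b / 2 = - b" "0 + 2 * b / 2 = b" by simp_all
  have P: "degree (GLproj k b v) \<le> k \<and> (\<forall>j\<le>k. GLfun b j (poly (GLproj k b v)) = GLfun b j v)"
    using GLproj[OF assms(1,2)] by blast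
  have U: "p = GLproj k b v" if "degree p \<le> k \<and> (\<forall>j\<le>k. GLfun b j (poly p) = GLfun b j v)" for p
    using GLproj_unique[OF assms(1,2)] that by blast
  show "gauss_lobatto k (2 * b) 0 v = GLproj k b v"
    unfolding gauss_lobatto_def e iff all using P U by (rule the_equality)
  show "\<exists>!p. degree p \<le> k \<and> poly p (0 - 2 * b / 2) = v (0 - 2 * b / 2) \<and> poly p (0 + 2 * b / 2) = v (0 + 2 * b / 2) \<and>
      (\<forall>q. degree q + 2 \<le> k \<longrightarrow> integral (cell (2 * b) 0) (\<lambda>t. (v t - poly p t) * poly q t) = 0)"
    unfolding e iff all using P U by (rule ex1I)
qed

section \<open>Corrections after the projection in y\<close>

definition locX :: "nat \<Rightarrow> real \<Rightarrow> real \<Rightarrow> nat \<Rightarrow> jet \<Rightarrow> real \<Rightarrow> real \<Rightarrow> real" where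
  "locX k t b l d x y = poly (GLproj k b (\<lambda>\<eta>. loc k t l d x \<eta>)) y"

lemma locX_eq: "locX k t b l d x y = (\<Sum>j\<le>k. GLfun b j (\<lambda>\<eta>. loc k t l d x \<eta>) * poly (GLbasis k b j) y)"
  by (simp add: locX_def GLproj_def poly_sum)

lemma loc_cont2: "jcont d \<Longrightarrow> cont2 (loc k t l d)"
  using loc_continuous by (simp add: cont2_def)

lemma GLfun_continuous:
  assumes "cont2 f" shows "continuous_on UNIV (\<lambda>x. GLfun b j (f x))"
proof -
  have "continuous_on UNIV (\<lambda>x. weighted_int 0 (- b) b \<psi> (f x))" for \<psi>
    using weighted_int_continuous[of "\<lambda>y x. f x y"] cont2_swap[OF assms] by (simp add: cont2_def)
  then show ?thesis unfolding GLfun_def using cont2_slices(2)[OF assms]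
    by (cases "j = 0"; cases "j = 1") simp_all
qed

lemma locX_cont2: assumes "jcont d" shows "cont2 (locX k t b l d)"
  unfolding locX_eq by (intro cont2_sum cont2_tensor GLfun_continuous loc_cont2 assms poly_continuous)

lemma locX_jlin:
  assumes "jcont d" "jcont d'"
  shows "locX k t b l (jlin \<alpha> d \<beta> d') x y = \<alpha> * locX k t b l d x y + \<beta> * locX k t b l d' x y"
proof -
  have "GLfun b j (\<lambda>\<eta>. loc k t l (jlin \<alpha> d \<beta> d') x \<eta>) = \<alpha> * GLfun b j (\<lambda>\<eta>. loc k t l d x \<eta>) + \<beta> * GLfun b j (\<lambda>\<eta>. loc k t l d' x \<eta>)" for j
    unfolding loc_jlin[OF assms] by (intro GLfun_lin cont2_slices(1) loc_cont2 assms)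
  then show ?thesis by (simp add: locX_eq distrib_right sum.distrib sum_distrib_left mult.assoc)
qed

lemma locX_bound:
  assumes b: "b > 0"
  shows "\<exists>C\<ge>0. \<forall>d M. (\<forall>y. \<bar>y\<bar> \<le> b \<longrightarrow> jbound l ((real l + 1) / 2) d y M) \<longrightarrow>
    (\<forall>x y. \<bar>x\<bar> \<le> 1/2 \<longrightarrow> \<bar>y\<bar> \<le> b \<longrightarrow> \<bar>locX k t b l d x y\<bar> \<le> C * M)"
proof -
  obtain A where A: "A \<ge> 0" "\<And>d y M x. jbound l ((real l + 1) / 2) d y M \<Longrightarrow> \<bar>x\<bar> \<le> 1/2 \<Longrightarrow> \<bar>loc k t l d x y\<bar> \<le> A * M"
    using loc_bound by blast
  have "\<exists>C\<ge>0. \<forall>v M. continuous_on UNIV v \<longrightarrow> (\<forall>y\<in>{- b..b}. \<bar>v y\<bar> \<le> M) \<longrightarrow> \<bar>GLfun b j v\<bar> \<le> C * M" for j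
  proof (cases "j \<le> 1")
    case True
    then have "j = 0 \<or> j = 1" by auto
    then show ?thesis using b by (intro exI[of _ 1]) (auto simp: GLfun_def)
  next
    case False
    then show ?thesis using weighted_int_bound[of "- b" b 0 "monom 1 (j - 2)"] b by (simp add: GLfun_def)
  qed
  then obtain G where G: "\<And>j. G j \<ge> 0" "\<And>j v M. continuous_on UNIV v \<Longrightarrow> (\<forall>y\<in>{- b..b}. \<bar>v y\<bar> \<le> M) \<Longrightarrow> \<bar>GLfun b j v\<bar> \<le> G j * M"
    by metis
  have "\<exists>N\<ge>0. \<forall>y\<in>{- b..b}. \<bar>poly (GLbasis k b j) y\<bar> \<le> N" for j by (rule poly_bounded_on)
  then obtain N where N: "\<And>j. N j \<ge> 0" "\<And>j y. y \<in> {- b..b} \<Longrightarrow> \<bar>poly (GLbasis k b j) y\<bar> \<le> N j" by metis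
  have "\<bar>locX k t b l d x y\<bar> \<le> (\<Sum>j\<le>k. G j * A * N j) * M"
    if d: "\<forall>y. \<bar>y\<bar> \<le> b \<longrightarrow> jbound l ((real l + 1) / 2) d y M" and x: "\<bar>x\<bar> \<le> 1/2" and y: "\<bar>y\<bar> \<le> b" for d M x y
  proof -
    have j0: "jbound l ((real l + 1) / 2) d 0 M" using d b by simp
    then have jd: "jcont d" by (simp add: jbound_def)
    have M: "M \<ge> 0" using jbound_nonneg[OF j0] by simp
    have ly: "\<forall>y\<in>{- b..b}. \<bar>loc k t l d x y\<bar> \<le> A * M"
      using d by (intro ballI A(2)) (use x in auto)
    have "\<bar>GLfun b j (\<lambda>\<eta>. loc k t l d x \<eta>) * poly (GLbasis k b j) y\<bar> \<le> (G j * A * N j) * M" for j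
    proof -
      have "\<bar>GLfun b j (\<lambda>\<eta>. loc k t l d x \<eta>)\<bar> \<le> G j * (A * M)"
        by (rule G(2)[OF _ ly]) (intro cont2_slices(1) loc_cont2 jd)
      then have "\<bar>GLfun b j (\<lambda>\<eta>. loc k t l d x \<eta>)\<bar> * \<bar>poly (GLbasis k b j) y\<bar> \<le> (G j * (A * M)) * N j"
      proof (intro mult_mono N(2))
        show "y \<in> {- b..b}" using y by (simp only: atLeastAtMost_iff) linarith
      qed (use A(1) G(1)[of j] M in auto)
      then show ?thesis by (simp add: abs_mult mult_ac)
    qed
    then show ?thesis unfolding locX_eq sum_distrib_right by (intro order.trans[OF sum_abs] sum_mono)
  qed
  moreover have "(\<Sum>j\<le>k. G j * A * N j) \<ge> 0" using G A N by (intro sum_nonneg) auto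
  ultimately show ?thesis by blast
qed

text \<open>For polynomial data a level is of degree at most k in y, so the projection reproduces it
  on every vertical cell of either mesh. The pieces glued in y are therefore pieces of one
  polynomial and the seam disappears.\<close>

lemma locX_exact:
  assumes "t > 0" "b > 0" "k \<ge> 1" "pjet n d" "n \<le> 2 * k + 2"
  shows "locX k t b l (jshift r s d) x y = loc k t l (jshift r 0 d) x (y + s)"
proof -
  obtain p where p: "degree p \<le> k" "\<And>y. loc k t l (jshift r 0 d) x y = poly p y"
    using loc_poly_snd[OF assms(1) pjet_jshift_fst[OF assms(4)] assms(5)] by blast
  have e: "loc k t l (jshift r s d) x y = poly (p \<circ>\<^sub>p [:s, 1:]) y" for y
  proof -
    have "jshift r s d = jshift 0 s (jshift r 0 d)" by (simp add: jet_ops_commute)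
    then show ?thesis by (simp add: loc_jshift_snd p poly_pcompose add.commute)
  qed
  have gl: "p \<circ>\<^sub>p [:s, 1:] = GLproj k b (\<lambda>\<eta>. loc k t l (jshift r s d) x \<eta>)"
    using p(1) e by (intro GLproj_unique assms) (simp_all add: degree_pcompose)
  have "locX k t b l (jshift r s d) x y = poly (p \<circ>\<^sub>p [:s, 1:]) y" by (simp only: locX_def gl)
  then show ?thesis by (simp add: p poly_pcompose add.commute)
qed

section \<open>Integration of locally bounded Borel functions\<close>

text \<open>Glued functions may jump across the two axes, so continuity is too strong for Fubini;
  this class contains the continuous functions and is closed under gluing along the axes.\<close>

definition bmeas :: "(real \<Rightarrow> real \<Rightarrow> real) \<Rightarrow> bool" where
  "bmeas f \<longleftrightarrow> (\<lambda>z. f (fst z) (snd z)) \<in> borel_measurable borel \<and>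
     (\<forall>a b. \<exists>M. \<forall>x y. \<bar>x\<bar> \<le> a \<longrightarrow> \<bar>y\<bar> \<le> b \<longrightarrow> \<bar>f x y\<bar> \<le> M)"

lemma bmeasD: "bmeas f \<Longrightarrow> \<exists>M. \<forall>x y. \<bar>x\<bar> \<le> a \<longrightarrow> \<bar>y\<bar> \<le> b \<longrightarrow> \<bar>f x y\<bar> \<le> M"
  by (simp add: bmeas_def)

lemma cont2_bmeas: assumes "cont2 f" shows "bmeas f"
proof -
  have c: "continuous_on UNIV (\<lambda>z. f (fst z) (snd z))" using assms by (simp add: cont2_def case_prod_unfold)
  have "\<exists>M. \<forall>x y. \<bar>x\<bar> \<le> a \<longrightarrow> \<bar>y\<bar> \<le> b \<longrightarrow> \<bar>f x y\<bar> \<le> M" for a b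
  proof -
    have "compact ((\<lambda>z. f (fst z) (snd z)) ` cbox (- a, - b) (a, b))"
      by (intro compact_continuous_image compact_cbox continuous_on_subset[OF c]) auto
    then obtain M where "\<forall>z\<in>cbox (- a, - b) (a, b). \<bar>f (fst z) (snd z)\<bar> \<le> M"
      by (auto dest!: compact_imp_bounded simp: bounded_iff)
    then show ?thesis by (intro exI[of _ M]) (auto simp: cbox_Pair_eq abs_le_iff)
  qed
  then show ?thesis using borel_measurable_continuous_onI[OF c] by (simp add: bmeas_def)
qed

lemma bmeas_mult: assumes "bmeas f" "bmeas g" shows "bmeas (\<lambda>x y. f x y * g x y)"
  unfolding bmeas_def
proof (intro conjI allI)
  show "(\<lambda>z. f (fst z) (snd z) * g (fst z) (snd z)) \<in> borel_measurable borel"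
    using assms unfolding bmeas_def by (intro borel_measurable_times) auto
  fix a b
  obtain M N where "\<And>x y. \<bar>x\<bar> \<le> a \<Longrightarrow> \<bar>y\<bar> \<le> b \<Longrightarrow> \<bar>f x y\<bar> \<le> M" "\<And>x y. \<bar>x\<bar> \<le> a \<Longrightarrow> \<bar>y\<bar> \<le> b \<Longrightarrow> \<bar>g x y\<bar> \<le> N"
    using bmeasD[OF assms(1), of a b] bmeasD[OF assms(2), of a b] by blast
  then have "\<bar>f x y * g x y\<bar> \<le> M * N" if "\<bar>x\<bar> \<le> a" "\<bar>y\<bar> \<le> b" for x y
    using that unfolding abs_mult by (intro mult_mono) (auto intro: order.trans[OF abs_ge_zero])
  then show "\<exists>M. \<forall>x y. \<bar>x\<bar> \<le> a \<longrightarrow> \<bar>y\<bar> \<le> b \<longrightarrow> \<bar>f x y * g x y\<bar> \<le> M" by blast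
qed

lemma bmeas_shift: assumes "bmeas f" shows "bmeas (\<lambda>x y. f (x + r) (y + s))"
  unfolding bmeas_def
proof (intro conjI allI)
  have "(\<lambda>z. f (fst z) (snd z)) \<in> borel_measurable borel" using assms by (simp add: bmeas_def)
  from measurable_compose[OF _ this, of "\<lambda>z. (fst z + r, snd z + s)" borel]
  show "(\<lambda>z. f (fst z + r) (snd z + s)) \<in> borel_measurable borel"
    by (simp add: borel_measurable_continuous_onI continuous_intros)
  fix a b
  obtain M where M: "\<And>x y. \<bar>x\<bar> \<le> a + \<bar>r\<bar> \<Longrightarrow> \<bar>y\<bar> \<le> b + \<bar>s\<bar> \<Longrightarrow> \<bar>f x y\<bar> \<le> M"
    using bmeasD[OF assms, of "a + \<bar>r\<bar>" "b + \<bar>s\<bar>"] by blast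
  have "\<bar>f (x + r) (y + s)\<bar> \<le> M" if "\<bar>x\<bar> \<le> a" "\<bar>y\<bar> \<le> b" for x y using that by (intro M) linarith+
  then show "\<exists>M. \<forall>x y. \<bar>x\<bar> \<le> a \<longrightarrow> \<bar>y\<bar> \<le> b \<longrightarrow> \<bar>f (x + r) (y + s)\<bar> \<le> M" by blast
qed

lemma bmeas_if:
  assumes "bmeas f" "bmeas g"
  shows "bmeas (\<lambda>x y. if x < 0 then f x y else g x y)" "bmeas (\<lambda>x y. if y < 0 then f x y else g x y)"
proof -
  have s: "{z::real \<times> real. fst z < 0} \<in> sets borel" "{z::real \<times> real. snd z < 0} \<in> sets borel"
    by (intro borel_open open_Collect_less continuous_intros)+
  have m: "(\<lambda>z. f (fst z) (snd z)) \<in> borel_measurable borel" "(\<lambda>z. g (fst z) (snd z)) \<in> borel_measurable borel"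
    using assms by (auto simp: bmeas_def)
  have bd: "\<exists>M. \<forall>x y. \<bar>x\<bar> \<le> a \<longrightarrow> \<bar>y\<bar> \<le> b \<longrightarrow> \<bar>f x y\<bar> \<le> M \<and> \<bar>g x y\<bar> \<le> M" for a b
  proof -
    obtain M N where "\<And>x y. \<bar>x\<bar> \<le> a \<Longrightarrow> \<bar>y\<bar> \<le> b \<Longrightarrow> \<bar>f x y\<bar> \<le> M" "\<And>x y. \<bar>x\<bar> \<le> a \<Longrightarrow> \<bar>y\<bar> \<le> b \<Longrightarrow> \<bar>g x y\<bar> \<le> N"
      using bmeasD[OF assms(1), of a b] bmeasD[OF assms(2), of a b] by blast
    then show ?thesis by (intro exI[of _ "max M N"]) (auto intro: le_max_iff_disj[THEN iffD2])
  qed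
  show "bmeas (\<lambda>x y. if x < 0 then f x y else g x y)" "bmeas (\<lambda>x y. if y < 0 then f x y else g x y)"
  proof -
    have e1: "\<exists>M. \<forall>x y. \<bar>x\<bar> \<le> a \<longrightarrow> \<bar>y\<bar> \<le> b \<longrightarrow> \<bar>if P x y then f x y else g x y\<bar> \<le> M" for P and a b
      using bd[of a b] by (elim exE, intro exI) auto
    have e2: "(\<lambda>z. if fst z < 0 then f (fst z) (snd z) else g (fst z) (snd z)) \<in> borel_measurable borel"
      "(\<lambda>z. if snd z < 0 then f (fst z) (snd z) else g (fst z) (snd z)) \<in> borel_measurable borel"
      by (rule measurable_If[OF m], use s in simp)+
    show "bmeas (\<lambda>x y. if x < 0 then f x y else g x y)" "bmeas (\<lambda>x y. if y < 0 then f x y else g x y)"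
      unfolding bmeas_def by (intro conjI allI; rule e2 e1)+
  qed
qed

lemma bmeas_integrable:
  assumes "bmeas f"
  shows "set_integrable lborel ({- a..a} \<times> {- b..b}) (\<lambda>z. f (fst z) (snd z))"
    "(\<lambda>z. f (fst z) (snd z)) integrable_on ({- a..a} \<times> {- b..b})"
    "x \<in> {- a..a} \<Longrightarrow> set_integrable lborel {- b..b} (f x)"
    "y \<in> {- b..b} \<Longrightarrow> set_integrable lborel {- a..a} (\<lambda>x. f x y)"
proof -
  have m: "(\<lambda>z. f (fst z) (snd z)) \<in> borel_measurable borel" using assms by (simp add: bmeas_def)
  obtain M where M: "\<And>x y. \<bar>x\<bar> \<le> a \<Longrightarrow> \<bar>y\<bar> \<le> b \<Longrightarrow> \<bar>f x y\<bar> \<le> M" using bmeasD[OF assms, of a b] by blast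
  have gen: "set_integrable lborel S g" if "S \<in> sets borel" "emeasure lborel S < \<infinity>" "g \<in> borel_measurable borel" "\<And>z. z \<in> S \<Longrightarrow> \<bar>g z\<bar> \<le> M"
    for S :: "'z::euclidean_space set" and g
    unfolding set_integrable_def
  proof (rule Bochner_Integration.integrable_bound)
    show "integrable lborel (\<lambda>z. indicator S z *\<^sub>R M)"
      using that by (intro integrable_scaleR_left integrable_real_indicator) auto
    show "(\<lambda>z. indicator S z *\<^sub>R g z) \<in> borel_measurable lborel" using that by measurable
    show "AE z in lborel. norm (indicat_real S z *\<^sub>R g z) \<le> norm (indicat_real S z *\<^sub>R M)"
    proof (intro AE_I2)
      fix z
      show "norm (indicat_real S z *\<^sub>R g z) \<le> norm (indicat_real S z *\<^sub>R M)"
        using that(4)[of z] by (cases "z \<in> S") auto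
    qed
  qed
  have box: "({- a..a} \<times> {- b..b}) = cbox (- a, - b) (a, b)" by (simp add: cbox_Pair_eq)
  show s: "set_integrable lborel ({- a..a} \<times> {- b..b}) (\<lambda>z. f (fst z) (snd z))"
  proof (rule gen)
    show "({- a..a} \<times> {- b..b}) \<in> sets borel" unfolding box by simp
    show "emeasure lborel ({- a..a} \<times> {- b..b}) < \<infinity>" unfolding box by (rule emeasure_lborel_cbox_finite)
    show "\<bar>f (fst z) (snd z)\<bar> \<le> M" if "z \<in> {- a..a} \<times> {- b..b}" for z
      using that by (intro M) (auto simp: abs_le_iff)
  qed (rule m)
  show "(\<lambda>z. f (fst z) (snd z)) integrable_on ({- a..a} \<times> {- b..b})"
    using set_borel_integral_eq_integral(1)[OF s] .
  have m1: "f x \<in> borel_measurable borel" for x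
    using measurable_compose[OF _ m, of "\<lambda>y. (x, y)" borel] by (simp add: borel_measurable_continuous_onI continuous_intros)
  have m2: "(\<lambda>x. f x y) \<in> borel_measurable borel" for y
    using measurable_compose[OF _ m, of "\<lambda>x. (x, y)" borel] by (simp add: borel_measurable_continuous_onI continuous_intros)
  have e: "emeasure lborel {c..d::real} < \<infinity>" for c d using emeasure_lborel_cbox_finite[of c d] by simp
  show "x \<in> {- a..a} \<Longrightarrow> set_integrable lborel {- b..b} (f x)"
    using M by (intro gen m1 e) (auto simp: abs_le_iff)
  show "y \<in> {- b..b} \<Longrightarrow> set_integrable lborel {- a..a} (\<lambda>x. f x y)"
    using M by (intro gen m2 e) (auto simp: abs_le_iff)
qed

lemma bmeas_fubini:
  assumes "bmeas f"
  shows "integral ({- a..a} \<times> {- b..b}) (\<lambda>z. f (fst z) (snd z)) = integral {- a..a} (\<lambda>x. integral {- b..b} (f x))"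
    "integral ({- a..a} \<times> {- b..b}) (\<lambda>z. f (fst z) (snd z)) = integral {- b..b} (\<lambda>y. integral {- a..a} (\<lambda>x. f x y))"
    "(\<lambda>x. integral {- b..b} (f x)) integrable_on {- a..a}"
    "(\<lambda>y. integral {- a..a} (\<lambda>x. f x y)) integrable_on {- b..b}"
proof -
  note I = bmeas_integrable[OF assms, where a = a and b = b]
  define F where "F z = indicat_real ({- a..a} \<times> {- b..b}) z *\<^sub>R f (fst z) (snd z)" for z
  have F: "integrable (lborel \<Otimes>\<^sub>M lborel) F"
    using I(1) by (simp add: set_integrable_def F_def[abs_def] lborel_prod)
  have i1: "(LINT y|lborel. F (x, y)) = indicat_real {- a..a} x *\<^sub>R integral {- b..b} (f x)" for x
  proof (cases "x \<in> {- a..a}")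
    case True
    have "(LINT y|lborel. F (x, y)) = (LINT y:{- b..b}|lborel. f x y)"
      unfolding set_lebesgue_integral_def using True by (intro Bochner_Integration.integral_cong) (auto simp: F_def indicator_def)
    also have "\<dots> = integral {- b..b} (f x)" by (rule set_borel_integral_eq_integral(2)[OF I(3)[OF True]])
    finally show ?thesis using True by simp
  qed (auto simp: F_def indicator_def)
  have i2: "(LINT x|lborel. F (x, y)) = indicat_real {- b..b} y *\<^sub>R integral {- a..a} (\<lambda>x. f x y)" for y
  proof (cases "y \<in> {- b..b}")
    case True
    have "(LINT x|lborel. F (x, y)) = (LINT x:{- a..a}|lborel. f x y)"
      unfolding set_lebesgue_integral_def using True by (intro Bochner_Integration.integral_cong) (auto simp: F_def indicator_def)
    also have "\<dots> = integral {- a..a} (\<lambda>x. f x y)" by (rule set_borel_integral_eq_integral(2)[OF I(4)[OF True]])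
    finally show ?thesis using True by simp
  qed (auto simp: F_def indicator_def)
  have Fs: "integrable (lborel \<Otimes>\<^sub>M lborel) (\<lambda>(x, y). F (x, y))" using F by simp
  have s1: "set_integrable lborel {- a..a} (\<lambda>x. integral {- b..b} (f x))"
    using lborel_pair.integrable_fst[OF Fs] by (simp add: i1 set_integrable_def)
  have s2: "set_integrable lborel {- b..b} (\<lambda>y. integral {- a..a} (\<lambda>x. f x y))"
    using lborel_pair.integrable_snd[OF Fs] by (simp add: i2 set_integrable_def)
  have w: "integral ({- a..a} \<times> {- b..b}) (\<lambda>z. f (fst z) (snd z)) = integral\<^sup>L (lborel \<Otimes>\<^sub>M lborel) F"
    using set_borel_integral_eq_integral(2)[OF I(1)] by (simp add: set_lebesgue_integral_def F_def[abs_def] lborel_prod)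
  show "integral ({- a..a} \<times> {- b..b}) (\<lambda>z. f (fst z) (snd z)) = integral {- a..a} (\<lambda>x. integral {- b..b} (f x))"
    using lborel_pair.integral_fst[OF Fs] set_borel_integral_eq_integral(2)[OF s1] by (simp add: w i1 set_lebesgue_integral_def)
  show "integral ({- a..a} \<times> {- b..b}) (\<lambda>z. f (fst z) (snd z)) = integral {- b..b} (\<lambda>y. integral {- a..a} (\<lambda>x. f x y))"
    using lborel_pair.integral_snd[OF Fs] set_borel_integral_eq_integral(2)[OF s2] by (simp add: w i2 set_lebesgue_integral_def)
  show "(\<lambda>x. integral {- b..b} (f x)) integrable_on {- a..a}" using set_borel_integral_eq_integral(1)[OF s1] .
  show "(\<lambda>y. integral {- a..a} (\<lambda>x. f x y)) integrable_on {- b..b}" using set_borel_integral_eq_integral(1)[OF s2] .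
qed

section \<open>The cell functional: linearity, bound and exactness\<close>

definition bulk :: "real \<Rightarrow> real poly \<Rightarrow> (real \<Rightarrow> real \<Rightarrow> real) \<Rightarrow> real" where
  "bulk b p w = integral ({- (1/2)..1/2} \<times> {- b..b}) (\<lambda>z. w (fst z) (snd z) * poly p (snd z))"

definition xside :: "real \<Rightarrow> real \<Rightarrow> real poly \<Rightarrow> (real \<Rightarrow> real \<Rightarrow> real) \<Rightarrow> real" where
  "xside b x p w = integral {- b..b} (\<lambda>y. w x y * poly p y)"

definition yside :: "real \<Rightarrow> (real \<Rightarrow> real \<Rightarrow> real) \<Rightarrow> real" where
  "yside y w = integral {- (1/2)..1/2} (\<lambda>x. w x y)"

text \<open>The operator \<^const>\<open>B2\<close> on the cell \<open>[-1/2, 1/2] \<times> [-b, b]\<close> for a test function \<open>q\<close> of \<open>y\<close>.\<close>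

definition refB :: "real \<Rightarrow> real \<Rightarrow> (real \<Rightarrow> real \<Rightarrow> real) \<Rightarrow> (real \<Rightarrow> real \<Rightarrow> real) \<Rightarrow> real poly \<Rightarrow> real" where
  "refB t b wC wD q = 1 / t * (bulk b q wD - bulk b q wC) + bulk b (pderiv q) wD
     - (xside b (1/2) q wD - xside b (- (1/2)) q wD)
     - (yside b wD * poly q b - yside (- b) wD * poly q (- b))"

text \<open>The other component on a cell consists of quarters of four neighbours, whose centres lie
  half a cell away in both variables. Shifts are written as sums, such as \<open>y + - b\<close>, to
  match \<open>bmeas_shift\<close>.\<close>

definition gluX :: "nat \<Rightarrow> real \<Rightarrow> real \<Rightarrow> nat \<Rightarrow> jet \<Rightarrow> real \<Rightarrow> real \<Rightarrow> real" where
  "gluX k t b l d x y = (if x < 0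
     then (if y < 0 then locX k t b l (jshift (- (1/2)) (- b) d) (x + 1/2) (y + b)
       else locX k t b l (jshift (- (1/2)) b d) (x + 1/2) (y + - b))
     else (if y < 0 then locX k t b l (jshift (1/2) (- b) d) (x + - (1/2)) (y + b)
       else locX k t b l (jshift (1/2) b d) (x + - (1/2)) (y + - b)))"

definition cellB :: "nat \<Rightarrow> real \<Rightarrow> real \<Rightarrow> jet \<Rightarrow> real poly \<Rightarrow> real" where
  "cellB k t b d q = (\<Sum>l=0..min k 2. refB t b (locX k t b l d) (gluX k t b l d) q)"

lemma bmeas_poly: "bmeas (\<lambda>x y. poly p y)"
  using cont2_tensor[of "\<lambda>x. 1" "poly p"] by (intro cont2_bmeas) (simp add: continuous_intros)

lemma bmeas_mult_poly: "bmeas w \<Longrightarrow> bmeas (\<lambda>x y. w x y * poly p y)"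
  by (intro bmeas_mult bmeas_poly)

lemma bmeas_slice_integrable:
  assumes "bmeas w" shows "w x integrable_on {- b..b}" "(\<lambda>x. w x y) integrable_on {- a..a}"
proof -
  have "x \<in> {- \<bar>x\<bar>..\<bar>x\<bar>}" "y \<in> {- \<bar>y\<bar>..\<bar>y\<bar>}" by (simp_all only: atLeastAtMost_iff) linarith+
  then show "w x integrable_on {- b..b}" "(\<lambda>x. w x y) integrable_on {- a..a}"
    using bmeas_integrable(3)[OF assms] bmeas_integrable(4)[OF assms] set_borel_integral_eq_integral(1) by blast+
qed

lemma bulk_lin:
  assumes "bmeas f" "bmeas g"
  shows "bulk b p (\<lambda>x y. \<alpha> * f x y + \<beta> * g x y) = \<alpha> * bulk b p f + \<beta> * bulk b p g"
proof -
  note I = bmeas_integrable(2)[OF bmeas_mult_poly[OF assms(1)], where a = "1/2" and b = b and p1 = p]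
    bmeas_integrable(2)[OF bmeas_mult_poly[OF assms(2)], where a = "1/2" and b = b and p1 = p]
  have "bulk b p (\<lambda>x y. \<alpha> * f x y + \<beta> * g x y) = integral ({- (1/2)..1/2} \<times> {- b..b})
      (\<lambda>z. \<alpha> * (f (fst z) (snd z) * poly p (snd z)) + \<beta> * (g (fst z) (snd z) * poly p (snd z)))"
    by (simp add: bulk_def algebra_simps)
  also have "\<dots> = integral ({- (1/2)..1/2} \<times> {- b..b}) (\<lambda>z. \<alpha> * (f (fst z) (snd z) * poly p (snd z)))
     + integral ({- (1/2)..1/2} \<times> {- b..b}) (\<lambda>z. \<beta> * (g (fst z) (snd z) * poly p (snd z)))"
    by (intro integral_add integrable_on_mult_right I)
  finally show ?thesis by (simp add: bulk_def)
qed

lemma xside_lin: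
  assumes "bmeas f" "bmeas g"
  shows "xside b x p (\<lambda>x y. \<alpha> * f x y + \<beta> * g x y) = \<alpha> * xside b x p f + \<beta> * xside b x p g"
proof -
  note I = bmeas_slice_integrable(1)[OF bmeas_mult_poly[OF assms(1)], where x = x and b = b and p1 = p]
    bmeas_slice_integrable(1)[OF bmeas_mult_poly[OF assms(2)], where x = x and b = b and p1 = p]
  have "xside b x p (\<lambda>x y. \<alpha> * f x y + \<beta> * g x y) = integral {- b..b} (\<lambda>y. \<alpha> * (f x y * poly p y) + \<beta> * (g x y * poly p y))"
    by (simp add: xside_def algebra_simps)
  also have "\<dots> = integral {- b..b} (\<lambda>y. \<alpha> * (f x y * poly p y)) + integral {- b..b} (\<lambda>y. \<beta> * (g x y * poly p y))"
    by (intro integral_add integrable_on_mult_right I)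
  finally show ?thesis by (simp add: xside_def)
qed

lemma yside_lin:
  assumes "bmeas f" "bmeas g"
  shows "yside y (\<lambda>x y. \<alpha> * f x y + \<beta> * g x y) = \<alpha> * yside y f + \<beta> * yside y g"
proof -
  have "yside y (\<lambda>x y. \<alpha> * f x y + \<beta> * g x y) = integral {- (1/2)..1/2} (\<lambda>x. \<alpha> * f x y) + integral {- (1/2)..1/2} (\<lambda>x. \<beta> * g x y)"
    unfolding yside_def by (intro integral_add integrable_on_mult_right bmeas_slice_integrable assms)
  then show ?thesis by (simp add: yside_def)
qed

lemma refB_lin:
  assumes "bmeas f" "bmeas g" "bmeas f'" "bmeas g'"
  shows "refB t b (\<lambda>x y. \<alpha> * f x y + \<beta> * f' x y) (\<lambda>x y. \<alpha> * g x y + \<beta> * g' x y) q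
    = \<alpha> * refB t b f g q + \<beta> * refB t b f' g' q"
  unfolding refB_def bulk_lin[OF assms(1,3)] bulk_lin[OF assms(2,4)] xside_lin[OF assms(2,4)] yside_lin[OF assms(2,4)]
  by (simp add: algebra_simps add_divide_distrib diff_divide_distrib)

lemma refB_bound:
  assumes t: "t > 0" and b: "b > 0" and w: "bmeas wC" "bmeas wD"
    and bd: "\<And>x y. \<bar>x\<bar> \<le> 1/2 \<Longrightarrow> \<bar>y\<bar> \<le> b \<Longrightarrow> \<bar>wC x y\<bar> \<le> M \<and> \<bar>wD x y\<bar> \<le> M"
    and q: "\<And>y. \<bar>y\<bar> \<le> b \<Longrightarrow> \<bar>poly q y\<bar> \<le> N \<and> \<bar>poly (pderiv q) y\<bar> \<le> N"
  shows "\<bar>refB t b wC wD q\<bar> \<le> (4 * b / t + 6 * b + 2) * (M * N)"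
proof -
  have M: "M \<ge> 0" and N: "N \<ge> 0" using bd[of 0 0] q[of 0] b by auto
  have bulk: "\<bar>bulk b p w\<bar> \<le> 2 * b * (M * N)"
    if "bmeas w" "\<And>x y. \<bar>x\<bar> \<le> 1/2 \<Longrightarrow> \<bar>y\<bar> \<le> b \<Longrightarrow> \<bar>w x y\<bar> \<le> M" "\<And>y. \<bar>y\<bar> \<le> b \<Longrightarrow> \<bar>poly p y\<bar> \<le> N" for w p
  proof -
    have bx: "{- (1/2)..1/2} \<times> {- b..b} = cbox (- (1/2), - b) (1/2::real, b)" by (simp add: cbox_Pair_eq)
    have "(\<lambda>z. w (fst z) (snd z) * poly p (snd z)) integrable_on cbox (- (1/2), - b) (1/2, b)"
      using bmeas_integrable(2)[OF bmeas_mult_poly[OF that(1)], where a = "1/2" and b = b and p1 = p] unfolding bx .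
    then have hi: "((\<lambda>z. w (fst z) (snd z) * poly p (snd z)) has_integral bulk b p w) (cbox (- (1/2), - b) (1/2, b))"
      unfolding bulk_def bx by (rule integrable_integral)
    have "norm (bulk b p w) \<le> (M * N) * Henstock_Kurzweil_Integration.content (cbox (- (1/2), - b) (1/2::real, b))"
    proof (rule has_integral_bound[OF _ hi])
      show "0 \<le> M * N" using M N by simp
      fix z assume "z \<in> cbox (- (1/2), - b) (1/2::real, b)"
      then have z: "\<bar>fst z\<bar> \<le> 1/2" "\<bar>snd z\<bar> \<le> b" by (auto simp: bx[symmetric] abs_le_iff)
      show "norm (w (fst z) (snd z) * poly p (snd z)) \<le> M * N"
        using that(2)[OF z] that(3)[OF z(2)] M by (simp add: abs_mult mult_mono)
    qed
    also have "Henstock_Kurzweil_Integration.content (cbox (- (1/2), - b) (1/2::real, b)) = 2 * b"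
      using b by (simp add: content_Pair)
    finally show ?thesis by (simp add: mult_ac)
  qed
  have xs: "\<bar>xside b x q wD\<bar> \<le> 2 * b * (M * N)" if "\<bar>x\<bar> \<le> 1/2" for x
  proof -
    have "\<bar>xside b x q wD\<bar> \<le> (M * N) * (b - (- b))"
      unfolding xside_def
    proof (rule abs_integral_le)
      show "(\<lambda>y. wD x y * poly q y) integrable_on {- b..b}" by (intro bmeas_slice_integrable bmeas_mult_poly w)
      fix y assume "y \<in> {- b..b}"
      then have "\<bar>y\<bar> \<le> b" by auto
      then show "\<bar>wD x y * poly q y\<bar> \<le> M * N" using bd[OF that] q M by (simp add: abs_mult mult_mono)
    qed (use b in simp)
    then show ?thesis by (simp add: mult_ac)
  qed
  have ys: "\<bar>yside y wD * poly q y\<bar> \<le> M * N" if "\<bar>y\<bar> \<le> b" for y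
  proof -
    have "\<bar>yside y wD\<bar> \<le> M * (1/2 - (- (1/2)))"
      unfolding yside_def
    proof (rule abs_integral_le)
      show "(\<lambda>x. wD x y) integrable_on {- (1/2)..1/2}" by (intro bmeas_slice_integrable w)
      fix x :: real assume "x \<in> {- (1/2)..1/2}"
      then have "\<bar>x\<bar> \<le> 1/2" by (simp only: atLeastAtMost_iff) linarith
      then show "\<bar>wD x y\<bar> \<le> M" using bd that by blast
    qed simp
    then show ?thesis using q[OF that] M by (simp add: abs_mult mult_mono)
  qed
  have b1: "\<bar>bulk b q wD\<bar> \<le> 2 * b * (M * N)" "\<bar>bulk b q wC\<bar> \<le> 2 * b * (M * N)" "\<bar>bulk b (pderiv q) wD\<bar> \<le> 2 * b * (M * N)"
    using bd q by (intro bulk w; blast)+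
  have *: "\<bar>1 / t * (bulk b q wD - bulk b q wC)\<bar> \<le> 1 / t * (4 * b * (M * N))"
    unfolding abs_mult using b1 t by (intro mult_mono) auto
  \<comment> \<open>The reference cell has area 2b: the mass terms give 4b / t, the derivative term
    2b, the vertical sides 4b and the horizontal sides 2.\<close>
  then have "\<bar>refB t b wC wD q\<bar> \<le> 1 / t * (4 * b * (M * N)) + 2 * b * (M * N) + 4 * b * (M * N) + 2 * (M * N)"
  proof -
    have "\<bar>xside b (1/2) q wD\<bar> \<le> 2 * b * (M * N)" "\<bar>xside b (- (1/2)) q wD\<bar> \<le> 2 * b * (M * N)"
      "\<bar>yside b wD * poly q b\<bar> \<le> M * N" "\<bar>yside (- b) wD * poly q (- b)\<bar> \<le> M * N"
      using b by (intro xs ys; simp)+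
    with * b1(3) show ?thesis unfolding refB_def by linarith
  qed
  then show ?thesis by (simp add: algebra_simps)
qed

lemma gluX_bmeas: assumes "jcont d" shows "bmeas (gluX k t b l d)"
  unfolding gluX_def
  by (intro bmeas_if bmeas_shift[of "locX _ _ _ _ _"] cont2_bmeas locX_cont2 jcont_intros assms)

lemma locX_bmeas: "jcont d \<Longrightarrow> bmeas (locX k t b l d)"
  by (intro cont2_bmeas locX_cont2)

lemma gluX_jlin:
  assumes "jcont d" "jcont d'"
  shows "gluX k t b l (jlin \<alpha> d \<beta> d') x y = \<alpha> * gluX k t b l d x y + \<beta> * gluX k t b l d' x y"
  unfolding gluX_def by (simp add: jet_ops_jlin locX_jlin jcont_intros assms)

lemma cellB_jlin:
  assumes "jcont d" "jcont d'"
  shows "cellB k t b (jlin \<alpha> d \<beta> d') q = \<alpha> * cellB k t b d q + \<beta> * cellB k t b d' q"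
proof -
  have "locX k t b l (jlin \<alpha> d \<beta> d') = (\<lambda>x y. \<alpha> * locX k t b l d x y + \<beta> * locX k t b l d' x y)"
    "gluX k t b l (jlin \<alpha> d \<beta> d') = (\<lambda>x y. \<alpha> * gluX k t b l d x y + \<beta> * gluX k t b l d' x y)" for l
    by (simp_all add: fun_eq_iff locX_jlin gluX_jlin assms)
  then show ?thesis
    unfolding cellB_def by (simp only: refB_lin[OF locX_bmeas gluX_bmeas locX_bmeas gluX_bmeas, OF assms(1) assms(1) assms(2) assms(2)] sum.distrib sum_distrib_left)
qed

text \<open>A level up to 2 reaches 3/2 from the centre in x, and passing to a neighbour adds 1/2;
  in y the shift reaches 2b. The neighbourhood of five by five cells contains this with room to
  spare.\<close>

definition pbound :: "real \<Rightarrow> jet \<Rightarrow> real \<Rightarrow> bool" where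
  "pbound b d M \<longleftrightarrow> jcont d \<and>
    (\<forall>a c x y. a + c \<le> 2 \<longrightarrow> \<bar>x\<bar> \<le> 5/2 \<longrightarrow> \<bar>y\<bar> \<le> 5 * b \<longrightarrow> \<bar>d a c x y\<bar> \<le> M)"

lemma cellB_bound:
  assumes t: "t > 0" and b: "b > 0"
  shows "\<exists>C\<ge>0. \<forall>d q M N. pbound b d M \<longrightarrow> (\<forall>y. \<bar>y\<bar> \<le> b \<longrightarrow> \<bar>poly q y\<bar> \<le> N \<and> \<bar>poly (pderiv q) y\<bar> \<le> N) \<longrightarrow>
    \<bar>cellB k t b d q\<bar> \<le> C * (M * N)"
proof -
  have "\<exists>C\<ge>0. \<forall>d M. (\<forall>y. \<bar>y\<bar> \<le> b \<longrightarrow> jbound l ((real l + 1) / 2) d y M) \<longrightarrow>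
    (\<forall>x y. \<bar>x\<bar> \<le> 1/2 \<longrightarrow> \<bar>y\<bar> \<le> b \<longrightarrow> \<bar>locX k t b l d x y\<bar> \<le> C * M)" for l by (rule locX_bound[OF b])
  then obtain A where A: "\<And>l. A l \<ge> 0" "\<And>l d M x y. (\<forall>y. \<bar>y\<bar> \<le> b \<longrightarrow> jbound l ((real l + 1) / 2) d y M) \<Longrightarrow>
    \<bar>x\<bar> \<le> 1/2 \<Longrightarrow> \<bar>y\<bar> \<le> b \<Longrightarrow> \<bar>locX k t b l d x y\<bar> \<le> A l * M" by metis
  define K where "K = 4 * b / t + 6 * b + 2"
  have K: "K \<ge> 0" using t b by (simp add: K_def)
  have "\<bar>cellB k t b d q\<bar> \<le> (\<Sum>l=0..min k 2. K * A l) * (M * N)"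
    if d: "pbound b d M" and q: "\<And>y. \<bar>y\<bar> \<le> b \<Longrightarrow> \<bar>poly q y\<bar> \<le> N \<and> \<bar>poly (pderiv q) y\<bar> \<le> N" for d q M N
  proof -
    have jd: "jcont d" using d by (simp add: pbound_def)
    have "\<bar>refB t b (locX k t b l d) (gluX k t b l d) q\<bar> \<le> (K * A l) * (M * N)" if l: "l \<le> 2" for l
    proof -
      have l2: "(real l + 1) / 2 \<le> 3/2" using l by simp
      have sh: "\<forall>y. \<bar>y\<bar> \<le> b \<longrightarrow> jbound l ((real l + 1) / 2) (jshift r s d) y M" if "\<bar>r\<bar> \<le> 1/2" "\<bar>s\<bar> \<le> b" for r s
      proof (intro allI impI)
        fix y assume y: "\<bar>y\<bar> \<le> b"
        have "\<bar>d a c (x + r) (y + s)\<bar> \<le> M" if "a + c \<le> l" "\<bar>x\<bar> \<le> (real l + 1) / 2" for a c x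
        proof -
          have "\<bar>x + r\<bar> \<le> 5/2" using that \<open>\<bar>r\<bar> \<le> 1/2\<close> l2 by linarith
          moreover have "\<bar>y + s\<bar> \<le> 5 * b" using y \<open>\<bar>s\<bar> \<le> b\<close> b by linarith
          moreover have "a + c \<le> 2" using that l by simp
          ultimately show ?thesis using d unfolding pbound_def by blast
        qed
        then show "jbound l ((real l + 1) / 2) (jshift r s d) y M"
          unfolding jbound_def using jcont_jshift[OF jd] by (auto simp: jshift_def)
      qed
      have 0: "\<bar>locX k t b l d x y\<bar> \<le> A l * M" if "\<bar>x\<bar> \<le> 1/2" "\<bar>y\<bar> \<le> b" for x y
      proof -
        have "jshift 0 0 d = d" by (simp add: jshift_def)
        then show ?thesis using A(2)[OF sh[of 0 0] that] b by simp
      qed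
      have 1: "\<bar>gluX k t b l d x y\<bar> \<le> A l * M" if "\<bar>x\<bar> \<le> 1/2" "\<bar>y\<bar> \<le> b" for x y
      proof -
        have s: "\<bar>r\<bar> \<le> 1/2 \<Longrightarrow> \<bar>s\<bar> \<le> b \<Longrightarrow> \<bar>x'\<bar> \<le> 1/2 \<Longrightarrow> \<bar>y'\<bar> \<le> b \<Longrightarrow>
          \<bar>locX k t b l (jshift r s d) x' y'\<bar> \<le> A l * M" for r s x' y'
          by (rule A(2)[OF sh])
        show ?thesis unfolding gluX_def using that b 
          by (cases "x < 0"; cases "y < 0"; simp only: if_True if_False; intro s; linarith)
      qed
      have "\<bar>refB t b (locX k t b l d) (gluX k t b l d) q\<bar> \<le> K * ((A l * M) * N)"
        unfolding K_def by (intro refB_bound t b locX_bmeas gluX_bmeas jd conjI 0 1 q)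
      then show ?thesis by (simp add: mult_ac)
    qed
    then show ?thesis unfolding cellB_def sum_distrib_right
      by (intro order.trans[OF sum_abs] sum_mono) auto
  qed
  moreover have "(\<Sum>l=0..min k 2. K * A l) \<ge> 0" using K A(1) by (intro sum_nonneg) auto
  ultimately show ?thesis by blast
qed

lemma locglue_bmeas: assumes "jcont d" shows "bmeas (locglue k t l d)"
proof -
  have "locglue k t l d = (\<lambda>x y. if x < 0 then loc k t l (jshift (- (1/2)) 0 d) (x + 1/2) (y + 0)
      else loc k t l (jshift (1/2) 0 d) (x + - (1/2)) (y + 0))"
    by (auto simp: fun_eq_iff locglue_def xglue_def)
  moreover have "bmeas \<dots>"
    by (intro bmeas_if bmeas_shift[of "loc _ _ _ _"] cont2_bmeas loc_cont2 jcont_intros assms)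
  ultimately show ?thesis by simp
qed

lemma locglue_deriv:
  assumes "pjet n d" shows "((\<lambda>y. locglue k t l d x y) has_real_derivative locglue k t l (jdy d) x y) (at y)"
proof (cases "x < 0")
  case True
  then show ?thesis
    using loc_deriv_snd[OF pjet_jshift_fst[OF assms], of k t l "- (1/2)" "x + 1/2" y]
    by (simp add: locglue_def xglue_def jet_ops_commute)
next
  case False
  then show ?thesis
    using loc_deriv_snd[OF pjet_jshift_fst[OF assms], of k t l "1/2" "x - 1/2" y]
    by (simp add: locglue_def xglue_def jet_ops_commute)
qed

lemma bulk_fubini:
  assumes "bmeas w"
  shows "bulk b p w = integral {- b..b} (\<lambda>y. poly p y * integral {- (1/2)..1/2} (\<lambda>x. w x y))"
    "bulk b p w = integral {- (1/2)..1/2} (\<lambda>x. integral {- b..b} (\<lambda>y. w x y * poly p y))"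
    "(\<lambda>y. poly p y * integral {- (1/2)..1/2} (\<lambda>x. w x y)) integrable_on {- b..b}"
    "(\<lambda>x. integral {- b..b} (\<lambda>y. w x y * poly p y)) integrable_on {- (1/2)..1/2}"
  using bmeas_fubini[OF bmeas_mult_poly[OF assms], where a = "1/2" and b = b and p1 = p] by (simp_all add: bulk_def mult.commute)

text \<open>Integrating by parts on each vertical line moves the derivative from \<open>q\<close> to
  the glued function, and the boundary values cancel the two horizontal sides. What is left is q(y)
  times integrals and point values in x. Differentiating in y is possible because gluing takes place
  in x only.\<close>

lemma refB_exact:
  assumes t: "t > 0" and b: "b > 0" and d: "pjet n d"
  shows "refB t b (loc k t l d) (locglue k t l d) q = integral {- b..b} (\<lambda>y. poly q y * xresidual k t l d y)"
    and "(\<lambda>y. poly q y * xresidual k t l d y) integrable_on {- b..b}"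
proof -
  let ?w = "locglue k t l d" and ?v = "locglue k t l (jdy d)" and ?c = "loc k t l d"
  have jd: "jcont d" "jcont (jdy d)" using pjet_jcont[OF d] jcont_jdy by blast+
  note w = locglue_bmeas[OF jd(1), of k t l] and v = locglue_bmeas[OF jd(2), of k t l] and c = cont2_bmeas[OF loc_cont2[OF jd(1)], of k t l]
  have ibp: "integral {- b..b} (\<lambda>y. ?w x y * poly (pderiv q) y)
      = (?w x b * poly q b - ?w x (- b) * poly q (- b)) - integral {- b..b} (\<lambda>y. ?v x y * poly q y)" for x
  proof -
    have "((\<lambda>y. ?v x y * poly q y + poly (pderiv q) y * ?w x y) has_integral (?w x b * poly q b - ?w x (- b) * poly q (- b))) {- b..b}"
    proof (rule fundamental_theorem_of_calculus)
      fix y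
      show "((\<lambda>y. ?w x y * poly q y) has_vector_derivative ?v x y * poly q y + poly (pderiv q) y * ?w x y) (at y within {- b..b})"
        unfolding has_real_derivative_iff_has_vector_derivative[symmetric]
        by (rule DERIV_subset[OF DERIV_mult[OF locglue_deriv[OF d] poly_DERIV]]) simp
    qed (use b in simp)
    moreover have "integral {- b..b} (\<lambda>y. ?v x y * poly q y + poly (pderiv q) y * ?w x y)
      = integral {- b..b} (\<lambda>y. ?v x y * poly q y) + integral {- b..b} (\<lambda>y. poly (pderiv q) y * ?w x y)"
      using bmeas_slice_integrable(1)[OF bmeas_mult_poly[OF v], where x = x and b = b and p1 = q]
        bmeas_slice_integrable(1)[OF bmeas_mult_poly[OF w], where x = x and b = b and p1 = "pderiv q"]
      by (intro integral_add) (simp_all add: mult.commute)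
    ultimately show ?thesis by (simp add: has_integral_iff mult.commute)
  qed
  have ys: "(\<lambda>x. ?w x y) integrable_on {- (1/2)..1/2}" for y by (rule bmeas_slice_integrable(2)[OF w])
  have B': "bulk b (pderiv q) ?w = (yside b ?w * poly q b - yside (- b) ?w * poly q (- b)) - bulk b q ?v"
  proof -
    have "bulk b (pderiv q) ?w = integral {- (1/2)..1/2} (\<lambda>x. (?w x b * poly q b - ?w x (- b) * poly q (- b)) - integral {- b..b} (\<lambda>y. ?v x y * poly q y))"
      unfolding bulk_fubini(2)[OF w] ibp ..
    also have "\<dots> = integral {- (1/2)..1/2} (\<lambda>x. ?w x b * poly q b - ?w x (- b) * poly q (- b)) - integral {- (1/2)..1/2} (\<lambda>x. integral {- b..b} (\<lambda>y. ?v x y * poly q y))"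
      by (intro integral_diff integrable_diff integrable_on_mult_left ys bulk_fubini(4) v)
    also have "integral {- (1/2)..1/2} (\<lambda>x. ?w x b * poly q b - ?w x (- b) * poly q (- b))
        = integral {- (1/2)..1/2} (\<lambda>x. ?w x b * poly q b) - integral {- (1/2)..1/2} (\<lambda>x. ?w x (- b) * poly q (- b))"
      by (intro integral_diff integrable_on_mult_left ys)
    finally show ?thesis unfolding bulk_fubini(2)[OF v] by (simp add: yside_def)
  qed
  define X where "X = (\<lambda>y. loc k t l (jshift (1/2) 0 d) 0 y - loc k t l (jshift (- (1/2)) 0 d) 0 y)"
  have gl: "?w (1/2) y = loc k t l (jshift (1/2) 0 d) 0 y" "?w (- (1/2)) y = loc k t l (jshift (- (1/2)) 0 d) 0 y" for y
    by (simp_all add: locglue_def xglue_def)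
  have i2: "(\<lambda>y. poly q y * X y) integrable_on {- b..b}"
    unfolding X_def by (intro continuous_imp_integrable continuous_intros cont2_slices(1) loc_cont2 jcont_intros jd)
  have xs: "xside b (1/2) q ?w - xside b (- (1/2)) q ?w = integral {- b..b} (\<lambda>y. poly q y * X y)"
    unfolding xside_def X_def gl right_diff_distrib
    by (subst integral_diff) (simp_all add: mult.commute, (intro continuous_imp_integrable continuous_intros cont2_slices(1) loc_cont2 jcont_intros jd)+)
  let ?I = "\<lambda>w y. integral {- (1/2)..1/2} (\<lambda>x. w x y)"
  have xr: "xresidual k t l d y = 1 / t * (?I ?w y - ?I ?c y) - X y - ?I ?v y" for y
    unfolding xresidual_def X_def
    by (subst integral_diff) (auto intro!: ys bmeas_slice_integrable(2)[OF c])
  have e: "poly q y * xresidual k t l d y = (1 / t * (poly q y * ?I ?w y - poly q y * ?I ?c y) - poly q y * X y) - poly q y * ?I ?v y" for y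
    unfolding xr by (simp add: algebra_simps)
  note I = bulk_fubini(3)[OF w, where p = q and b = b] bulk_fubini(3)[OF c, where p = q and b = b] bulk_fubini(3)[OF v, where p = q and b = b]
  show "(\<lambda>y. poly q y * xresidual k t l d y) integrable_on {- b..b}"
    unfolding e by (intro integrable_diff integrable_on_mult_right I i2)
  have "integral {- b..b} (\<lambda>y. poly q y * xresidual k t l d y)
    = integral {- b..b} (\<lambda>y. 1 / t * (poly q y * ?I ?w y - poly q y * ?I ?c y)) - integral {- b..b} (\<lambda>y. poly q y * X y) - integral {- b..b} (\<lambda>y. poly q y * ?I ?v y)"
    unfolding e by (subst integral_diff, intro integrable_diff integrable_on_mult_right I i2, rule I,
        subst integral_diff, intro integrable_diff integrable_on_mult_right I, rule i2, rule refl)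
  also have "integral {- b..b} (\<lambda>y. 1 / t * (poly q y * ?I ?w y - poly q y * ?I ?c y)) = 1 / t * (bulk b q ?w - bulk b q ?c)"
    unfolding bulk_fubini(1)[OF w] bulk_fubini(1)[OF c]
    by (subst integral_mult_right, subst integral_diff) (intro I refl)+
  finally show "refB t b ?c ?w q = integral {- b..b} (\<lambda>y. poly q y * xresidual k t l d y)"
    unfolding refB_def B' xs bulk_fubini(1)[OF v] by simp
qed

text \<open>The sum over the levels is taken inside the integral: single residuals need not vanish,
  only their sum does.\<close>

lemma cellB_exact:
  assumes t: "t > 0" and b: "b > 0" and k: "k \<ge> 1" and d: "pjet n d" "n \<le> 2 * k + 2" "n \<le> k + 4"
  shows "cellB k t b d q = 0"
proof -
  have X: "locX k t b l d = loc k t l d" for l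
  proof -
    have "jshift 0 0 d = d" by (simp add: jshift_def)
    then show ?thesis using locX_exact[OF t b k d(1,2), of l 0 0] by (intro ext) simp
  qed
  have G: "gluX k t b l d = locglue k t l d" for l
    by (auto simp: fun_eq_iff gluX_def locX_exact[OF t b k d(1,2)] locglue_def xglue_def)
  have "cellB k t b d q = (\<Sum>l=0..min k 2. integral {- b..b} (\<lambda>y. poly q y * xresidual k t l d y))"
    unfolding cellB_def X G refB_exact(1)[OF t b d(1)] ..
  also have "\<dots> = integral {- b..b} (\<lambda>y. \<Sum>l=0..min k 2. poly q y * xresidual k t l d y)"
    by (intro integral_sum[symmetric] refB_exact(2)[OF t b d(1)]) simp
  also have "\<dots> = integral {- b..b} (\<lambda>y. poly q y * (\<Sum>l=0..min k 2. xresidual k t l d y))"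
    by (simp only: sum_distrib_left)
  finally show ?thesis by (simp only: xresidual_sum_zero[OF t k d]) simp
qed

text \<open>Bramble-Hilbert argument: subtracting a polynomial does not change the functional, and
  the remainder is small with its derivatives up to order two, which is all that the bound of the
  functional sees.\<close>

theorem cellB_estimate:
  assumes t: "t > 0" and b: "b > 0" and k: "k \<ge> 1"
  defines "s \<equiv> min (2 * k + 2) (k + 4)"
  shows "\<exists>C\<ge>0. \<forall>d q N. smooth_jet d \<longrightarrow> (\<forall>y. \<bar>y\<bar> \<le> b \<longrightarrow> \<bar>poly q y\<bar> \<le> N \<and> \<bar>poly (pderiv q) y\<bar> \<le> N) \<longrightarrow>
    \<bar>cellB k t b d q\<bar> \<le> C * (N * (\<Sum>m\<le>s. iint (5/2) (5 * b) (\<lambda>x y. \<bar>d m (s - m) x y\<bar>)))"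
proof -
  obtain A where A: "A \<ge> 0" "\<And>d q M N. pbound b d M \<Longrightarrow> (\<forall>y. \<bar>y\<bar> \<le> b \<longrightarrow> \<bar>poly q y\<bar> \<le> N \<and> \<bar>poly (pderiv q) y\<bar> \<le> N) \<Longrightarrow>
    \<bar>cellB k t b d q\<bar> \<le> A * (M * N)" using cellB_bound[OF t b] by blast
  have s: "s \<ge> 4" using k by (simp add: s_def)
  obtain B where B: "B \<ge> 0" "\<And>d. smooth_jet d \<Longrightarrow> \<exists>p. pjet s p \<and> (\<forall>i j x y. i + j \<le> 2 \<longrightarrow> x \<in> {- (5/2)..5/2} \<longrightarrow> y \<in> {- (5 * b)..5 * b} \<longrightarrow>
    \<bar>d i j x y - p i j x y\<bar> \<le> B * (\<Sum>m\<le>s. iint (5/2) (5 * b) (\<lambda>x y. \<bar>d m (s - m) x y\<bar>)))"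
    using polynomial_approximation[of "5/2" "5 * b" s] b s by auto
  have "\<bar>cellB k t b d q\<bar> \<le> (A * B) * (N * (\<Sum>m\<le>s. iint (5/2) (5 * b) (\<lambda>x y. \<bar>d m (s - m) x y\<bar>)))"
    if d: "smooth_jet d" and q: "\<forall>y. \<bar>y\<bar> \<le> b \<longrightarrow> \<bar>poly q y\<bar> \<le> N \<and> \<bar>poly (pderiv q) y\<bar> \<le> N" for d q N
  proof -
    define S where "S = (\<Sum>m\<le>s. iint (5/2) (5 * b) (\<lambda>x y. \<bar>d m (s - m) x y\<bar>))"
    obtain p where p: "pjet s p" "\<And>i j x y. i + j \<le> 2 \<Longrightarrow> x \<in> {- (5/2)..5/2} \<Longrightarrow> y \<in> {- (5 * b)..5 * b} \<Longrightarrow> \<bar>d i j x y - p i j x y\<bar> \<le> B * S"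
      unfolding S_def using B(2)[OF d] by blast
    have jd: "jcont d" using smooth_jetD(1)[OF d] by (simp add: jcont_def cont2_def)
    note jp = pjet_jcont[OF p(1)]
    have "pbound b (jlin 1 d (-1) p) (B * S)"
      unfolding pbound_def
    proof (intro conjI allI impI jcont_jlin jd jp)
      fix a c :: nat and x y :: real
      assume h: "a + c \<le> 2" "\<bar>x\<bar> \<le> 5/2" "\<bar>y\<bar> \<le> 5 * b"
      then have "x \<in> {- (5/2)..5/2}" "y \<in> {- (5 * b)..5 * b}" by (simp_all only: atLeastAtMost_iff) linarith+
      then show "\<bar>jlin 1 d (-1) p a c x y\<bar> \<le> B * S" using p(2)[OF h(1)] by (simp add: jlin_def)
    qed
    then have "\<bar>cellB k t b (jlin 1 d (-1) p) q\<bar> \<le> A * ((B * S) * N)" by (rule A(2)[OF _ q])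
    \<comment> \<open>Here \<open>s\<close> = \<open>min (2 * k + 2) (k + 4)\<close> meets the two
      degree restrictions of exactness.\<close>
    moreover have "cellB k t b (jlin 1 d (-1) p) q = cellB k t b d q"
      using cellB_exact[OF t b k p(1)] by (simp add: cellB_jlin[OF jd jp] s_def)
    ultimately show ?thesis by (simp add: S_def mult_ac)
  qed
  then show ?thesis using A(1) B(1) by (intro exI[of _ "A * B"]) auto
qed

section \<open>Scaling to the reference cell\<close>

text \<open>No integrability is assumed: it transfers in both directions, and if it fails both
  integrals are zero. The operators can thus be rescaled before anything is known about their
  arguments.\<close>

lemma integral_affine_cbox:
  fixes g :: "'a::euclidean_space \<Rightarrow> real"
  assumes h: "h > 0" and ne: "cbox a b \<noteq> {}"
  shows "integral (cbox (h *\<^sub>R a + c) (h *\<^sub>R b + c)) g = h ^ DIM('a) * integral (cbox a b) (\<lambda>x. g (h *\<^sub>R x + c))"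
proof -
  let ?f = "\<lambda>x. g (h *\<^sub>R x + c)" and ?C = "cbox (h *\<^sub>R a + c) (h *\<^sub>R b + c)"
  have im: "(\<lambda>x. h *\<^sub>R x + c) ` cbox a b = ?C" using h ne by (simp add: image_affinity_cbox)
  have im': "(\<lambda>x. (1 / h) *\<^sub>R x + - ((1 / h) *\<^sub>R c)) ` ?C = cbox a b"
    unfolding im[symmetric] image_image using h by (simp add: algebra_simps)
  have 1: "(?f has_integral (1 / h ^ DIM('a)) *\<^sub>R i) (cbox a b)" if "(g has_integral i) ?C" for i
    using has_integral_affinity[OF that, of h c] h unfolding im' by simp
  have 2: "(g has_integral (h ^ DIM('a)) *\<^sub>R i) ?C" if "(?f has_integral i) (cbox a b)" for i
  proof -
    have "((\<lambda>x. ?f ((1 / h) *\<^sub>R x + - ((1 / h) *\<^sub>R c))) has_integral (1 / \<bar>1 / h\<bar> ^ DIM('a)) *\<^sub>R i)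
        ((\<lambda>x. (1 / (1 / h)) *\<^sub>R x + - ((1 / (1 / h)) *\<^sub>R - ((1 / h) *\<^sub>R c))) ` cbox a b)"
      using h by (intro has_integral_affinity that) auto
    moreover have "(\<lambda>x. (1 / (1 / h)) *\<^sub>R x + - ((1 / (1 / h)) *\<^sub>R - ((1 / h) *\<^sub>R c))) = (\<lambda>x. h *\<^sub>R x + c)"
      using h by (auto simp: fun_eq_iff)
    moreover have "(\<lambda>x. ?f ((1 / h) *\<^sub>R x + - ((1 / h) *\<^sub>R c))) = g"
      using h by (auto simp: fun_eq_iff algebra_simps)
    ultimately show ?thesis using h im by (simp add: power_one_over)
  qed
  show ?thesis
  proof (cases "g integrable_on ?C")
    case True
    then have "(g has_integral integral ?C g) ?C" by (rule integrable_integral)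
    from integral_unique[OF 1[OF this]] show ?thesis using h by simp
  next
    case False
    then have "\<not> ?f integrable_on cbox a b" using 2 by (auto simp: integrable_on_def)
    then show ?thesis using False by (simp add: not_integrable_integral)
  qed
qed

lemma integral_affine:
  fixes g :: "real \<Rightarrow> real"
  assumes "h > 0" "a \<le> b"
  shows "integral {c + h * a..c + h * b} g = h * integral {a..b} (\<lambda>x. g (c + h * x))"
  using integral_affine_cbox[of h a b c g] assms by (simp add: add.commute)

lemma integral_affine2:
  fixes g :: "real \<times> real \<Rightarrow> real"
  assumes "h > 0" "a \<le> b" "a' \<le> b'"
  shows "integral ({c + h * a..c + h * b} \<times> {e + h * a'..e + h * b'}) g
    = h\<^sup>2 * integral ({a..b} \<times> {a'..b'}) (\<lambda>z. g (c + h * fst z, e + h * snd z))"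
proof -
  have "cbox (a, a') (b, b') \<noteq> {}" using assms by (auto simp: cbox_Pair_eq)
  from integral_affine_cbox[OF assms(1) this, of "(c, e)" g] show ?thesis
    by (simp add: cbox_Pair_eq add.commute scaleR_prod_def power2_eq_square plus_prod_def)
qed

lemma integral_affine_halves:
  fixes g :: "real \<Rightarrow> real"
  assumes h: "h > 0"
  shows "integral {c - h / 2..c} g = h * integral {- (1/2)..0} (\<lambda>x. g (c + h * x))"
    "integral {c..c + h / 2} g = h * integral {0..1/2} (\<lambda>x. g (c + h * x))"
    "integral (cell h c) g = h * integral {- (1/2)..1/2} (\<lambda>x. g (c + h * x))"
  using integral_affine[OF h, of "- (1/2)" 0 c g] integral_affine[OF h, of 0 "1/2" c g]
    integral_affine[OF h, of "- (1/2)" "1/2" c g] by (simp_all add: cell_def)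

lemma cell_1_0: "cell 1 0 = {- (1/2)..1/2}" by (simp add: cell_def)

abbreviation pscale :: "real \<Rightarrow> real \<Rightarrow> real poly \<Rightarrow> real poly" where
  "pscale h c p \<equiv> p \<circ>\<^sub>p [:c, h:]"

lemma poly_pscale: "poly (pscale h c p) x = poly p (c + h * x)"
  by (simp add: poly_pcompose mult.commute)

lemma poly_pderiv_pscale: "poly (pderiv (pscale h c p)) x = h * poly (pderiv p) (c + h * x)"
  by (simp add: pderiv_pcompose poly_pcompose pderiv_pCons mult.commute)

lemma degree_pscale: "h \<noteq> 0 \<Longrightarrow> degree (pscale h c p) = degree p"
  by (simp add: degree_pcompose)

lemma pscale_inverse:
  assumes "h \<noteq> 0"
  shows "pscale h c (pscale (1 / h) (- c / h) p) = p" "pscale (1 / h) (- c / h) (pscale h c p) = p"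
proof -
  have eq: "p = q" if "\<And>x. poly p x = poly q x" for p q :: "real poly"
    using that by (simp add: poly_eq_poly_eq_iff[symmetric] fun_eq_iff)
  show "pscale h c (pscale (1 / h) (- c / h) p) = p" "pscale (1 / h) (- c / h) (pscale h c p) = p"
    using assms by (intro eq; simp add: poly_pscale field_simps)+
qed

text \<open>A bijection carries one definite description to the other; unique existence is required
  only on the side of the reference cell.\<close>

lemma the_transfer:
  assumes "\<exists>!q. Q' q" "\<And>p. Q p \<longleftrightarrow> Q' (A p)" "\<And>q. A (B q) = q" "\<And>p. B (A p) = p"
  shows "A (THE p. Q p) = (THE q. Q' q)"
proof -
  obtain q0 where q0: "Q' q0" "\<And>q. Q' q \<Longrightarrow> q = q0" using assms(1) by blast
  have "(THE p. Q p) = B q0"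
  proof (rule the_equality)
    show "Q (B q0)" unfolding assms(2) assms(3) by (rule q0)
    fix p assume "Q p"
    then have "A p = q0" unfolding assms(2) by (rule q0)
    then show "p = B q0" using assms(4)[of p] by simp
  qed
  moreover have "(THE q. Q' q) = q0" using q0 by (rule the_equality)
  ultimately show ?thesis using assms(3) by simp
qed

text \<open>Rescaling permutes the test polynomials, so a quantifier over them can be pulled back to
  the reference cell.\<close>

lemma all_pscale:
  fixes h c :: real
  assumes "h \<noteq> 0"
  shows "(\<forall>\<psi>. P (pscale h c \<psi>)) \<longleftrightarrow> (\<forall>\<psi>. P \<psi>)"
proof
  assume *: "\<forall>\<psi>. P (pscale h c \<psi>)"
  show "\<forall>\<psi>. P \<psi>"
  proof
    fix \<psi>
    show "P \<psi>" using *[rule_format, of "pscale (1 / h) (- c / h) \<psi>"] unfolding pscale_inverse(1)[OF assms] .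
  qed
qed blast

text \<open>P1 is scale invariant: the factor h of the integrals is absorbed by \<tau> / h in the
  mass terms and by the chain rule in the derivative terms, while point values do not scale.\<close>

lemma P1_scale:
  assumes h: "h > 0"
  shows "P1 \<tau> h c \<omega> \<psi> = P1 (\<tau> / h) 1 0 (\<lambda>x. \<omega> (c + h * x)) (pscale h c \<psi>)"
proof -
  have s: "\<omega> (c + h * x + h / 2) = \<omega> (c + h * (x + 1/2))" "\<omega> (c + h * x - h / 2) = \<omega> (c + h * (x - 1/2))" for x
    by (simp_all add: algebra_simps)
  have "1 / \<tau> * (h * A + h * B) = 1 / (\<tau> / h) * (A + B)" for A B :: real
    by (simp add: add_divide_distrib ring_distribs)
  then show ?thesis unfolding P1_def integral_affine_halves[OF h] s
    by (simp add: poly_pscale poly_pderiv_pscale mult.left_commute[of _ h])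
qed

lemma B1_scale:
  assumes h: "h > 0"
  shows "B1 \<tau> h c wC wD \<psi> = B1 (\<tau> / h) 1 0 (\<lambda>x. wC (c + h * x)) (\<lambda>x. wD (c + h * x)) (pscale h c \<psi>)"
  unfolding B1_def integral_affine_halves[OF h] cell_1_0
  by (simp add: poly_pscale poly_pderiv_pscale mult.left_commute[of _ h])

lemma T1_scale:
  assumes h: "h > 0"
  shows "T1 \<tau> h c wC wD \<psi> = T1 (\<tau> / h) 1 0 (\<lambda>x. wC (c + h * x)) (\<lambda>x. wD (c + h * x)) (pscale h c \<psi>)"
  unfolding T1_def B1_scale[OF h] P1_scale[OF h] ..

text \<open>Without 1 / \<tau> or a derivative the factor h remains; it is compensated later by the
  factor 1 / h of a rescaled derivative of u.\<close>

lemma D1_scale: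
  assumes h: "h > 0"
  shows "D1 h c wC wD \<psi> = h * D1 1 0 (\<lambda>x. wC (c + h * x)) (\<lambda>x. wD (c + h * x)) (pscale h c \<psi>)"
proof -
  have s: "wC (c + h * x + h / 2) = wC (c + h * (x + 1/2))" "wC (c + h * x - h / 2) = wC (c + h * (x - 1/2))" for x
    by (simp_all add: algebra_simps)
  show ?thesis unfolding D1_def integral_affine_halves[OF h] cell_1_0 s
    by (simp add: poly_pscale right_diff_distrib)
qed

lemma cell_proj_scale:
  assumes h: "h > 0" and t: "\<tau> / h > 0" and w: "continuous_on UNIV (\<lambda>x. \<omega> (c + h * x))"
  shows "poly (cell_proj k \<tau> h c \<omega>) (c + h * x) = poly (cell_proj k (\<tau> / h) 1 0 (\<lambda>x. \<omega> (c + h * x))) x"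
proof -
  have h0: "h \<noteq> 0" using h by simp
  have "pscale h c (cell_proj k \<tau> h c \<omega>) = cell_proj k (\<tau> / h) 1 0 (\<lambda>x. \<omega> (c + h * x))"
    unfolding cell_proj_def
  proof (rule the_transfer[OF cell_proj_ref(2)[OF t w] _ pscale_inverse[OF h0]])
    fix p
    have "(\<forall>\<psi>. degree \<psi> \<le> k \<longrightarrow> P1 \<tau> h c (poly p) \<psi> = P1 \<tau> h c \<omega> \<psi>) \<longleftrightarrow>
      (\<forall>\<psi>. degree (pscale h c \<psi>) \<le> k \<longrightarrow> P1 (\<tau> / h) 1 0 (poly (pscale h c p)) (pscale h c \<psi>) = P1 (\<tau> / h) 1 0 (\<lambda>x. \<omega> (c + h * x)) (pscale h c \<psi>))"
      unfolding P1_scale[OF h] degree_pscale[OF h0] poly_pscale[abs_def] ..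
    also have "\<dots> \<longleftrightarrow> (\<forall>\<psi>. degree \<psi> \<le> k \<longrightarrow> P1 (\<tau> / h) 1 0 (poly (pscale h c p)) \<psi> = P1 (\<tau> / h) 1 0 (\<lambda>x. \<omega> (c + h * x)) \<psi>)"
      by (rule all_pscale[OF h0])
    finally show "(degree p \<le> k \<and> integral (cell h c) (poly p) = integral (cell h c) \<omega> \<and>
        (\<forall>\<psi>. degree \<psi> \<le> k \<longrightarrow> P1 \<tau> h c (poly p) \<psi> = P1 \<tau> h c \<omega> \<psi>)) \<longleftrightarrow>
      (degree (pscale h c p) \<le> k \<and> integral (cell 1 0) (poly (pscale h c p)) = integral (cell 1 0) (\<lambda>x. \<omega> (c + h * x)) \<and>
        (\<forall>\<psi>. degree \<psi> \<le> k \<longrightarrow> P1 (\<tau> / h) 1 0 (poly (pscale h c p)) \<psi> = P1 (\<tau> / h) 1 0 (\<lambda>x. \<omega> (c + h * x)) \<psi>))"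
      using h0 unfolding integral_affine_halves[OF h] degree_pscale[OF h0] cell_1_0 poly_pscale[abs_def] by simp
  qed
  then show ?thesis by (simp add: poly_pscale[symmetric])
qed

lemma cell_corr_scale:
  assumes h: "h > 0" and t: "\<tau> / h > 0" and F: "lin_poly F"
  shows "poly (cell_corr k \<tau> h c (\<lambda>\<psi>. F (pscale h c \<psi>))) (c + h * x) = poly (cell_corr k (\<tau> / h) 1 0 F) x"
proof -
  have h0: "h \<noteq> 0" using h by simp
  have "pscale h c (cell_corr k \<tau> h c (\<lambda>\<psi>. F (pscale h c \<psi>))) = cell_corr k (\<tau> / h) 1 0 F"
    unfolding cell_corr_def
  proof (rule the_transfer[OF cell_corr_ref(3)[OF t F] _ pscale_inverse[OF h0]])
    fix p
    have i: "integral (cell h c) (poly \<psi>) = 0 \<longleftrightarrow> integral (cell 1 0) (poly (pscale h c \<psi>)) = 0" for \<psi>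
      using h0 unfolding integral_affine_halves[OF h] cell_1_0 poly_pscale[abs_def] by simp
    have "(\<forall>\<psi>. degree \<psi> \<le> k \<and> integral (cell h c) (poly \<psi>) = 0 \<longrightarrow> P1 \<tau> h c (\<lambda>x. - poly p x) \<psi> = F (pscale h c \<psi>)) \<longleftrightarrow>
      (\<forall>\<psi>. degree (pscale h c \<psi>) \<le> k \<and> integral (cell 1 0) (poly (pscale h c \<psi>)) = 0 \<longrightarrow>
        P1 (\<tau> / h) 1 0 (\<lambda>x. - poly (pscale h c p) x) (pscale h c \<psi>) = F (pscale h c \<psi>))"
      unfolding P1_scale[OF h] degree_pscale[OF h0] i poly_pscale ..
    also have "\<dots> \<longleftrightarrow> (\<forall>\<psi>. degree \<psi> \<le> k \<and> integral (cell 1 0) (poly \<psi>) = 0 \<longrightarrow>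
        P1 (\<tau> / h) 1 0 (\<lambda>x. - poly (pscale h c p) x) \<psi> = F \<psi>)"
      by (rule all_pscale[OF h0])
    finally show "(degree p \<le> k \<and> integral (cell h c) (poly p) = 0 \<and>
        (\<forall>\<psi>. degree \<psi> \<le> k \<and> integral (cell h c) (poly \<psi>) = 0 \<longrightarrow> P1 \<tau> h c (\<lambda>x. - poly p x) \<psi> = F (pscale h c \<psi>))) \<longleftrightarrow>
      (degree (pscale h c p) \<le> k \<and> integral (cell 1 0) (poly (pscale h c p)) = 0 \<and>
        (\<forall>\<psi>. degree \<psi> \<le> k \<and> integral (cell 1 0) (poly \<psi>) = 0 \<longrightarrow> P1 (\<tau> / h) 1 0 (\<lambda>x. - poly (pscale h c p) x) \<psi> = F \<psi>))"
      unfolding degree_pscale[OF h0] i by simp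
  qed
  then show ?thesis by (simp add: poly_pscale[symmetric])
qed

text \<open>The vertical width is written as h (2b), so that scaling by the horizontal width h leads
  to the interval [-b, b].\<close>

lemma gauss_lobatto_scale:
  assumes h: "h > 0" and b: "b > 0" and k: "k \<ge> 1" and v: "continuous_on UNIV (\<lambda>x. v (c + h * x))"
  shows "poly (gauss_lobatto k (h * (2 * b)) c v) (c + h * x) = poly (GLproj k b (\<lambda>x. v (c + h * x))) x"
proof -
  have h0: "h \<noteq> 0" using h by simp
  have ce: "integral (cell (h * (2 * b)) c) g = h * integral (cell (2 * b) 0) (\<lambda>x. g (c + h * x))" for g
    using integral_affine[OF h, of "- b" b c g] b by (simp add: cell_def)
  have e: "c - h * (2 * b) / 2 = c + h * (0 - 2 * b / 2)" "c + h * (2 * b) / 2 = c + h * (0 + 2 * b / 2)" by simp_all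
  have "pscale h c (gauss_lobatto k (h * (2 * b)) c v) = gauss_lobatto k (2 * b) 0 (\<lambda>x. v (c + h * x))"
    unfolding gauss_lobatto_def
  proof (rule the_transfer[OF gauss_lobatto_ref(2)[OF b k v] _ pscale_inverse[OF h0]])
    fix p
    have "(\<forall>q. degree q + 2 \<le> k \<longrightarrow> integral (cell (h * (2 * b)) c) (\<lambda>t. (v t - poly p t) * poly q t) = 0) \<longleftrightarrow>
      (\<forall>q. degree (pscale h c q) + 2 \<le> k \<longrightarrow> integral (cell (2 * b) 0) (\<lambda>t. (v (c + h * t) - poly (pscale h c p) t) * poly (pscale h c q) t) = 0)"
      using h0 unfolding ce degree_pscale[OF h0] poly_pscale by simp
    also have "\<dots> \<longleftrightarrow> (\<forall>q. degree q + 2 \<le> k \<longrightarrow> integral (cell (2 * b) 0) (\<lambda>t. (v (c + h * t) - poly (pscale h c p) t) * poly q t) = 0)"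
      by (rule all_pscale[OF h0])
    finally show "(degree p \<le> k \<and> poly p (c - h * (2 * b) / 2) = v (c - h * (2 * b) / 2) \<and> poly p (c + h * (2 * b) / 2) = v (c + h * (2 * b) / 2) \<and>
        (\<forall>q. degree q + 2 \<le> k \<longrightarrow> integral (cell (h * (2 * b)) c) (\<lambda>t. (v t - poly p t) * poly q t) = 0)) \<longleftrightarrow>
      (degree (pscale h c p) \<le> k \<and> poly (pscale h c p) (0 - 2 * b / 2) = v (c + h * (0 - 2 * b / 2)) \<and> poly (pscale h c p) (0 + 2 * b / 2) = v (c + h * (0 + 2 * b / 2)) \<and>
        (\<forall>q. degree q + 2 \<le> k \<longrightarrow> integral (cell (2 * b) 0) (\<lambda>t. (v (c + h * t) - poly (pscale h c p) t) * poly q t) = 0))"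
      unfolding degree_pscale[OF h0] e poly_pscale by simp
  qed
  then show ?thesis by (simp add: poly_pscale[symmetric] gauss_lobatto_ref(1)[OF b k v])
qed

lemma centre_at_eq:
  assumes "h > 0" "centre m h z0 i - h / 2 \<le> z" "z < centre m h z0 i + h / 2"
  shows "centre_at m h z0 z = centre m h z0 i"
proof -
  have "of_int (i - 1) \<le> (z - offset m h z0) / h" "(z - offset m h z0) / h < of_int (i - 1) + 1"
    using assms by (auto simp: centre_def field_simps)
  then have "\<lfloor>(z - offset m h z0) / h\<rfloor> = i - 1" by (intro floor_unique) auto
  then show ?thesis by (simp add: centre_at_def)
qed

lemma other_centre:
  "\<exists>j. centre (other m) h z0 j = centre m h z0 i - h / 2" "\<exists>j. centre (other m) h z0 j = centre m h z0 i + h / 2"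
proof -
  show "\<exists>j. centre (other m) h z0 j = centre m h z0 i - h / 2"
    by (cases m; intro exI[of _ "if m = Primal then i - 1 else i"]) (auto simp: centre_def offset_def algebra_simps)
  show "\<exists>j. centre (other m) h z0 j = centre m h z0 i + h / 2"
    by (cases m; intro exI[of _ "if m = Primal then i else i + 1"]) (auto simp: centre_def offset_def algebra_simps)
qed

text \<open>The jet of u(c + h x, e + h y). Equal scaling of both variables gives the single factor
  h^(a + b).\<close>

definition jscale :: "real \<Rightarrow> real \<Rightarrow> real \<Rightarrow> jet \<Rightarrow> jet" where
  "jscale h c e d = (\<lambda>a b x y. h ^ (a + b) * d a b (c + h * x) (e + h * y))"

text \<open>Consistency is asked for orders below r only, since the limit of the partial sums is
  known to have just two classical derivatives.\<close>

definition jderiv :: "nat \<Rightarrow> jet \<Rightarrow> bool" where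
  "jderiv r d \<longleftrightarrow> (\<forall>a b x y. a + b < r \<longrightarrow>
     ((\<lambda>s. d a b s y) has_real_derivative d (Suc a) b x y) (at x) \<and>
     ((\<lambda>s. d a b x s) has_real_derivative d a (Suc b) x y) (at y))"

lemma jderiv_ops:
  assumes "jderiv (Suc r) d"
  shows "jderiv r (jdx d)" "jderiv r (jdy d)" "dx (d 0 0) = jdx d 0 0" "dy (d 0 0) = jdy d 0 0"
  using assms by (auto simp: jderiv_def jdx_def jdy_def dx_def dy_def fun_eq_iff intro!: DERIV_imp_deriv)

lemma jderiv_mono: "jderiv r d \<Longrightarrow> r' \<le> r \<Longrightarrow> jderiv r' d"
  by (simp add: jderiv_def)

lemma jcont_jscale: "jcont d \<Longrightarrow> jcont (jscale h c e d)"
  unfolding jcont_def jscale_def case_prod_unfold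
  by (intro allI continuous_on_mult continuous_on_const continuous_curried[of "d _ _"] continuous_intros)
    (auto simp: case_prod_unfold)

lemma jscale_shift: "jscale h (c + h * r) (e + h * s) d = jshift r s (jscale h c e d)"
  by (simp add: jscale_def jshift_def fun_eq_iff algebra_simps)

lemma jscale_jdx: "h \<noteq> 0 \<Longrightarrow> jscale h c e (jdx d) = jlin (1 / h) (jdx (jscale h c e d)) 0 d"
  and jscale_jdy: "h \<noteq> 0 \<Longrightarrow> jscale h c e (jdy d) = jlin (1 / h) (jdy (jscale h c e d)) 0 d"
  by (simp_all add: jscale_def jdx_def jdy_def jlin_def fun_eq_iff)

text \<open>The mass of wC cancels between B1 and P1, and with it everything except differences of
  the components. The function wC is known on the half-open cell only, because its right end point
  belongs to the next cell; for integrals this is a null set. For wD both end points are needed, as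
  B1 evaluates it there.\<close>

lemma T1_ref:
  assumes W: "continuous_on UNIV W" "continuous_on UNIV Wm" "continuous_on UNIV Wp"
    and wC: "\<And>x. - (1/2) \<le> x \<Longrightarrow> x < 1/2 \<Longrightarrow> wC x = W x"
    and wD: "\<And>x. - (1/2) \<le> x \<Longrightarrow> x \<le> 1/2 \<Longrightarrow> wD x = xglue Wm Wp x"
  shows "T1 t 1 0 wC wD \<psi> = Tref t (\<lambda>x. Wm x - W x) (\<lambda>x. Wp x - W x) \<psi>"
    and "D1 1 0 wC wD \<psi> = Dref (\<lambda>x. Wm x - W x) (\<lambda>x. Wp x - W x) \<psi>"
proof -
  have D: "((\<lambda>x. wD x * poly p x) has_integral Dref Wm Wp p) {- (1/2)..1/2}" for p
  unfolding Dref_def weighted_int_def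
  proof (rule has_integral_combine[of "- (1/2)" 0 "1/2"])
    show "((\<lambda>x. wD x * poly p x) has_integral integral {- (1/2)..0} (\<lambda>x. Wm (x + 1/2) * poly p x)) {- (1/2)..0}"
    proof (rule has_integral_spike[of "{0}"])
      show "((\<lambda>x. Wm (x + 1/2) * poly p x) has_integral integral {- (1/2)..0} (\<lambda>x. Wm (x + 1/2) * poly p x)) {- (1/2)..0}"
        by (intro integrable_integral continuous_imp_integrable continuous_intros continuous_on_shift[OF W(2)])
    qed (auto simp: wD xglue_def)
    have "((\<lambda>x. Wp (x + - (1/2)) * poly p x) has_integral integral {0..1/2} (\<lambda>x. Wp (x + - (1/2)) * poly p x)) {0..1/2}"
      by (intro integrable_integral continuous_imp_integrable continuous_intros continuous_on_shift[OF W(3)])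
    then show "((\<lambda>x. wD x * poly p x) has_integral integral {0..1/2} (\<lambda>x. Wp (x + - (1/2)) * poly p x)) {0..1/2}"
      by (rule has_integral_eq[rotated]) (auto simp: wD xglue_def)
  qed simp_all
  have C: "((\<lambda>x. wC x * poly p x) has_integral weighted_int 0 (- (1/2)) (1/2) p W) {- (1/2)..1/2}" for p
  proof (rule has_integral_spike[of "{1/2}"])
    show "((\<lambda>x. W x * poly p x) has_integral weighted_int 0 (- (1/2)) (1/2) p W) {- (1/2)..1/2}"
      unfolding weighted_int_def add_0_right
      by (intro integrable_integral continuous_imp_integrable continuous_intros W)
  qed (auto simp: wC)
  have sp: "integral {- (1/2)..0} (\<lambda>x. wC (x + 1/2) * poly p x) = integral {- (1/2)..0} (\<lambda>x. W (x + 1/2) * poly p x)"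
    "integral {0..1/2} (\<lambda>x. wC (x - 1/2) * poly p x) = integral {0..1/2} (\<lambda>x. W (x - 1/2) * poly p x)"
    "integral {- (1/2)..0} (\<lambda>x. (wC (x + 1/2) - wC x) * poly p x) = integral {- (1/2)..0} (\<lambda>x. (W (x + 1/2) - W x) * poly p x)"
    "integral {0..1/2} (\<lambda>x. (wC (x - 1/2) - wC x) * poly p x) = integral {0..1/2} (\<lambda>x. (W (x - 1/2) - W x) * poly p x)" for p
    by (intro integral_spike[of "{0, 1/2}"]; auto simp: wC)+
  have PC: "P1 t 1 0 wC \<psi> = P1ref t W \<psi>"
    unfolding P1_eq_P1ref[OF W(1), symmetric] P1_def using sp[of \<psi>] sp[of "pderiv \<psi>"] wC[of 0] by simp
  have Dl: "Dref (\<lambda>x. Wm x - W x) (\<lambda>x. Wp x - W x) p = Dref Wm Wp p - Dref W W p" for p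
    using Dref_lin[OF W(2,3,1,1), of 1 "-1" p] by simp
  have "integral (cell 1 0) (\<lambda>x. (wD x - wC x) * poly \<psi> x) = Dref Wm Wp \<psi> - weighted_int 0 (- (1/2)) (1/2) \<psi> W"
    unfolding cell_1_0 using has_integral_diff[OF D[of \<psi>] C[of \<psi>]] by (simp add: has_integral_iff left_diff_distrib)
  moreover have "integral (cell 1 0) (\<lambda>x. wD x * poly (pderiv \<psi>) x) = Dref Wm Wp (pderiv \<psi>)"
    unfolding cell_1_0 using D by (simp add: has_integral_iff)
  moreover have "wD (0 + 1/2) = Wp 0" "wD (0 - 1/2) = Wm 0" using wD[of "1/2"] wD[of "- (1/2)"] by (simp_all add: xglue_def)
  ultimately have B: "B1 t 1 0 wC wD \<psi> = 1 / t * (Dref Wm Wp \<psi> - weighted_int 0 (- (1/2)) (1/2) \<psi> W) + Dref Wm Wp (pderiv \<psi>)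
      - Wp 0 * poly \<psi> (1/2) + Wm 0 * poly \<psi> (- (1/2))"
    unfolding B1_def by simp
  have PW: "P1ref t W \<psi> = 1 / t * (Dref W W \<psi> - weighted_int 0 (- (1/2)) (1/2) \<psi> W) + Dref W W (pderiv \<psi>)
      - W 0 * (poly \<psi> (1/2) - poly \<psi> (- (1/2)))"
    unfolding P1ref_def Dref_def weighted_int_split[OF W(1)] by (simp add: algebra_simps)
  define q where "q = 1 / t"
  show "T1 t 1 0 wC wD \<psi> = Tref t (\<lambda>x. Wm x - W x) (\<lambda>x. Wp x - W x) \<psi>"
    unfolding T1_def B PC PW Tref_def Dl q_def[symmetric] by (simp add: algebra_simps)
  have "D1 1 0 wC wD \<psi> = Dref Wm Wp \<psi> - Dref W W \<psi>"
    unfolding D1_def cell_1_0 using D[of \<psi>] sp(1,2)[of \<psi>] by (simp add: has_integral_iff Dref_def weighted_int_def)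
  then show "D1 1 0 wC wD \<psi> = Dref (\<lambda>x. Wm x - W x) (\<lambda>x. Wp x - W x) \<psi>" by (simp add: Dl)
qed

lemma jump_ref:
  assumes h: "h > 0" and V: "continuous_on UNIV V" and g: "\<And>x. - (1/2) \<le> x \<Longrightarrow> x < 1/2 \<Longrightarrow> g (c + h * x) = V x"
  shows "integral {c - h / 2..c} (\<lambda>s. (g s - g (s + h / 2)) * poly \<psi> s)
    + integral {c..c + h / 2} (\<lambda>s. (g s - g (s - h / 2)) * poly \<psi> s) = h * jumpref V (pscale h c \<psi>)"
proof -
  have s: "g (c + h * x + h / 2) = g (c + h * (x + 1/2))" "g (c + h * x - h / 2) = g (c + h * (x - 1/2))" for x
    by (simp_all add: algebra_simps)
  have i: "(\<lambda>x. V (x + r) * poly p x) integrable_on {a..b}" for r p a b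
    by (intro continuous_imp_integrable continuous_intros continuous_on_shift[OF V])
  have "integral {- (1/2)..0} (\<lambda>x. (g (c + h * x) - g (c + h * (x + 1/2))) * poly \<psi> (c + h * x))
      = integral {- (1/2)..0} (\<lambda>x. V (x + 0) * poly (pscale h c \<psi>) x - V (x + 1/2) * poly (pscale h c \<psi>) x)"
    by (intro integral_spike[of "{0}"]) (auto simp: g poly_pscale left_diff_distrib)
  also have "\<dots> = weighted_int 0 (- (1/2)) 0 (pscale h c \<psi>) V - weighted_int (1/2) (- (1/2)) 0 (pscale h c \<psi>) V"
    unfolding weighted_int_def by (intro integral_diff i)
  finally have 1: "integral {- (1/2)..0} (\<lambda>x. (g (c + h * x) - g (c + h * (x + 1/2))) * poly \<psi> (c + h * x)) = \<dots>" .
  have "integral {0..1/2} (\<lambda>x. (g (c + h * x) - g (c + h * (x - 1/2))) * poly \<psi> (c + h * x))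
      = integral {0..1/2} (\<lambda>x. V (x + 0) * poly (pscale h c \<psi>) x - V (x + - (1/2)) * poly (pscale h c \<psi>) x)"
    by (intro integral_spike[of "{1/2}"]) (auto simp: g poly_pscale left_diff_distrib)
  also have "\<dots> = weighted_int 0 0 (1/2) (pscale h c \<psi>) V - weighted_int (- (1/2)) 0 (1/2) (pscale h c \<psi>) V"
    unfolding weighted_int_def by (intro integral_diff i)
  finally have 2: "integral {0..1/2} (\<lambda>x. (g (c + h * x) - g (c + h * (x - 1/2))) * poly \<psi> (c + h * x)) = \<dots>" .
  show ?thesis unfolding integral_affine_halves[OF h] s 1 2 jumpref_def Dref_def weighted_int_split[OF V]
    by (simp add: algebra_simps)
qed

lemma loc_jscale_deriv:
  assumes "jcont d" "h > 0"
  shows "loc k t l (jscale h c e (jdx d)) x y = 1 / h * loc k t l (jdx (jscale h c e d)) x y"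
    "loc k t l (jscale h c e (jdy d)) x y = 1 / h * loc k t l (jdy (jscale h c e d)) x y"
    "loc k t l (jdiff r (jscale h c e (jdy d))) x y = 1 / h * loc k t l (jdiff r (jdy (jscale h c e d))) x y"
proof -
  have h: "h \<noteq> 0" using assms by simp
  note j = jcont_jscale[OF assms(1), of h c e]
  show "loc k t l (jscale h c e (jdx d)) x y = 1 / h * loc k t l (jdx (jscale h c e d)) x y"
    "loc k t l (jscale h c e (jdy d)) x y = 1 / h * loc k t l (jdy (jscale h c e d)) x y"
    "loc k t l (jdiff r (jscale h c e (jdy d))) x y = 1 / h * loc k t l (jdiff r (jdy (jscale h c e d))) x y"
    unfolding jscale_jdx[OF h] jscale_jdy[OF h] jet_ops_jlin
    by (simp_all only: loc_jlin[OF jcont_jdx[OF j] assms(1)] loc_jlin[OF jcont_jdy[OF j] assms(1)]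
      loc_jlin[OF jcont_jdiff[OF jcont_jdy[OF j]] jcont_jdiff[OF assms(1)]] mult_zero_left add_0_right)
qed

text \<open>If on every cell of the other mesh a function is a fixed expression in the rescaled jet,
  then on this cell it is that expression glued from the two half-cell translates.\<close>

lemma other_mesh_glue:
  fixes i :: int
  assumes g: "\<And>j \<xi>. - (1/2) \<le> \<xi> \<Longrightarrow> \<xi> < 1/2 \<Longrightarrow>
      g (centre (other m) h x0 j + h * \<xi>) = f (jscale h (centre (other m) h x0 j) e d) \<xi>"
    and x: "- (1/2) \<le> x" "x \<le> 1/2"
  defines "D \<equiv> jscale h (centre m h x0 i) e d"
  shows "g (centre m h x0 i + h * x) = xglue (f (jshift (- (1/2)) 0 D)) (f (jshift (1/2) 0 D)) x"
proof -
  have s: "jshift r 0 D = jscale h (centre m h x0 i + h * r) e d" for r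
    using jscale_shift[of h "centre m h x0 i" r e 0 d] by (simp add: D_def)
  obtain j1 j2 where j: "centre (other m) h x0 j1 = centre m h x0 i - h / 2" "centre (other m) h x0 j2 = centre m h x0 i + h / 2"
    using other_centre[of m h x0 i] by auto
  have c: "centre (other m) h x0 j1 = centre m h x0 i + h * - (1/2)" "centre (other m) h x0 j2 = centre m h x0 i + h * (1/2)"
    using j by simp_all
  have p: "centre m h x0 i + h * x = centre (other m) h x0 j1 + h * (x + 1/2)"
    "centre m h x0 i + h * x = centre (other m) h x0 j2 + h * (x - 1/2)"
    unfolding c by (simp_all add: algebra_simps)
  show ?thesis
  proof (cases "x < 0")
    case True
    have "g (centre (other m) h x0 j1 + h * (x + 1/2)) = f (jscale h (centre (other m) h x0 j1) e d) (x + 1/2)"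
      by (rule g) (use x True in linarith)+
    then show ?thesis unfolding p(1) s c xglue_def using True by simp
  next
    case False
    have "g (centre (other m) h x0 j2 + h * (x - 1/2)) = f (jscale h (centre (other m) h x0 j2) e d) (x - 1/2)"
      by (rule g) (use x False in linarith)+
    then show ?thesis unfolding p(2) s c xglue_def using False by simp
  qed
qed

lemma centre_at_affine:
  assumes "h > 0" "- (1/2) \<le> \<xi>" "\<xi> < 1/2"
  shows "centre_at m h z0 (centre m h z0 i + h * \<xi>) = centre m h z0 i"
proof (rule centre_at_eq[OF assms(1)])
  have "h * - (1/2) \<le> h * \<xi>" "h * \<xi> < h * (1/2)" using assms by (simp_all only: mult_le_cancel_left_pos mult_less_cancel_left_pos)
  then show "centre m h z0 i - h / 2 \<le> centre m h z0 i + h * \<xi>" "centre m h z0 i + h * \<xi> < centre m h z0 i + h / 2"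
    by linarith+
qed

text \<open>Level l differentiates u at most l times, so a jet consistent up to order l suffices.
  The induction runs over both meshes at once, since each component needs its neighbours on the
  other one. The base height \<open>e\<close> is arbitrary because the corrections do not mix
  different heights.\<close>

lemma chi_loc:
  assumes h: "h > 0" and \<tau>: "\<tau> > 0"
  shows "jcont d \<Longrightarrow> jderiv l d \<Longrightarrow> - (1/2) \<le> \<xi> \<Longrightarrow> \<xi> < 1/2 \<Longrightarrow>
    chi k \<tau> h x0 l m (d 0 0) (centre m h x0 i + h * \<xi>) (e + h * \<eta>)
    = loc k (\<tau> / h) l (jscale h (centre m h x0 i) e d) \<xi> \<eta>"
proof (induction l arbitrary: d m i \<xi> rule: level_induct)
  case 0
  define c where "c = centre m h x0 i"
  have t: "\<tau> / h > 0" using h \<tau> by simp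
  have "continuous_on UNIV (\<lambda>x. jscale h c e d 0 0 x \<eta>)" by (intro jcont_slice jcont_jscale 0)
  then have w: "continuous_on UNIV (\<lambda>x. d 0 0 (c + h * x) (e + h * \<eta>))" by (simp add: jscale_def)
  show ?case
    unfolding chi.simps c_def[symmetric] centre_at_affine[OF h 0(3,4), of m x0 i, folded c_def] loc.simps cell_proj_scale[OF h t w, where k = k]
      cell_proj_ref(1)[OF t w] by (simp add: jscale_def poly_sum)
next
  case (Suc l)
  define c t D Y where "c = centre m h x0 i" and "t = \<tau> / h" and "D = jscale h c e d" and "Y = e + h * \<eta>"
  have t: "t > 0" using h \<tau> by (simp add: t_def)
  have jD: "jcont D" unfolding D_def by (intro jcont_jscale Suc.prems)
  note ops = jderiv_ops[OF Suc.prems(2)]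
  have jd: "jderiv l d" "jderiv l (jdx d)" "jderiv l (jdy d)"
    using ops jderiv_mono[OF Suc.prems(2), of l] by simp_all
  have same: "chi k \<tau> h x0 l m (d' 0 0) (c + h * x) Y = loc k t l (jscale h c e d') x \<eta>"
    if "jcont d'" "jderiv l d'" "- (1/2) \<le> x" "x < 1/2" for d' x
    using Suc.IH(1)[OF that] by (simp add: c_def t_def Y_def)
  \<comment> \<open>At the right end point of the cell the left part of the right neighbour still
    applies, so this holds on the closed interval.\<close>
  have glue: "chi k \<tau> h x0 l (other m) (d 0 0) (c + h * x) Y
      = xglue (\<lambda>x. loc k t l (jshift (- (1/2)) 0 D) x \<eta>) (\<lambda>x. loc k t l (jshift (1/2) 0 D) x \<eta>) x"
    if "- (1/2) \<le> x" "x \<le> 1/2" for x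
    unfolding c_def D_def
    by (rule other_mesh_glue[where f = "\<lambda>d x. loc k t l d x \<eta>" and g = "\<lambda>x. chi k \<tau> h x0 l (other m) (d 0 0) x Y"])
      (use Suc.IH(1)[OF Suc.prems(1) jd(1)] that in \<open>simp_all add: t_def Y_def\<close>)
  let ?L = "\<lambda>d x. loc k t l d x \<eta>" and ?P = "pscale h c"
  have ls: "continuous_on UNIV (?L d')" if "jcont d'" for d' by (rule loc_slice[OF that])
  have 1: "integral (cell h c) (\<lambda>s. chi k \<tau> h x0 l m (dx (d 0 0)) s Y * poly \<psi> s)
      = weighted_int 0 (- (1/2)) (1/2) (?P \<psi>) (?L (jdx D))" for \<psi>
  proof -
    have "integral {- (1/2)..1/2} (\<lambda>x. chi k \<tau> h x0 l m (dx (d 0 0)) (c + h * x) Y * poly \<psi> (c + h * x))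
        = integral {- (1/2)..1/2} (\<lambda>x. 1 / h * (?L (jdx D) (x + 0) * poly (?P \<psi>) x))"
      unfolding ops(3) D_def
      by (intro integral_spike[of "{1/2}"])
        (auto simp: same jcont_jdx Suc.prems(1) jd(2) loc_jscale_deriv(1)[OF Suc.prems(1) h] poly_pscale)
    then show ?thesis unfolding integral_affine_halves[OF h] weighted_int_def using h by simp
  qed
  have 2: "T1 \<tau> h c (\<lambda>s. chi k \<tau> h x0 l m (d 0 0) s Y) (\<lambda>s. chi k \<tau> h x0 l (other m) (d 0 0) s Y) \<psi>
      = Tref t (?L (jdiff (- (1/2)) D)) (?L (jdiff (1/2) D)) (?P \<psi>)" for \<psi>
    unfolding T1_scale[OF h] t_def[symmetric] loc_jdiff[OF jD]
    by (rule T1_ref(1)) (simp_all add: ls jcont_intros jD glue same Suc.prems(1) jd(1) flip: D_def)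
  have 3: "(case l of 0 \<Rightarrow> 0 | Suc l' \<Rightarrow> D1 h c (\<lambda>s. chi k \<tau> h x0 l' m (dy (d 0 0)) s Y)
        (\<lambda>s. chi k \<tau> h x0 l' (other m) (dy (d 0 0)) s Y) \<psi>)
      = Dref (\<lambda>s. locprev k t l (jdiff (- (1/2)) (jdy D)) s \<eta>) (\<lambda>s. locprev k t l (jdiff (1/2) (jdy D)) s \<eta>) (?P \<psi>)" for \<psi>
  proof (cases l)
    case 0 then show ?thesis by (simp add: locprev_def Dref_def weighted_int_def)
  next
    case (Suc l')
    let ?d = "jdy d" and ?D = "jscale h c e (jdy d)" and ?K = "\<lambda>d x. loc k t l' d x \<eta>"
    have jd': "jcont ?d" "jderiv l' ?d" using Suc.prems(1) jd(3) Suc by (auto intro: jcont_jdy jderiv_mono)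
    have same': "chi k \<tau> h x0 l' m (?d 0 0) (c + h * x) Y = ?K ?D x" if "- (1/2) \<le> x" "x < 1/2" for x
      using Suc.IH(2)[OF Suc jd' that] by (simp add: c_def t_def Y_def)
    have glue': "chi k \<tau> h x0 l' (other m) (?d 0 0) (c + h * x) Y
        = xglue (?K (jshift (- (1/2)) 0 ?D)) (?K (jshift (1/2) 0 ?D)) x" if "- (1/2) \<le> x" "x \<le> 1/2" for x
      unfolding c_def
      by (rule other_mesh_glue[where f = "\<lambda>d x. loc k t l' d x \<eta>" and g = "\<lambda>x. chi k \<tau> h x0 l' (other m) (?d 0 0) x Y"])
        (use Suc.IH(2)[OF Suc jd'] that in \<open>simp_all add: t_def Y_def\<close>)
    have jD': "jcont ?D" by (intro jcont_jscale jd')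
    have cK: "continuous_on UNIV (?K d')" if "jcont d'" for d' by (rule loc_slice[OF that])
    have "D1 h c (\<lambda>s. chi k \<tau> h x0 l' m (?d 0 0) s Y) (\<lambda>s. chi k \<tau> h x0 l' (other m) (?d 0 0) s Y) \<psi>
        = h * Dref (?K (jdiff (- (1/2)) ?D)) (?K (jdiff (1/2) ?D)) (?P \<psi>)"
      unfolding D1_scale[OF h] loc_jdiff[OF jD']
      by (intro arg_cong[of _ _ "times h"] T1_ref(2)) (simp_all add: cK jcont_intros jD' glue' same')
    \<comment> \<open>The factor h of D1 meets the 1 / h of the rescaled y-derivative; the integrals
      numbered 1 and 4 balance in the same way.\<close>
    also have "\<dots> = h * (1 / h * Dref (?K (jdiff (- (1/2)) (jdy D))) (?K (jdiff (1/2) (jdy D))) (?P \<psi>))"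
      unfolding loc_jscale_deriv(3)[OF Suc.prems(1) h] D_def[symmetric]
      using Dref_lin[of "?K (jdiff (- (1/2)) (jdy D))" "?K (jdiff (1/2) (jdy D))" "?K (jdiff (- (1/2)) (jdy D))"
        "?K (jdiff (1/2) (jdy D))" "1 / h" 0 "?P \<psi>"] by (simp add: cK jcont_intros jD)
    finally show ?thesis using h by (simp add: Suc locprev_def ops(4))
  qed
  have 4: "integral {c - h / 2..c} (\<lambda>s. (chi k \<tau> h x0 l m (dy (d 0 0)) s Y - chi k \<tau> h x0 l m (dy (d 0 0)) (s + h / 2) Y) * poly \<psi> s)
    + integral {c..c + h / 2} (\<lambda>s. (chi k \<tau> h x0 l m (dy (d 0 0)) s Y - chi k \<tau> h x0 l m (dy (d 0 0)) (s - h / 2) Y) * poly \<psi> s)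
    = jumpref (?L (jdy D)) (?P \<psi>)" for \<psi>
  proof -
    have cD: "continuous_on UNIV (?L (jdy D))" by (intro ls jcont_intros jD)
    have "continuous_on UNIV (\<lambda>x. 1 / h * ?L (jdy D) x)" by (intro continuous_intros cD)
    then have "integral {c - h / 2..c} (\<lambda>s. (chi k \<tau> h x0 l m (jdy d 0 0) s Y - chi k \<tau> h x0 l m (jdy d 0 0) (s + h / 2) Y) * poly \<psi> s)
      + integral {c..c + h / 2} (\<lambda>s. (chi k \<tau> h x0 l m (jdy d 0 0) s Y - chi k \<tau> h x0 l m (jdy d 0 0) (s - h / 2) Y) * poly \<psi> s)
      = h * jumpref (\<lambda>x. 1 / h * ?L (jdy D) x) (?P \<psi>)"
      by (rule jump_ref[OF h]) (simp only: same jcont_jdy Suc.prems(1) jd(3) loc_jscale_deriv(2)[OF Suc.prems(1) h] D_def)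
    also have "jumpref (\<lambda>x. 1 / h * ?L (jdy D) x) (?P \<psi>) = 1 / h * jumpref (?L (jdy D)) (?P \<psi>)"
      unfolding jumpref_def using weighted_int_lin[OF cD cD, of 0 "- (1/2)" "1/2" "?P \<psi>" "1 / h" 0]
        Dref_lin[OF cD cD cD cD, of "1 / h" 0 "?P \<psi>"] by (simp add: diff_divide_distrib)
    finally show ?thesis using h by (simp add: ops(4))
  qed
  have rhs: "locrhs k t l D \<eta> (?P \<psi>) = integral (cell h c) (\<lambda>s. chi k \<tau> h x0 l m (dx (d 0 0)) s Y * poly \<psi> s)
            + T1 \<tau> h c (\<lambda>s. chi k \<tau> h x0 l m (d 0 0) s Y) (\<lambda>s. chi k \<tau> h x0 l (other m) (d 0 0) s Y) \<psi>
            - (case l of 0 \<Rightarrow> 0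
               | Suc l' \<Rightarrow> D1 h c (\<lambda>s. chi k \<tau> h x0 l' m (dy (d 0 0)) s Y)
                                 (\<lambda>s. chi k \<tau> h x0 l' (other m) (dy (d 0 0)) s Y) \<psi>)
            + integral {c - h / 2 .. c} (\<lambda>s.
                (chi k \<tau> h x0 l m (dy (d 0 0)) s Y - chi k \<tau> h x0 l m (dy (d 0 0)) (s + h / 2) Y) * poly \<psi> s)
            + integral {c .. c + h / 2} (\<lambda>s.
                (chi k \<tau> h x0 l m (dy (d 0 0)) s Y - chi k \<tau> h x0 l m (dy (d 0 0)) (s - h / 2) Y) * poly \<psi> s)" for \<psi>
    unfolding 1 2 3 add.assoc 4 unfolding locrhs_def rhsref_def by simp
  show ?case
    unfolding chi.simps Let_def c_def[symmetric] centre_at_affine[OF h Suc.prems(3,4), of m x0 i, folded c_def] Y_def[symmetric] rhs[symmetric]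
      t_def[symmetric] D_def[symmetric] loc_Suc
      cell_corr_scale[OF h t[unfolded t_def] locrhs_lin_poly[OF jD], folded t_def] cell_corr_ref(1)[OF t locrhs_lin_poly[OF jD]]
    by (simp add: poly_sum sum_negf)
qed

lemma centre_at_affine2:
  assumes "h > 0" "b > 0" "- b \<le> \<eta>" "\<eta> < b"
  shows "centre_at m (h * (2 * b)) z0 (centre m (h * (2 * b)) z0 i + h * \<eta>) = centre m (h * (2 * b)) z0 i"
proof -
  have "h * \<eta> = h * (2 * b) * (\<eta> / (2 * b))" using assms by simp
  moreover have "- (1/2) \<le> \<eta> / (2 * b)" "\<eta> / (2 * b) < 1/2" using assms by (simp_all add: field_simps)
  ultimately show ?thesis using centre_at_affine[of "h * (2 * b)" "\<eta> / (2 * b)" m z0 i] assms by simp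
qed

lemma corr_X_loc:
  assumes h: "h > 0" and \<tau>: "\<tau> > 0" and b: "b > 0" and k: "k \<ge> 1" and d: "jcont d" "jderiv l d"
    and \<xi>: "- (1/2) \<le> \<xi>" "\<xi> < 1/2" and \<eta>: "- b \<le> \<eta>" "\<eta> < b"
  shows "corr_X k \<tau> h (h * (2 * b)) x0 y0 l m (d 0 0) (centre m h x0 i + h * \<xi>) (centre m (h * (2 * b)) y0 j + h * \<eta>)
    = locX k (\<tau> / h) b l (jscale h (centre m h x0 i) (centre m (h * (2 * b)) y0 j) d) \<xi> \<eta>"
proof -
  define cy where "cy = centre m (h * (2 * b)) y0 j"
  let ?v = "\<lambda>t. chi k \<tau> h x0 l m (d 0 0) (centre m h x0 i + h * \<xi>) t"
  have v: "?v (cy + h * y) = loc k (\<tau> / h) l (jscale h (centre m h x0 i) cy d) \<xi> y" for y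
    by (rule chi_loc[OF h \<tau> d \<xi>])
  have "continuous_on UNIV (\<lambda>y. ?v (cy + h * y))"
    unfolding v by (intro cont2_slices loc_cont2 jcont_jscale d)
  from gauss_lobatto_scale[OF h b k this] show ?thesis
    unfolding corr_X_def cy_def[symmetric] centre_at_affine2[OF h b \<eta>, of m y0 j, folded cy_def] locX_def by (simp add: v)
qed

lemma corr_X_other:
  assumes h: "h > 0" and \<tau>: "\<tau> > 0" and b: "b > 0" and k: "k \<ge> 1" and d: "jcont d" "jderiv l d"
    and \<xi>: "\<bar>\<xi>\<bar> \<le> 1/2" and \<eta>: "\<bar>\<eta>\<bar> \<le> b"
  shows "corr_X k \<tau> h (h * (2 * b)) x0 y0 l (other m) (d 0 0) (centre m h x0 i + h * \<xi>) (centre m (h * (2 * b)) y0 j + h * \<eta>)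
    = gluX k (\<tau> / h) b l (jscale h (centre m h x0 i) (centre m (h * (2 * b)) y0 j) d) \<xi> \<eta>"
proof -
  \<comment> \<open>The translation to the centre of the neighbour that owns the quarter of the
    point. The coordinates relative to that centre lie in its half-open cell even when the point is
    on the boundary of the present cell.\<close>
  define r s where "r = (if \<xi> < 0 then - (1/2) else 1/2 :: real)" and "s = (if \<eta> < 0 then - b else b)"
  let ?D = "jscale h (centre m h x0 i) (centre m (h * (2 * b)) y0 j) d"
  obtain i' where i': "centre (other m) h x0 i' = centre m h x0 i + h * r"
    using other_centre[of m h x0 i] by (cases "\<xi> < 0") (auto simp: r_def)
  obtain j' where j': "centre (other m) (h * (2 * b)) y0 j' = centre m (h * (2 * b)) y0 j + h * s"
    using other_centre[of m "h * (2 * b)" y0 j] by (cases "\<eta> < 0") (auto simp: s_def)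
  have e: "centre m h x0 i + h * \<xi> = centre (other m) h x0 i' + h * (\<xi> - r)"
    "centre m (h * (2 * b)) y0 j + h * \<eta> = centre (other m) (h * (2 * b)) y0 j' + h * (\<eta> - s)"
    unfolding i' j' by (simp_all add: algebra_simps)
  have "- (1/2) \<le> \<xi> - r" "\<xi> - r < 1/2" "- b \<le> \<eta> - s" "\<eta> - s < b"
    using \<xi> \<eta> b by (auto simp: r_def s_def abs_le_iff)
  from corr_X_loc[OF h \<tau> b k d this, of x0 y0 "other m" i' j']
  have "corr_X k \<tau> h (h * (2 * b)) x0 y0 l (other m) (d 0 0) (centre m h x0 i + h * \<xi>) (centre m (h * (2 * b)) y0 j + h * \<eta>)
      = locX k (\<tau> / h) b l (jshift r s ?D) (\<xi> - r) (\<eta> - s)"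
    unfolding e by (simp only: i' j' jscale_shift)
  then show ?thesis by (simp add: gluX_def r_def s_def)
qed

text \<open>Test functions are polynomial only inside a cell, so their traces on the boundary are
  read off as one-sided limits.\<close>

lemma Lim_transform_value:
  fixes f g :: "real \<Rightarrow> real"
  assumes "continuous_on UNIV g" "a < b" "\<And>x. a < x \<Longrightarrow> x < b \<Longrightarrow> f x = g x"
  shows "Lim (at_left b) f = g b" "Lim (at_right a) f = g a"
proof -
  have "(g \<longlongrightarrow> g x) (at x within S)" for x S
    using assms(1) by (meson UNIV_I continuous_on_def subset_UNIV tendsto_within_subset)
  then have g: "(g \<longlongrightarrow> g b) (at_left b)" "(g \<longlongrightarrow> g a) (at_right a)" by blast+
  have "\<forall>\<^sub>F x in at_left b. g x = f x"
    using eventually_at_left_real[OF assms(2)] by eventually_elim (auto simp: assms(3))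
  from Lim_transform_eventually[OF g(1) this] show "Lim (at_left b) f = g b" by (intro tendsto_Lim) auto
  have "\<forall>\<^sub>F x in at_right a. g x = f x"
    using eventually_at_right_real[OF assms(2)] by eventually_elim (auto simp: assms(3))
  from Lim_transform_eventually[OF g(2) this] show "Lim (at_right a) f = g a" by (intro tendsto_Lim) auto
qed

lemma integral_rect_spike:
  assumes "\<And>x y. \<bar>x\<bar> < a \<Longrightarrow> \<bar>y\<bar> < b \<Longrightarrow> f (x, y) = g (x, y)"
  shows "integral ({- a..a} \<times> {- b..b}) f = integral ({- a..a} \<times> {- b..b :: real}) (g :: real \<times> real \<Rightarrow> real)"
proof -
  have c: "{- a..a} \<times> {- b..b} = cbox (- a, - b) (a, b)" by (simp add: cbox_Pair_eq)
  show ?thesis unfolding c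
  proof (rule integral_spike[OF negligible_frontier_interval])
    fix z assume "z \<in> cbox (- a, - b) (a, b) - (cbox (- a, - b) (a, b) - box (- a, - b) (a, b))"
    then show "g z = f z" by (cases z) (auto simp: box_def Basis_prod_def abs_less_iff intro!: assms[symmetric])
  qed
qed

text \<open>Every term is h times its reference value: the mass term by h^2 / \<tau> = h / (\<tau> /
  h), the derivative term by h^2 / h, and the sides by their length. Each formula holds off the cell
  boundary, where the test function or one component is not controlled, and null sets are
  discarded.\<close>

lemma B2_ref:
  assumes h: "h > 0" and \<tau>: "\<tau> > 0" and b: "b > 0" and w: "bmeas WC" "bmeas WD"
    and \<psi>: "\<And>x y. x \<in> interior (cell h c) \<Longrightarrow> y \<in> interior (cell (h * (2 * b)) cy) \<Longrightarrow> \<psi> x y = poly q y"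
    and wC: "\<And>x y. - (1/2) \<le> x \<Longrightarrow> x < 1/2 \<Longrightarrow> - b \<le> y \<Longrightarrow> y < b \<Longrightarrow> wC (c + h * x) (cy + h * y) = WC x y"
    and wD: "\<And>x y. \<bar>x\<bar> \<le> 1/2 \<Longrightarrow> \<bar>y\<bar> \<le> b \<Longrightarrow> wD (c + h * x) (cy + h * y) = WD x y"
  shows "B2 \<tau> h (h * (2 * b)) c cy wC wD \<psi> = h * refB (\<tau> / h) b WC WD (pscale h cy q)"
proof -
  let ?Q = "pscale h cy q"
  let ?R = "{- (1/2)..1/2 :: real} \<times> {- b..b}"
  have cells: "cell h c = {c + h * - (1/2)..c + h * (1/2)}" "cell (h * (2 * b)) cy = {cy + h * - b..cy + h * b}"
    by (auto simp: cell_def)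
  have psi: "\<psi> x y = poly q y" if "c + h * - (1/2) < x" "x < c + h * (1/2)" "cy + h * - b < y" "y < cy + h * b" for x y
    by (rule \<psi>) (use that in \<open>auto simp: cells\<close>)
  have int: "c + h * - (1/2) < c + h * x" "c + h * x < c + h * (1/2)" if "\<bar>x\<bar> < 1/2" for x
    using that h mult_strict_left_mono[of "- (1/2)" x h] by (auto simp: abs_less_iff)
  have int': "cy + h * - b < cy + h * y" "cy + h * y < cy + h * b" if "\<bar>y\<bar> < b" for y
    using that h mult_strict_left_mono[of "- b" y h] by (auto simp: abs_less_iff)
  have psi': "\<psi> (c + h * x) (cy + h * y) = poly ?Q y" if "\<bar>x\<bar> < 1/2" "\<bar>y\<bar> < b" for x y
    unfolding poly_pscale by (rule psi) (use int int' that in auto)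
  have dpsi: "dx \<psi> (c + h * x) (cy + h * y) + dy \<psi> (c + h * x) (cy + h * y) = 1 / h * poly (pderiv ?Q) y"
    if "\<bar>x\<bar> < 1/2" "\<bar>y\<bar> < b" for x y
  proof -
    have "((\<lambda>s. \<psi> s (cy + h * y)) has_real_derivative 0) (at (c + h * x))"
    proof (rule has_field_derivative_transform_within_open)
      show "((\<lambda>s. poly q (cy + h * y)) has_real_derivative 0) (at (c + h * x))" by simp
      show "c + h * x \<in> {c + h * - (1/2)<..<c + h * (1/2)}" using int[OF that(1)] by simp
    qed (use int' that in \<open>auto simp: psi\<close>)
    then have 1: "dx \<psi> (c + h * x) (cy + h * y) = 0" unfolding dx_def by (rule DERIV_imp_deriv)
    have "((\<lambda>s. \<psi> (c + h * x) s) has_real_derivative poly (pderiv q) (cy + h * y)) (at (cy + h * y))"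
    proof (rule has_field_derivative_transform_within_open)
      show "(poly q has_real_derivative poly (pderiv q) (cy + h * y)) (at (cy + h * y))" by (rule poly_DERIV)
      show "cy + h * y \<in> {cy + h * - b<..<cy + h * b}" using int'[OF that(2)] by simp
    qed (use int that in \<open>auto simp: psi\<close>)
    then have 2: "dy \<psi> (c + h * x) (cy + h * y) = poly (pderiv q) (cy + h * y)" unfolding dy_def by (rule DERIV_imp_deriv)
    show ?thesis unfolding 1 2 poly_pderiv_pscale using h by simp
  qed
  have I: "(\<lambda>z. W (fst z) (snd z) * poly p (snd z)) integrable_on ?R" if "bmeas W" for W p
    by (rule bmeas_integrable(2)[OF bmeas_mult_poly[OF that]])
  have "integral ?R (\<lambda>z. (wD (c + h * fst z) (cy + h * snd z) - wC (c + h * fst z) (cy + h * snd z)) * \<psi> (c + h * fst z) (cy + h * snd z))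
      = integral ?R (\<lambda>z. WD (fst z) (snd z) * poly ?Q (snd z) - WC (fst z) (snd z) * poly ?Q (snd z))"
    by (rule integral_rect_spike) (auto simp: psi' wC wD left_diff_distrib abs_less_iff)
  also have "\<dots> = bulk b ?Q WD - bulk b ?Q WC"
    unfolding bulk_def by (intro integral_diff I w)
  finally have 1: "integral (cell h c \<times> cell (h * (2 * b)) cy) (\<lambda>(x, y). (wD x y - wC x y) * \<psi> x y) = h\<^sup>2 * (bulk b ?Q WD - bulk b ?Q WC)"
    unfolding cells using b by (subst integral_affine2[OF h]) (simp_all add: case_prod_unfold)
  have "integral ?R (\<lambda>z. wD (c + h * fst z) (cy + h * snd z) * (dx \<psi> (c + h * fst z) (cy + h * snd z) + dy \<psi> (c + h * fst z) (cy + h * snd z)))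
      = integral ?R (\<lambda>z. 1 / h * (WD (fst z) (snd z) * poly (pderiv ?Q) (snd z)))"
    by (rule integral_rect_spike) (simp add: dpsi wD)
  also have "\<dots> = 1 / h * bulk b (pderiv ?Q) WD" unfolding bulk_def by simp
  finally have 2: "integral (cell h c \<times> cell (h * (2 * b)) cy) (\<lambda>(x, y). wD x y * (dx \<psi> x y + dy \<psi> x y)) = h * bulk b (pderiv ?Q) WD"
    unfolding cells using b h by (subst integral_affine2[OF h]) (simp_all add: case_prod_unfold power2_eq_square)
  have L1: "Lim (at_left (c + h / 2)) (\<lambda>s. \<psi> s (cy + h * y)) = poly ?Q y" "Lim (at_right (c - h / 2)) (\<lambda>s. \<psi> s (cy + h * y)) = poly ?Q y"
    if "\<bar>y\<bar> < b" for y
    using Lim_transform_value[of "\<lambda>s. poly ?Q y" "c - h / 2" "c + h / 2" "\<lambda>s. \<psi> s (cy + h * y)"] psi[of _ "cy + h * y"] int'[OF that] h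
    by (simp_all add: poly_pscale)
  have L2: "Lim (at_left (cy + h * (2 * b) / 2)) (\<lambda>t. \<psi> (c + h * x) t) = poly ?Q b" "Lim (at_right (cy - h * (2 * b) / 2)) (\<lambda>t. \<psi> (c + h * x) t) = poly ?Q (- b)"
    if "\<bar>x\<bar> < 1/2" for x
  proof -
    have "continuous_on UNIV (poly q)" by (intro continuous_intros)
    from Lim_transform_value[OF this, of "cy + h * - b" "cy + h * b" "\<lambda>t. \<psi> (c + h * x) t"] psi[of "c + h * x"] int[OF that] h b
    show "Lim (at_left (cy + h * (2 * b) / 2)) (\<lambda>t. \<psi> (c + h * x) t) = poly ?Q b" "Lim (at_right (cy - h * (2 * b) / 2)) (\<lambda>t. \<psi> (c + h * x) t) = poly ?Q (- b)"
      by (simp_all add: poly_pscale)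
  qed
  have e: "wD (c + h / 2) (cy + h * y) = WD (1/2) y" "wD (c - h / 2) (cy + h * y) = WD (- (1/2)) y" if "\<bar>y\<bar> \<le> b" for y
    using wD[of "1/2" y] wD[of "- (1/2)" y] that by simp_all
  have e': "wD (c + h * x) (cy + h * (2 * b) / 2) = WD x b" "wD (c + h * x) (cy - h * (2 * b) / 2) = WD x (- b)" if "\<bar>x\<bar> \<le> 1/2" for x
    using wD[of x b] wD[of x "- b"] that b by simp_all
  have J: "(\<lambda>y. W x y * poly p y) integrable_on {- b..b}" "(\<lambda>x. W x y * r) integrable_on {- (1/2)..1/2}" if "bmeas W" for W p x y r
    using bmeas_slice_integrable(1)[OF bmeas_mult_poly[OF that]] bmeas_slice_integrable(2)[OF that] by (auto intro: integrable_on_mult_left)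
  have "integral {- b..b} (\<lambda>y. wD (c + h / 2) (cy + h * y) * Lim (at_left (c + h / 2)) (\<lambda>s. \<psi> s (cy + h * y))
        - wD (c - h / 2) (cy + h * y) * Lim (at_right (c - h / 2)) (\<lambda>s. \<psi> s (cy + h * y)))
      = integral {- b..b} (\<lambda>y. WD (1/2) y * poly ?Q y - WD (- (1/2)) y * poly ?Q y)"
    by (rule integral_spike[of "{- b, b}"]) (auto simp: L1 e abs_le_iff abs_less_iff)
  also have "\<dots> = xside b (1/2) ?Q WD - xside b (- (1/2)) ?Q WD" unfolding xside_def by (intro integral_diff J w)
  finally have 3: "integral (cell (h * (2 * b)) cy) (\<lambda>y. wD (c + h / 2) y * Lim (at_left (c + h / 2)) (\<lambda>s. \<psi> s y)
        - wD (c - h / 2) y * Lim (at_right (c - h / 2)) (\<lambda>s. \<psi> s y)) = h * (xside b (1/2) ?Q WD - xside b (- (1/2)) ?Q WD)"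
    unfolding cells using b by (subst integral_affine[OF h]) simp_all
  have "integral {- (1/2)..1/2} (\<lambda>x. wD (c + h * x) (cy + h * (2 * b) / 2) * Lim (at_left (cy + h * (2 * b) / 2)) (\<lambda>t. \<psi> (c + h * x) t)
        - wD (c + h * x) (cy - h * (2 * b) / 2) * Lim (at_right (cy - h * (2 * b) / 2)) (\<lambda>t. \<psi> (c + h * x) t))
      = integral {- (1/2)..1/2} (\<lambda>x. WD x b * poly ?Q b - WD x (- b) * poly ?Q (- b))"
  proof (rule integral_spike[of "{- (1/2), 1/2}"])
    fix x :: real assume x: "x \<in> {- (1/2)..1/2} - {- (1/2), 1/2}"
    then have "\<bar>x\<bar> < 1/2" by (auto simp: abs_less_iff)
    then show "WD x b * poly ?Q b - WD x (- b) * poly ?Q (- b)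
      = wD (c + h * x) (cy + h * (2 * b) / 2) * Lim (at_left (cy + h * (2 * b) / 2)) (\<lambda>t. \<psi> (c + h * x) t)
        - wD (c + h * x) (cy - h * (2 * b) / 2) * Lim (at_right (cy - h * (2 * b) / 2)) (\<lambda>t. \<psi> (c + h * x) t)"
      by (simp only: L2 e' less_imp_le)
  qed simp
  also have "\<dots> = yside b WD * poly ?Q b - yside (- b) WD * poly ?Q (- b)"
    unfolding yside_def by (subst integral_diff) (auto intro: J w)
  finally have 4: "integral (cell h c) (\<lambda>x. wD x (cy + h * (2 * b) / 2) * Lim (at_left (cy + h * (2 * b) / 2)) (\<lambda>t. \<psi> x t)
        - wD x (cy - h * (2 * b) / 2) * Lim (at_right (cy - h * (2 * b) / 2)) (\<lambda>t. \<psi> x t))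
      = h * (yside b WD * poly ?Q b - yside (- b) WD * poly ?Q (- b))"
    unfolding cells using b by (subst integral_affine[OF h]) simp_all
  show ?thesis unfolding B2_def 1 2 3 4 refB_def by (simp add: algebra_simps power2_eq_square)
qed

lemma sum_B2_corr_X:
  assumes h: "h > 0" and \<tau>: "\<tau> > 0" and b: "b > 0" and k: "k \<ge> 1" and d: "jcont d" "jderiv 2 d"
    and \<psi>: "\<And>x y. x \<in> interior (cell h (centre m h x0 i)) \<Longrightarrow>
      y \<in> interior (cell (h * (2 * b)) (centre m (h * (2 * b)) y0 j)) \<Longrightarrow> \<psi> x y = poly q y"
  shows "(\<Sum>l = 0..min k 2. B2 \<tau> h (h * (2 * b)) (centre m h x0 i) (centre m (h * (2 * b)) y0 j)
      (corr_X k \<tau> h (h * (2 * b)) x0 y0 l m (d 0 0)) (corr_X k \<tau> h (h * (2 * b)) x0 y0 l (other m) (d 0 0)) \<psi>)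
    = h * cellB k (\<tau> / h) b (jscale h (centre m h x0 i) (centre m (h * (2 * b)) y0 j) d)
        (pscale h (centre m (h * (2 * b)) y0 j) q)"
  unfolding cellB_def sum_distrib_left
proof (rule sum.cong[OF refl])
  fix l assume "l \<in> {0..min k 2}"
  then have l: "jderiv l d" using d(2) by (auto intro: jderiv_mono)
  have j: "jcont (jscale h (centre m h x0 i) (centre m (h * (2 * b)) y0 j) d)" by (intro jcont_jscale d)
  show "B2 \<tau> h (h * (2 * b)) (centre m h x0 i) (centre m (h * (2 * b)) y0 j)
      (corr_X k \<tau> h (h * (2 * b)) x0 y0 l m (d 0 0)) (corr_X k \<tau> h (h * (2 * b)) x0 y0 l (other m) (d 0 0)) \<psi>
    = h * refB (\<tau> / h) b (locX k (\<tau> / h) b l (jscale h (centre m h x0 i) (centre m (h * (2 * b)) y0 j) d))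
        (gluX k (\<tau> / h) b l (jscale h (centre m h x0 i) (centre m (h * (2 * b)) y0 j) d))
        (pscale h (centre m (h * (2 * b)) y0 j) q)"
    by (rule B2_ref[OF h \<tau> b locX_bmeas[OF j] gluX_bmeas[OF j] \<psi>])
      (simp_all only: corr_X_loc[OF h \<tau> b k d(1) l] corr_X_other[OF h \<tau> b k d(1) l])
qed

section \<open>Summation over the mesh\<close>

text \<open>Cauchy-Schwarz with the constant 1, obtained from the nonnegative integral of (f - r)^2
  with \<open>r\<close> the mean value of f.\<close>

lemma square_integral_le:
  fixes f :: "'a::euclidean_space \<Rightarrow> real"
  assumes f: "f integrable_on S" "(\<lambda>x. (f x)\<^sup>2) integrable_on S" and c: "((\<lambda>x. 1) has_integral A) S" and A: "A > 0"
  shows "(integral S f)\<^sup>2 \<le> A * integral S (\<lambda>x. (f x)\<^sup>2)"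
proof -
  define r where "r = integral S f / A"
  have "((\<lambda>x. (f x)\<^sup>2 - 2 * r * f x + r\<^sup>2 * 1) has_integral (integral S (\<lambda>x. (f x)\<^sup>2) - 2 * r * integral S f + r\<^sup>2 * A)) S"
    by (intro has_integral_add has_integral_diff has_integral_mult_right integrable_integral f c)
  then have "0 \<le> integral S (\<lambda>x. (f x)\<^sup>2) - 2 * r * integral S f + r\<^sup>2 * A"
  proof (rule has_integral_nonneg)
    fix x
    have "(f x)\<^sup>2 - 2 * r * f x + r\<^sup>2 * 1 = (f x - r)\<^sup>2" by (simp add: power2_eq_square algebra_simps)
    then show "0 \<le> (f x)\<^sup>2 - 2 * r * f x + r\<^sup>2 * 1" by simp
  qed
  also have "\<dots> = integral S (\<lambda>x. (f x)\<^sup>2) - (integral S f)\<^sup>2 / A"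
    using A by (simp add: r_def power2_eq_square field_simps)
  finally show ?thesis using A by (simp add: field_simps)
qed

text \<open>Equivalence of norms on polynomials of degree at most k. A polynomial is expanded in the
  basis dual to its first k + 1 moments, which determine it because p is itself a combination of the
  monomials, and each moment is controlled by the L2 norm.\<close>

lemma poly_inverse_estimate:
  assumes b: "b > 0"
  shows "\<exists>C\<ge>0. \<forall>q. degree q \<le> k \<longrightarrow> (\<forall>y. \<bar>y\<bar> \<le> b \<longrightarrow>
    \<bar>poly q y\<bar> \<le> C * sqrt (integral {- b..b} (\<lambda>y. (poly q y)\<^sup>2)) \<and>
    \<bar>poly (pderiv q) y\<bar> \<le> C * sqrt (integral {- b..b} (\<lambda>y. (poly q y)\<^sup>2)))"
proof -
  define L where "L i q = weighted_int 0 (- b) b (monom 1 i) (poly q)" for i q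
  define S where "S q = sqrt (integral {- b..b} (\<lambda>y. (poly q y)\<^sup>2))" for q
  have pc: "continuous_on UNIV (poly q)" for q :: "real poly" by (intro continuous_intros)
  have lin: "lin_poly (L i)" for i
    unfolding lin_poly_def
  proof (intro conjI allI)
    fix p q :: "real poly" and a
    have e: "poly (p + q) = (\<lambda>x. 1 * poly p x + 1 * poly q x)" "poly (smult a p) = (\<lambda>x. a * poly p x + 0 * poly p x)"
      by (auto simp: fun_eq_iff)
    show "L i (p + q) = L i p + L i q" "L i (smult a p) = a * L i p"
      unfolding L_def e weighted_int_lin[OF pc pc] by simp_all
  qed
  have inj: "p = 0" if p: "degree p \<le> k" "\<And>i. i \<le> k \<Longrightarrow> L i p = 0" for p
  proof -
    have "weighted_int 0 (- b) b (\<Sum>i\<le>k. smult (coeff p i) (monom 1 i)) (poly p) = (\<Sum>i\<le>k. coeff p i * L i p)"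
      unfolding L_def lin_polyD(6)[OF weighted_int_lin_poly[OF pc]] lin_polyD(2)[OF weighted_int_lin_poly[OF pc]] ..
    also have "\<dots> = 0" using p(2) by simp
    also have "(\<Sum>i\<le>k. smult (coeff p i) (monom 1 i)) = p"
      using poly_as_sum_of_monoms'[OF p(1)] by (simp add: smult_monom)
    finally have "integral {- b..b} (\<lambda>x. (poly p x)\<^sup>2) = 0" by (simp add: weighted_int_def power2_eq_square)
    then have "poly p x = 0" if "x \<in> {- b..b}" for x
      using integral_square_zero_imp_zero[OF pc _ _ that] b by simp
    then show "p = 0" using b by (intro poly_zero_on_interval[of "- b" b]) auto
  qed
  from dual_basis_exists[of k L, OF lin inj] obtain e where e: "\<And>j. j \<le> k \<Longrightarrow> degree (e j) \<le> k"
    "\<And>i j. i \<le> k \<Longrightarrow> j \<le> k \<Longrightarrow> L i (e j) = (if i = j then 1 else 0)" by blast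
  have "\<exists>N\<ge>0. \<forall>q y. \<bar>y\<bar> \<le> b \<longrightarrow> \<bar>L j q * poly (e j) y\<bar> \<le> N * S q \<and> \<bar>L j q * poly (pderiv (e j)) y\<bar> \<le> N * S q" for j
  proof -
    obtain m where m: "m \<ge> 0" "\<And>x. x \<in> {- b..b} \<Longrightarrow> \<bar>poly (monom 1 j) x\<bar> \<le> m" using poly_bounded_on by blast
    obtain n where n: "n \<ge> 0" "\<And>x. x \<in> {- b..b} \<Longrightarrow> \<bar>poly (e j) x\<bar> \<le> n" using poly_bounded_on by blast
    obtain n' where n': "n' \<ge> 0" "\<And>x. x \<in> {- b..b} \<Longrightarrow> \<bar>poly (pderiv (e j)) x\<bar> \<le> n'" using poly_bounded_on by blast
    define B where "B = sqrt (2 * b) * m"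
    have B: "\<bar>L j q\<bar> \<le> B * S q" for q
    proof -
      have I: "(\<lambda>x. poly q x * poly (monom 1 j) x) integrable_on {- b..b}" "(\<lambda>x. (poly q x * poly (monom 1 j) x)\<^sup>2) integrable_on {- b..b}"
        "(\<lambda>x. (poly q x)\<^sup>2) integrable_on {- b..b}"
        by (intro continuous_imp_integrable continuous_intros)+
      have nn: "0 \<le> integral {- b..b} (\<lambda>x. (poly q x)\<^sup>2)" by (intro integral_nonneg I) simp
      have "((\<lambda>x::real. 1::real) has_integral 2 * b) {- b..b}" using has_integral_const_real[of "1::real" "- b" b] b by simp
      from square_integral_le[OF I(1,2) this] have "(L j q)\<^sup>2 \<le> 2 * b * integral {- b..b} (\<lambda>x. (poly q x * poly (monom 1 j) x)\<^sup>2)"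
        using b by (simp add: L_def weighted_int_def)
      also have "integral {- b..b} (\<lambda>x. (poly q x * poly (monom 1 j) x)\<^sup>2) \<le> integral {- b..b} (\<lambda>x. m\<^sup>2 * (poly q x)\<^sup>2)"
      proof (intro integral_le I integrable_on_mult_right)
        fix x assume "x \<in> {- b..b}"
        from power_mono[OF m(2)[OF this], of 2] have "(poly (monom 1 j) x)\<^sup>2 \<le> m\<^sup>2" by simp
        then have "(poly q x)\<^sup>2 * (poly (monom 1 j) x)\<^sup>2 \<le> (poly q x)\<^sup>2 * m\<^sup>2" by (rule mult_left_mono) simp
        then show "(poly q x * poly (monom 1 j) x)\<^sup>2 \<le> m\<^sup>2 * (poly q x)\<^sup>2"
          by (simp only: power_mult_distrib mult.commute)
      qed
      also have "2 * b * integral {- b..b} (\<lambda>x. m\<^sup>2 * (poly q x)\<^sup>2) = (B * S q)\<^sup>2"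
        using b nn by (simp add: B_def S_def power_mult_distrib)
      finally have "\<bar>L j q\<bar> \<le> \<bar>B * S q\<bar>" using b by (simp add: abs_le_square_iff)
      then show ?thesis using b m nn by (simp add: B_def S_def abs_mult)
    qed
    have B0: "B \<ge> 0" using b m by (simp add: B_def)
    have S0: "S q \<ge> 0" for q unfolding S_def by (intro real_sqrt_ge_zero integral_nonneg_always) simp
    have "\<bar>L j q * r\<bar> \<le> B * (n + n') * S q" if "\<bar>r\<bar> \<le> n + n'" for q r
    proof -
      have "\<bar>L j q\<bar> * \<bar>r\<bar> \<le> (B * S q) * (n + n')" using B[of q] that B0 S0[of q] by (intro mult_mono) auto
      then show ?thesis by (simp add: abs_mult mult_ac)
    qed
    moreover have "\<bar>poly (e j) y\<bar> \<le> n + n'" "\<bar>poly (pderiv (e j)) y\<bar> \<le> n + n'" if "\<bar>y\<bar> \<le> b" for y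
      using n(2)[of y] n'(2)[of y] that n(1) n'(1) by (auto simp: abs_le_iff)
    ultimately show ?thesis using B0 n n' by (intro exI[of _ "B * (n + n')"]) auto
  qed
  then obtain N where N: "\<And>j. N j \<ge> 0" "\<And>j q y. \<bar>y\<bar> \<le> b \<Longrightarrow> \<bar>L j q * poly (e j) y\<bar> \<le> N j * S q \<and> \<bar>L j q * poly (pderiv (e j)) y\<bar> \<le> N j * S q"
    by metis
  show ?thesis
  proof (intro exI[of _ "\<Sum>j\<le>k. N j"] conjI allI impI)
    show "0 \<le> (\<Sum>j\<le>k. N j)" using N by (intro sum_nonneg) auto
    fix q :: "real poly" and y assume q: "degree q \<le> k" and y: "\<bar>y\<bar> \<le> b"
    from dual_basis_expand[of k L e q "\<lambda>i. L i q", OF lin inj e q refl]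
    have q: "q = (\<Sum>j\<le>k. smult (L j q) (e j))" .
    have F: "F q = (\<Sum>j\<le>k. L j q * F (e j))" if "lin_poly F" for F :: "real poly \<Rightarrow> real"
    proof -
      have "F q = F (\<Sum>j\<le>k. smult (L j q) (e j))" by (rule arg_cong[OF q])
      then show ?thesis by (simp only: lin_polyD(2,6)[OF that])
    qed
    have "poly q y = (\<Sum>j\<le>k. L j q * poly (e j) y)" "poly (pderiv q) y = (\<Sum>j\<le>k. L j q * poly (pderiv (e j)) y)"
      by (rule F, rule lin_poly_eval) (rule F, rule lin_poly_pderiv[OF lin_poly_eval])
    then show "\<bar>poly q y\<bar> \<le> (\<Sum>j\<le>k. N j) * sqrt (integral {- b..b} (\<lambda>y. (poly q y)\<^sup>2))"
      "\<bar>poly (pderiv q) y\<bar> \<le> (\<Sum>j\<le>k. N j) * sqrt (integral {- b..b} (\<lambda>y. (poly q y)\<^sup>2))"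
      using N(2)[OF y] unfolding S_def[symmetric] sum_distrib_right by (auto intro!: order.trans[OF sum_abs] sum_mono)
  qed
qed

lemma additive_period:
  fixes J :: "real \<Rightarrow> real \<Rightarrow> real"
  assumes add: "\<And>a b c. a \<le> b \<Longrightarrow> b \<le> c \<Longrightarrow> J a c = J a b + J b c"
    and per: "\<And>a b. a \<le> b \<Longrightarrow> J (a + L) (b + L) = J a b" and L: "L \<ge> 0"
  shows "J z (z + L) = J w (w + L)"
proof -
  have "J z (z + L) = J w (w + L)" if "z \<le> w" for z w
  proof -
    have "J z (w + L) = J z w + J w (w + L)" "J z (w + L) = J z (z + L) + J (z + L) (w + L)"
      using that L by (intro add; linarith)+
    then show ?thesis using per[OF that] by simp
  qed
  from this[of z w] this[of w z] show ?thesis by linarith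
qed

lemma additive_sum:
  fixes J :: "real \<Rightarrow> real \<Rightarrow> real"
  assumes add: "\<And>a b c. a \<le> b \<Longrightarrow> b \<le> c \<Longrightarrow> J a c = J a b + J b c" and h: "h \<ge> 0"
  shows "(\<Sum>a<n. J (z + real a * h) (z + real a * h + h)) = J z (z + real n * h)"
proof (induction n)
  case 0
  then show ?case using add[of z z z] by simp
next
  case (Suc n)
  have "J z (z + real n * h + h) = J z (z + real n * h) + J (z + real n * h) (z + real n * h + h)"
    using h by (intro add) auto
  then show ?case using Suc by (simp add: algebra_simps)
qed

lemma sum_int_atLeast1: "(\<Sum>i = 1..int N. f i) = (\<Sum>a<N. f (int a + 1))"
  by (rule sum.reindex_bij_witness[of _ "\<lambda>a. int a + 1" "\<lambda>i. nat (i - 1)"]) auto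

text \<open>A patch of n cells around each centre splits into n cells; those in the same position
  within their patches tile one full period, so each period is counted n times.\<close>

lemma additive_cells:
  fixes J :: "real \<Rightarrow> real \<Rightarrow> real"
  assumes add: "\<And>a b c. a \<le> b \<Longrightarrow> b \<le> c \<Longrightarrow> J a c = J a b + J b c"
    and per: "\<And>a b. a \<le> b \<Longrightarrow> J (a + real N * h) (b + real N * h) = J a b" and h: "h > 0"
  shows "(\<Sum>i = 1..int N. J (centre m h x0 i - real n * (h / 2)) (centre m h x0 i + real n * (h / 2)))
    = real n * J x0 (x0 + real N * h)"
proof -
  \<comment> \<open>The left end of the e-th cell in the patch around the first centre.\<close>
  define z where "z e = offset m h x0 + h / 2 - real n * (h / 2) + real e * h" for e :: nat
  have c: "centre m h x0 (int a + 1) - real n * (h / 2) + real e * h = z e + real a * h" for a e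
    by (simp add: centre_def z_def algebra_simps)
  have "J (centre m h x0 (int a + 1) - real n * (h / 2)) (centre m h x0 (int a + 1) + real n * (h / 2))
      = (\<Sum>e<n. J (z e + real a * h) (z e + real a * h + h))" for a
    using additive_sum[where J = J and h = h and n = n and z = "centre m h x0 (int a + 1) - real n * (h / 2)", OF add] h unfolding c
    by (simp add: z_def centre_def algebra_simps)
  then have "(\<Sum>i = 1..int N. J (centre m h x0 i - real n * (h / 2)) (centre m h x0 i + real n * (h / 2)))
      = (\<Sum>a<N. \<Sum>e<n. J (z e + real a * h) (z e + real a * h + h))"
    unfolding sum_int_atLeast1 by simp
  also have "\<dots> = (\<Sum>e<n. \<Sum>a<N. J (z e + real a * h) (z e + real a * h + h))" by (rule sum.swap)
  also have "\<dots> = (\<Sum>e<n. J (z e) (z e + real N * h))" using additive_sum[where J = J and h = h and n = N, OF add] h by simp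
  also have "\<dots> = (\<Sum>e<n. J x0 (x0 + real N * h))"
    using h by (intro sum.cong refl additive_period[where J = J and L = "real N * h", OF add per]) auto
  finally show ?thesis by simp
qed

definition locint :: "(real \<times> real \<Rightarrow> real) \<Rightarrow> bool" where
  "locint f \<longleftrightarrow> (\<forall>a b c e. f integrable_on {a..b} \<times> {c..e})"

lemma locintD: "locint f \<Longrightarrow> f integrable_on {a..b} \<times> {c..e}"
  by (simp add: locint_def)

lemma rect_combine:
  fixes f :: "real \<times> real \<Rightarrow> real"
  shows "a \<le> b \<Longrightarrow> b \<le> c \<Longrightarrow> f integrable_on {a..b} \<times> Y \<Longrightarrow> f integrable_on {b..c} \<times> Y \<Longrightarrow>
      (f has_integral integral ({a..b} \<times> Y) f + integral ({b..c} \<times> Y) f) ({a..c} \<times> Y)"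
    and "a \<le> b \<Longrightarrow> b \<le> c \<Longrightarrow> f integrable_on X \<times> {a..b} \<Longrightarrow> f integrable_on X \<times> {b..c} \<Longrightarrow>
      (f has_integral integral (X \<times> {a..b}) f + integral (X \<times> {b..c}) f) (X \<times> {a..c})"
proof -
  have "negligible ({a..b} \<times> Y \<inter> {b..c} \<times> Y)" for Y :: "real set"
    by (rule negligible_subset[OF negligible_standard_hyperplane[of "(1, 0) :: real \<times> real" b]]) (auto simp: Basis_prod_def)
  moreover have "negligible (X \<times> {a..b} \<inter> X \<times> {b..c})" for X :: "real set"
    by (rule negligible_subset[OF negligible_standard_hyperplane[of "(0, 1) :: real \<times> real" b]]) (auto simp: Basis_prod_def)
  moreover have "{a..c} \<times> Y = {a..b} \<times> Y \<union> {b..c} \<times> Y" "X \<times> {a..c} = X \<times> {a..b} \<union> X \<times> {b..c}" if "a \<le> b" "b \<le> c"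
    using that by auto
  ultimately show "a \<le> b \<Longrightarrow> b \<le> c \<Longrightarrow> f integrable_on {a..b} \<times> Y \<Longrightarrow> f integrable_on {b..c} \<times> Y \<Longrightarrow>
      (f has_integral integral ({a..b} \<times> Y) f + integral ({b..c} \<times> Y) f) ({a..c} \<times> Y)"
    "a \<le> b \<Longrightarrow> b \<le> c \<Longrightarrow> f integrable_on X \<times> {a..b} \<Longrightarrow> f integrable_on X \<times> {b..c} \<Longrightarrow>
      (f has_integral integral (X \<times> {a..b}) f + integral (X \<times> {b..c}) f) (X \<times> {a..c})"
    by (simp_all only: has_integral_Un[OF integrable_integral integrable_integral])
qed

lemma rect_translate:
  fixes f :: "real \<times> real \<Rightarrow> real"
  assumes "a \<le> b" "c \<le> e"
  shows "integral ({a + r..b + r} \<times> {c + s..e + s}) f = integral ({a..b} \<times> {c..e}) (\<lambda>z. f (fst z + r, snd z + s))"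
proof -
  have "cbox (a, c) (b, e) \<noteq> {}" using assms by (auto simp: cbox_Pair_eq)
  from integral_affine_cbox[OF zero_less_one this, of "(r, s)" f] show ?thesis
    by (simp add: cbox_Pair_eq plus_prod_def)
qed

text \<open>Additivity and periodicity are used in one variable at a time. The value n = 5 is needed
  for the data and n = 1 for the test function.\<close>

lemma patch_sum:
  assumes f: "locint f" and per: "\<And>x y. f (x + real N * h, y) = f (x, y)" "\<And>x y. f (x, y + real N' * h') = f (x, y)"
    and h: "h > 0" "h' > 0"
  shows "(\<Sum>i = 1..int N. \<Sum>j = 1..int N'. integral
      ({centre m h x0 i - real n * (h / 2)..centre m h x0 i + real n * (h / 2)} \<times>
       {centre m h' y0 j - real n * (h' / 2)..centre m h' y0 j + real n * (h' / 2)}) f)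
    = (real n)\<^sup>2 * integral (rect x0 (x0 + real N * h) y0 (y0 + real N' * h')) f"
proof -
  have add: "a \<le> b \<Longrightarrow> b \<le> c' \<Longrightarrow> integral ({a..c'} \<times> {c..e}) f = integral ({a..b} \<times> {c..e}) f + integral ({b..c'} \<times> {c..e}) f"
    "a \<le> b \<Longrightarrow> b \<le> c' \<Longrightarrow> integral ({c..e} \<times> {a..c'}) f = integral ({c..e} \<times> {a..b}) f + integral ({c..e} \<times> {b..c'}) f" for a b c c' e
    using rect_combine[OF _ _ locintD[OF f] locintD[OF f]] by (simp_all add: integral_unique)
  have tr: "integral ({a + real N * h..b + real N * h} \<times> {c..e}) f = integral ({a..b} \<times> {c..e}) f"
    "integral ({c..e} \<times> {a + real N' * h'..b + real N' * h'}) f = integral ({c..e} \<times> {a..b}) f"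
    if "a \<le> b" "c \<le> e" for a b c e
    using rect_translate[OF that, of "real N * h" 0 f] rect_translate[OF that(2,1), of 0 "real N' * h'" f] by (simp_all add: per)
  let ?c = "centre m h x0" and ?e = "centre m h' y0"
  have Y: "?e j - real n * (h' / 2) \<le> ?e j + real n * (h' / 2)" for j using h by simp
  have X: "x0 \<le> x0 + real N * h" using h by simp
  have "(\<Sum>i = 1..int N. \<Sum>j = 1..int N'. integral ({?c i - real n * (h / 2)..?c i + real n * (h / 2)} \<times> {?e j - real n * (h' / 2)..?e j + real n * (h' / 2)}) f)
    = (\<Sum>j = 1..int N'. \<Sum>i = 1..int N. integral ({?c i - real n * (h / 2)..?c i + real n * (h / 2)} \<times> {?e j - real n * (h' / 2)..?e j + real n * (h' / 2)}) f)"
    by (rule sum.swap)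
  also have "\<dots> = (\<Sum>j = 1..int N'. real n * integral ({x0..x0 + real N * h} \<times> {?e j - real n * (h' / 2)..?e j + real n * (h' / 2)}) f)"
    by (intro sum.cong refl additive_cells[where J = "\<lambda>a b. integral ({a..b} \<times> _) f"] add tr Y h)
  also have "\<dots> = real n * (\<Sum>j = 1..int N'. integral ({x0..x0 + real N * h} \<times> {?e j - real n * (h' / 2)..?e j + real n * (h' / 2)}) f)"
    by (simp add: sum_distrib_left)
  also have "\<dots> = real n * (real n * integral ({x0..x0 + real N * h} \<times> {y0..y0 + real N' * h'}) f)"
    by (intro arg_cong[of _ _ "times (real n)"] additive_cells[where J = "\<lambda>a b. integral ({x0..x0 + real N * h} \<times> {a..b}) f"] add tr X h)
  finally show ?thesis by (simp add: rect_def power2_eq_square)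
qed

text \<open>For properties known cell by cell: consecutive cells are joined until they cover the
  interval. It makes a piecewise polynomial test function integrable on every rectangle.\<close>

lemma cells_exhaust:
  assumes trans: "\<And>a b c. a \<le> b \<Longrightarrow> b \<le> c \<Longrightarrow> P a b \<Longrightarrow> P b c \<Longrightarrow> P a c"
    and mono: "\<And>a b a' b'. P a b \<Longrightarrow> a \<le> a' \<Longrightarrow> b' \<le> b \<Longrightarrow> P a' b'"
    and cells: "\<And>i. P (centre m h x0 i - h / 2) (centre m h x0 i + h / 2)" and h: "h > 0"
  shows "P a b"
proof -
  define z where "z i = offset m h x0 + real_of_int i * h" for i
  have z: "P (z i) (z (i + 1))" for i using cells[of "i + 1"] by (simp add: z_def centre_def algebra_simps)
  have n: "P (z i) (z (i + 1 + int n))" for i n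
  proof (induction n)
    case (Suc n)
    have "P (z (i + 1 + int n)) (z (i + 1 + int n + 1))" by (rule z)
    then show ?case using Suc h by (intro trans[OF _ _ Suc]) (auto simp: z_def algebra_simps)
  qed (simp add: z)
  define i where "i = \<lfloor>(a - offset m h x0) / h\<rfloor>"
  have "real_of_int i \<le> (a - offset m h x0) / h" unfolding i_def by simp
  then have 1: "z i \<le> a" using h by (simp add: z_def field_simps)
  obtain n where "(b - z i) / h \<le> real n" using real_arch_simple by blast
  then have "b \<le> z i + real n * h" using h by (simp add: field_simps)
  also have "\<dots> \<le> z (i + 1 + int n)" using h by (simp add: z_def algebra_simps)
  finally show ?thesis by (rule mono[OF n 1])
qed

lemma locint_cells:
  fixes f :: "real \<times> real \<Rightarrow> real"
  assumes f: "\<And>i j. f integrable_on cell h (centre m h x0 i) \<times> cell h' (centre m h' y0 j)" and h: "h > 0" "h' > 0"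
  shows "locint f"
proof -
  have mono: "f integrable_on X' \<times> Y'" if "f integrable_on X \<times> Y" "X = {a..b}" "Y = {c..e}" "X' = {a'..b'}" "Y' = {c'..e'}" "X' \<subseteq> X" "Y' \<subseteq> Y"
    for X Y X' Y' a b c e a' b' c' e'
  proof -
    have "X \<times> Y = cbox (a, c) (b, e)" "X' \<times> Y' = cbox (a', c') (b', e')" using that(2-5) by (simp_all add: cbox_Pair_eq)
    moreover have "X' \<times> Y' \<subseteq> X \<times> Y" using that by auto
    ultimately show ?thesis using that(1) by (metis integrable_on_subcbox)
  qed
  have 1: "f integrable_on {a..b} \<times> cell h' (centre m h' y0 j)" for a b j
  proof (rule cells_exhaust[of "\<lambda>a b. f integrable_on {a..b} \<times> cell h' (centre m h' y0 j)" m h x0, OF _ _ _ h(1)])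
    show "f integrable_on {a..c} \<times> cell h' (centre m h' y0 j)" if "a \<le> b" "b \<le> c" "f integrable_on {a..b} \<times> cell h' (centre m h' y0 j)"
      "f integrable_on {b..c} \<times> cell h' (centre m h' y0 j)" for a b c
      using rect_combine(1)[OF that] by (auto simp: integrable_on_def)
    show "f integrable_on {a'..b'} \<times> cell h' (centre m h' y0 j)" if "f integrable_on {a..b} \<times> cell h' (centre m h' y0 j)" "a \<le> a'" "b' \<le> b" for a b a' b'
      by (rule mono[OF that(1) refl cell_def refl cell_def]) (use that in auto)
    show "f integrable_on {centre m h x0 i - h / 2..centre m h x0 i + h / 2} \<times> cell h' (centre m h' y0 j)" for i
      using f[of i j] unfolding cell_def[of h] .
  qed
  have "f integrable_on {a..b} \<times> {c..e}" for a b c e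
  proof (rule cells_exhaust[of "\<lambda>c e. f integrable_on {a..b} \<times> {c..e}" m h' y0, OF _ _ _ h(2)])
    show "f integrable_on {a..b} \<times> {c..c''}" if "c \<le> c'" "c' \<le> c''" "f integrable_on {a..b} \<times> {c..c'}" "f integrable_on {a..b} \<times> {c'..c''}" for c c' c''
      using rect_combine(2)[OF that] by (auto simp: integrable_on_def)
    show "f integrable_on {a..b} \<times> {c'..e'}" if "f integrable_on {a..b} \<times> {c..e}" "c \<le> c'" "e' \<le> e" for c e c' e'
      by (rule mono[OF that(1) refl refl refl refl]) (use that in auto)
    show "f integrable_on {a..b} \<times> {centre m h' y0 j - h' / 2..centre m h' y0 j + h' / 2}" for j
      using 1[of a b j] unfolding cell_def .
  qed
  then show ?thesis by (simp add: locint_def)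
qed

section \<open>Exchanging the variables\<close>

text \<open>Valid without integrability, since the integral of a non-integrable function is zero on
  both sides.\<close>

lemma integral_rect_swap:
  fixes f :: "real \<times> real \<Rightarrow> real"
  shows "integral ({a..b} \<times> {c..e}) f = integral ({c..e} \<times> {a..b}) (\<lambda>z. f (prod.swap z))"
proof -
  have *: "(g has_integral i) (cbox (a, c) (b, e))" if "((\<lambda>z. g (prod.swap z)) has_integral i) (cbox (c, a) (e, b))"
    for g :: "real \<times> real \<Rightarrow> real" and i a b c e
  proof -
    have "(g has_integral i) (prod.swap ` cbox (c, a) (e, b))"
    proof (rule has_integral_twiddle[of 1 prod.swap prod.swap "\<lambda>z. g (prod.swap z)" i, simplified])
      show "\<And>u v. measure lborel (prod.swap ` cbox u v) = measure lborel (cbox u v)"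
        by (metis content_Pair mult.commute old.prod.exhaust swap_cbox_Pair)
      show "((\<lambda>z. g (prod.swap z)) has_integral i) (cbox (c, a) (e, b))" by (rule that)
    qed (use isCont_swap in \<open>fastforce+\<close>)
    then show ?thesis by (simp add: swap_cbox_Pair)
  qed
  have C: "{a..b} \<times> {c..e} = cbox (a, c) (b, e)" "{c..e} \<times> {a..b} = cbox (c, a) (e, b)" by (simp_all add: cbox_Pair_eq)
  show ?thesis unfolding C
  proof (cases "f integrable_on cbox (a, c) (b, e)")
    case True
    from *[where g = "\<lambda>z. f (prod.swap z)" and c = a and a = c and e = b and b = e] integrable_integral[OF True]
    have "((\<lambda>z. f (prod.swap z)) has_integral integral (cbox (a, c) (b, e)) f) (cbox (c, a) (e, b))" by simp
    then show "integral (cbox (a, c) (b, e)) f = integral (cbox (c, a) (e, b)) (\<lambda>z. f (prod.swap z))" by (simp add: integral_unique)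
  next
    case False
    moreover have "\<not> (\<lambda>z. f (prod.swap z)) integrable_on cbox (c, a) (e, b)"
      using False *[of f _ c a e b] unfolding integrable_on_def by blast
    ultimately show "integral (cbox (a, c) (b, e)) f = integral (cbox (c, a) (e, b)) (\<lambda>z. f (prod.swap z))"
      by (simp add: not_integrable_integral)
  qed
qed

lemma B2_swap:
  "B2 \<tau> hx hy cx cy wC wD \<phi> = B2 \<tau> hy hx cy cx (\<lambda>s t. wC t s) (\<lambda>s t. wD t s) (\<lambda>s t. \<phi> t s)"
proof -
  have "dx (\<lambda>s t. \<phi> t s) y x = dy \<phi> x y" "dy (\<lambda>s t. \<phi> t s) y x = dx \<phi> x y" for x y by (simp_all add: dx_def dy_def)
  then show ?thesis unfolding B2_def cell_def by (subst (1 2) integral_rect_swap) (simp add: case_prod_unfold add.commute)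
qed

text \<open>The y-direction is the x-direction of the transposed function on the transposed mesh, so
  one directional estimate serves both.\<close>

lemma corr_Gam_swap:
  "corr_Gam k \<tau> hx hy x0 y0 l m v = (\<lambda>x y. corr_X k \<tau> hy hx y0 x0 l m (\<lambda>s t. v t s) y x)"
  by (simp add: corr_Gam_def corr_X_def gam_def fun_eq_iff)

section \<open>The global estimate\<close>

lemma smooth_jet_jcont: "smooth_jet d \<Longrightarrow> jcont d"
  by (simp add: smooth_jet_def jcont_def)

lemma smooth_jet_jscale:
  assumes "smooth_jet d" shows "smooth_jet (jscale h c e d)"
proof -
  have "((\<lambda>s. h ^ (a + b) * d a b (c + h * s) (e + h * y)) has_real_derivative h ^ (Suc a + b) * d (Suc a) b (c + h * x) (e + h * y)) (at x)"
    for a b x y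
  proof -
    have "((\<lambda>s. d a b s (e + h * y)) has_real_derivative d (Suc a) b (c + h * x) (e + h * y)) (at (c + h * x))"
      using assms by (simp add: smooth_jet_def)
    moreover have "((\<lambda>s. c + h * s) has_real_derivative h) (at x)" by (auto intro!: derivative_eq_intros)
    ultimately have "((\<lambda>s. d a b (c + h * s) (e + h * y)) has_real_derivative d (Suc a) b (c + h * x) (e + h * y) * h) (at x)"
      by (rule DERIV_chain2)
    from DERIV_cmult[OF this, of "h ^ (a + b)"] show ?thesis by (simp add: mult_ac)
  qed
  moreover have "((\<lambda>s. h ^ (a + b) * d a b (c + h * x) (e + h * s)) has_real_derivative h ^ (a + Suc b) * d a (Suc b) (c + h * x) (e + h * y)) (at y)"
    for a b x y
  proof -
    have "((\<lambda>s. d a b (c + h * x) s) has_real_derivative d a (Suc b) (c + h * x) (e + h * y)) (at (e + h * y))"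
      using assms by (simp add: smooth_jet_def)
    moreover have "((\<lambda>s. e + h * s) has_real_derivative h) (at y)" by (auto intro!: derivative_eq_intros)
    ultimately have "((\<lambda>s. d a b (c + h * x) (e + h * s)) has_real_derivative d a (Suc b) (c + h * x) (e + h * y) * h) (at y)"
      by (rule DERIV_chain2)
    from DERIV_cmult[OF this, of "h ^ (a + b)"] show ?thesis by (simp add: mult_ac)
  qed
  moreover have "jcont (jscale h c e d)" by (intro jcont_jscale smooth_jet_jcont assms)
  ultimately show ?thesis unfolding smooth_jet_def jcont_def jscale_def by blast
qed

abbreviation patch :: "real \<Rightarrow> real \<Rightarrow> real \<Rightarrow> real \<Rightarrow> real \<Rightarrow> (real \<times> real) set" where
  "patch b r h c e \<equiv> {c + h * - (r / 2)..c + h * (r / 2)} \<times> {e + h * - (r * b)..e + h * (r * b)}"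

text \<open>The rescaled derivative carries h^(\<sigma> + 1), and returning from the reference patch
  to the L2 norm on the actual one costs a factor h. The number 50b is the area of the reference
  patch, 5 times 10b.\<close>

lemma iint_jscale_le:
  assumes h: "h > 0" and b: "b > 0" and d: "jcont d" and mn: "m + n = Suc \<sigma>"
  shows "iint (5/2) (5 * b) (\<lambda>x y. \<bar>jscale h c e d m n x y\<bar>)
    \<le> sqrt (50 * b) * h ^ \<sigma> * sqrt (integral (patch b 5 h c e) (\<lambda>z. (d m n (fst z) (snd z))\<^sup>2))"
proof -
  let ?D = "jscale h c e d m n" and ?S = "{- (5/2)..5/2 :: real} \<times> {- (5 * b)..5 * b}"
  let ?I = "integral (patch b 5 h c e) (\<lambda>z. (d m n (fst z) (snd z))\<^sup>2)"
  have c2: "cont2 ?D" using jcont_jscale[OF d, of h c e] by (simp add: jcont_def cont2_def)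
  note bm = cont2_bmeas[OF cont2_intros(4)[OF c2]]
  have e: "iint (5/2) (5 * b) (\<lambda>x y. \<bar>?D x y\<bar>) = integral ?S (\<lambda>z. \<bar>?D (fst z) (snd z)\<bar>)"
    unfolding iint_def bmeas_fubini(1)[OF bm] ..
  have I: "(\<lambda>z. \<bar>?D (fst z) (snd z)\<bar>) integrable_on ?S" by (rule bmeas_integrable(2)[OF bm])
  have I2: "(\<lambda>z. \<bar>?D (fst z) (snd z)\<bar>\<^sup>2) integrable_on ?S"
    using bmeas_integrable(2)[OF bmeas_mult[OF bm bm]] by (simp add: power2_eq_square)
  have C: "?S = cbox (- (5/2), - (5 * b)) (5/2, 5 * b)" by (simp add: cbox_Pair_eq)
  have "((\<lambda>z::real \<times> real. 1 :: real) has_integral 50 * b) ?S"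
    using has_integral_const[of "1::real" "(- (5/2) :: real, - (5 * b))" "(5/2, 5 * b)"] b unfolding C by (simp add: content_Pair)
  from square_integral_le[OF I I2 this] b
  have "(iint (5/2) (5 * b) (\<lambda>x y. \<bar>?D x y\<bar>))\<^sup>2 \<le> 50 * b * integral ?S (\<lambda>z. \<bar>?D (fst z) (snd z)\<bar>\<^sup>2)" unfolding e by simp
  also have "integral ?S (\<lambda>z. \<bar>?D (fst z) (snd z)\<bar>\<^sup>2)
      = (h ^ \<sigma>)\<^sup>2 * (h\<^sup>2 * integral ?S (\<lambda>z. (d m n (c + h * fst z) (e + h * snd z))\<^sup>2))"
    by (simp add: jscale_def mn power_mult_distrib mult_ac flip: integral_mult_right)
  also have "h\<^sup>2 * integral ?S (\<lambda>z. (d m n (c + h * fst z) (e + h * snd z))\<^sup>2) = ?I"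
    using b by (subst integral_affine2[OF h]) simp_all
  finally have "(iint (5/2) (5 * b) (\<lambda>x y. \<bar>?D x y\<bar>))\<^sup>2 \<le> 50 * b * ((h ^ \<sigma>)\<^sup>2 * ?I)" .
  also have "\<dots> = (sqrt (50 * b) * h ^ \<sigma> * sqrt ?I)\<^sup>2"
    using b integral_nonneg_always[of "\<lambda>z. (d m n (fst z) (snd z))\<^sup>2" "patch b 5 h c e"] by (simp add: power_mult_distrib)
  finally show ?thesis
  proof (rule power2_le_imp_le)
    show "0 \<le> sqrt (50 * b) * h ^ \<sigma> * sqrt ?I"
      by (intro mult_nonneg_nonneg real_sqrt_ge_zero integral_nonneg_always) (use b h in auto)
  qed
qed

text \<open>The factor h is exactly the one standing in front of \<open>cellB\<close>, so the test
  function leaves the power of h untouched.\<close>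

lemma cell_norm_eq:
  assumes h: "h > 0" and b: "b > 0"
  shows "sqrt (integral (patch b 1 h c e) (\<lambda>z. (poly q (snd z))\<^sup>2)) = h * sqrt (integral {- b..b} (\<lambda>y. (poly (pscale h e q) y)\<^sup>2))"
proof -
  have "cont2 (\<lambda>x y. 1 * (poly (pscale h e q) y)\<^sup>2)" by (intro cont2_tensor continuous_intros)
  then have bm: "bmeas (\<lambda>x y. (poly (pscale h e q) y)\<^sup>2)" by (intro cont2_bmeas) simp
  have "integral (patch b 1 h c e) (\<lambda>z. (poly q (snd z))\<^sup>2)
      = h\<^sup>2 * integral ({- (1/2)..1/2 :: real} \<times> {- b..b}) (\<lambda>z. (poly (pscale h e q) (snd z))\<^sup>2)"
    using b by (simp only: mult_1, subst integral_affine2[OF h]) (simp_all add: poly_pscale)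
  also have "integral ({- (1/2)..1/2 :: real} \<times> {- b..b}) (\<lambda>z. (poly (pscale h e q) (snd z))\<^sup>2)
      = integral {- b..b} (\<lambda>y. (poly (pscale h e q) y)\<^sup>2)"
    using bmeas_fubini(2)[OF bm, of "1/2" b] by simp
  finally show ?thesis using h by (simp add: real_sqrt_mult)
qed

text \<open>The functional estimate needs a pointwise bound of the test polynomial and its
  derivative, which the inverse estimate converts into its L2 norm. The count \<sigma> + 2 is the
  number of derivatives of order \<sigma> + 1.\<close>

lemma cell_smooth_estimate:
  assumes t: "t > 0" and b: "b > 0" and k: "k \<ge> 1"
  defines "\<sigma> \<equiv> min (2 * k + 1) (k + 3)"
  shows "\<exists>C\<ge>0. \<forall>h c e d q. h > 0 \<longrightarrow> smooth_jet d \<longrightarrow> degree q \<le> k \<longrightarrow>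
    \<bar>h * cellB k t b (jscale h c e d) (pscale h e q)\<bar> \<le> C * h ^ \<sigma> *
      (sqrt (\<Sum>m\<le>\<sigma> + 1. integral (patch b 5 h c e) (\<lambda>z. (d m (\<sigma> + 1 - m) (fst z) (snd z))\<^sup>2)) *
       sqrt (integral (patch b 1 h c e) (\<lambda>z. (poly q (snd z))\<^sup>2)))"
proof -
  have s: "min (2 * k + 2) (k + 4) = \<sigma> + 1" by (simp add: \<sigma>_def)
  obtain A where A: "A \<ge> 0" "\<And>d q N. smooth_jet d \<Longrightarrow> (\<And>y. \<bar>y\<bar> \<le> b \<Longrightarrow> \<bar>poly q y\<bar> \<le> N \<and> \<bar>poly (pderiv q) y\<bar> \<le> N) \<Longrightarrow>
    \<bar>cellB k t b d q\<bar> \<le> A * (N * (\<Sum>m\<le>\<sigma> + 1. iint (5/2) (5 * b) (\<lambda>x y. \<bar>d m (\<sigma> + 1 - m) x y\<bar>)))"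
    using cellB_estimate[OF t b k] unfolding s by blast
  obtain B where B: "B \<ge> 0" "\<And>q y. degree q \<le> k \<Longrightarrow> \<bar>y\<bar> \<le> b \<Longrightarrow> \<bar>poly q y\<bar> \<le> B * sqrt (integral {- b..b} (\<lambda>y. (poly q y)\<^sup>2)) \<and>
    \<bar>poly (pderiv q) y\<bar> \<le> B * sqrt (integral {- b..b} (\<lambda>y. (poly q y)\<^sup>2))"
    using poly_inverse_estimate[OF b, of k] by blast
  define E where "E = sqrt (50 * b)"
  have E: "E \<ge> 0" using b by (simp add: E_def)
  have "\<bar>h * cellB k t b (jscale h c e d) (pscale h e q)\<bar> \<le> (A * B * real (\<sigma> + 2) * E) * h ^ \<sigma> *
      (sqrt (\<Sum>m\<le>\<sigma> + 1. integral (patch b 5 h c e) (\<lambda>z. (d m (\<sigma> + 1 - m) (fst z) (snd z))\<^sup>2)) *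
       sqrt (integral (patch b 1 h c e) (\<lambda>z. (poly q (snd z))\<^sup>2)))"
    if h: "h > 0" and d: "smooth_jet d" and q: "degree q \<le> k" for h c e d q
  proof -
    let ?Q = "pscale h e q"
    let ?G = "\<lambda>m. integral (patch b 5 h c e) (\<lambda>z. (d m (\<sigma> + 1 - m) (fst z) (snd z))\<^sup>2)"
    define K G where "K = sqrt (integral {- b..b} (\<lambda>y. (poly ?Q y)\<^sup>2))" and "G = sqrt (\<Sum>m\<le>\<sigma> + 1. ?G m)"
    have K: "K \<ge> 0" unfolding K_def by (intro real_sqrt_ge_zero integral_nonneg_always) simp
    have dQ: "degree ?Q \<le> k" using q h by (simp add: degree_pscale)
    have "iint (5/2) (5 * b) (\<lambda>x y. \<bar>jscale h c e d m (\<sigma> + 1 - m) x y\<bar>) \<le> E * h ^ \<sigma> * G" if "m \<le> \<sigma> + 1" for m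
    proof -
      have "?G m \<le> (\<Sum>m\<le>\<sigma> + 1. ?G m)" by (rule member_le_sum) (use that in \<open>auto intro!: integral_nonneg_always\<close>)
      then have "sqrt (?G m) \<le> G" unfolding G_def by (rule real_sqrt_le_mono)
      have "m + (\<sigma> + 1 - m) = Suc \<sigma>" using that by simp
      from iint_jscale_le[OF h b smooth_jet_jcont[OF d] this, of c e]
      have "iint (5/2) (5 * b) (\<lambda>x y. \<bar>jscale h c e d m (\<sigma> + 1 - m) x y\<bar>) \<le> E * h ^ \<sigma> * sqrt (?G m)"
        by (simp only: E_def)
      also have "\<dots> \<le> E * h ^ \<sigma> * G" using E h \<open>sqrt (?G m) \<le> G\<close> by (intro mult_left_mono) auto
      finally show ?thesis .
    qed
    then have "(\<Sum>m\<le>\<sigma> + 1. iint (5/2) (5 * b) (\<lambda>x y. \<bar>jscale h c e d m (\<sigma> + 1 - m) x y\<bar>)) \<le> (\<Sum>m\<le>\<sigma> + 1. E * h ^ \<sigma> * G)"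
      by (intro sum_mono) auto
    then have S: "(\<Sum>m\<le>\<sigma> + 1. iint (5/2) (5 * b) (\<lambda>x y. \<bar>jscale h c e d m (\<sigma> + 1 - m) x y\<bar>)) \<le> real (\<sigma> + 2) * (E * h ^ \<sigma> * G)"
      by simp
    have "\<bar>cellB k t b (jscale h c e d) ?Q\<bar> \<le> A * ((B * K) * (\<Sum>m\<le>\<sigma> + 1. iint (5/2) (5 * b) (\<lambda>x y. \<bar>jscale h c e d m (\<sigma> + 1 - m) x y\<bar>)))"
      unfolding K_def by (rule A(2)[OF smooth_jet_jscale[OF d] B(2)[OF dQ]])
    also have "\<dots> \<le> A * ((B * K) * (real (\<sigma> + 2) * (E * h ^ \<sigma> * G)))"
      using A(1) B(1) K by (intro mult_left_mono S) auto
    finally have "h * \<bar>cellB k t b (jscale h c e d) ?Q\<bar> \<le> h * (A * ((B * K) * (real (\<sigma> + 2) * (E * h ^ \<sigma> * G))))"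
      using h by (intro mult_left_mono) auto
    then show ?thesis unfolding cell_norm_eq[OF h b] K_def[symmetric] G_def[symmetric] using h by (simp add: abs_mult mult_ac)
  qed
  moreover have "0 \<le> A * B * real (\<sigma> + 2) * E" using A(1) B(1) E by simp
  ultimately show ?thesis by blast
qed

text \<open>Being constant in x on the cell, the function is determined by its values at the centre
  abscissa.\<close>

lemma Qbar_x_poly:
  assumes "\<psi> \<in> Qbar_x m k x0 y0 hx hy Nx Ny" and h: "hx > 0"
  shows "\<exists>q. degree q \<le> k \<and> (\<forall>x \<in> interior (cell hx (centre m hx x0 i)).
    \<forall>y \<in> interior (cell hy (centre m hy y0 j)). \<psi> x y = poly q y)"
proof -
  let ?c = "centre m hx x0 i"
  have c: "?c \<in> interior (cell hx ?c)" using h by (simp add: cell_def)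
  obtain a where a: "\<And>x y. x \<in> interior (cell hx ?c) \<Longrightarrow> y \<in> interior (cell hy (centre m hy y0 j)) \<Longrightarrow>
      \<psi> x y = (\<Sum>p\<le>k. \<Sum>q\<le>k. a p q * x ^ p * y ^ q)"
    using assms(1) unfolding Qbar_x_def Qspace_def by blast
  define q where "q = (\<Sum>r\<le>k. monom (\<Sum>p\<le>k. a p r * ?c ^ p) r)"
  have "degree q \<le> k" unfolding q_def by (intro degree_sum_le) (auto intro: order.trans[OF degree_monom_le])
  moreover have "\<psi> x y = poly q y" if "x \<in> interior (cell hx ?c)" "y \<in> interior (cell hy (centre m hy y0 j))" for x y
  proof -
    have "\<psi> x y = \<psi> ?c y" using assms(1) that c unfolding Qbar_x_def by blast
    also have "\<dots> = (\<Sum>p\<le>k. \<Sum>r\<le>k. a p r * ?c ^ p * y ^ r)" by (rule a[OF c that(2)])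
    also have "\<dots> = poly q y" by (subst sum.swap) (simp add: q_def poly_sum poly_monom sum_distrib_right)
    finally show ?thesis .
  qed
  ultimately show ?thesis by blast
qed

lemma cell_square_integral:
  assumes "\<And>x y. x \<in> interior (cell hx c) \<Longrightarrow> y \<in> interior (cell hy e) \<Longrightarrow> \<psi> x y = poly q y"
  shows "((\<lambda>(x, y). (\<psi> x y)\<^sup>2) has_integral integral (cell hx c \<times> cell hy e) (\<lambda>z. (poly q (snd z))\<^sup>2)) (cell hx c \<times> cell hy e)"
proof -
  have C: "cell hx c \<times> cell hy e = cbox (c - hx / 2, e - hy / 2) (c + hx / 2, e + hy / 2)"
    by (simp add: cell_def cbox_Pair_eq)
  show ?thesis unfolding C
  proof (rule has_integral_spike[OF negligible_frontier_interval])
    show "((\<lambda>z. (poly q (snd z))\<^sup>2) has_integral integral (cbox (c - hx / 2, e - hy / 2) (c + hx / 2, e + hy / 2)) (\<lambda>z. (poly q (snd z))\<^sup>2))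
        (cbox (c - hx / 2, e - hy / 2) (c + hx / 2, e + hy / 2))"
      by (intro integrable_integral integrable_continuous continuous_intros)
    fix z assume "z \<in> cbox (c - hx / 2, e - hy / 2) (c + hx / 2, e + hy / 2)
        - (cbox (c - hx / 2, e - hy / 2) (c + hx / 2, e + hy / 2) - box (c - hx / 2, e - hy / 2) (c + hx / 2, e + hy / 2))"
    then have "fst z \<in> interior (cell hx c)" "snd z \<in> interior (cell hy e)"
      by (cases z; auto simp: box_def Basis_prod_def cell_def)+
    then show "(case z of (x, y) \<Rightarrow> (\<psi> x y)\<^sup>2) = (poly q (snd z))\<^sup>2" by (simp add: assms case_prod_unfold)
  qed
qed

lemma double_sum_Cauchy_Schwarz:
  fixes f g :: "'a \<Rightarrow> 'b \<Rightarrow> real"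
  assumes "\<And>i j. f i j \<ge> 0" "\<And>i j. g i j \<ge> 0"
  shows "(\<Sum>i\<in>A. \<Sum>j\<in>B. sqrt (f i j) * sqrt (g i j)) \<le> sqrt (\<Sum>i\<in>A. \<Sum>j\<in>B. f i j) * sqrt (\<Sum>i\<in>A. \<Sum>j\<in>B. g i j)"
proof -
  have "(\<Sum>z\<in>A \<times> B. \<bar>sqrt (f (fst z) (snd z))\<bar> * \<bar>sqrt (g (fst z) (snd z))\<bar>)
      \<le> L2_set (\<lambda>z. sqrt (f (fst z) (snd z))) (A \<times> B) * L2_set (\<lambda>z. sqrt (g (fst z) (snd z))) (A \<times> B)"
    by (rule L2_set_mult_ineq)
  then show ?thesis using assms by (simp add: L2_set_def sum.cartesian_product case_prod_unfold)
qed

text \<open>The patches overlap 25-fold, which costs a factor 5 after the Cauchy-Schwarz inequality,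
  whereas the squared norms of the test function on the cells add up without overlap.\<close>

lemma smooth_estimate:
  assumes t: "t > 0" and b: "b > 0" and k: "k \<ge> 1"
  defines "\<sigma> \<equiv> min (2 * k + 1) (k + 3)"
  shows "\<exists>C\<ge>0. \<forall>h x0 y0 Nx Ny m d \<psi> q. h > 0 \<longrightarrow> smooth_jet d \<longrightarrow>
    (\<forall>a c. periodic2 (real Nx * h) (real Ny * (h * (2 * b))) (d a c)) \<longrightarrow>
    periodic2 (real Nx * h) (real Ny * (h * (2 * b))) \<psi> \<longrightarrow>
    (\<forall>i j. degree (q i j) \<le> k) \<longrightarrow>
    (\<forall>i j. \<forall>x \<in> interior (cell h (centre m h x0 i)). \<forall>y \<in> interior (cell (h * (2 * b)) (centre m (h * (2 * b)) y0 j)). \<psi> x y = poly (q i j) y) \<longrightarrow>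
    (\<Sum>i = 1..int Nx. \<Sum>j = 1..int Ny. \<bar>h * cellB k t b (jscale h (centre m h x0 i) (centre m (h * (2 * b)) y0 j) d)
        (pscale h (centre m (h * (2 * b)) y0 j) (q i j))\<bar>)
    \<le> C * h ^ \<sigma> *
      (sqrt (\<Sum>n\<le>\<sigma> + 1. integral (rect x0 (x0 + real Nx * h) y0 (y0 + real Ny * (h * (2 * b)))) (\<lambda>z. (d n (\<sigma> + 1 - n) (fst z) (snd z))\<^sup>2)) *
       L2_norm (rect x0 (x0 + real Nx * h) y0 (y0 + real Ny * (h * (2 * b)))) \<psi>)"
proof -
  obtain C where C: "C \<ge> 0" "\<And>h c e d q. h > 0 \<Longrightarrow> smooth_jet d \<Longrightarrow> degree q \<le> k \<Longrightarrow>
    \<bar>h * cellB k t b (jscale h c e d) (pscale h e q)\<bar> \<le> C * h ^ \<sigma> *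
      (sqrt (\<Sum>m\<le>\<sigma> + 1. integral (patch b 5 h c e) (\<lambda>z. (d m (\<sigma> + 1 - m) (fst z) (snd z))\<^sup>2)) *
       sqrt (integral (patch b 1 h c e) (\<lambda>z. (poly q (snd z))\<^sup>2)))"
    using cell_smooth_estimate[OF t b k] unfolding \<sigma>_def by blast
  have "(\<Sum>i = 1..int Nx. \<Sum>j = 1..int Ny. \<bar>h * cellB k t b (jscale h (centre m h x0 i) (centre m (h * (2 * b)) y0 j) d)
        (pscale h (centre m (h * (2 * b)) y0 j) (q i j))\<bar>)
    \<le> (C * 5) * h ^ \<sigma> *
      (sqrt (\<Sum>n\<le>\<sigma> + 1. integral (rect x0 (x0 + real Nx * h) y0 (y0 + real Ny * (h * (2 * b)))) (\<lambda>z. (d n (\<sigma> + 1 - n) (fst z) (snd z))\<^sup>2)) *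
       L2_norm (rect x0 (x0 + real Nx * h) y0 (y0 + real Ny * (h * (2 * b)))) \<psi>)"
    if h: "h > 0" and d: "smooth_jet d" and pd: "\<And>a c. periodic2 (real Nx * h) (real Ny * (h * (2 * b))) (d a c)"
      and pp: "periodic2 (real Nx * h) (real Ny * (h * (2 * b))) \<psi>" and q: "\<And>i j. degree (q i j) \<le> k"
      and \<psi>: "\<And>i j x y. x \<in> interior (cell h (centre m h x0 i)) \<Longrightarrow> y \<in> interior (cell (h * (2 * b)) (centre m (h * (2 * b)) y0 j)) \<Longrightarrow> \<psi> x y = poly (q i j) y"
    for h x0 y0 Nx Ny m d \<psi> q
  proof -
    define h' where "h' = h * (2 * b)"
    have h': "h' > 0" using h b by (simp add: h'_def)
    let ?c = "centre m h x0" and ?e = "centre m h' y0" and ?R = "rect x0 (x0 + real Nx * h) y0 (y0 + real Ny * h')"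
    let ?g = "\<lambda>n z. (d n (\<sigma> + 1 - n) (fst z) (snd z))\<^sup>2" and ?f = "\<lambda>(x, y). (\<psi> x y)\<^sup>2"
    define G P where "G i j = (\<Sum>n\<le>\<sigma> + 1. integral (patch b 5 h (?c i) (?e j)) (?g n))"
      and "P i j = integral (patch b 1 h (?c i) (?e j)) (\<lambda>z. (poly (q i j) (snd z))\<^sup>2)" for i j
    have p5: "patch b 5 h c e = {c - real 5 * (h / 2)..c + real 5 * (h / 2)} \<times> {e - real 5 * (h' / 2)..e + real 5 * (h' / 2)}" for c e
      by (simp add: h'_def mult_ac)
    have p1: "patch b 1 h c e = cell h c \<times> cell h' e"
      "cell h c \<times> cell h' e = {c - real 1 * (h / 2)..c + real 1 * (h / 2)} \<times> {e - real 1 * (h' / 2)..e + real 1 * (h' / 2)}" for c e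
      by (simp_all add: h'_def cell_def)
    have sq: "(?f has_integral P i j) (cell h (?c i) \<times> cell h' (?e j))" for i j
      unfolding P_def p1(1) using \<psi> unfolding h'_def by (rule cell_square_integral)
    have GS: "(\<Sum>i = 1..int Nx. \<Sum>j = 1..int Ny. G i j) = 25 * (\<Sum>n\<le>\<sigma> + 1. integral ?R (?g n))"
    proof -
      have c: "continuous_on UNIV (?g n)" for n
        using smooth_jetD(1)[OF d, of n "\<sigma> + 1 - n"] by (auto simp: cont2_def case_prod_unfold intro!: continuous_intros)
      have li: "locint (?g n)" for n
        unfolding locint_def
      proof (intro allI)
        fix a b c' e
        have "?g n integrable_on cbox (a, c') (b, e)" by (rule integrable_continuous[OF continuous_on_subset[OF c]]) simp
        then show "?g n integrable_on {a..b} \<times> {c'..e}" by (simp add: cbox_Pair_eq)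
      qed
      have per: "?g n (x + real Nx * h, y) = ?g n (x, y)" "?g n (x, y + real Ny * h') = ?g n (x, y)" for n x y
        using pd[of n "\<sigma> + 1 - n"] by (simp_all add: periodic2_def h'_def)
      have "(\<Sum>i = 1..int Nx. \<Sum>j = 1..int Ny. G i j)
          = (\<Sum>n\<le>\<sigma> + 1. \<Sum>i = 1..int Nx. \<Sum>j = 1..int Ny. integral (patch b 5 h (?c i) (?e j)) (?g n))"
        unfolding G_def by (simp only: sum.swap[of _ "{..\<sigma> + 1}"])
      also have "\<dots> = (\<Sum>n\<le>\<sigma> + 1. (real 5)\<^sup>2 * integral ?R (?g n))"
        unfolding p5 by (intro sum.cong refl patch_sum li per h h')
      finally show ?thesis by (simp add: sum_distrib_left)
    qed
    have PS: "(\<Sum>i = 1..int Nx. \<Sum>j = 1..int Ny. P i j) = (L2_norm ?R \<psi>)\<^sup>2"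
    proof -
      have li: "locint ?f" by (rule locint_cells[OF _ h h']) (use sq in \<open>auto simp: integrable_on_def\<close>)
      have per: "?f (x + real Nx * h, y) = ?f (x, y)" "?f (x, y + real Ny * h') = ?f (x, y)" for x y
        using pp by (simp_all add: periodic2_def h'_def)
      have "P i j = integral (cell h (?c i) \<times> cell h' (?e j)) ?f" for i j
        using integral_unique[OF sq[of i j]] by simp
      then have "(\<Sum>i = 1..int Nx. \<Sum>j = 1..int Ny. P i j) = (real 1)\<^sup>2 * integral ?R ?f"
        unfolding p1(2) by (simp only:) (intro patch_sum li per h h')
      also have "\<dots> = (L2_norm ?R \<psi>)\<^sup>2"
        unfolding L2_norm_def by (subst real_sqrt_pow2) (auto intro!: integral_nonneg_always)
      finally show ?thesis .
    qed
    have L0: "L2_norm ?R \<psi> \<ge> 0" unfolding L2_norm_def by (intro real_sqrt_ge_zero integral_nonneg_always) auto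
    have "(\<Sum>i = 1..int Nx. \<Sum>j = 1..int Ny. \<bar>h * cellB k t b (jscale h (?c i) (?e j) d) (pscale h (?e j) (q i j))\<bar>)
      \<le> (\<Sum>i = 1..int Nx. \<Sum>j = 1..int Ny. C * h ^ \<sigma> * (sqrt (G i j) * sqrt (P i j)))"
      unfolding G_def P_def by (intro sum_mono C(2)[OF h d q])
    also have "\<dots> = C * h ^ \<sigma> * (\<Sum>i = 1..int Nx. \<Sum>j = 1..int Ny. sqrt (G i j) * sqrt (P i j))"
      by (simp add: sum_distrib_left)
    also have "\<dots> \<le> C * h ^ \<sigma> * (sqrt (\<Sum>i = 1..int Nx. \<Sum>j = 1..int Ny. G i j) * sqrt (\<Sum>i = 1..int Nx. \<Sum>j = 1..int Ny. P i j))"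
      using C(1) h unfolding G_def P_def
      by (intro mult_left_mono double_sum_Cauchy_Schwarz sum_nonneg integral_nonneg_always) auto
    also have "sqrt (\<Sum>i = 1..int Nx. \<Sum>j = 1..int Ny. G i j) = 5 * sqrt (\<Sum>n\<le>\<sigma> + 1. integral ?R (?g n))"
      unfolding GS real_sqrt_mult by simp
    also have "sqrt (\<Sum>i = 1..int Nx. \<Sum>j = 1..int Ny. P i j) = L2_norm ?R \<psi>" unfolding PS using L0 by simp
    finally show ?thesis unfolding h'_def[symmetric] by (simp only: mult_ac)
  qed
  then show ?thesis using C(1) by (intro exI[of _ "C * 5"]) auto
qed

text \<open>The functional is linear and bounded by derivatives up to order two, hence continuous
  under uniform convergence of these.\<close>

lemma cellB_tendsto:
  assumes t: "t > 0" and b: "b > 0" and h: "h > 0" and w: "jcont w" and dn: "\<And>n. jcont (dn n)"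
    and lim: "\<And>a c \<epsilon>. a + c \<le> 2 \<Longrightarrow> \<epsilon> > 0 \<Longrightarrow> \<forall>\<^sub>F n in sequentially. \<forall>x y. \<bar>dn n a c x y - w a c x y\<bar> < \<epsilon>"
  shows "(\<lambda>n. cellB k t b (jscale h c e (dn n)) q) \<longlonglongrightarrow> cellB k t b (jscale h c e w) q"
proof (rule tendstoI)
  fix r :: real assume r: "r > 0"
  obtain A where A: "A \<ge> 0" "\<And>d q M N. pbound b d M \<Longrightarrow> (\<forall>y. \<bar>y\<bar> \<le> b \<longrightarrow> \<bar>poly q y\<bar> \<le> N \<and> \<bar>poly (pderiv q) y\<bar> \<le> N) \<Longrightarrow>
    \<bar>cellB k t b d q\<bar> \<le> A * (M * N)" using cellB_bound[OF t b] by blast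
  obtain N1 where N1: "N1 \<ge> 0" "\<forall>x\<in>{- b..b}. \<bar>poly q x\<bar> \<le> N1" using poly_bounded_on by blast
  obtain N2 where N2: "N2 \<ge> 0" "\<forall>x\<in>{- b..b}. \<bar>poly (pderiv q) x\<bar> \<le> N2" using poly_bounded_on by blast
  have N: "\<forall>y. \<bar>y\<bar> \<le> b \<longrightarrow> \<bar>poly q y\<bar> \<le> N1 + N2 \<and> \<bar>poly (pderiv q) y\<bar> \<le> N1 + N2"
  proof (intro allI impI)
    fix y assume "\<bar>y\<bar> \<le> b"
    then have "y \<in> {- b..b}" by (auto simp: abs_le_iff)
    then show "\<bar>poly q y\<bar> \<le> N1 + N2 \<and> \<bar>poly (pderiv q) y\<bar> \<le> N1 + N2" using N1 N2 by force
  qed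
  define K where "K = A * ((1 + h)\<^sup>2 * (N1 + N2))"
  have K: "K \<ge> 0" using A(1) N1(1) N2(1) by (simp add: K_def)
  define \<epsilon> where "\<epsilon> = r / (K + 1)"
  have \<epsilon>: "\<epsilon> > 0" using r K by (simp add: \<epsilon>_def)
  have fin: "finite {(a, c). a + c \<le> (2::nat)}" by (rule finite_subset[of _ "{..2} \<times> {..2}"]) auto
  have "\<forall>\<^sub>F n in sequentially. \<forall>z\<in>{(a, c). a + c \<le> (2::nat)}. \<forall>x y. \<bar>dn n (fst z) (snd z) x y - w (fst z) (snd z) x y\<bar> < \<epsilon>"
    by (intro eventually_ball_finite fin) (use lim \<epsilon> in auto)
  then show "\<forall>\<^sub>F n in sequentially. dist (cellB k t b (jscale h c e (dn n)) q) (cellB k t b (jscale h c e w) q) < r"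
  proof eventually_elim
    case (elim n)
    let ?J = "jlin 1 (jscale h c e (dn n)) (- 1) (jscale h c e w)"
    have j: "jcont (jscale h c e (dn n))" "jcont (jscale h c e w)" by (intro jcont_jscale w dn)+
    have "pbound b ?J ((1 + h)\<^sup>2 * \<epsilon>)"
      unfolding pbound_def
    proof (intro conjI allI impI)
      show "jcont ?J" by (intro jcont_jlin j)
      fix a c' :: nat and x y :: real assume ac: "a + c' \<le> 2"
      \<comment> \<open>A bound of the scaling factors for all orders up to two, whether h is below
        or above 1.\<close>
      have "h ^ (a + c') \<le> (1 + h) ^ (a + c')" using h by (intro power_mono) auto
      also have "\<dots> \<le> (1 + h)\<^sup>2" using h ac by (intro power_increasing) auto
      finally have "h ^ (a + c') \<le> (1 + h)\<^sup>2" .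
      moreover have "\<bar>dn n a c' (c + h * x) (e + h * y) - w a c' (c + h * x) (e + h * y)\<bar> \<le> \<epsilon>"
        using elim ac by (force intro: less_imp_le)
      ultimately have "h ^ (a + c') * \<bar>dn n a c' (c + h * x) (e + h * y) - w a c' (c + h * x) (e + h * y)\<bar> \<le> (1 + h)\<^sup>2 * \<epsilon>"
        by (intro mult_mono) auto
      moreover have "?J a c' x y = h ^ (a + c') * (dn n a c' (c + h * x) (e + h * y) - w a c' (c + h * x) (e + h * y))"
        by (simp add: jlin_def jscale_def algebra_simps)
      ultimately show "\<bar>?J a c' x y\<bar> \<le> (1 + h)\<^sup>2 * \<epsilon>" using h by (simp only: abs_mult) simp
    qed
    from A(2)[OF this N] have "\<bar>cellB k t b ?J q\<bar> \<le> K * \<epsilon>" by (simp add: K_def mult_ac)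
    also have "K * \<epsilon> < r" using K r by (simp add: \<epsilon>_def field_simps)
    finally show ?case unfolding cellB_jlin[OF j] by (simp add: dist_real_def)
  qed
qed

text \<open>The approximating jets enter abstractly, through their convergence up to order two and a
  uniform bound \<open>H\<close> at order \<sigma> + 1, so that the partial sums and their
  transposes can both be inserted.\<close>

lemma directional_estimate:
  assumes t: "t > 0" and b: "b > 0" and k: "k \<ge> 1"
  defines "\<sigma> \<equiv> min (2 * k + 1) (k + 3)"
  shows "\<exists>C\<ge>0. \<forall>h \<tau> h' x0 y0 x1 y1 Nx Ny m w dn H \<psi>. h > 0 \<longrightarrow> \<tau> = t * h \<longrightarrow> h' = h * (2 * b) \<longrightarrow>
    x1 = x0 + real Nx * h \<longrightarrow> y1 = y0 + real Ny * h' \<longrightarrow> jcont w \<longrightarrow> jderiv 2 w \<longrightarrow> (\<forall>n. smooth_jet (dn n)) \<longrightarrow>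
    (\<forall>n a c. periodic2 (x1 - x0) (y1 - y0) (dn n a c)) \<longrightarrow>
    (\<forall>a c \<epsilon>. a + c \<le> 2 \<longrightarrow> \<epsilon> > 0 \<longrightarrow> (\<forall>\<^sub>F n in sequentially. \<forall>x y. \<bar>dn n a c x y - w a c x y\<bar> < \<epsilon>)) \<longrightarrow>
    (\<forall>n. (\<Sum>a\<le>\<sigma> + 1. integral (rect x0 x1 y0 y1) (\<lambda>z. (dn n a (\<sigma> + 1 - a) (fst z) (snd z))\<^sup>2)) \<le> H\<^sup>2) \<longrightarrow> H \<ge> 0 \<longrightarrow>
    \<psi> \<in> Qbar_x m k x0 y0 h h' Nx Ny \<longrightarrow>
    (\<Sum>i = 1..int Nx. \<Sum>j = 1..int Ny. \<bar>\<Sum>l = 0..min k 2. B2 \<tau> h h' (centre m h x0 i) (centre m h' y0 j)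
        (corr_X k \<tau> h h' x0 y0 l m (w 0 0)) (corr_X k \<tau> h h' x0 y0 l (other m) (w 0 0)) \<psi>\<bar>)
    \<le> C * (h ^ \<sigma> * H * L2_norm (rect x0 x1 y0 y1) \<psi>)"
proof -
  obtain C where C: "C \<ge> 0" "\<And>h x0 y0 Nx Ny m d \<psi> q. h > 0 \<Longrightarrow> smooth_jet d \<Longrightarrow>
    (\<forall>a c. periodic2 (real Nx * h) (real Ny * (h * (2 * b))) (d a c)) \<Longrightarrow>
    periodic2 (real Nx * h) (real Ny * (h * (2 * b))) \<psi> \<Longrightarrow>
    (\<forall>i j. degree (q i j) \<le> k) \<Longrightarrow>
    (\<forall>i j. \<forall>x \<in> interior (cell h (centre m h x0 i)). \<forall>y \<in> interior (cell (h * (2 * b)) (centre m (h * (2 * b)) y0 j)). \<psi> x y = poly (q i j) y) \<Longrightarrow>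
    (\<Sum>i = 1..int Nx. \<Sum>j = 1..int Ny. \<bar>h * cellB k t b (jscale h (centre m h x0 i) (centre m (h * (2 * b)) y0 j) d)
        (pscale h (centre m (h * (2 * b)) y0 j) (q i j))\<bar>)
    \<le> C * h ^ \<sigma> *
      (sqrt (\<Sum>n\<le>\<sigma> + 1. integral (rect x0 (x0 + real Nx * h) y0 (y0 + real Ny * (h * (2 * b)))) (\<lambda>z. (d n (\<sigma> + 1 - n) (fst z) (snd z))\<^sup>2)) *
       L2_norm (rect x0 (x0 + real Nx * h) y0 (y0 + real Ny * (h * (2 * b)))) \<psi>)"
    using smooth_estimate[OF t b k] unfolding \<sigma>_def by blast
  show ?thesis
  proof (intro exI[of _ C] conjI C(1) allI impI)
    fix h \<tau> h' x0 y0 x1 y1 :: real and Nx Ny m w and dn :: "nat \<Rightarrow> jet" and H and \<psi>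
    assume h: "h > 0" and \<tau>: "\<tau> = t * h" and h': "h' = h * (2 * b)" and x1: "x1 = x0 + real Nx * h" and y1: "y1 = y0 + real Ny * h'"
      and w: "jcont w" "jderiv 2 w" and dn: "\<forall>n. smooth_jet (dn n)" and per: "\<forall>n a c. periodic2 (x1 - x0) (y1 - y0) (dn n a c)"
      and lim: "\<forall>a c \<epsilon>. a + c \<le> 2 \<longrightarrow> \<epsilon> > 0 \<longrightarrow> (\<forall>\<^sub>F n in sequentially. \<forall>x y. \<bar>dn n a c x y - w a c x y\<bar> < \<epsilon>)"
      and H: "\<forall>n. (\<Sum>a\<le>\<sigma> + 1. integral (rect x0 x1 y0 y1) (\<lambda>z. (dn n a (\<sigma> + 1 - a) (fst z) (snd z))\<^sup>2)) \<le> H\<^sup>2" "H \<ge> 0"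
      and \<psi>: "\<psi> \<in> Qbar_x m k x0 y0 h h' Nx Ny"
    let ?c = "centre m h x0" and ?e = "centre m h' y0"
    have "\<exists>q. degree q \<le> k \<and> (\<forall>x \<in> interior (cell h (?c i)). \<forall>y \<in> interior (cell h' (?e j)). \<psi> x y = poly q y)" for i j
      by (rule Qbar_x_poly[OF \<psi> h])
    then obtain q where q: "\<And>i j. degree (q i j) \<le> k"
      "\<And>i j x y. x \<in> interior (cell h (?c i)) \<Longrightarrow> y \<in> interior (cell h' (?e j)) \<Longrightarrow> \<psi> x y = poly (q i j) y" by metis
    have th: "\<tau> / h = t" "\<tau> > 0" using \<tau> h t by simp_all
    have eq: "(\<Sum>l = 0..min k 2. B2 \<tau> h h' (?c i) (?e j) (corr_X k \<tau> h h' x0 y0 l m (w 0 0)) (corr_X k \<tau> h h' x0 y0 l (other m) (w 0 0)) \<psi>)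
      = h * cellB k t b (jscale h (?c i) (?e j) w) (pscale h (?e j) (q i j))" for i j
      using sum_B2_corr_X[OF h th(2) b k w, of m x0 i y0 j \<psi> "q i j"] q(2) unfolding th(1) h' by blast
    define S where "S d = (\<Sum>i = 1..int Nx. \<Sum>j = 1..int Ny. \<bar>h * cellB k t b (jscale h (?c i) (?e j) d) (pscale h (?e j) (q i j))\<bar>)" for d
    \<comment> \<open>On a fixed mesh this is a finite sum of cell functionals, and the bound does
      not depend on n.\<close>
    have "(\<lambda>n. S (dn n)) \<longlonglongrightarrow> S w"
      unfolding S_def using lim dn
      by (intro tendsto_sum tendsto_rabs tendsto_mult tendsto_const cellB_tendsto t b h w smooth_jet_jcont) auto
    moreover have "S (dn n) \<le> C * (h ^ \<sigma> * H * L2_norm (rect x0 x1 y0 y1) \<psi>)" for n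
    proof -
      let ?G = "\<Sum>a\<le>\<sigma> + 1. integral (rect x0 x1 y0 y1) (\<lambda>z. (dn n a (\<sigma> + 1 - a) (fst z) (snd z))\<^sup>2)"
      have p: "\<forall>a c. periodic2 (real Nx * h) (real Ny * (h * (2 * b))) (dn n a c)" using per by (simp add: x1 y1 h')
      have p': "periodic2 (real Nx * h) (real Ny * (h * (2 * b))) \<psi>" using \<psi> by (simp add: Qbar_x_def Qspace_def h')
      have "S (dn n) \<le> C * h ^ \<sigma> * (sqrt ?G * L2_norm (rect x0 x1 y0 y1) \<psi>)"
        unfolding S_def x1 y1 h' by (rule C(2)[OF h _ p p']) (use dn q in \<open>auto simp: h'\<close>)
      also have "\<dots> \<le> C * h ^ \<sigma> * (H * L2_norm (rect x0 x1 y0 y1) \<psi>)"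
      proof (intro mult_left_mono mult_right_mono)
        show "sqrt ?G \<le> H" using H by (intro real_le_lsqrt) auto
        show "0 \<le> L2_norm (rect x0 x1 y0 y1) \<psi>" unfolding L2_norm_def by (intro real_sqrt_ge_zero integral_nonneg_always) auto
      qed (use C(1) h in auto)
      finally show ?thesis by (simp add: mult_ac)
    qed
    ultimately have "S w \<le> C * (h ^ \<sigma> * H * L2_norm (rect x0 x1 y0 y1) \<psi>)" by (intro LIMSEQ_le_const2) auto
    then show "(\<Sum>i = 1..int Nx. \<Sum>j = 1..int Ny. \<bar>\<Sum>l = 0..min k 2. B2 \<tau> h h' (?c i) (?e j)
        (corr_X k \<tau> h h' x0 y0 l m (w 0 0)) (corr_X k \<tau> h h' x0 y0 l (other m) (w 0 0)) \<psi>\<bar>)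
      \<le> C * (h ^ \<sigma> * H * L2_norm (rect x0 x1 y0 y1) \<psi>)" unfolding eq S_def .
  qed
qed

text \<open>Transposition also transposes the coefficient matrix of the polynomial on each
  cell.\<close>

lemma Qbar_swap:
  assumes "\<psi> \<in> Qbar_y m k x0 y0 hx hy Nx Ny"
  shows "(\<lambda>s t. \<psi> t s) \<in> Qbar_x m k y0 x0 hy hx Ny Nx"
proof -
  have p: "periodic2 (real Nx * hx) (real Ny * hy) \<psi>"
    and s: "\<And>i j. \<exists>a. \<forall>x \<in> interior (cell hx (centre m hx x0 i)). \<forall>y \<in> interior (cell hy (centre m hy y0 j)).
          \<psi> x y = (\<Sum>p\<le>k. \<Sum>q\<le>k. a p q * x ^ p * y ^ q)"
    and c: "\<And>i j x y y'. x \<in> interior (cell hx (centre m hx x0 i)) \<Longrightarrow> y \<in> interior (cell hy (centre m hy y0 j)) \<Longrightarrow>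
       y' \<in> interior (cell hy (centre m hy y0 j)) \<Longrightarrow> \<psi> x y = \<psi> x y'"
    using assms unfolding Qbar_y_def Qspace_def by blast+
  have "\<exists>a. \<forall>y \<in> interior (cell hy (centre m hy y0 j)). \<forall>x \<in> interior (cell hx (centre m hx x0 i)).
          \<psi> x y = (\<Sum>p\<le>k. \<Sum>q\<le>k. a p q * y ^ p * x ^ q)" for i j
  proof -
    obtain a where a: "\<And>x y. x \<in> interior (cell hx (centre m hx x0 i)) \<Longrightarrow> y \<in> interior (cell hy (centre m hy y0 j)) \<Longrightarrow>
          \<psi> x y = (\<Sum>p\<le>k. \<Sum>q\<le>k. a p q * x ^ p * y ^ q)" using s by blast
    have "(\<Sum>p\<le>k. \<Sum>q\<le>k. a p q * x ^ p * y ^ q) = (\<Sum>p\<le>k. \<Sum>q\<le>k. a q p * y ^ p * x ^ q)" for x y :: real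
      by (subst sum.swap) (simp add: mult_ac)
    then show ?thesis using a by (intro exI[of _ "\<lambda>p q. a q p"]) simp
  qed
  moreover have "periodic2 (real Ny * hy) (real Nx * hx) (\<lambda>s t. \<psi> t s)" using p by (simp add: periodic2_def)
  ultimately have "(\<lambda>s t. \<psi> t s) \<in> Qspace m k y0 x0 hy hx Ny Nx" unfolding Qspace_def by simp
  moreover have "\<forall>i j. \<forall>x \<in> interior (cell hy (centre m hy y0 i)). \<forall>x' \<in> interior (cell hy (centre m hy y0 i)).
       \<forall>y \<in> interior (cell hx (centre m hx x0 j)). \<psi> y x = \<psi> y x'"
    by (intro allI ballI) (rule c; assumption)
  ultimately show ?thesis unfolding Qbar_x_def by (intro CollectI conjI)
qed

theorem proposition4p10:
  fixes k :: nat and CFL \<rho> x0 x1 y0 y1 :: real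
  assumes "k \<ge> 1" and "CFL > 0" and "\<rho> > 0" and "x0 < x1" and "y0 < y1"
  defines "\<sigma> \<equiv> min (2 * k + 1) (k + 3)"
  shows "\<exists>M>0. \<forall>(Nx::nat) (Ny::nat) hx hy h \<tau> u v.
    Nx \<ge> 1 \<and> Ny \<ge> 1 \<and> hx = (x1 - x0) / real Nx \<and> hy = (y1 - y0) / real Ny \<and> hx / hy = \<rho> \<and>
    h = max hx hy \<and> \<tau> = tau_max CFL hx hy \<and>
    u \<in> H_per x0 x1 y0 y1 (\<sigma> + 1) \<and> v = cont_rep u \<longrightarrow>
    (\<forall>m. \<forall>\<psi>x \<in> Qbar_x m k x0 y0 hx hy Nx Ny. \<forall>\<psi>y \<in> Qbar_y m k x0 y0 hx hy Nx Ny.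
        (\<Sum>i = 1..int Nx. \<Sum>j = 1..int Ny. \<bar>\<Sum>l = 0..min k 2.
            B2 \<tau> hx hy (centre m hx x0 i) (centre m hy y0 j)
              (corr_X k \<tau> hx hy x0 y0 l m v) (corr_X k \<tau> hx hy x0 y0 l (other m) v) \<psi>x\<bar>)
        \<le> M * (h ^ \<sigma> * H_norm x0 x1 y0 y1 (\<sigma> + 1) u * L2_norm (rect x0 x1 y0 y1) \<psi>x) \<and>
        (\<Sum>i = 1..int Nx. \<Sum>j = 1..int Ny. \<bar>\<Sum>l = 0..min k 2.
            B2 \<tau> hx hy (centre m hx x0 i) (centre m hy y0 j)
              (corr_Gam k \<tau> hx hy x0 y0 l m v) (corr_Gam k \<tau> hx hy x0 y0 l (other m) v) \<psi>y\<bar>)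
        \<le> M * (h ^ \<sigma> * H_norm x0 x1 y0 y1 (\<sigma> + 1) u * L2_norm (rect x0 x1 y0 y1) \<psi>y))"
proof -
  interpret torus x0 x1 y0 y1 using assms by unfold_locales
  \<comment> \<open>With hx as unit, \<tau> / hx = CFL / (1 + \<rho>) and b = hy / (2 hx) = 1 / (2
    \<rho>). With hy as unit \<rho> is replaced by 1 / \<rho>.\<close>
  have pos: "CFL / (1 + \<rho>) > 0" "1 / (2 * \<rho>) > 0" "CFL / (1 + 1 / \<rho>) > 0" "\<rho> / 2 > 0"
    using assms by (simp_all add: add_pos_pos)
  obtain C where C: "C \<ge> 0" "\<And>h \<tau> h' x0 y0 x1 y1 Nx Ny m w dn H \<psi>. h > 0 \<Longrightarrow> \<tau> = CFL / (1 + \<rho>) * h \<Longrightarrow> h' = h * (2 * (1 / (2 * \<rho>))) \<Longrightarrow>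
    x1 = x0 + real Nx * h \<Longrightarrow> y1 = y0 + real Ny * h' \<Longrightarrow> jcont w \<Longrightarrow> jderiv 2 w \<Longrightarrow> (\<forall>n. smooth_jet (dn n)) \<Longrightarrow>
    (\<forall>n a c. periodic2 (x1 - x0) (y1 - y0) (dn n a c)) \<Longrightarrow>
    (\<forall>a c \<epsilon>. a + c \<le> 2 \<longrightarrow> \<epsilon> > 0 \<longrightarrow> (\<forall>\<^sub>F n in sequentially. \<forall>x y. \<bar>dn n a c x y - w a c x y\<bar> < \<epsilon>)) \<Longrightarrow>
    (\<forall>n. (\<Sum>a\<le>\<sigma> + 1. integral (rect x0 x1 y0 y1) (\<lambda>z. (dn n a (\<sigma> + 1 - a) (fst z) (snd z))\<^sup>2)) \<le> H\<^sup>2) \<Longrightarrow> H \<ge> 0 \<Longrightarrow>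
    \<psi> \<in> Qbar_x m k x0 y0 h h' Nx Ny \<Longrightarrow>
    (\<Sum>i = 1..int Nx. \<Sum>j = 1..int Ny. \<bar>\<Sum>l = 0..min k 2. B2 \<tau> h h' (centre m h x0 i) (centre m h' y0 j)
        (corr_X k \<tau> h h' x0 y0 l m (w 0 0)) (corr_X k \<tau> h h' x0 y0 l (other m) (w 0 0)) \<psi>\<bar>)
    \<le> C * (h ^ \<sigma> * H * L2_norm (rect x0 x1 y0 y1) \<psi>)"
    using directional_estimate[OF pos(1,2) assms(1)] unfolding \<sigma>_def by blast
  obtain C' where C': "C' \<ge> 0" "\<And>h \<tau> h' x0 y0 x1 y1 Nx Ny m w dn H \<psi>. h > 0 \<Longrightarrow> \<tau> = CFL / (1 + 1 / \<rho>) * h \<Longrightarrow> h' = h * (2 * (\<rho> / 2)) \<Longrightarrow>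
    x1 = x0 + real Nx * h \<Longrightarrow> y1 = y0 + real Ny * h' \<Longrightarrow> jcont w \<Longrightarrow> jderiv 2 w \<Longrightarrow> (\<forall>n. smooth_jet (dn n)) \<Longrightarrow>
    (\<forall>n a c. periodic2 (x1 - x0) (y1 - y0) (dn n a c)) \<Longrightarrow>
    (\<forall>a c \<epsilon>. a + c \<le> 2 \<longrightarrow> \<epsilon> > 0 \<longrightarrow> (\<forall>\<^sub>F n in sequentially. \<forall>x y. \<bar>dn n a c x y - w a c x y\<bar> < \<epsilon>)) \<Longrightarrow>
    (\<forall>n. (\<Sum>a\<le>\<sigma> + 1. integral (rect x0 x1 y0 y1) (\<lambda>z. (dn n a (\<sigma> + 1 - a) (fst z) (snd z))\<^sup>2)) \<le> H\<^sup>2) \<Longrightarrow> H \<ge> 0 \<Longrightarrow>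
    \<psi> \<in> Qbar_x m k x0 y0 h h' Nx Ny \<Longrightarrow>
    (\<Sum>i = 1..int Nx. \<Sum>j = 1..int Ny. \<bar>\<Sum>l = 0..min k 2. B2 \<tau> h h' (centre m h x0 i) (centre m h' y0 j)
        (corr_X k \<tau> h h' x0 y0 l m (w 0 0)) (corr_X k \<tau> h h' x0 y0 l (other m) (w 0 0)) \<psi>\<bar>)
    \<le> C' * (h ^ \<sigma> * H * L2_norm (rect x0 x1 y0 y1) \<psi>)"
    using directional_estimate[OF pos(3,4) assms(1)] unfolding \<sigma>_def by blast
  \<comment> \<open>One constant for both directions; the added 1 makes it positive.\<close>
  define M where "M = C + C' + 1"
  have M: "M > 0" "C \<le> M" "C' \<le> M" using C(1) C'(1) by (auto simp: M_def)
  show ?thesis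
  proof (intro exI[of _ M] conjI M(1) allI impI ballI; (elim conjE)?)
    fix Nx Ny :: nat and hx hy h \<tau> u v m \<psi>x \<psi>y
    assume N: "Nx \<ge> 1" "Ny \<ge> 1" and hx: "hx = (x1 - x0) / real Nx" and hy: "hy = (y1 - y0) / real Ny" and r: "hx / hy = \<rho>"
      and hm: "h = max hx hy" and \<tau>: "\<tau> = tau_max CFL hx hy" and u: "u \<in> H_per x0 x1 y0 y1 (\<sigma> + 1)" and v: "v = cont_rep u"
      and \<psi>x: "\<psi>x \<in> Qbar_x m k x0 y0 hx hy Nx Ny" and \<psi>y: "\<psi>y \<in> Qbar_y m k x0 y0 hx hy Nx Ny"
    let ?H = "H_norm x0 x1 y0 y1 (\<sigma> + 1) u"
    have h0: "hx > 0" "hy > 0" using N hx hy assms(4,5) by simp_all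
    have ends: "x1 = x0 + real Nx * hx" "y1 = y0 + real Ny * hy" using N hx hy by simp_all
    have ratio: "hy = hx * (2 * (1 / (2 * \<rho>)))" "hx = hy * (2 * (\<rho> / 2))" using r h0 by (auto simp: field_simps)
    have taus: "\<tau> = CFL / (1 + \<rho>) * hx" "\<tau> = CFL / (1 + 1 / \<rho>) * hy"
    proof -
      have 1: "1 / hx + 1 / hy = (1 + \<rho>) / hx" using ratio(1) assms(3) by (simp add: add_divide_distrib)
      show "\<tau> = CFL / (1 + \<rho>) * hx" unfolding \<tau> tau_max_def 1 by simp
      have 2: "1 / hx + 1 / hy = (1 + 1 / \<rho>) / hy" using ratio(2) assms(3) by (simp add: add_divide_distrib)
      show "\<tau> = CFL / (1 + 1 / \<rho>) * hy" unfolding \<tau> tau_max_def 2 by simp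
    qed
    have H0: "?H \<ge> 0" unfolding H_norm_def by (intro real_sqrt_ge_zero sum_nonneg) (simp add: case_prod_unfold)
    have L0: "L2_norm (rect x0 x1 y0 y1) f \<ge> 0" for f
      unfolding L2_norm_def by (intro real_sqrt_ge_zero integral_nonneg_always) auto
    have "\<sigma> + 1 \<ge> 4" using assms(1) by (simp add: \<sigma>_def)
    from smooth_approximation[OF u this] obtain w where w: "jcont w" "w 0 0 = cont_rep u" "jderiv 2 w"
      and lim: "\<And>a b. a + b \<le> 2 \<Longrightarrow> uniform_limit UNIV (\<lambda>n z. partial u n a b (fst z) (snd z)) (\<lambda>z. w a b (fst z) (snd z)) sequentially"
      unfolding jderiv_def by blast
    have lim': "\<forall>\<^sub>F n in sequentially. \<forall>x y. \<bar>partial u n a b x y - w a b x y\<bar> < \<epsilon>" if "a + b \<le> 2" "\<epsilon> > 0" for a b \<epsilon>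
      using lim[OF that(1)] that(2) unfolding uniform_limit_iff dist_real_def by (auto elim!: eventually_mono)
    have pn: "(\<Sum>a\<le>\<sigma> + 1. integral (rect x0 x1 y0 y1) (\<lambda>z. (partial u n a (\<sigma> + 1 - a) (fst z) (snd z))\<^sup>2)) \<le> ?H\<^sup>2" for n
      using partial_H_norm[OF u, of n] by (simp add: case_prod_unfold)
    \<comment> \<open>Each directional estimate holds with its own width, and both widths are at
      most h.\<close>
    have final: "c * (h0 ^ \<sigma> * ?H * L) \<le> M * (h ^ \<sigma> * ?H * L)" if "c \<le> M" "c \<ge> 0" "h0 \<ge> 0" "h0 \<le> h" "L \<ge> 0" for c h0 L
      using that M(1) H0 by (intro mult_mono power_mono) auto
    have "(\<Sum>i = 1..int Nx. \<Sum>j = 1..int Ny. \<bar>\<Sum>l = 0..min k 2. B2 \<tau> hx hy (centre m hx x0 i) (centre m hy y0 j)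
        (corr_X k \<tau> hx hy x0 y0 l m (w 0 0)) (corr_X k \<tau> hx hy x0 y0 l (other m) (w 0 0)) \<psi>x\<bar>)
      \<le> C * (hx ^ \<sigma> * ?H * L2_norm (rect x0 x1 y0 y1) \<psi>x)"
      using lim' pn by (intro C(2)[where dn = "partial u"] h0 taus ratio ends w \<psi>x H0 allI impI partial_smooth partial_periodic) auto
    also have "\<dots> \<le> M * (h ^ \<sigma> * ?H * L2_norm (rect x0 x1 y0 y1) \<psi>x)"
      using C(1) M(2) h0 L0 by (intro final) (auto simp: hm)
    finally show "(\<Sum>i = 1..int Nx. \<Sum>j = 1..int Ny. \<bar>\<Sum>l = 0..min k 2. B2 \<tau> hx hy (centre m hx x0 i) (centre m hy y0 j)
        (corr_X k \<tau> hx hy x0 y0 l m v) (corr_X k \<tau> hx hy x0 y0 l (other m) v) \<psi>x\<bar>)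
      \<le> M * (h ^ \<sigma> * ?H * L2_norm (rect x0 x1 y0 y1) \<psi>x)" by (simp only: w(2) v)
    \<comment> \<open>Transposed jets: the two orders of differentiation are exchanged together with
      the variables.\<close>
    let ?T = "\<lambda>d. (\<lambda>a b x y. d b a y x) :: jet" and ?\<psi> = "\<lambda>s t. \<psi>y t s"
    have sw: "smooth_jet (?T (partial u n))" for n
    proof -
      have "continuous_on UNIV (\<lambda>(x, y). partial u n b a y x)" for a b
        using cont2_swap[OF smooth_jetD(1)[OF partial_smooth[of u n], of b a]] by (simp add: cont2_def)
      then show ?thesis using partial_smooth[of u n] by (simp add: smooth_jet_def)
    qed
    have wT: "jcont (?T w)" "jderiv 2 (?T w)"
      using w(1,3) cont2_swap[of "w _ _"] by (auto simp: jcont_def cont2_def jderiv_def)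
    have pT: "periodic2 (y1 - y0) (x1 - x0) (?T (partial u n) a c)" for n a c
      using partial_periodic[of u n c a] by (simp add: periodic2_def)
    have limT: "\<forall>\<^sub>F n in sequentially. \<forall>x y. \<bar>?T (partial u n) a c x y - ?T w a c x y\<bar> < \<epsilon>" if "a + c \<le> 2" "\<epsilon> > 0" for a c \<epsilon>
    proof -
      have "c + a \<le> 2" using that by simp
      from lim'[OF this that(2)] show ?thesis by (rule eventually_mono) blast
    qed
    have nT: "(\<Sum>a\<le>\<sigma> + 1. integral (rect y0 y1 x0 x1) (\<lambda>z. (?T (partial u n) a (\<sigma> + 1 - a) (fst z) (snd z))\<^sup>2)) \<le> ?H\<^sup>2" for n
    proof -
      have "(\<Sum>a\<le>\<sigma> + 1. integral (rect y0 y1 x0 x1) (\<lambda>z. (?T (partial u n) a (\<sigma> + 1 - a) (fst z) (snd z))\<^sup>2))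
        = (\<Sum>a\<le>\<sigma> + 1. integral (rect x0 x1 y0 y1) (\<lambda>z. (partial u n (\<sigma> + 1 - a) a (fst z) (snd z))\<^sup>2))"
        unfolding rect_def by (subst integral_rect_swap) simp
      \<comment> \<open>Transposing reverses the order in which the derivatives of total order
        \<sigma> + 1 are listed.\<close>
      also have "\<dots> = (\<Sum>a\<le>\<sigma> + 1. integral (rect x0 x1 y0 y1) (\<lambda>z. (partial u n a (\<sigma> + 1 - a) (fst z) (snd z))\<^sup>2))"
        by (rule sum.reindex_bij_witness[of _ "\<lambda>a. \<sigma> + 1 - a" "\<lambda>a. \<sigma> + 1 - a"]) auto
      finally show ?thesis using pn[of n] by simp
    qed
    have "L2_norm (rect y0 y1 x0 x1) ?\<psi> = L2_norm (rect x0 x1 y0 y1) \<psi>y"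
      unfolding L2_norm_def rect_def by (subst integral_rect_swap) (simp add: case_prod_unfold)
    moreover have "(\<Sum>j = 1..int Ny. \<Sum>i = 1..int Nx. \<bar>\<Sum>l = 0..min k 2. B2 \<tau> hy hx (centre m hy y0 j) (centre m hx x0 i)
        (corr_X k \<tau> hy hx y0 x0 l m (?T w 0 0)) (corr_X k \<tau> hy hx y0 x0 l (other m) (?T w 0 0)) ?\<psi>\<bar>)
      \<le> C' * (hy ^ \<sigma> * ?H * L2_norm (rect y0 y1 x0 x1) ?\<psi>)"
      using limT nT by (intro C'(2)[where dn = "\<lambda>n. ?T (partial u n)" and w = "?T w"] h0 taus ratio ends wT sw pT Qbar_swap \<psi>y H0 allI impI)
    ultimately have "(\<Sum>j = 1..int Ny. \<Sum>i = 1..int Nx. \<bar>\<Sum>l = 0..min k 2. B2 \<tau> hy hx (centre m hy y0 j) (centre m hx x0 i)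
        (corr_X k \<tau> hy hx y0 x0 l m (?T w 0 0)) (corr_X k \<tau> hy hx y0 x0 l (other m) (?T w 0 0)) ?\<psi>\<bar>)
      \<le> C' * (hy ^ \<sigma> * ?H * L2_norm (rect x0 x1 y0 y1) \<psi>y)" by simp
    also have "\<dots> \<le> M * (h ^ \<sigma> * ?H * L2_norm (rect x0 x1 y0 y1) \<psi>y)"
      using C'(1) M(3) h0 L0 by (intro final) (auto simp: hm)
    finally show "(\<Sum>i = 1..int Nx. \<Sum>j = 1..int Ny. \<bar>\<Sum>l = 0..min k 2. B2 \<tau> hx hy (centre m hx x0 i) (centre m hy y0 j)
        (corr_Gam k \<tau> hx hy x0 y0 l m v) (corr_Gam k \<tau> hx hy x0 y0 l (other m) v) \<psi>y\<bar>)
      \<le> M * (h ^ \<sigma> * ?H * L2_norm (rect x0 x1 y0 y1) \<psi>y)"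
      unfolding B2_swap[of \<tau> hx hy] corr_Gam_swap by (subst sum.swap) (simp only: w(2) v)
  qed
qed

end
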